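(* Let $T>0$, $p\in[1,\infty)$, let $D\subset\mathbb{R}^d$ be a bounded convex polyhedron with nonempty interior, and let $b:[0,T]\times\bar D\times\mathcal{P}_p(\bar D\times\mathbb{R}^d)\to\mathbb{R}^d$ be a measurable function for which there is a constant $K_b$ such that $$|b(t,x,\mu)-b(t,x',\mu')|^p\le K_b\big(|x-x'|^p+\mathcal{W}_{\bar D\times\mathbb{R}^d,p}(\mu,\mu')^p\big)$$ for all $t\in[0,T]$, $x,x'\in\bar D$, $\mu,\mu'\in\mathcal{P}_p(\bar D\times\mathbb{R}^d)$. Then: (1) For every input $(\zeta,W)$ (random variable in $L^p(\bar D\times C_T)$) with finite $p$-moment, there exists a unique (up to almost sure equality) solution $(X,k)$ to the generalized McKean-Vlasov Skorokhod problem $$\left\{\begin{array}{l}dX_t=b(t,X_t,\mathcal{L}(X_t,k_t))\,dt+dW_t-dk_t,\\ X\in C_T(\bar D),\quad X_0=\zeta,\\ k\in BV_T,\quad d|k|_t=1_{X_t\in\partial D}\,d|k|_t,\quad dk_t=n(X_t)\,d|k|_t.\end{array}\right.$$ (2) There exists a constant $\tilde C=\tilde C(p,T,b)>0$ such that for every two inputs $(\zeta^i,W^i)$, $i=1,2$ (defined possibly on different probability spaces), with finite $p$-moments, the corresponding solutions satisfy $$\mathcal{W}_{C_T(\bar D)\times C_T,p}(\mathcal{L}(X^1,k^1),\mathcal{L}(X^2,k^2))\le\tilde C\,\mathcal{W}_{\bar D\times C_T,p}(\mathcal{L}(\zeta^1,W^1),\mathcal{L}(\zeta^2,W^2)).$$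 In particular, the law of a solution $(X,k)$ depends only on the law of $(\zeta,W)$.
   Context: $C_T:=C([0,T],\mathbb{R}^d)$ and $C_T(\bar D):=C([0,T],\bar D)$ carry the supremum norm; products carry a product norm (e.g. the sum). $\mathcal{P}_p(E)$ is the set of Borel probability measures with finite $p$-th moment and $\mathcal{W}_{E,p}$ the $p$-Wasserstein metric. $BV_T:=BV([0,T];\mathbb{R}^d)$; $|k|$ denotes the total variation process of $k$ (not its modulus). $\mathcal{L}$ denotes law. The input is a random variable $(\zeta,W)$ on a probability space $(\Omega,\mathcal{A},\mathbb{P})$ with values in $\bar D\times C_T$. A solution is a couple of random variables $X:\Omega\to C_T(\bar D)$, $k:\Omega\to C_T$ such that for Lebesgue-a.e. $t$, $\mathcal{L}(X_t,k_t)\in\mathcal{P}_p(\bar D\times\mathbb{R}^d)$, and for a.e. $\omega$: $k\in BV_T$ with $k_0=0$; $X_t=\zeta+\int_0^tb(s,X_s,\mathcal{L}(X_s,k_s))\,ds+W_t-W_0-k_t$ for all $t\in[0,T]$; $d|k|_t=1_{X_t\in\partial D}\,d|k|_t$; and the condition $dk_t=n(X_t)\,d|k|_t$ holds in the following sense: there is a Borel function $\gamma=\gamma^\omega:[0,T]\to\mathbb{R}^d$ with $dk_t=\gamma_t\,d|k|_t$ and, for $d|k|$-a.e. $t$, $\gamma_t\in d(X_t)$, where $$d(x)=\Big\{\sum_{i:\,x\in\partial D_i}\alpha_in_i\ \Big|\ \alpha_i\ge0,\ \Big|\sum_{i:\,x\in\partial D_i}\alpha_in_i\Big|=1\Big\},$$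 $\partial D_i$ being the faces of the polyhedron, with outer unit normals $n_i$.
   Formalization: It is additionally assumed that t ↦ b(t,x,μ) is Lebesgue integrable on [0,T] for some x in D̄ and μ in P_p; without this the claim fails, e.g. b(t,x,μ)=e/t (0 at t=0) admits no solution for any input. *)

theory Defs
  imports "HOL-Probability.Probability"
begin

text \<open>
  A continuous function on \<open>[0,T]\<close> is represented by its constant extension to the real line. On
  these extensions the distance of bounded continuous functions is the supremum distance over
  \<open>[0,T]\<close>, so \<open>cpaths T S\<close> is an isometric copy of \<open>C([0,T], S)\<close>. Products carry the product metric
  of the library, \<open>sqrt (dist\<^sup>2 + dist\<^sup>2)\<close>.
\<close>

type_synonym 'a cpath = "real \<Rightarrow>\<^sub>C 'a"

definition cpaths :: "real \<Rightarrow> 'a set \<Rightarrow> 'a::metric_space cpath set" where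
  "cpaths T S = {f :: real \<Rightarrow>\<^sub>C 'a. (\<forall>t\<in>{0..T}. f t \<in> S) \<and> (\<forall>t. f t = f (max 0 (min T t)))}"

definition law :: "'w measure \<Rightarrow> 'e set \<Rightarrow> ('w \<Rightarrow> 'e) \<Rightarrow> 'e::topological_space measure" where
  "law M E Z = distr M (restrict_space borel E) Z"

definition prob_moment :: "real \<Rightarrow> 'e set \<Rightarrow> 'e::metric_space measure set" where
  "prob_moment p E = {\<mu>. prob_space \<mu> \<and> sets \<mu> = sets (restrict_space borel E) \<and>
     (\<exists>x\<^sub>0\<in>E. (\<integral>\<^sup>+ x. ennreal (dist x x\<^sub>0 powr p) \<partial>\<mu>) < \<infinity>)}"

definition couplings :: "'e measure \<Rightarrow> 'e measure \<Rightarrow> ('e \<times> 'e) measure set" where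
  "couplings \<mu> \<nu> = {\<pi>. sets \<pi> = sets (\<mu> \<Otimes>\<^sub>M \<nu>) \<and> distr \<pi> \<mu> fst = \<mu> \<and> distr \<pi> \<nu> snd = \<nu>}"

text \<open>Meaningful for two elements of the same \<open>prob_moment p E\<close>, where the infimum is finite.\<close>

definition wasserstein :: "real \<Rightarrow> 'e::metric_space measure \<Rightarrow> 'e measure \<Rightarrow> real" where
  "wasserstein p \<mu> \<nu> =
     enn2real (INF \<pi>\<in>couplings \<mu> \<nu>. \<integral>\<^sup>+ (x, y). ennreal (dist x y powr p) \<partial>\<pi>) powr (1 / p)"

definition wasserstein_borel :: "real \<Rightarrow> 'e set \<Rightarrow> 'e::metric_space measure measure" where
  "wasserstein_borel p E =
     sigma (prob_moment p E) {U. Metric_space.mopen (prob_moment p E) (wasserstein p) U}"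

definition variation_sums :: "(real \<Rightarrow> 'a::real_normed_vector) \<Rightarrow> real \<Rightarrow> real \<Rightarrow> real set" where
  "variation_sums f a b =
     {\<Sum>i<n. norm (f (s (Suc i)) - f (s i)) | n s. mono s \<and> range s \<subseteq> {a..b}}"

definition bounded_variation_on :: "(real \<Rightarrow> 'a::real_normed_vector) \<Rightarrow> real \<Rightarrow> real \<Rightarrow> bool" where
  "bounded_variation_on f a b \<longleftrightarrow> bdd_above (variation_sums f a b)"

definition total_variation :: "(real \<Rightarrow> 'a::real_normed_vector) \<Rightarrow> real \<Rightarrow> real \<Rightarrow> real" where
  "total_variation f a b = Sup (variation_sums f a b)"

text \<open>
  The Lebesgue-Stieltjes measure \<open>d|k|\<close> on \<open>[0,T]\<close>, as a measure on the line that does not charge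
  the complement of \<open>[0,T]\<close>. For continuous \<open>k\<close> of bounded variation the distribution function is
  continuous.
\<close>

definition variation_measure :: "real \<Rightarrow> (real \<Rightarrow> 'a::real_normed_vector) \<Rightarrow> real measure" where
  "variation_measure T k = interval_measure (\<lambda>t. total_variation k 0 (max 0 (min T t)))"

text \<open>
  For a full-dimensional polyhedron \<open>D\<close> the outer unit normal of a facet (face of codimension one)
  is unique. In the interior of \<open>D\<close> the sum is empty, so there are no normal directions.
\<close>

definition outer_unit_normal :: "'a set \<Rightarrow> 'a set \<Rightarrow> 'a::euclidean_space" where
  "outer_unit_normal D F =
     (THE n. norm n = 1 \<and> (\<exists>c. D \<subseteq> {x. n \<bullet> x \<le> c} \<and> F = D \<inter> {x. n \<bullet> x = c}))"

definition normal_directions :: "'a set \<Rightarrow> 'a \<Rightarrow> 'a::euclidean_space set" where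
  "normal_directions D x =
     {v. norm v = 1 \<and> (\<exists>\<alpha>. (\<forall>F. \<alpha> F \<ge> 0) \<and>
        v = (\<Sum>F | F facet_of D \<and> x \<in> F. \<alpha> F *\<^sub>R outer_unit_normal D F))}"

text \<open>
  \<open>dk = \<gamma> d|k|\<close> as vector measures, and \<open>\<gamma>\<^sub>t\<close> is a normal direction at \<open>x\<^sub>t\<close> for \<open>d|k|\<close>-almost every
  \<open>t\<close>. The measure \<open>dk\<close> is given by its values \<open>k\<^sub>t - k\<^sub>s\<close> on the intervals \<open>(s,t]\<close>.
\<close>

definition reflects_along_normals ::
  "real \<Rightarrow> 'a set \<Rightarrow> (real \<Rightarrow> 'a) \<Rightarrow> (real \<Rightarrow> 'a::euclidean_space) \<Rightarrow> bool" where
  "reflects_along_normals T D x k \<longleftrightarrow>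
     (\<exists>\<gamma>\<in>borel_measurable borel.
        (\<forall>s t. 0 \<le> s \<and> s \<le> t \<and> t \<le> T \<longrightarrow>
           set_integrable (variation_measure T k) {s<..t} \<gamma> \<and>
           k t - k s = (LINT r:{s<..t}|variation_measure T k. \<gamma> r)) \<and>
        (AE t in variation_measure T k. \<gamma> t \<in> normal_directions D (x t)))"

text \<open>In what follows \<open>D\<close> is the closed domain: it plays the role of its own closure.\<close>

definition mv_input ::
  "real \<Rightarrow> real \<Rightarrow> 'a set \<Rightarrow> 'w measure \<Rightarrow> ('w \<Rightarrow> 'a) \<Rightarrow> ('w \<Rightarrow> 'a::euclidean_space cpath) \<Rightarrow> bool" where
  "mv_input p T D M \<zeta> W \<longleftrightarrow>
     prob_space M \<and>
     (\<lambda>\<omega>. (\<zeta> \<omega>, W \<omega>)) \<in> M \<rightarrow>\<^sub>M restrict_space borel (D \<times> cpaths T UNIV) \<and>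
     law M (D \<times> cpaths T UNIV) (\<lambda>\<omega>. (\<zeta> \<omega>, W \<omega>)) \<in> prob_moment p (D \<times> cpaths T UNIV)"

type_synonym 'a mv_drift = "real \<Rightarrow> 'a \<Rightarrow> ('a \<times> 'a) measure \<Rightarrow> 'a"

text \<open>
  The time integral is taken with respect to completed Lebesgue measure because the drift is
  arbitrary at the null set of times at which the law of \<open>(X\<^sub>t, k\<^sub>t)\<close> has no finite moment.
\<close>

definition mv_solution ::
  "real \<Rightarrow> real \<Rightarrow> 'a set \<Rightarrow> 'a mv_drift \<Rightarrow> 'w measure \<Rightarrow> ('w \<Rightarrow> 'a) \<Rightarrow> ('w \<Rightarrow> 'a cpath) \<Rightarrow>
   ('w \<Rightarrow> 'a cpath) \<Rightarrow> ('w \<Rightarrow> 'a::euclidean_space cpath) \<Rightarrow> bool" where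
  "mv_solution p T D b M \<zeta> W X k \<longleftrightarrow>
     X \<in> M \<rightarrow>\<^sub>M restrict_space borel (cpaths T D) \<and>
     k \<in> M \<rightarrow>\<^sub>M restrict_space borel (cpaths T UNIV) \<and>
     (AE t in lebesgue. t \<in> {0..T} \<longrightarrow>
        law M (D \<times> UNIV) (\<lambda>\<omega>. (X \<omega> t, k \<omega> t)) \<in> prob_moment p (D \<times> UNIV)) \<and>
     (AE \<omega> in M.
        bounded_variation_on (k \<omega>) 0 T \<and> k \<omega> 0 = 0 \<and>
        set_integrable lebesgue {0..T}
          (\<lambda>s. b s (X \<omega> s) (law M (D \<times> UNIV) (\<lambda>\<omega>. (X \<omega> s, k \<omega> s)))) \<and>
        (\<forall>t\<in>{0..T}. X \<omega> t = \<zeta> \<omega>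
           + (LINT s:{0..t}|lebesgue. b s (X \<omega> s) (law M (D \<times> UNIV) (\<lambda>\<omega>. (X \<omega> s, k \<omega> s))))
           + W \<omega> t - W \<omega> 0 - k \<omega> t) \<and>
        variation_measure T (k \<omega>) =
          density (variation_measure T (k \<omega>)) (\<lambda>t. indicator (frontier D) (X \<omega> t)) \<and>
        reflects_along_normals T D (X \<omega>) (k \<omega>))"

text \<open>
  \<open>C\<close> is a Lipschitz constant for the map from laws of inputs to laws of solutions, where the two
  inputs live on arbitrary probability spaces with points in the types \<open>'v\<close> and \<open>'w\<close>. A constant
  that serves for every choice of sample types cannot be asserted by an existential quantifier
  alone, since types are only quantified outermost. One therefore asserts that a constant exists
  for the sample type \<open>'a \<times> 'a cpath\<close> of the canonical input spaces, and that every constant for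
  that type is a constant for all other sample types.
\<close>

definition stability_constant ::
  "'v itself \<Rightarrow> 'w itself \<Rightarrow> real \<Rightarrow> real \<Rightarrow> 'a set \<Rightarrow> 'a::euclidean_space mv_drift \<Rightarrow> real \<Rightarrow> bool" where
  "stability_constant _ _ p T D b C \<longleftrightarrow>
     C > 0 \<and>
     (\<forall>(M1 :: 'v measure) \<zeta>1 W1 X1 k1 (M2 :: 'w measure) \<zeta>2 W2 X2 k2.
        mv_input p T D M1 \<zeta>1 W1 \<and> mv_solution p T D b M1 \<zeta>1 W1 X1 k1 \<and>
        mv_input p T D M2 \<zeta>2 W2 \<and> mv_solution p T D b M2 \<zeta>2 W2 X2 k2 \<longrightarrow>
        wasserstein p
          (law M1 (cpaths T D \<times> cpaths T UNIV) (\<lambda>\<omega>. (X1 \<omega>, k1 \<omega>)))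
          (law M2 (cpaths T D \<times> cpaths T UNIV) (\<lambda>\<omega>. (X2 \<omega>, k2 \<omega>)))
        \<le> C * wasserstein p
          (law M1 (D \<times> cpaths T UNIV) (\<lambda>\<omega>. (\<zeta>1 \<omega>, W1 \<omega>)))
          (law M2 (D \<times> cpaths T UNIV) (\<lambda>\<omega>. (\<zeta>2 \<omega>, W2 \<omega>))))"

end

theory Submission
  imports Defs
begin

text \<open>
  The difference of two solutions of the Skorokhod problem in a polyhedron moves in cones spanned by
  facet normals and their opposites, and such a normal contributes only while its inner product with
  the difference is at most the distance of the driving paths. A weighted maximum, over sets \<open>S\<close> of
  normals, of the distances to \<open>span S\<close> therefore cannot increase once it is large compared with
  that distance. Hence the Skorokhod map is Lipschitz in the supremum norm, and the implicit Euler
  scheme converges to a solution.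

  Since \<open>D\<close> is bounded, the difference of two Picard iterates is bounded by a deterministic constant,
  so in the norm with weight \<open>exp (- lam t)\<close> the Picard map contracts uniformly in \<open>\<omega>\<close>. The same
  estimate, raised to the power \<open>p\<close> and integrated over a coupling of the inputs, gives stability;
  pathwise uniqueness identifies every solution with a function of the input that solves the
  problem on the canonical space.
\<close>

section \<open>Facets of a polyhedron and their normals\<close>

text \<open>The driving path is only continuous. Pairing the difference of two reflected paths with
  itself, as convexity suggests, leaves a term with the variation of \<open>k\<close>, which no
  supremum bound on the drivers controls. Testing with the component orthogonal to a well chosen set
  of normals avoids that term and uses that a polyhedron has finitely many of them. The cone form of
  the Skorokhod problem is silent about \<open>d|k|\<close>, so the Stieltjes description is
  recovered at the end: an interior point of \<open>D\<close> bounds the variation, Radon-Nikodym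
  yields a density, and separation identifies its direction. The rate \<open>lam\<close> is so large
  that crude \<open>p\<close>-norm inequalities still leave contraction factors 1/16 and 1/4.
  Distances of paths need not be measurable on products of path spaces, so estimates there rest on
  inequalities for \<open>nn_integral\<close> that hold without measurability; that the Wasserstein
  distance is a metric is proved only over second countable types, which covers the state space,
  where the measurability of the drift refers to it.\<close>

lemma unit_normals_eq_or_opposite:
  fixes n n' :: "'a::real_inner"
  assumes n: "norm n = 1" "norm n' = 1" and H: "{x. n \<bullet> x = c} = {x. n' \<bullet> x = c'}"
  shows "n' = n \<or> n' = - n"
proof -
  let ?q = "n' \<bullet> n"
  have nn: "n \<bullet> n = 1" "n' \<bullet> n' = 1" using n by (auto simp: dot_square_norm)
  \<comment> \<open>The foot point and its translate by the part of \<open>n'\<close> orthogonal to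
    \<open>n\<close> both lie on the hyperplane, so this part is orthogonal to \<open>n'\<close>.
    Hence \<open>?q\<close> squares to 1, the equality case of Cauchy-Schwarz.\<close>
  have "c *\<^sub>R n \<in> {x. n \<bullet> x = c}" "c *\<^sub>R n + (n' - ?q *\<^sub>R n) \<in> {x. n \<bullet> x = c}"
    using nn by (auto simp: inner_simps inner_commute)
  then have "n' \<bullet> (c *\<^sub>R n) = c'" "n' \<bullet> (c *\<^sub>R n + (n' - ?q *\<^sub>R n)) = c'" using H by auto
  then have "n' \<bullet> (n' - ?q *\<^sub>R n) = 0" by (simp add: inner_add_right)
  then have "?q * ?q = 1" using nn by (simp add: inner_simps)
  then have "(?q - 1) * (?q + 1) = 0" by (simp add: algebra_simps)
  then consider "?q = 1" | "?q = -1" by force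
  then show ?thesis
  proof cases
    case 1
    then have "(n' - n) \<bullet> (n' - n) = 0" using nn by (simp add: inner_simps inner_commute)
    then show ?thesis by simp
  next
    case 2
    then have "(n' + n) \<bullet> (n' + n) = 0" using nn by (simp add: inner_simps inner_commute)
    then show ?thesis by (simp add: add_eq_0_iff2)
  qed
qed

lemma inner_less_of_mem_interior:
  assumes "a \<in> interior D" "D \<subseteq> {x. n \<bullet> x \<le> c}" "norm n = 1"
  shows "n \<bullet> a < c"
proof -
  obtain r where r: "r > 0" "cball a r \<subseteq> D" using assms(1) mem_interior_cball by blast
  then have "a + r *\<^sub>R n \<in> cball a r" using assms(3) by (simp add: dist_norm)
  then have "n \<bullet> (a + r *\<^sub>R n) \<le> c" using r assms(2) by blast
  then show ?thesis using r assms(3) by (simp add: inner_simps dot_square_norm)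
qed

text \<open>Both sides are affine of dimension \<open>DIM('a) - 1\<close>, so the obvious inclusion
  is an equality. A facet therefore determines its supporting hyperplane, whichever normal describes
  it.\<close>

lemma facet_affine_hull:
  fixes D :: "'a::euclidean_space set"
  assumes "interior D \<noteq> {}" "F facet_of D" "norm n = 1" "F = D \<inter> {x. n \<bullet> x = c}"
  shows "affine hull F = {x. n \<bullet> x = c}"
proof -
  have "aff_dim D = int DIM('a)" using aff_dim_nonempty_interior[OF assms(1)] by simp
  then have F: "aff_dim F = int DIM('a) - 1" using assms(2) by (simp add: facet_of_def)
  have n0: "n \<noteq> 0" using assms(3) by auto
  have sub: "affine hull F \<subseteq> {x. n \<bullet> x = c}"
    using assms(4) by (intro hull_minimal affine_hyperplane) auto
  moreover have "aff_dim {x. n \<bullet> x = c} = int DIM('a) - 1" using n0 by simp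
  moreover have "affine hull F \<noteq> {}" using assms(2) by (simp add: facet_of_def)
  ultimately show ?thesis
    using F by (intro affine_dim_equal) (auto simp: affine_hyperplane aff_dim_affine_hull)
qed

text \<open>Justifies the definite description in \<open>outer_unit_normal\<close>. Existence
  normalises a supporting hyperplane of the facet. For uniqueness the affine hull of the facet fixes
  the hyperplane, so only the sign is open, and an interior point, strictly below both levels,
  excludes opposite normals.\<close>

lemma outer_unit_normal_facet:
  fixes D :: "'a::euclidean_space set"
  assumes D: "polyhedron D" "interior D \<noteq> {}" and F: "F facet_of D"
  shows "norm (outer_unit_normal D F) = 1 \<and> (\<exists>c. D \<subseteq> {x. outer_unit_normal D F \<bullet> x \<le> c} \<and>
    F = D \<inter> {x. outer_unit_normal D F \<bullet> x = c})"
proof -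
  let ?P = "\<lambda>n. norm n = 1 \<and> (\<exists>c. D \<subseteq> {x. n \<bullet> x \<le> c} \<and> F = D \<inter> {x. n \<bullet> x = c})"
  obtain a b where ab: "a \<noteq> 0" "D \<subseteq> {x. a \<bullet> x \<le> b}" "F = D \<inter> {x. a \<bullet> x = b}"
    using facet_of_polyhedron[OF D(1) F] by blast
  have "{x. a \<bullet> x \<le> b} = {x. (a /\<^sub>R norm a) \<bullet> x \<le> b / norm a}"
    "{x. a \<bullet> x = b} = {x. (a /\<^sub>R norm a) \<bullet> x = b / norm a}"
    using ab(1) by (auto simp: field_simps)
  then have ex: "?P (a /\<^sub>R norm a)" using ab by (intro conjI exI[of _ "b / norm a"]) auto
  have uniq: "n = n'" if n: "?P n" and n': "?P n'" for n n'
  proof -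
    obtain c c' where c: "D \<subseteq> {x. n \<bullet> x \<le> c}" "F = D \<inter> {x. n \<bullet> x = c}"
      "D \<subseteq> {x. n' \<bullet> x \<le> c'}" "F = D \<inter> {x. n' \<bullet> x = c'}" using n n' by blast
    have "{x. n \<bullet> x = c} = {x. n' \<bullet> x = c'}"
      using facet_affine_hull[OF D(2) F _ c(2)] facet_affine_hull[OF D(2) F _ c(4)] n n' by blast
    then consider "n' = n" | "n' = - n" using unit_normals_eq_or_opposite n n' by blast
    then show ?thesis
    proof cases
      case 2
      obtain x where "x \<in> F" using F by (auto simp: facet_of_def)
      then have cc: "n \<bullet> x = c" "n' \<bullet> x = c'" using c by blast+
      obtain y where "y \<in> interior D" using D(2) by blast
      then have "n \<bullet> y < c" "n' \<bullet> y < c'" using inner_less_of_mem_interior c n n' by blast+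
      then show ?thesis using 2 cc by simp
    qed simp
  qed
  have "\<exists>!n. ?P n"
  proof (rule ex1I)
    show "?P (a /\<^sub>R norm a)" by (rule ex)
    show "n = a /\<^sub>R norm a" if "?P n" for n using that ex by (rule uniq)
  qed
  from theI'[OF this] show ?thesis unfolding outer_unit_normal_def .
qed

text \<open>The level of the supporting hyperplane, read off at an arbitrary point of the facet, so
  that the existential constant becomes a function of the facet.\<close>

definition facet_offset :: "'a::euclidean_space set \<Rightarrow> 'a set \<Rightarrow> real" where
  "facet_offset D F = outer_unit_normal D F \<bullet> (SOME x. x \<in> F)"

locale solid_polyhedron =
  fixes D :: "'a::euclidean_space set"
  assumes poly: "polyhedron D" and solid: "interior D \<noteq> {}"
begin

abbreviation "nrm \<equiv> outer_unit_normal D"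
abbreviation "off \<equiv> facet_offset D"

lemma norm_nrm: "F facet_of D \<Longrightarrow> norm (nrm F) = 1"
  using outer_unit_normal_facet[OF poly solid] by blast

lemma off_props:
  assumes "F facet_of D"
  shows "D \<subseteq> {x. nrm F \<bullet> x \<le> off F}" "F = D \<inter> {x. nrm F \<bullet> x = off F}"
proof -
  obtain c where c: "D \<subseteq> {x. nrm F \<bullet> x \<le> c}" "F = D \<inter> {x. nrm F \<bullet> x = c}"
    using outer_unit_normal_facet[OF poly solid assms] by blast
  have "(SOME x. x \<in> F) \<in> F" using assms by (simp add: facet_of_def some_in_eq)
  then have "off F = c" using c(2) unfolding facet_offset_def by auto
  then show "D \<subseteq> {x. nrm F \<bullet> x \<le> off F}" "F = D \<inter> {x. nrm F \<bullet> x = off F}" using c by auto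
qed

lemma nrm_le: "F facet_of D \<Longrightarrow> x \<in> D \<Longrightarrow> nrm F \<bullet> x \<le> off F"
  using off_props(1) by blast

lemma mem_facet_iff: "F facet_of D \<Longrightarrow> x \<in> F \<longleftrightarrow> x \<in> D \<and> nrm F \<bullet> x = off F"
  using off_props(2)[of F] by blast

lemma fin_facets: "finite {F. F facet_of D}" using finite_polyhedron_facets[OF poly] .

lemma D_closed: "closed D" and D_convex: "convex D" and D_ne: "D \<noteq> {}"
  using poly solid interior_subset by (auto simp: polyhedron_imp_closed polyhedron_imp_convex)

text \<open>A segment from an interior point to a point outside leaves \<open>D\<close> through some
  facet. The corresponding linear form is strictly below its level at the start and equal to it at
  the exit, hence above it at the far end.\<close>

lemma mem_of_halfspaces:
  assumes y: "\<And>F. F facet_of D \<Longrightarrow> nrm F \<bullet> y \<le> off F"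
  shows "y \<in> D"
proof (rule ccontr)
  assume yD: "y \<notin> D"
  obtain a where a: "a \<in> interior D" using solid by blast
  have "closed_segment a y \<inter> frontier D \<noteq> {}"
    using a yD interior_subset by (intro connected_Int_frontier) auto
  then obtain z where z: "z \<in> closed_segment a y" "z \<in> frontier D" by blast
  have "z \<in> D - rel_interior D"
    using z(2) D_closed solid by (simp add: frontier_def rel_interior_nonempty_interior)
  then obtain F where F: "F facet_of D" "z \<in> F" using rel_boundary_of_polyhedron[OF poly] by blast
  have "nrm F \<bullet> a < off F" using inner_less_of_mem_interior[OF a off_props(1)[OF F(1)] norm_nrm[OF F(1)]] .
  moreover have "nrm F \<bullet> z = off F" using F mem_facet_iff by blast
  moreover obtain u where u: "0 \<le> u" "u \<le> 1" "z = (1 - u) *\<^sub>R a + u *\<^sub>R y"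
    using z(1) by (auto simp: in_segment)
  moreover have "u \<noteq> 1" using u yD F facet_of_imp_subset[OF F(1)] by auto
  moreover have "nrm F \<bullet> z = (1 - u) * (nrm F \<bullet> a) + u * (nrm F \<bullet> y)" using u by (simp add: inner_simps)
  moreover have "u * (nrm F \<bullet> y) \<le> u * off F" using y[OF F(1)] u by (intro mult_left_mono) auto
  ultimately have "(1 - u) * off F \<le> (1 - u) * (nrm F \<bullet> a)" by (simp add: algebra_simps)
  then have "off F \<le> nrm F \<bullet> a" using \<open>u \<noteq> 1\<close> u by simp
  then show False using \<open>nrm F \<bullet> a < off F\<close> by simp
qed

lemma facet_subset_frontier:
  assumes "F facet_of D" "x \<in> F" shows "x \<in> frontier D"
proof -
  have "x \<in> D" "nrm F \<bullet> x = off F" using assms mem_facet_iff by auto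
  then show ?thesis
    using inner_less_of_mem_interior[OF _ off_props(1)[OF assms(1)] norm_nrm[OF assms(1)], of x] D_closed
    by (auto simp: frontier_def)
qed

text \<open>Constraints active at \<open>x\<close> do not increase along \<open>v\<close>, inactive
  ones have slack. As there are finitely many facets, one positive step serves all of them.\<close>

lemma feasible_direction:
  assumes x: "x \<in> D" and v: "\<And>F. F facet_of D \<Longrightarrow> x \<in> F \<Longrightarrow> v \<bullet> nrm F \<le> 0"
  obtains e where "e > 0" "x + e *\<^sub>R v \<in> D"
proof -
  have "\<exists>e>0. \<forall>F. F facet_of D \<longrightarrow> nrm F \<bullet> (x + e *\<^sub>R v) \<le> off F"
  proof -
    have "\<forall>F\<in>{F. F facet_of D}. \<exists>e>0. \<forall>d. 0 \<le> d \<and> d \<le> e \<longrightarrow> nrm F \<bullet> (x + d *\<^sub>R v) \<le> off F"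
    proof clarify
      fix F assume F: "F facet_of D"
      show "\<exists>e>0. \<forall>d. 0 \<le> d \<and> d \<le> e \<longrightarrow> nrm F \<bullet> (x + d *\<^sub>R v) \<le> off F"
      proof (cases "x \<in> F")
        case True
        then have "nrm F \<bullet> x = off F" "nrm F \<bullet> v \<le> 0" using v F mem_facet_iff by (auto simp: inner_commute)
        then show ?thesis by (intro exI[of _ 1]) (auto simp: inner_simps mult_nonneg_nonpos)
      next
        case False
        then have lt: "nrm F \<bullet> x < off F" using nrm_le[OF F x] mem_facet_iff[OF F] x by force
        \<comment> \<open>The slack divided by a bound for the slope; adding 1 keeps the denominator
          positive when \<open>v\<close> is parallel to the facet.\<close>
        let ?e = "(off F - nrm F \<bullet> x) / (\<bar>nrm F \<bullet> v\<bar> + 1)"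
        have "d * (nrm F \<bullet> v) \<le> off F - nrm F \<bullet> x" if "0 \<le> d" "d \<le> ?e" for d
        proof -
          have "d * (nrm F \<bullet> v) \<le> d * (\<bar>nrm F \<bullet> v\<bar> + 1)" using that by (intro mult_left_mono) auto
          also have "\<dots> \<le> ?e * (\<bar>nrm F \<bullet> v\<bar> + 1)" using that by (intro mult_right_mono) auto
          finally show ?thesis by simp
        qed
        then show ?thesis using lt by (intro exI[of _ ?e]) (auto simp: inner_simps algebra_simps)
      qed
    qed
    then obtain e where e: "\<And>F. F facet_of D \<Longrightarrow> e F > 0"
      "\<And>F d. F facet_of D \<Longrightarrow> 0 \<le> d \<Longrightarrow> d \<le> e F \<Longrightarrow> nrm F \<bullet> (x + d *\<^sub>R v) \<le> off F"
      by (metis (no_types, lifting) bchoice mem_Collect_eq)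
    \<comment> \<open>Inserting 1 keeps the set nonempty when there are no facets.\<close>
    let ?m = "Min (insert 1 (e ` {F. F facet_of D}))"
    have "?m > 0" using e fin_facets by (subst Min_gr_iff) auto
    moreover have "?m \<le> e F" if "F facet_of D" for F using fin_facets that by (intro Min_le) auto
    ultimately show ?thesis using e(2) by (intro exI[of _ ?m]) (auto simp: less_imp_le)
  qed
  then show ?thesis using that mem_of_halfspaces by blast
qed

text \<open>Polar form of the fact that the residual of a projection lies in the cone of active
  normals: a direction that is nonpositive on all active normals is feasible, and the variational
  inequality of the projection applies to it.\<close>

lemma closest_point_normal:
  assumes v: "\<And>F. F facet_of D \<Longrightarrow> closest_point D y \<in> F \<Longrightarrow> v \<bullet> nrm F \<le> 0"
  shows "v \<bullet> (y - closest_point D y) \<le> 0"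
proof -
  let ?x = "closest_point D y"
  have x: "?x \<in> D" using D_closed D_ne by (rule closest_point_in_set)
  obtain e where e: "e > 0" "?x + e *\<^sub>R v \<in> D" using feasible_direction[OF x v] by blast
  then have "(y - ?x) \<bullet> (?x + e *\<^sub>R v - ?x) \<le> 0" by (intro closest_point_dot D_convex D_closed)
  then have "e * (v \<bullet> (y - ?x)) \<le> 0" by (simp add: inner_commute)
  then show ?thesis using e(1) by (simp add: mult_le_0_iff)
qed

end

section \<open>The oscillation lemma\<close>

text \<open>The component of \<open>z\<close> orthogonal to \<open>span S\<close>, so
  \<open>norm (perp S z)\<close> is the distance from \<open>z\<close> to that subspace. The choice
  is harmless by \<open>perp_unique\<close>.\<close>

definition perp :: "'a::euclidean_space set \<Rightarrow> 'a \<Rightarrow> 'a" where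
  "perp S z = (SOME r. z - r \<in> span S \<and> (\<forall>w\<in>span S. r \<bullet> w = 0))"

lemma perp_props: "z - perp S z \<in> span S" "w \<in> span S \<Longrightarrow> perp S z \<bullet> w = 0"
proof -
  obtain y r where "y \<in> span S" "\<And>w. w \<in> span S \<Longrightarrow> orthogonal r w" "z = y + r"
    using orthogonal_subspace_decomp_exists[of S z] by blast
  then have "\<exists>r. z - r \<in> span S \<and> (\<forall>w\<in>span S. r \<bullet> w = 0)"
    by (intro exI[of _ r]) (auto simp: orthogonal_def)
  from someI_ex[OF this] show "z - perp S z \<in> span S" "w \<in> span S \<Longrightarrow> perp S z \<bullet> w = 0"
    unfolding perp_def by auto
qed

lemma perp_unique:
  assumes "z - r \<in> span S" "\<And>w. w \<in> span S \<Longrightarrow> r \<bullet> w = 0"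
  shows "perp S z = r"
proof -
  have "perp S z - r = (z - r) - (z - perp S z)" by simp
  then have m: "perp S z - r \<in> span S" using assms(1) perp_props(1) span_diff by metis
  then have "(perp S z - r) \<bullet> (perp S z - r) = 0"
    using assms(2)[OF m] perp_props(2)[OF m] by (simp add: inner_diff_left)
  then show ?thesis by simp
qed

lemma perp_inner_eq: "w - w' \<in> span S \<Longrightarrow> perp S z \<bullet> w = perp S z \<bullet> w'"
  using perp_props(2)[of "w - w'" S z] by (simp add: inner_diff_right)

lemma perp_pythagoras: "(norm z)\<^sup>2 = (norm (perp S z))\<^sup>2 + (norm (z - perp S z))\<^sup>2"
proof -
  have "perp S z \<bullet> (z - perp S z) = 0" using perp_props by blast
  then have "(norm (perp S z + (z - perp S z)))\<^sup>2 = (norm (perp S z))\<^sup>2 + (norm (z - perp S z))\<^sup>2"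
    by (intro norm_add_Pythagorean) (simp add: orthogonal_def)
  then show ?thesis by simp
qed

text \<open>The squared distance to a subspace is convex with gradient \<open>2 * perp S z\<close>
  at \<open>z\<close>; this is its tangent inequality at \<open>z\<close>. The gradient is taken at
  the first argument, which matches implicit schemes.\<close>

lemma perp_tangent: "(norm (perp S z))\<^sup>2 \<le> (norm (perp S z'))\<^sup>2 + 2 * (perp S z \<bullet> (z - z'))"
proof -
  let ?r = "perp S z" and ?r' = "perp S z'"
  have "(z - z') - (?r - ?r') \<in> span S"
    using span_diff[OF perp_props(1)[of z S] perp_props(1)[of z' S]] by (simp add: algebra_simps)
  then have "?r \<bullet> (z - z') = ?r \<bullet> (?r - ?r')" by (rule perp_inner_eq)
  moreover have "0 \<le> (?r - ?r') \<bullet> (?r - ?r')" by simp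
  ultimately show ?thesis by (simp add: power2_norm_eq_inner inner_simps inner_commute)
qed

text \<open>One Gram-Schmidt step: enlarging \<open>S\<close> by \<open>n\<close> removes from
  \<open>perp S z\<close> its component along \<open>perp S n\<close>, and against vectors
  orthogonal to \<open>span S\<close> the products with \<open>n\<close> and with
  \<open>perp S n\<close> coincide.\<close>

lemma perp_insert:
  assumes "n \<notin> span S"
  shows "perp S n \<noteq> 0"
    "(norm (perp (insert n S) z))\<^sup>2 = (norm (perp S z))\<^sup>2 - (perp S z \<bullet> n)\<^sup>2 / (norm (perp S n))\<^sup>2"
proof -
  let ?m = "perp S n" and ?r = "perp S z"
  show m0: "?m \<noteq> 0" using perp_props(1)[of n S] assms by auto
  have rm: "?r \<bullet> n = ?r \<bullet> ?m" by (rule perp_inner_eq) (rule perp_props)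
  have mn: "?m \<bullet> n = ?m \<bullet> ?m" by (rule perp_inner_eq) (rule perp_props)
  let ?c = "(?r \<bullet> n) / (?m \<bullet> ?m)"
  have mm: "?m \<bullet> ?m \<noteq> 0" using m0 by simp
  have sub: "span S \<subseteq> span (insert n S)" by (rule span_mono) auto
  have "perp (insert n S) z = ?r - ?c *\<^sub>R ?m"
  proof (rule perp_unique)
    have "n - (n - ?m) \<in> span (insert n S)"
      using perp_props(1)[of n S] sub by (intro span_diff[of n _ "n - ?m"]) (auto intro: span_base)
    then have "?m \<in> span (insert n S)" by simp
    moreover have "z - (?r - ?c *\<^sub>R ?m) = (z - ?r) + ?c *\<^sub>R ?m" by simp
    moreover have "z - ?r \<in> span (insert n S)" using perp_props(1) sub by blast
    ultimately show "z - (?r - ?c *\<^sub>R ?m) \<in> span (insert n S)"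
      by (metis span_add span_scale)
    fix w assume "w \<in> span (insert n S)"
    then obtain k where k: "w - k *\<^sub>R n \<in> span S" by (auto simp: span_insert)
    have "?r \<bullet> w = ?r \<bullet> (k *\<^sub>R n)" "?m \<bullet> w = ?m \<bullet> (k *\<^sub>R n)" by (rule perp_inner_eq, rule k)+
    then show "(?r - ?c *\<^sub>R ?m) \<bullet> w = 0" using mn mm by (simp add: inner_diff_left)
  qed
  then have "(norm (perp (insert n S) z))\<^sup>2 = (?r - ?c *\<^sub>R ?m) \<bullet> (?r - ?c *\<^sub>R ?m)"
    by (simp add: power2_norm_eq_inner)
  also have "\<dots> = ?r \<bullet> ?r - 2 * ?c * (?r \<bullet> ?m) + ?c * ?c * (?m \<bullet> ?m)"
    by (simp add: inner_simps inner_commute algebra_simps)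
  also have "\<dots> = ?r \<bullet> ?r - (?r \<bullet> n)\<^sup>2 / (?m \<bullet> ?m)"
    using mm rm by (simp add: field_simps power2_eq_square)
  finally show "(norm (perp (insert n S) z))\<^sup>2 = (norm ?r)\<^sup>2 - (?r \<bullet> n)\<^sup>2 / (norm ?m)\<^sup>2"
    by (simp add: power2_norm_eq_inner)
qed

lemma perp_minus: "perp S (- z) = - perp S z"
proof (rule perp_unique)
  show "- z - - perp S z \<in> span S" using span_neg[OF perp_props(1)[of z S]] by simp
qed (simp add: perp_props)

lemma norm_perp_le: "(norm (perp S z))\<^sup>2 \<le> (norm z)\<^sup>2"
  using perp_pythagoras[of z S] by simp

text \<open>
  The weights grow so fast with the number of normals that, if \<open>S\<close> maximises the weighted
  distance of \<open>z\<close> to \<open>span S\<close>, then \<open>z\<close> is almost orthogonal to \<open>span S\<close>; a normal \<open>n\<close> with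
  \<open>z \<bullet> n\<close> small but \<open>perp S z \<bullet> n > 0\<close> could be added to \<open>S\<close> at a gain.
\<close>

lemma maximal_weight_normal:
  fixes z :: "'a::euclidean_space" and \<epsilon> :: "nat \<Rightarrow> real"
  assumes S: "finite S" and n: "norm n \<le> 1"
    and c: "c > 0" "n \<notin> span S \<Longrightarrow> c \<le> norm (perp S n)"
    and \<epsilon>: "\<epsilon> (Suc (card S)) - \<epsilon> (card S) = (4 * \<epsilon> (card S) + 8 * \<delta>\<^sup>2) / c\<^sup>2"
      "0 \<le> \<epsilon> (card S)" "\<epsilon> (card S) \<le> 1/2" "n \<notin> span S \<Longrightarrow> \<epsilon> (Suc (card S)) \<le> 1/2"
    and base: "(norm z)\<^sup>2 \<le> (norm (perp S z))\<^sup>2 / (1 - \<epsilon> (card S))"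
    and max: "(norm (perp (insert n S) z))\<^sup>2 / (1 - \<epsilon> (card (insert n S)))
      \<le> (norm (perp S z))\<^sup>2 / (1 - \<epsilon> (card S))"
    and e: "0 \<le> e" "e \<le> \<delta> * norm z" "\<delta> > 0" "z \<noteq> 0" and zn: "z \<bullet> n \<le> e"
  shows "perp S z \<bullet> n \<le> 0"
proof (rule ccontr)
  let ?r = "perp S z" and ?k = "card S" and ?q = "perp S z \<bullet> n"
  assume "\<not> ?q \<le> 0"
  then have q: "?q > 0" by simp
  then have nS: "n \<notin> span S" using perp_props(2)[of n S z] by auto
  then have cd: "card (insert n S) = Suc ?k" using S span_base by (subst card_insert_disjoint) auto
  define R Z m where "R = (norm ?r)\<^sup>2" and "Z = (norm z)\<^sup>2" and "m = (norm (perp S n))\<^sup>2"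
  have m: "c\<^sup>2 \<le> m" "0 < c\<^sup>2" unfolding m_def using c nS by (auto intro: power_mono)
  then have m0: "0 < m" by linarith
  have Z: "Z > 0" using e by (simp add: Z_def)
  \<comment> \<open>The empty set of normals competes in the maximum with the full norm, so the
    maximising \<open>S\<close> cannot lose more than the fraction \<open>\<epsilon> ?k\<close> of
    it; Pythagoras then bounds the part of \<open>z\<close> inside \<open>span S\<close>.\<close>
  have RZ: "(1 - \<epsilon> ?k) * Z \<le> R"
    using base \<epsilon>(3) by (simp add: R_def Z_def pos_le_divide_eq mult.commute)
  have "1/2 * Z \<le> (1 - \<epsilon> ?k) * Z" using Z \<epsilon> by (intro mult_right_mono) auto
  then have R2: "Z \<le> 2 * R" using RZ by simp
  have d: "(norm (z - ?r))\<^sup>2 \<le> \<epsilon> ?k * Z"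
    using perp_pythagoras[of z S] RZ unfolding R_def Z_def by (simp add: algebra_simps)
  have "?q = z \<bullet> n - (z - ?r) \<bullet> n" by (simp add: inner_diff_left)
  also have "\<dots> \<le> e + norm (z - ?r)"
  proof -
    have "\<bar>(z - ?r) \<bullet> n\<bar> \<le> norm (z - ?r) * norm n" by (rule Cauchy_Schwarz_ineq2)
    also have "\<dots> \<le> norm (z - ?r)" using n by (simp add: mult_left_le)
    finally show ?thesis using zn by linarith
  qed
  finally have "?q\<^sup>2 \<le> (e + norm (z - ?r))\<^sup>2" using q by (intro power_mono) auto
  also have "\<dots> \<le> 2 * e\<^sup>2 + 2 * (norm (z - ?r))\<^sup>2"
    using zero_le_power2[of "e - norm (z - ?r)"] unfolding power2_sum power2_diff by linarith
  also have "\<dots> \<le> 2 * (\<delta>\<^sup>2 * Z) + 2 * (\<epsilon> ?k * Z)"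
    using d power_mono[OF e(2) e(1), of 2] by (simp add: Z_def power_mult_distrib)
  finally have q2: "?q\<^sup>2 \<le> (2 * \<delta>\<^sup>2 + 2 * \<epsilon> ?k) * Z" by (simp add: algebra_simps)
  have "(R - ?q\<^sup>2 / m) / (1 - \<epsilon> (Suc ?k)) \<le> R / (1 - \<epsilon> ?k)"
    using max unfolding cd perp_insert(2)[OF nS] R_def m_def .
  then have "(R - ?q\<^sup>2 / m) * (1 - \<epsilon> ?k) \<le> R * (1 - \<epsilon> (Suc ?k))"
    using \<epsilon>(3) \<epsilon>(4)[OF nS] by (simp add: divide_simps split: if_splits)
  \<comment> \<open>Maximality of \<open>S\<close> in the form: the weight gained by one more normal
    is outdone by the squared distance lost.\<close>
  then have "(\<epsilon> (Suc ?k) - \<epsilon> ?k) * R \<le> (1 - \<epsilon> ?k) * (?q\<^sup>2 / m)" by (simp add: algebra_simps)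
  also have "\<dots> \<le> 1 * (?q\<^sup>2 / m)" using \<epsilon> m0 by (intro mult_right_mono) auto
  also have "\<dots> \<le> ?q\<^sup>2 / c\<^sup>2" using m by (simp add: frac_le)
  finally have "(4 * \<epsilon> ?k + 8 * \<delta>\<^sup>2) * R \<le> ?q\<^sup>2"
    unfolding \<epsilon>(1) using m by (simp add: divide_simps mult.commute)
  \<comment> \<open>The increment of \<open>\<epsilon>\<close> is chosen for this collision: the
    lower bound for the square of \<open>?q\<close> exceeds the upper bound by
    \<open>2 * \<delta>\<close> squared times \<open>Z\<close>, which is positive.\<close>
  moreover have "(2 * \<epsilon> ?k + 4 * \<delta>\<^sup>2) * Z \<le> (2 * \<epsilon> ?k + 4 * \<delta>\<^sup>2) * (2 * R)"
    using R2 \<epsilon>(2) by (intro mult_left_mono) auto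
  ultimately have "2 * \<delta>\<^sup>2 * Z \<le> 0" using q2 by (simp add: algebra_simps)
  then show False using Z e(3) by (simp add: mult_le_0_iff)
qed

text \<open>The hypothesis on \<open>v\<close> is dual: increments lie in the cone spanned by
  normals on which the new point is at most \<open>e\<close> and by negatives of normals on which it
  is at least \<open>- e\<close>. For a set \<open>S\<close> of maximal weight the vector
  \<open>perp S z\<close> is an admissible test, by \<open>maximal_weight_normal\<close> applied to
  \<open>z\<close> and to \<open>- z\<close>. The tangent inequality then shows that the distance to
  \<open>span S\<close> does not increase in this step. The bound is independent of the number of
  steps.\<close>

lemma oscillation:
  fixes N :: "'a::euclidean_space set"
  assumes N: "finite N" "\<And>n. n \<in> N \<Longrightarrow> norm n \<le> 1"
  shows "\<exists>C>0. \<forall>\<eta> m e j. 0 \<le> e \<longrightarrow> \<eta> (0::nat) = 0 \<longrightarrow>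
      (\<forall>i<m. \<forall>v. (\<forall>n\<in>N. (\<eta> (Suc i) \<bullet> n \<le> e \<longrightarrow> v \<bullet> n \<le> 0) \<and> (- e \<le> \<eta> (Suc i) \<bullet> n \<longrightarrow> 0 \<le> v \<bullet> n)) \<longrightarrow>
         v \<bullet> (\<eta> (Suc i) - \<eta> i) \<le> 0) \<longrightarrow>
      j \<le> m \<longrightarrow> norm (\<eta> j) \<le> C * e"
proof -
  define G where "G = (\<lambda>(S, n). norm (perp S n)) ` {(S, n). S \<subseteq> N \<and> n \<in> N \<and> n \<notin> span S}"
  \<comment> \<open>The least nonzero distance from a normal to the span of some of the others. It
    is positive because there are finitely many pairs; the inserted 1 covers an empty
    family.\<close>
  define c where "c = Min (insert 1 G)"
  have "finite {(S, n). S \<subseteq> N \<and> n \<in> N \<and> n \<notin> span S}"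
    by (rule finite_subset[of _ "Pow N \<times> N"]) (use N in auto)
  then have G: "finite G" by (simp add: G_def)
  have c0: "c > 0" unfolding c_def using G by (subst Min_gr_iff) (auto simp: G_def perp_insert(1))
  have c: "c \<le> norm (perp S n)" if "S \<subseteq> N" "n \<in> N" "n \<notin> span S" for S n
    unfolding c_def using G that by (intro Min_le) (auto simp: G_def image_iff intro!: exI[of _ S] bexI[of _ n])
  \<comment> \<open>The recursion for \<open>\<epsilon>\<close> is homogeneous in
    \<open>\<epsilon>\<close> and the square of \<open>\<delta>\<close>. Dividing by the latter
    gives a sequence \<open>E\<close> free of \<open>\<delta>\<close>, so \<open>\<delta>\<close>
    can be fixed afterwards to keep all weights at most 1/2.\<close>
  define E where "E k = ((\<lambda>x. x * (1 + 4 / c\<^sup>2) + 8 / c\<^sup>2) ^^ k) 0" for k :: nat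
  have ES: "E (Suc k) = E k * (1 + 4 / c\<^sup>2) + 8 / c\<^sup>2" for k by (simp add: E_def)
  have E0: "E 0 = 0" by (simp add: E_def)
  have Epos: "0 \<le> E k" for k by (induction k) (auto simp: E0 ES)
  have "E k \<le> E (Suc k)" for k using Epos[of k] by (simp add: ES algebra_simps)
  then have Emono: "E k \<le> E l" if "k \<le> l" for k l using lift_Suc_mono_le that by blast
  define \<delta> where "\<delta> = sqrt (1 / (2 * (E (card N) + 1)))"
  have \<delta>: "\<delta> > 0" "\<delta>\<^sup>2 = 1 / (2 * (E (card N) + 1))" using Epos[of "card N"] by (auto simp: \<delta>_def)
  define \<epsilon> where "\<epsilon> k = \<delta>\<^sup>2 * E k" for k
  have \<epsilon>0: "\<epsilon> 0 = 0" "0 \<le> \<epsilon> k" for k by (auto simp: \<epsilon>_def E0 Epos)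
  have \<epsilon>S: "\<epsilon> (Suc k) - \<epsilon> k = (4 * \<epsilon> k + 8 * \<delta>\<^sup>2) / c\<^sup>2" for k
    by (simp add: \<epsilon>_def ES algebra_simps add_divide_distrib)
  have \<epsilon>h: "\<epsilon> k \<le> 1/2" if "k \<le> card N" for k
  proof -
    have "\<epsilon> k \<le> \<delta>\<^sup>2 * E (card N)" unfolding \<epsilon>_def using Emono[OF that] by (intro mult_left_mono) auto
    also have "\<dots> \<le> 1/2" using Epos[of "card N"] by (simp add: \<delta>(2) divide_simps)
    finally show ?thesis .
  qed
  define w where "w S z = (norm (perp S z))\<^sup>2 / (1 - \<epsilon> (card S))" for S and z :: 'a
  define \<Phi> where "\<Phi> z = Max ((\<lambda>S. w S z) ` Pow N)" for z
  have w_le: "w S z \<le> \<Phi> z" if "S \<subseteq> N" for S z unfolding \<Phi>_def using N(1) that by (intro Max_ge) auto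
  have \<Phi>_w: "\<exists>S\<subseteq>N. \<Phi> z = w S z" for z
  proof -
    have "\<Phi> z \<in> (\<lambda>S. w S z) ` Pow N" unfolding \<Phi>_def using N(1) by (intro Max_in) auto
    then show ?thesis by auto
  qed
  have "perp {} z = z" for z :: 'a by (rule perp_unique) auto
  then have w_empty: "w {} z = (norm z)\<^sup>2" for z by (simp add: w_def \<epsilon>0)
  have cardS: "card S \<le> card N" if "S \<subseteq> N" for S using that N(1) by (rule card_mono[rotated])
  have \<Phi>_le: "\<Phi> z \<le> 2 * (norm z)\<^sup>2" for z
  proof -
    obtain S where S: "S \<subseteq> N" "\<Phi> z = w S z" using \<Phi>_w by blast
    have "w S z \<le> (norm z)\<^sup>2 / (1/2)"
      unfolding w_def using \<epsilon>h[OF cardS[OF S(1)]] norm_perp_le[of S z] by (intro frac_le) auto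
    then show ?thesis using S by simp
  qed
  have step: "perp S z \<bullet> n \<le> 0"
    if "S \<subseteq> N" "\<Phi> z = w S z" "n \<in> N" "0 \<le> e" "e \<le> \<delta> * norm z" "z \<noteq> 0" "z \<bullet> n \<le> e" for S z n e
  proof (rule maximal_weight_normal[where \<epsilon> = \<epsilon> and c = c and \<delta> = \<delta> and e = e])
    show "finite S" using that N finite_subset by blast
    show "c \<le> norm (perp S n)" if "n \<notin> span S" using c that \<open>S \<subseteq> N\<close> \<open>n \<in> N\<close> by blast
    show "\<epsilon> (Suc (card S)) \<le> 1/2" if "n \<notin> span S"
    proof -
      have "n \<notin> S" using that span_base by blast
      then have "card (insert n S) = Suc (card S)" using \<open>finite S\<close> by simp
      then show ?thesis using cardS[of "insert n S"] \<epsilon>h \<open>S \<subseteq> N\<close> \<open>n \<in> N\<close> by auto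
    qed
    show "\<epsilon> (card S) \<le> 1/2" using \<epsilon>h cardS that by blast
    show "(norm z)\<^sup>2 \<le> (norm (perp S z))\<^sup>2 / (1 - \<epsilon> (card S))"
      using w_le[of "{}" z] that(2) unfolding w_empty w_def[of S] by simp
    show "(norm (perp (insert n S) z))\<^sup>2 / (1 - \<epsilon> (card (insert n S)))
      \<le> (norm (perp S z))\<^sup>2 / (1 - \<epsilon> (card S))"
      using w_le[of "insert n S" z] that by (simp add: w_def)
  qed (use that N c0 \<epsilon>S \<epsilon>0 \<delta> in auto)
  have w_minus: "w S (- z) = w S z" for S z by (simp add: w_def perp_minus)
  then have \<Phi>_minus: "\<Phi> (- z) = \<Phi> z" for z by (simp add: \<Phi>_def)
  have main: "norm (\<eta> j) \<le> 2 / \<delta> * e"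
    if e: "0 \<le> e" and \<eta>0: "\<eta> (0::nat) = 0"
      and \<eta>: "\<forall>i<m. \<forall>v. (\<forall>n\<in>N. (\<eta> (Suc i) \<bullet> n \<le> e \<longrightarrow> v \<bullet> n \<le> 0) \<and> (- e \<le> \<eta> (Suc i) \<bullet> n \<longrightarrow> 0 \<le> v \<bullet> n)) \<longrightarrow>
         v \<bullet> (\<eta> (Suc i) - \<eta> i) \<le> 0"
      and j: "j \<le> m" for \<eta> :: "nat \<Rightarrow> 'a" and m e j
  proof -
    \<comment> \<open>Invariant along the sequence: below the threshold \<open>e / \<delta>\<close>
      the bound \<open>\<Phi>_le\<close> suffices, above it \<open>\<Phi>\<close> has not grown in
      the last step.\<close>
    have "\<Phi> (\<eta> j) \<le> 2 * (e / \<delta>)\<^sup>2" using j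
    proof (induction j)
      case 0
      have "\<Phi> (\<eta> 0) \<le> 0" "0 \<le> 2 * (e / \<delta>)\<^sup>2" using \<Phi>_le[of 0] by (simp_all add: \<eta>0)
      then show ?case by linarith
    next
      case (Suc i)
      let ?z = "\<eta> (Suc i)"
      show ?case
      proof (cases "norm ?z \<le> e / \<delta>")
        case True
        then have "(norm ?z)\<^sup>2 \<le> (e / \<delta>)\<^sup>2" by (intro power_mono) auto
        then show ?thesis using \<Phi>_le[of ?z] by linarith
      next
        case False
        then have z: "e \<le> \<delta> * norm ?z" using \<delta>(1) by (simp add: field_simps)
        have "0 \<le> e / \<delta>" using e \<delta>(1) by simp
        then have z0: "?z \<noteq> 0" using False by auto
        obtain S where S: "S \<subseteq> N" "\<Phi> ?z = w S ?z" using \<Phi>_w by blast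
        have "perp S ?z \<bullet> n \<le> 0" if "n \<in> N" "?z \<bullet> n \<le> e" for n using step[OF S that(1) e z z0 that(2)] .
        moreover have "0 \<le> perp S ?z \<bullet> n" if "n \<in> N" "- e \<le> ?z \<bullet> n" for n
          using step[of S "- ?z" n e] S that e z z0 by (auto simp: \<Phi>_minus w_minus perp_minus)
        ultimately have "perp S ?z \<bullet> (?z - \<eta> i) \<le> 0" using \<eta> Suc.prems by auto
        then have "(norm (perp S ?z))\<^sup>2 \<le> (norm (perp S (\<eta> i)))\<^sup>2"
          using perp_tangent[of S ?z "\<eta> i"] by linarith
        then have "w S ?z \<le> w S (\<eta> i)" unfolding w_def using \<epsilon>h[OF cardS[OF S(1)]] by (intro divide_right_mono) auto
        also have "\<dots> \<le> \<Phi> (\<eta> i)" using w_le S by blast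
        finally show ?thesis using Suc S by simp
      qed
    qed
    then have "(norm (\<eta> j))\<^sup>2 \<le> 2 * (e / \<delta>)\<^sup>2" using w_le[of "{}" "\<eta> j"] by (simp add: w_empty)
    also have "\<dots> \<le> (2 / \<delta> * e)\<^sup>2" by (simp add: power_mult_distrib power_divide divide_right_mono)
    finally show ?thesis by (rule power2_le_imp_le) (use e \<delta> in auto)
  qed
  show ?thesis
    by (intro exI[of _ "2 / \<delta>"] conjI allI impI main) (use \<delta> in auto)
qed

section \<open>The deterministic Skorokhod problem\<close>

context solid_polyhedron
begin

text \<open>Increments belong to the cone of normals of facets that are within \<open>\<rho>\<close>
  of the new position, stated through the polar cone. The tolerance admits samples of a continuous
  solution, which may touch a facet between two grid points. Using the new position makes the scheme
  implicit, as \<open>oscillation\<close> requires.\<close>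

definition discrete_skorokhod :: "real \<Rightarrow> nat \<Rightarrow> (nat \<Rightarrow> 'a) \<Rightarrow> (nat \<Rightarrow> 'a) \<Rightarrow> bool" where
  "discrete_skorokhod \<rho> m u k \<longleftrightarrow> k 0 = 0 \<and> (\<forall>j\<le>m. u j - k j \<in> D) \<and>
     (\<forall>j<m. \<forall>v. (\<forall>F. F facet_of D \<and> off F - \<rho> \<le> nrm F \<bullet> (u (Suc j) - k (Suc j)) \<longrightarrow> v \<bullet> nrm F \<le> 0) \<longrightarrow>
        v \<bullet> (k (Suc j) - k j) \<le> 0)"

text \<open>If a facet is nearly active for the first path, the second path being in
  \<open>D\<close> forces the product of its normal with \<open>k - k'\<close> to be at most
  \<open>e + \<rho>\<close>; for facets nearly active for the second path the signs are reversed.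
  This is the situation of \<open>oscillation\<close> for the sequence
  \<open>k - k'\<close>.\<close>

lemma discrete_skorokhod_lipschitz_ex:
  "\<exists>C>0. \<forall>\<rho> m u k u' k' e j. 0 \<le> \<rho> \<longrightarrow> discrete_skorokhod \<rho> m u k \<longrightarrow> discrete_skorokhod \<rho> m u' k' \<longrightarrow>
     (\<forall>i\<le>m. norm (u i - u' i) \<le> e) \<longrightarrow> j \<le> m \<longrightarrow> norm (k j - k' j) \<le> C * (e + \<rho>)"
proof -
  have N: "finite (nrm ` {F. F facet_of D})" "\<And>n. n \<in> nrm ` {F. F facet_of D} \<Longrightarrow> norm n \<le> 1"
    using fin_facets norm_nrm by auto
  obtain C where C: "C > 0"
    and osc: "\<And>\<eta> m e j. 0 \<le> e \<Longrightarrow> \<eta> (0::nat) = 0 \<Longrightarrow>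
      \<forall>i<m. \<forall>v. (\<forall>n\<in>nrm ` {F. F facet_of D}. (\<eta> (Suc i) \<bullet> n \<le> e \<longrightarrow> v \<bullet> n \<le> 0) \<and>
        (- e \<le> \<eta> (Suc i) \<bullet> n \<longrightarrow> 0 \<le> v \<bullet> n)) \<longrightarrow> v \<bullet> (\<eta> (Suc i) - \<eta> i) \<le> 0 \<Longrightarrow>
      j \<le> m \<Longrightarrow> norm (\<eta> j) \<le> C * e"
    using oscillation[OF N] by blast
  show ?thesis
  proof (intro exI[of _ C] conjI C allI impI)
    fix \<rho> e :: real and m j :: nat and u k u' k' :: "nat \<Rightarrow> 'a"
    assume \<rho>: "0 \<le> \<rho>" and k: "discrete_skorokhod \<rho> m u k" and k': "discrete_skorokhod \<rho> m u' k'"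
      and u: "\<forall>i\<le>m. norm (u i - u' i) \<le> e" and j: "j \<le> m"
    have e: "0 \<le> e" using u by (meson le0 norm_ge_zero order_trans)
    have un: "\<bar>(u i - u' i) \<bullet> nrm F\<bar> \<le> e" if "i \<le> m" "F facet_of D" for i F
      using Cauchy_Schwarz_ineq2[of "u i - u' i" "nrm F"] u that norm_nrm[of F] by fastforce
    show "norm (k j - k' j) \<le> C * (e + \<rho>)"
    proof (rule osc[where m = m and \<eta> = "\<lambda>j. k j - k' j"], goal_cases)
      case 3
      have "v \<bullet> (k (Suc i) - k' (Suc i) - (k i - k' i)) \<le> 0" if i: "i < m"
        and v: "\<And>F. F facet_of D \<Longrightarrow> (k (Suc i) - k' (Suc i)) \<bullet> nrm F \<le> e + \<rho> \<Longrightarrow> v \<bullet> nrm F \<le> 0"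
          "\<And>F. F facet_of D \<Longrightarrow> - (e + \<rho>) \<le> (k (Suc i) - k' (Suc i)) \<bullet> nrm F \<Longrightarrow> 0 \<le> v \<bullet> nrm F" for i v
      proof -
      have D: "u (Suc i) - k (Suc i) \<in> D" "u' (Suc i) - k' (Suc i) \<in> D"
        using i k k' by (auto simp: discrete_skorokhod_def)
      have "v \<bullet> (k (Suc i) - k i) \<le> 0"
      proof -
        have "v \<bullet> nrm F \<le> 0" if F: "F facet_of D" "off F - \<rho> \<le> nrm F \<bullet> (u (Suc i) - k (Suc i))" for F
        proof (rule v(1))
          show "(k (Suc i) - k' (Suc i)) \<bullet> nrm F \<le> e + \<rho>"
            using nrm_le[OF F(1) D(2)] F(2) un[of "Suc i" F] i F(1) by (simp add: inner_simps inner_commute)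
        qed (use F in blast)
        then show ?thesis using k i unfolding discrete_skorokhod_def by blast
      qed
      moreover have "(- v) \<bullet> (k' (Suc i) - k' i) \<le> 0"
      proof -
        have "(- v) \<bullet> nrm F \<le> 0" if F: "F facet_of D" "off F - \<rho> \<le> nrm F \<bullet> (u' (Suc i) - k' (Suc i))" for F
        proof -
          have "- (e + \<rho>) \<le> (k (Suc i) - k' (Suc i)) \<bullet> nrm F"
            using nrm_le[OF F(1) D(1)] F(2) un[of "Suc i" F] i F(1) by (simp add: inner_simps inner_commute)
          then show ?thesis using v(2)[of F] F by simp
        qed
        then show ?thesis using k' i unfolding discrete_skorokhod_def by blast
      qed
      ultimately show ?thesis by (simp add: inner_simps)
      qed
      then show ?case by blast
    qed (use e \<rho> j k k' in \<open>auto simp: discrete_skorokhod_def\<close>)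
  qed
qed

text \<open>A constant of \<open>D\<close> alone: tolerance, number of steps and paths are all
  quantified inside.\<close>

definition lip :: real where
  "lip = (SOME C. C > 0 \<and> (\<forall>\<rho> m u k u' k' e j. 0 \<le> \<rho> \<longrightarrow> discrete_skorokhod \<rho> m u k \<longrightarrow>
     discrete_skorokhod \<rho> m u' k' \<longrightarrow> (\<forall>i\<le>m. norm (u i - u' i) \<le> e) \<longrightarrow> j \<le> m \<longrightarrow>
     norm (k j - k' j) \<le> C * (e + \<rho>)))"

lemma lip_pos: "lip > 0"
  and discrete_skorokhod_lipschitz:
    "\<lbrakk>0 \<le> \<rho>; discrete_skorokhod \<rho> m u k; discrete_skorokhod \<rho> m u' k';
      \<And>i. i \<le> m \<Longrightarrow> norm (u i - u' i) \<le> e; j \<le> m\<rbrakk> \<Longrightarrow> norm (k j - k' j) \<le> lip * (e + \<rho>)"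
  using someI_ex[OF discrete_skorokhod_lipschitz_ex] unfolding lip_def by blast+

text \<open>
  The increment of \<open>k\<close> over \<open>[s,t]\<close> lies in the cone spanned by the normals of the facets that the
  path \<open>u - k\<close> visits during \<open>[s,t]\<close>, expressed through the polar cone. This makes no reference to
  the variation of \<open>k\<close>, so it passes to uniform limits.
\<close>

definition skorokhod :: "real \<Rightarrow> (real \<Rightarrow> 'a) \<Rightarrow> (real \<Rightarrow> 'a) \<Rightarrow> bool" where
  "skorokhod T u k \<longleftrightarrow> continuous_on {0..T} k \<and> k 0 = 0 \<and> (\<forall>t\<in>{0..T}. u t - k t \<in> D) \<and>
     (\<forall>s t v. 0 \<le> s \<and> s \<le> t \<and> t \<le> T \<and>
        (\<forall>F. F facet_of D \<and> (\<exists>r\<in>{s..t}. u r - k r \<in> F) \<longrightarrow> v \<bullet> nrm F \<le> 0) \<longrightarrow> v \<bullet> (k t - k s) \<le> 0)"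

lemma skorokhod_cone:
  "\<lbrakk>skorokhod T u k; 0 \<le> s; s \<le> t; t \<le> T;
    \<And>F r. F facet_of D \<Longrightarrow> s \<le> r \<Longrightarrow> r \<le> t \<Longrightarrow> u r - k r \<in> F \<Longrightarrow> v \<bullet> nrm F \<le> 0\<rbrakk> \<Longrightarrow> v \<bullet> (k t - k s) \<le> 0"
  unfolding skorokhod_def by (elim conjE allE[of _ s] allE[of _ t] allE[of _ v]) auto

text \<open>A facet visited during a time step is still within \<open>\<rho>\<close> of the path at
  the end of the step, when the path oscillates by at most \<open>\<rho>\<close> over one step. The
  cone over the visited facets is thus contained in the tolerated one.\<close>

lemma skorokhod_sample:
  fixes t :: real and m :: nat
  assumes k: "skorokhod T u k" and t: "0 \<le> t" "t \<le> T" and m: "m > 0"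
    and \<rho>: "\<And>r s. \<lbrakk>r \<in> {0..t}; s \<in> {0..t}; \<bar>r - s\<bar> \<le> t / m\<rbrakk> \<Longrightarrow> norm (u r - k r - (u s - k s)) \<le> \<rho>"
  shows "discrete_skorokhod \<rho> m (\<lambda>j. u (real j * t / m)) (\<lambda>j. k (real j * t / m))"
proof -
  have "v \<bullet> (k (real (Suc j) * t / m) - k (real j * t / m)) \<le> 0"
    if j: "j < m" and v: "\<forall>F. F facet_of D \<and>
      off F - \<rho> \<le> nrm F \<bullet> (u (real (Suc j) * t / m) - k (real (Suc j) * t / m)) \<longrightarrow> v \<bullet> nrm F \<le> 0" for j v
  proof (rule skorokhod_cone[OF k])
    let ?s = "real j * t / m" and ?t = "real (Suc j) * t / m"
    have d: "?t - ?s = t / m" using m by (simp add: field_simps)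
    have tm: "0 \<le> t / m" using t m by simp
    have "?s \<le> ?t" using d tm by linarith
    then show le: "0 \<le> ?s" "?s \<le> ?t" using t by auto
    have "real (Suc j) \<le> real m" using j by linarith
    then have "real (Suc j) * t \<le> real m * t" using t by (intro mult_right_mono) auto
    then have tt: "?t \<le> t" using m by (simp add: field_simps)
    then show "?t \<le> T" using t by simp
    fix F r assume F: "F facet_of D" and r: "?s \<le> r" "r \<le> ?t" "u r - k r \<in> F"
    have "norm (u r - k r - (u ?t - k ?t)) \<le> \<rho>" using r tt le d by (intro \<rho>) auto
    then have "\<bar>nrm F \<bullet> (u r - k r - (u ?t - k ?t))\<bar> \<le> \<rho>"
      using Cauchy_Schwarz_ineq2[of "nrm F" "u r - k r - (u ?t - k ?t)"] norm_nrm[OF F] by simp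
    moreover have "nrm F \<bullet> (u r - k r) = off F" using mem_facet_iff[OF F] r by blast
    ultimately have "off F - \<rho> \<le> nrm F \<bullet> (u ?t - k ?t)" by (simp add: inner_diff_right)
    then show "v \<bullet> nrm F \<le> 0" using v F by blast
  qed
  moreover have "u (j * t / m) - k (j * t / m) \<in> D" if "j \<le> m" for j
  proof -
    have "j * t \<le> real m * t" using that t by (intro mult_right_mono) auto
    then have "j * t / m \<le> t" using m by (simp add: field_simps)
    then have "j * t / m \<in> {0..T}" using t by auto
    then show ?thesis using k by (auto simp: skorokhod_def)
  qed
  ultimately show ?thesis using k unfolding discrete_skorokhod_def skorokhod_def by auto
qed

text \<open>Both solutions are sampled on one grid, so fine that each oscillates by less than
  \<open>\<rho>\<close> per step. The discrete bound does not see the number of steps, and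
  \<open>\<rho>\<close> is arbitrary. With \<open>e = 0\<close> this is uniqueness.\<close>

lemma skorokhod_lipschitz:
  assumes k: "skorokhod T u k" "skorokhod T u' k'" and u: "continuous_on {0..T} u" "continuous_on {0..T} u'"
    and t: "0 \<le> t" "t \<le> T" and e: "\<And>s. 0 \<le> s \<Longrightarrow> s \<le> t \<Longrightarrow> norm (u s - u' s) \<le> e"
  shows "norm (k t - k' t) \<le> lip * e"
proof (rule field_le_epsilon)
  fix \<epsilon> :: real assume "\<epsilon> > 0"
  define \<rho> where "\<rho> = \<epsilon> / lip"
  have \<rho>: "\<rho> > 0" using lip_pos \<open>\<epsilon> > 0\<close> by (simp add: \<rho>_def)
  have "uniformly_continuous_on {0..t} (\<lambda>s. u s - k s)" "uniformly_continuous_on {0..t} (\<lambda>s. u' s - k' s)"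
    using k u t unfolding skorokhod_def
    by (auto intro!: compact_uniformly_continuous continuous_intros intro: continuous_on_subset)
  then obtain d d' where d: "d > 0" "d' > 0"
    "\<And>r s. r \<in> {0..t} \<Longrightarrow> s \<in> {0..t} \<Longrightarrow> \<bar>r - s\<bar> < d \<Longrightarrow> norm (u r - k r - (u s - k s)) < \<rho>"
    "\<And>r s. r \<in> {0..t} \<Longrightarrow> s \<in> {0..t} \<Longrightarrow> \<bar>r - s\<bar> < d' \<Longrightarrow> norm (u' r - k' r - (u' s - k' s)) < \<rho>"
    using \<rho> unfolding uniformly_continuous_on_def dist_norm real_norm_def by metis
  obtain m :: nat where m: "t / min d d' < m" using reals_Archimedean2 by blast
  moreover have "0 \<le> t / min d d'" using t d by simp
  ultimately have m0: "m > 0" by (metis less_le_trans not_gr_zero of_nat_0 order_less_irrefl)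
  have "t < m * min d d'" using m d by (simp add: pos_divide_less_eq)
  then have "t / m < min d d'" using m0 by (simp only: pos_divide_less_eq of_nat_0_less_iff mult.commute)
  then have tm: "t / m < d" "t / m < d'" by linarith+
  have "norm (k (real m * t / m) - k' (real m * t / m)) \<le> lip * (e + \<rho>)"
  proof (rule discrete_skorokhod_lipschitz[where m = m and j = m and \<rho> = \<rho>
        and u = "\<lambda>j. u (real j * t / m)" and u' = "\<lambda>j. u' (real j * t / m)"
        and k = "\<lambda>j. k (real j * t / m)" and k' = "\<lambda>j. k' (real j * t / m)"])
    show "discrete_skorokhod \<rho> m (\<lambda>j. u (real j * t / m)) (\<lambda>j. k (real j * t / m))"
      by (rule skorokhod_sample[OF k(1) t m0], rule less_imp_le, rule d(3)) (use tm in linarith)+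
    show "discrete_skorokhod \<rho> m (\<lambda>j. u' (real j * t / m)) (\<lambda>j. k' (real j * t / m))"
      by (rule skorokhod_sample[OF k(2) t m0], rule less_imp_le, rule d(4)) (use tm in linarith)+
    show "norm (u (real i * t / m) - u' (real i * t / m)) \<le> e" if "i \<le> m" for i
    proof (rule e)
      have "i * t \<le> real m * t" using that t by (intro mult_right_mono) auto
      then show "0 \<le> real i * t / m" "real i * t / m \<le> t" using m0 t by (auto simp: field_simps)
    qed
  qed (use \<rho> in auto)
  then show "norm (k t - k' t) \<le> lip * e + \<epsilon>" using m0 lip_pos by (simp add: \<rho>_def algebra_simps)
qed

subsection \<open>Existence\<close>

text \<open>Implicit Euler scheme for the pushing term: the new position
  \<open>w (Suc j) - euler w (Suc j)\<close> is the projection onto \<open>D\<close> of the path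
  moved with the old push, and the residual of the projection is added to the push.\<close>

primrec euler :: "(nat \<Rightarrow> 'a) \<Rightarrow> nat \<Rightarrow> 'a" where
  "euler w 0 = 0"
| "euler w (Suc j) = w (Suc j) - closest_point D (w (Suc j) - euler w j)"

lemma euler_mem: "w 0 \<in> D \<Longrightarrow> w j - euler w j \<in> D"
  by (cases j) (auto intro: closest_point_in_set D_closed D_ne)

lemma euler_discrete_skorokhod:
  assumes "w 0 \<in> D" shows "discrete_skorokhod 0 m w (euler w)"
proof -
  have "v \<bullet> (euler w (Suc j) - euler w j) \<le> 0"
    if v: "\<forall>F. F facet_of D \<and> off F - 0 \<le> nrm F \<bullet> (w (Suc j) - euler w (Suc j)) \<longrightarrow> v \<bullet> nrm F \<le> 0" for j v
  proof -
    let ?y = "w (Suc j) - euler w j"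
    have "v \<bullet> (?y - closest_point D ?y) \<le> 0"
    proof (rule closest_point_normal)
      fix F assume F: "F facet_of D" "closest_point D ?y \<in> F"
      then show "v \<bullet> nrm F \<le> 0" using v mem_facet_iff[OF F(1)] by auto
    qed
    then show ?thesis by (simp add: algebra_simps)
  qed
  then show ?thesis using euler_mem[where w = w, OF assms] unfolding discrete_skorokhod_def by simp
qed

text \<open>The previous position lies in \<open>D\<close> and competes with the closest
  point.\<close>

lemma euler_jump:
  assumes "w 0 \<in> D" shows "norm (euler w (Suc j) - euler w j) \<le> norm (w (Suc j) - w j)"
  using closest_point_le[OF D_closed euler_mem[where w = w and j = j, OF assms], of "w (Suc j) - euler w j"]
  by (simp add: dist_norm algebra_simps)

text \<open>Repeating an index contributes a zero increment. Schemes on different grids can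
  therefore be compared on the finer one.\<close>

lemma discrete_skorokhod_reparam:
  assumes k: "\<And>m. discrete_skorokhod 0 m w k"
    and f: "f 0 = 0" "\<And>j. f (Suc j) = f j \<or> f (Suc j) = Suc (f j)"
  shows "discrete_skorokhod 0 m (\<lambda>j. w (f j)) (\<lambda>j. k (f j))"
proof -
  have "v \<bullet> (k (f (Suc j)) - k (f j)) \<le> 0"
    if "\<forall>F. F facet_of D \<and> off F - 0 \<le> nrm F \<bullet> (w (f (Suc j)) - k (f (Suc j))) \<longrightarrow> v \<bullet> nrm F \<le> 0" for j v
    using f(2)[of j]
  proof
    assume "f (Suc j) = Suc (f j)"
    then show ?thesis using k[of "Suc (f j)"] that unfolding discrete_skorokhod_def by auto
  qed simp
  moreover have "w (f j) - k (f j) \<in> D" for j using k[of "f j"] by (auto simp: discrete_skorokhod_def)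
  moreover have "k 0 = 0" using k[of 0] by (auto simp: discrete_skorokhod_def)
  ultimately show ?thesis using f(1) by (simp add: discrete_skorokhod_def)
qed

end

section \<open>Dyadic time grids\<close>

definition dyadic_index :: "nat \<Rightarrow> real \<Rightarrow> nat" where
  "dyadic_index n t = nat \<lfloor>2 ^ n * t\<rfloor>"

lemma dyadic_index_grid [simp]: "dyadic_index n (real j / 2 ^ n) = j"
  by (simp add: dyadic_index_def)

lemma dyadic_index_zero [simp]: "dyadic_index n 0 = 0"
  by (simp add: dyadic_index_def)

text \<open>The grid of level \<open>n\<close> coarsens that of level \<open>m\<close>, each of its
  cells consisting of \<open>2 ^ (m - n)\<close> fine ones.\<close>

lemma dyadic_index_div:
  assumes "n \<le> m" shows "dyadic_index n t = dyadic_index m t div 2 ^ (m - n)"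
proof -
  have "(2::real) ^ m = 2 ^ n * 2 ^ (m - n)" using assms by (simp flip: power_add)
  then have "2 ^ n * t = 2 ^ m * t / real_of_int (2 ^ (m - n))" by simp
  then have "\<lfloor>2 ^ n * t\<rfloor> = \<lfloor>2 ^ m * t\<rfloor> div 2 ^ (m - n)"
    using floor_divide_real_eq_div[of "2 ^ (m - n)" "2 ^ m * t"] by simp
  then show ?thesis by (simp add: dyadic_index_def nat_div_distrib' nat_power_eq)
qed

lemma dyadic_index_bounds:
  assumes "0 \<le> t" shows "dyadic_index n t / 2 ^ n \<le> t" "t < dyadic_index n t / 2 ^ n + 1 / 2 ^ n"
proof -
  have "real (dyadic_index n t) = of_int \<lfloor>2 ^ n * t\<rfloor>" using assms by (simp add: dyadic_index_def)
  then have "real (dyadic_index n t) \<le> 2 ^ n * t" "2 ^ n * t < real (dyadic_index n t) + 1" by linarith+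
  then show "dyadic_index n t / 2 ^ n \<le> t" "t < dyadic_index n t / 2 ^ n + 1 / 2 ^ n"
    by (simp_all add: field_simps)
qed

lemma dyadic_index_mono: "s \<le> t \<Longrightarrow> dyadic_index n s \<le> dyadic_index n t"
  unfolding dyadic_index_def by (intro nat_mono floor_mono mult_left_mono) auto

lemma dyadic_index_near:
  assumes "0 \<le> s" "s \<le> t" "t < s + 1 / 2 ^ n"
  shows "dyadic_index n t = dyadic_index n s \<or> dyadic_index n t = Suc (dyadic_index n s)"
proof -
  have "2 ^ n * t < 2 ^ n * s + 1" using assms(3) by (simp add: field_simps)
  then have "\<lfloor>2 ^ n * t\<rfloor> \<le> \<lfloor>2 ^ n * s\<rfloor> + 1" by linarith
  then have "dyadic_index n t \<le> Suc (dyadic_index n s)" by (simp add: dyadic_index_def)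
  then show ?thesis using dyadic_index_mono[OF assms(2), of n] by linarith
qed

context solid_polyhedron
begin

text \<open>The dyadic Euler schemes are uniformly Cauchy by the discrete Lipschitz bound.
  Closedness of \<open>D\<close> and the cone condition pass to the uniform limit, the latter
  because a facet missed by the limit on a compact interval is missed with a margin. The
  approximations are step functions; continuity of the limit comes from their small jumps.\<close>

lemma skorokhod_exists:
  assumes T: "0 \<le> T" and u: "continuous_on {0..T} u" and u0: "u 0 \<in> D"
  shows "\<exists>k. skorokhod T u k"
proof -
  \<comment> \<open>Extends \<open>u\<close> constantly outside \<open>[0,T]\<close>, so that the
    scheme can run over all grid points although \<open>T\<close> need not be dyadic.\<close>
  define clamp where "clamp t = max 0 (min T t)" for t :: real
  define w where "w n j = u (clamp (real j / 2 ^ n))" for n j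
  define U where "U n t = w n (dyadic_index n t)" for n t
  define K where "K n t = euler (w n) (dyadic_index n t)" for n t
  have w0: "w n 0 \<in> D" for n using u0 T by (simp add: w_def clamp_def)
  have "uniformly_continuous_on {0..T} u" using u by (rule compact_uniformly_continuous) simp
  note uc = this[unfolded uniformly_continuous_on_def, rule_format]
  have mod: "\<exists>d>0. \<forall>s t. \<bar>s - t\<bar> < d \<longrightarrow> norm (u (clamp s) - u (clamp t)) < \<rho>" if \<rho>: "\<rho> > 0" for \<rho>
  proof -
    obtain d where d: "d > 0" "\<And>t s. t \<in> {0..T} \<Longrightarrow> s \<in> {0..T} \<Longrightarrow> dist s t < d \<Longrightarrow> dist (u s) (u t) < \<rho>"
      using uc[OF \<rho>] by auto
    have "norm (u (clamp s) - u (clamp t)) < \<rho>" if "\<bar>s - t\<bar> < d" for s t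
    proof -
      have "clamp s \<in> {0..T}" "clamp t \<in> {0..T}" "dist (clamp s) (clamp t) < d"
        using that T by (auto simp: clamp_def dist_real_def)
      from d(2)[OF this(2,1,3)] show ?thesis unfolding dist_norm .
    qed
    then show ?thesis using d(1) by blast
  qed
  have fine: "\<exists>n0. \<forall>n\<ge>n0. (\<forall>t\<ge>0. norm (U n t - u (clamp t)) < \<rho>) \<and> (\<forall>j. norm (w n (Suc j) - w n j) < \<rho>)"
    if \<rho>: "\<rho> > 0" for \<rho>
  proof -
    obtain d where d: "d > 0" "\<And>s t. \<bar>s - t\<bar> < d \<Longrightarrow> norm (u (clamp s) - u (clamp t)) < \<rho>"
      using mod[OF \<rho>] by blast
    obtain n0 where n0: "(1/2) ^ n0 < d" using real_arch_pow_inv[OF d(1), of "1/2"] by auto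
    have pow: "1 / 2 ^ n < d" if "n \<ge> n0" for n
    proof -
      have "(1/2::real) ^ n \<le> (1/2) ^ n0" using that by (intro power_decreasing) auto
      then show ?thesis using n0 by (simp add: power_one_over)
    qed
    have "\<bar>real (Suc j) / 2 ^ n - real j / 2 ^ n\<bar> = 1 / 2 ^ n" for j n
      by (simp add: add_divide_distrib)
    then have "norm (w n (Suc j) - w n j) < \<rho>" if "n \<ge> n0" for n j
      unfolding w_def using pow[OF that] by (intro d(2)) (simp only:)
    moreover have "norm (U n t - u (clamp t)) < \<rho>" if "n \<ge> n0" "t \<ge> 0" for n t
    proof -
      have "\<bar>dyadic_index n t / 2 ^ n - t\<bar> \<le> 1 / 2 ^ n" using dyadic_index_bounds[OF that(2), of n] by linarith
      also have "\<dots> < d" by (rule pow) fact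
      finally show ?thesis unfolding U_def w_def by (rule d(2))
    qed
    ultimately show ?thesis by blast
  qed
  have cauchy: "norm (K n t - K m t) \<le> lip * e"
    if nm: "n \<le> m" and t: "0 \<le> t" and e: "\<And>s. 0 \<le> s \<Longrightarrow> norm (U n s - U m s) \<le> e" for n m t e
  proof -
    let ?q = "2 ^ (m - n) :: nat"
    \<comment> \<open>The coarse scheme read on the fine grid: \<open>j div ?q\<close> is constant
      or increases by one from one fine index to the next.\<close>
    have dn: "discrete_skorokhod 0 M (\<lambda>j. w n (j div ?q)) (\<lambda>j. euler (w n) (j div ?q))" for M
      by (rule discrete_skorokhod_reparam[where f = "\<lambda>j. j div ?q"]) (auto simp: div_Suc intro!: euler_discrete_skorokhod w0)
    have "norm (euler (w n) (dyadic_index m t div ?q) - euler (w m) (dyadic_index m t)) \<le> lip * (e + 0)"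
    proof (rule discrete_skorokhod_lipschitz[where j = "dyadic_index m t" and m = "dyadic_index m t", OF _ dn euler_discrete_skorokhod[where w = "w m", OF w0]])
      fix i
      show "norm (w n (i div ?q) - w m i) \<le> e"
        using e[of "real i / 2 ^ m"] dyadic_index_div[OF nm, of "real i / 2 ^ m"] by (simp add: U_def)
    qed auto
    then show ?thesis using dyadic_index_div[OF nm, of t] by (simp add: K_def)
  qed
  have "uniformly_Cauchy_on {0..} K"
    unfolding uniformly_Cauchy_on_def
  proof (intro allI impI)
    fix \<epsilon> :: real assume "\<epsilon> > 0"
    define \<rho> where "\<rho> = \<epsilon> / (4 * lip)"
    have \<rho>: "\<rho> > 0" using lip_pos \<open>\<epsilon> > 0\<close> by (simp add: \<rho>_def)
    obtain n0 where n0: "\<And>n t. n \<ge> n0 \<Longrightarrow> t \<ge> 0 \<Longrightarrow> norm (U n t - u (clamp t)) < \<rho>" using fine[OF \<rho>] by blast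
    have e: "norm (U n s - U m s) \<le> 2 * \<rho>" if "n \<ge> n0" "m \<ge> n0" "0 \<le> s" for n m s
      using norm_triangle_ineq4[of "U n s - u (clamp s)" "U m s - u (clamp s)"] n0[of n s] n0[of m s] that by auto
    have "lip * (2 * \<rho>) < \<epsilon>" using lip_pos \<open>\<epsilon> > 0\<close> by (simp add: \<rho>_def)
    moreover have "norm (K m x - K n x) \<le> lip * (2 * \<rho>)" if "n \<ge> n0" "m \<ge> n0" "x \<ge> 0" for n m x
    proof (cases "m \<le> n")
      case True
      then show ?thesis using e that by (intro cauchy) auto
    next
      case False
      then have "norm (K n x - K m x) \<le> lip * (2 * \<rho>)" using e that by (intro cauchy) auto
      then show ?thesis by (simp add: norm_minus_commute)
    qed
    ultimately have "norm (K m x - K n x) < \<epsilon>" if "n \<ge> n0" "m \<ge> n0" "x \<ge> 0" for n m x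
      using that by (meson le_less_trans)
    then show "\<exists>M. \<forall>x\<in>{0..}. \<forall>m\<ge>M. \<forall>n\<ge>M. dist (K m x) (K n x) < \<epsilon>" by (auto simp: dist_norm)
  qed
  then obtain k where k: "uniform_limit {0..} K k sequentially"
    using Cauchy_uniformly_convergent unfolding uniformly_convergent_on_def by blast
  have lim_k: "(\<lambda>n. K n t) \<longlonglongrightarrow> k t" if "0 \<le> t" for t using tendsto_uniform_limitI[OF k] that by simp
  have lim_U: "uniform_limit {0..} U (\<lambda>t. u (clamp t)) sequentially"
  proof (rule uniform_limitI)
    fix \<rho> :: real assume "\<rho> > 0"
    from fine[OF this] show "\<forall>\<^sub>F n in sequentially. \<forall>t\<in>{0..}. dist (U n t) (u (clamp t)) < \<rho>"
      unfolding eventually_sequentially dist_norm by auto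
  qed
  have lim_X: "uniform_limit {0..} (\<lambda>n t. U n t - K n t) (\<lambda>t. u (clamp t) - k t) sequentially"
    by (intro uniform_limit_intros lim_U k)
  have XD: "U n t - K n t \<in> D" for n t unfolding U_def K_def by (rule euler_mem) (rule w0)
  have xD: "u (clamp t) - k t \<in> D" if "0 \<le> t" for t
  proof -
    have "(\<lambda>n. U n t - K n t) \<longlonglongrightarrow> u (clamp t) - k t"
      by (rule tendsto_uniform_limitI[OF lim_X]) (simp add: that)
    then show ?thesis by (rule closed_sequentially[OF D_closed XD])
  qed
  have cont: "continuous_on {0..T} k"
  proof (rule continuous_onI)
    fix t \<epsilon> :: real assume t: "t \<in> {0..T}" and \<epsilon>: "\<epsilon> > 0"
    have "\<epsilon> / 3 > 0" using \<epsilon> by simp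
    then obtain n0 where n0: "\<And>n j. n \<ge> n0 \<Longrightarrow> norm (w n (Suc j) - w n j) < \<epsilon> / 3" using fine by blast
    obtain n1 where n1: "\<And>n t. n \<ge> n1 \<Longrightarrow> t \<ge> 0 \<Longrightarrow> dist (K n t) (k t) < \<epsilon> / 3"
      using uniform_limitD[OF k \<open>\<epsilon> / 3 > 0\<close>] unfolding eventually_sequentially by auto
    define n where "n = max n0 n1"
    \<comment> \<open>Times less than a cell apart have equal or adjacent indices, so a step
      function changes by at most one Euler increment, which \<open>euler_jump\<close> bounds by the
      oscillation of the driver.\<close>
    have jump: "norm (K n s' - K n s) < \<epsilon> / 3" if s: "0 \<le> s" "s \<le> s'" "s' < s + 1 / 2 ^ n" for s s'
      using dyadic_index_near[OF s]
    proof
      assume "dyadic_index n s' = dyadic_index n s"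
      then show ?thesis using \<epsilon> by (simp add: K_def)
    next
      assume "dyadic_index n s' = Suc (dyadic_index n s)"
      then show ?thesis using euler_jump[where w = "w n" and j = "dyadic_index n s", OF w0] n0[of n "dyadic_index n s"]
        by (simp add: K_def n_def del: euler.simps)
    qed
    have "dist (k s) (k t) \<le> \<epsilon>" if s: "s \<in> {0..T}" "dist s t < 1 / 2 ^ n" for s
    proof -
      have "dist (K n s) (K n t) < \<epsilon> / 3"
        using jump[of s t] jump[of t s] s t by (cases "s \<le> t") (auto simp: dist_norm norm_minus_commute)
      moreover have "dist (K n s) (k s) < \<epsilon> / 3" "dist (K n t) (k t) < \<epsilon> / 3" using n1 s t by (auto simp: n_def)
      ultimately show ?thesis
        using dist_triangle[of "k s" "k t" "K n s"] dist_triangle[of "K n s" "k t" "K n t"]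
        by (simp add: dist_commute)
    qed
    then show "\<exists>d>0. \<forall>s\<in>{0..T}. dist s t < d \<longrightarrow> dist (k s) (k t) \<le> \<epsilon>" by (intro exI[of _ "1 / 2 ^ n"]) auto
  qed
  have clampT: "clamp t = t" if "t \<in> {0..T}" for t using that by (auto simp: clamp_def)
  \<comment> \<open>For large \<open>n\<close> the approximations avoid on \<open>[s,t]\<close>
    every facet whose normal has positive product with \<open>v\<close>. The discrete cone condition
    then applies with \<open>v\<close> at each grid point in \<open>(s,t]\<close>, and the sum of
    increments passes to the limit.\<close>
  have cone: "v \<bullet> (k t - k s) \<le> 0"
    if st: "0 \<le> s" "s \<le> t" "t \<le> T"
      and v: "\<forall>F. F facet_of D \<and> (\<exists>r\<in>{s..t}. u r - k r \<in> F) \<longrightarrow> v \<bullet> nrm F \<le> 0" for s t v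
  proof -
    have "\<forall>\<^sub>F n in sequentially. \<forall>F\<in>{F. F facet_of D}. v \<bullet> nrm F > 0 \<longrightarrow> (\<forall>r\<in>{s..t}. U n r - K n r \<notin> F)"
    proof (rule eventually_ball_finite[OF fin_facets], clarify)
      fix F assume F: "F facet_of D"
      show "\<forall>\<^sub>F n in sequentially. v \<bullet> nrm F > 0 \<longrightarrow> (\<forall>r\<in>{s..t}. U n r - K n r \<notin> F)"
      proof (cases "v \<bullet> nrm F > 0")
        case True
        then have nF: "u r - k r \<notin> F" if "r \<in> {s..t}" for r using v F that by (meson not_less)
        have "continuous_on {s..t} (\<lambda>r. nrm F \<bullet> (u r - k r))"
          using st by (intro continuous_intros continuous_on_subset[OF u] continuous_on_subset[OF cont]) auto
        then obtain r0 where r0: "r0 \<in> {s..t}" "\<And>r. r \<in> {s..t} \<Longrightarrow> nrm F \<bullet> (u r - k r) \<le> nrm F \<bullet> (u r0 - k r0)"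
          using continuous_attains_sup[of "{s..t}"] st by fastforce
        have r0D: "u r0 - k r0 \<in> D" using xD[of r0] clampT[of r0] r0(1) st by auto
        \<comment> \<open>The gap to the hyperplane at the time of closest approach; uniform
          convergence within this gap keeps the approximations off the facet.\<close>
        define \<rho> where "\<rho> = off F - nrm F \<bullet> (u r0 - k r0)"
        have "\<rho> > 0" using nrm_le[OF F r0D] nF[OF r0(1)] mem_facet_iff[OF F] r0D by (auto simp: \<rho>_def order_le_less)
        from uniform_limitD[OF lim_X this]
        obtain n0 where n0: "\<And>n r. n \<ge> n0 \<Longrightarrow> r \<ge> 0 \<Longrightarrow> norm (U n r - K n r - (u (clamp r) - k r)) < \<rho>"
          unfolding eventually_sequentially dist_norm by auto
        have "U n r - K n r \<notin> F" if "n \<ge> n0" "r \<in> {s..t}" for n r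
        proof
          assume "U n r - K n r \<in> F"
          then have "nrm F \<bullet> (U n r - K n r) = off F" using mem_facet_iff[OF F] by blast
          moreover have "norm (U n r - K n r - (u r - k r)) < \<rho>" using n0[of n r] that st clampT[of r] by auto
          then have "nrm F \<bullet> (U n r - K n r - (u r - k r)) < \<rho>"
            using norm_cauchy_schwarz[of "nrm F" "U n r - K n r - (u r - k r)"] norm_nrm[OF F] by simp
          ultimately show False using r0(2)[OF that(2)] by (simp add: \<rho>_def inner_diff_right)
        qed
        then show ?thesis unfolding eventually_sequentially by blast
      qed simp
    qed
    then have "\<forall>\<^sub>F n in sequentially. v \<bullet> (K n t - K n s) \<le> 0"
    proof eventually_elim
      case (elim n)
      have "v \<bullet> (euler (w n) i - euler (w n) (dyadic_index n s)) \<le> 0"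
        if "dyadic_index n s \<le> i" "i \<le> dyadic_index n t" for i
        using that
      proof (induction i rule: dec_induct)
        case (step i)
        have i: "s \<le> real (Suc i) / 2 ^ n" "real (Suc i) / 2 ^ n \<le> t"
        proof -
          have "real (Suc i) / 2 ^ n \<le> dyadic_index n t / 2 ^ n" using step by (intro divide_right_mono) auto
          then show "real (Suc i) / 2 ^ n \<le> t" using dyadic_index_bounds(1)[of t n] st by linarith
          have "real (Suc (dyadic_index n s)) / 2 ^ n \<le> real (Suc i) / 2 ^ n" using step by (intro divide_right_mono) auto
          then show "s \<le> real (Suc i) / 2 ^ n"
            using dyadic_index_bounds(2)[of s n] st by (simp add: add_divide_distrib)
        qed
        have "v \<bullet> (euler (w n) (Suc i) - euler (w n) i) \<le> 0"
        proof -
          have "v \<bullet> nrm F \<le> 0"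
            if F: "F facet_of D" "off F - 0 \<le> nrm F \<bullet> (w n (Suc i) - euler (w n) (Suc i))" for F
          proof (rule ccontr)
            assume "\<not> v \<bullet> nrm F \<le> 0"
            then have "U n (real (Suc i) / 2 ^ n) - K n (real (Suc i) / 2 ^ n) \<notin> F" using elim F(1) i by auto
            then have "w n (Suc i) - euler (w n) (Suc i) \<notin> F" by (simp add: U_def K_def del: of_nat_Suc euler.simps)
            moreover have "w n (Suc i) - euler (w n) (Suc i) \<in> D" by (rule euler_mem) (rule w0)
            ultimately show False using F mem_facet_iff[OF F(1)] nrm_le[OF F(1)] by force
          qed
          then show ?thesis
            using euler_discrete_skorokhod[where w = "w n" and m = "Suc i", OF w0] unfolding discrete_skorokhod_def by blast
        qed
        then show ?case using step by (simp add: inner_diff_right del: euler.simps)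
      qed simp
      then show ?case using dyadic_index_mono[OF st(2)] by (simp add: K_def)
    qed
    moreover have "(\<lambda>n. v \<bullet> (K n t - K n s)) \<longlonglongrightarrow> v \<bullet> (k t - k s)"
      using st by (intro tendsto_intros lim_k) auto
    ultimately show ?thesis by (intro tendsto_upperbound[of _ _ sequentially]) auto
  qed
  have "(\<lambda>n. K n 0) \<longlonglongrightarrow> 0" by (simp add: K_def)
  then have "k 0 = 0" using lim_k[of 0] LIMSEQ_unique by blast
  moreover have "u t - k t \<in> D" if "t \<in> {0..T}" for t using xD[of t] clampT[OF that] that by auto
  ultimately show ?thesis using cont cone unfolding skorokhod_def by (intro exI[of _ k]) blast
qed

end

section \<open>Functions of bounded variation and their measures\<close>

lemma variation_sums_nonempty: "a \<le> b \<Longrightarrow> 0 \<in> variation_sums k a b"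
  unfolding variation_sums_def by (intro CollectI exI[of _ 0] exI[of _ "\<lambda>_. a"]) (auto simp: mono_def)

text \<open>Typically a nondecreasing distribution function whose increments dominate those of
  \<open>k\<close>. The two increment lemmas for \<open>total_variation\<close> say that the total
  variation is the least such function.\<close>

definition variation_majorant ::
  "(real \<Rightarrow> 'a::real_normed_vector) \<Rightarrow> real \<Rightarrow> real \<Rightarrow> (real \<Rightarrow> real) \<Rightarrow> bool" where
  "variation_majorant k a b G \<longleftrightarrow> (\<forall>s t. a \<le> s \<and> s \<le> t \<and> t \<le> b \<longrightarrow> norm (k t - k s) \<le> G t - G s)"

lemma variation_majorantD:
  "\<lbrakk>variation_majorant k a b G; a \<le> s; s \<le> t; t \<le> b\<rbrakk> \<Longrightarrow> norm (k t - k s) \<le> G t - G s"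
  by (simp add: variation_majorant_def)

lemma mono_of_majorant:
  fixes k :: "real \<Rightarrow> 'a::real_normed_vector"
  assumes "variation_majorant k a b G" "a \<le> s" "s \<le> t" "t \<le> b"
  shows "G s \<le> (G t :: real)"
  using variation_majorantD[OF assms] norm_ge_zero[of "k t - k s"] by linarith

lemma variation_sums_le:
  fixes k :: "real \<Rightarrow> 'a::real_normed_vector"
  assumes G: "variation_majorant k a b G"
    and t: "a \<le> t" "t \<le> b" and x: "x \<in> variation_sums k a t"
  shows "x \<le> G t - G a"
proof -
  obtain n \<sigma> where \<sigma>: "mono \<sigma>" "range \<sigma> \<subseteq> {a..t}" "x = (\<Sum>i<n. norm (k (\<sigma> (Suc i)) - k (\<sigma> i)))"
    using x unfolding variation_sums_def by blast
  have m: "a \<le> \<sigma> i" "\<sigma> i \<le> t" "\<sigma> i \<le> \<sigma> (Suc i)" for i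
    using range_subsetD[OF \<sigma>(2), of i] monoD[OF \<sigma>(1), of i "Suc i"] by auto
  have "x \<le> (\<Sum>i<n. G (\<sigma> (Suc i)) - G (\<sigma> i))"
    unfolding \<sigma>(3) using m t by (intro sum_mono variation_majorantD[OF G]) (auto intro: order_trans)
  also have "\<dots> = G (\<sigma> n) - G (\<sigma> 0)" by (rule sum_lessThan_telescope)
  also have "\<dots> \<le> G t - G a"
    using mono_of_majorant[OF G, of "\<sigma> n" t] mono_of_majorant[OF G, of a "\<sigma> 0"] m[of 0] m[of n] t by auto
  finally show ?thesis .
qed

lemma bounded_variation_of_majorant:
  fixes k :: "real \<Rightarrow> 'a::real_normed_vector"
  assumes "variation_majorant k a b G" "a \<le> t" "t \<le> b"
  shows "bounded_variation_on k a t"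
  unfolding bounded_variation_on_def using variation_sums_le[OF assms] by (rule bdd_aboveI)

lemma total_variation_increment_ge:
  fixes k :: "real \<Rightarrow> 'a::real_normed_vector"
  assumes G: "variation_majorant k a b G"
    and st: "a \<le> s" "s \<le> t" "t \<le> b"
  shows "norm (k t - k s) \<le> total_variation k a t - total_variation k a s"
proof -
  have bdd: "bdd_above (variation_sums k a t)"
    using bounded_variation_of_majorant[OF G, of t] st unfolding bounded_variation_on_def by auto
  have "total_variation k a s \<le> total_variation k a t - norm (k t - k s)"
    unfolding total_variation_def[of k a s]
  proof (rule cSup_least)
    show "variation_sums k a s \<noteq> {}" using variation_sums_nonempty[OF st(1)] by auto
    fix x assume "x \<in> variation_sums k a s"
    then obtain n \<sigma> where \<sigma>: "mono \<sigma>" "range \<sigma> \<subseteq> {a..s}" "x = (\<Sum>i<n. norm (k (\<sigma> (Suc i)) - k (\<sigma> i)))"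
      unfolding variation_sums_def by blast
    \<comment> \<open>A partition of \<open>[a,s]\<close> prolonged by \<open>s\<close> and then by
      the constant value \<open>t\<close>; the last nontrivial step contributes the increment from
      \<open>s\<close> to \<open>t\<close>.\<close>
    define \<tau> where "\<tau> i = (if i \<le> n then \<sigma> i else if i = Suc n then s else t)" for i
    have m: "a \<le> \<sigma> i" "\<sigma> i \<le> s" for i using range_subsetD[OF \<sigma>(2), of i] by auto
    have "mono \<tau>" using \<sigma>(1) m st unfolding mono_iff_le_Suc \<tau>_def by (auto simp: le_Suc_eq)
    moreover have "range \<tau> \<subseteq> {a..t}" using m order_trans[OF m(2) st(2)] st by (auto simp: \<tau>_def)
    ultimately have "(\<Sum>i<Suc (Suc n). norm (k (\<tau> (Suc i)) - k (\<tau> i))) \<in> variation_sums k a t"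
      unfolding variation_sums_def by blast
    then have "(\<Sum>i<Suc (Suc n). norm (k (\<tau> (Suc i)) - k (\<tau> i))) \<le> total_variation k a t"
      unfolding total_variation_def by (rule cSup_upper[OF _ bdd])
    moreover have "(\<Sum>i<n. norm (k (\<tau> (Suc i)) - k (\<tau> i))) = x"
      unfolding \<sigma>(3) by (intro sum.cong) (auto simp: \<tau>_def)
    moreover have "\<tau> (Suc n) = s" "\<tau> (Suc (Suc n)) = t" by (auto simp: \<tau>_def)
    ultimately have "x + norm (k s - k (\<tau> n)) + norm (k t - k s) \<le> total_variation k a t" by simp
    then show "x \<le> total_variation k a t - norm (k t - k s)"
      using norm_ge_zero[of "k s - k (\<tau> n)"] by linarith
  qed
  then show ?thesis by simp
qed

lemma total_variation_increment_le:
  fixes k :: "real \<Rightarrow> 'a::real_normed_vector"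
  assumes G: "variation_majorant k a b G"
    and st: "a \<le> s" "s \<le> t" "t \<le> b"
  shows "total_variation k a t - total_variation k a s \<le> G t - G s"
proof -
  have bdd: "bdd_above (variation_sums k a s)"
    using bounded_variation_of_majorant[OF G, of s] st unfolding bounded_variation_on_def by auto
  have "total_variation k a t \<le> total_variation k a s + (G t - G s)"
    unfolding total_variation_def[of k a t]
  proof (rule cSup_least)
    show "variation_sums k a t \<noteq> {}" using variation_sums_nonempty[of a t] st by auto
    fix x assume "x \<in> variation_sums k a t"
    then obtain n \<sigma> where \<sigma>: "mono \<sigma>" "range \<sigma> \<subseteq> {a..t}" "x = (\<Sum>i<n. norm (k (\<sigma> (Suc i)) - k (\<sigma> i)))"
      unfolding variation_sums_def by blast
    have m: "a \<le> \<sigma> i" "\<sigma> i \<le> t" "\<sigma> i \<le> \<sigma> (Suc i)" for i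
    using range_subsetD[OF \<sigma>(2), of i] monoD[OF \<sigma>(1), of i "Suc i"] by auto
    \<comment> \<open>Splits each cell of the partition at \<open>s\<close>: the truncation by
      \<open>min\<close> belongs to the variation on \<open>[a,s]\<close>, the one by
      \<open>max\<close> is paid for by \<open>G\<close> and telescopes.\<close>
    have "norm (k v - k u) \<le> norm (k (min s v) - k (min s u)) + (G (max s v) - G (max s u))"
      if "a \<le> u" "u \<le> v" "v \<le> t" for u v
    proof (cases "v \<le> s \<or> s \<le> u")
      case True
      then show ?thesis using that variation_majorantD[OF G, of u v] st by (auto simp: min_def max_def)
    next
      case False
      then have "norm (k v - k s) \<le> G v - G s" using that st by (intro variation_majorantD[OF G]) auto
      then show ?thesis using False norm_triangle_ineq[of "k v - k s" "k s - k u"] by (simp add: min_def max_def)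
    qed
    then have "x \<le> (\<Sum>i<n. norm (k (min s (\<sigma> (Suc i))) - k (min s (\<sigma> i)))) +
        (\<Sum>i<n. G (max s (\<sigma> (Suc i))) - G (max s (\<sigma> i)))"
      unfolding \<sigma>(3) sum.distrib[symmetric] using m by (intro sum_mono) auto
    also have "(\<Sum>i<n. G (max s (\<sigma> (Suc i))) - G (max s (\<sigma> i))) = G (max s (\<sigma> n)) - G (max s (\<sigma> 0))"
      by (rule sum_lessThan_telescope[of "\<lambda>i. G (max s (\<sigma> i))"])
    also have "G (max s (\<sigma> n)) - G (max s (\<sigma> 0)) \<le> G t - G s"
      using mono_of_majorant[OF G, of "max s (\<sigma> n)" t] mono_of_majorant[OF G, of s "max s (\<sigma> 0)"] m[of n] m[of 0] st
      by (auto simp: le_max_iff_disj)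
    also have "(\<Sum>i<n. norm (k (min s (\<sigma> (Suc i))) - k (min s (\<sigma> i)))) \<le> total_variation k a s"
      unfolding total_variation_def
    proof (rule cSup_upper[OF _ bdd])
      have "mono (\<lambda>i. min s (\<sigma> i))" using m by (intro monoI) (metis \<sigma>(1) min.mono monoD order_refl)
      moreover have "range (\<lambda>i. min s (\<sigma> i)) \<subseteq> {a..s}" using m st by auto
      ultimately show "(\<Sum>i<n. norm (k (min s (\<sigma> (Suc i))) - k (min s (\<sigma> i)))) \<in> variation_sums k a s"
        unfolding variation_sums_def by (intro CollectI exI[of _ n] exI[of _ "\<lambda>i. min s (\<sigma> i)"]) auto
    qed
    finally show "x \<le> total_variation k a s + (G t - G s)" by simp
  qed
  then show ?thesis by simp
qed

subsection \<open>Comparison of measures on intervals\<close>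

text \<open>Inside an open set the dyadic cells of level \<open>n\<close> that fit and have index at
  most \<open>4 ^ n\<close> in modulus form a finite disjoint union, for which the comparison is
  additive. Every point of the set is eventually covered, and Fatou passes to the limit. The index
  bound reaches up to about \<open>2 ^ n\<close> on the line.\<close>

lemma measure_le_of_Ioc_open:
  fixes N1 N2 :: "real measure"
  assumes sets: "sets N1 = sets borel" "sets N2 = sets borel"
    and le: "\<And>a b. a \<le> b \<Longrightarrow> emeasure N1 {a<..b} \<le> emeasure N2 {a<..b}" and U: "open U"
  shows "emeasure N1 U \<le> emeasure N2 U"
proof -
  define cell where "cell n j = {of_int j / 2 ^ n <.. (of_int j + 1) / (2::real) ^ n}" for n :: nat and j :: int
  define J where "J n = {j \<in> {- (4 ^ n) .. 4 ^ n}. cell n j \<subseteq> U}" for n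
  define A where "A n = (\<Union>j\<in>J n. cell n j)" for n
  have J: "finite (J n)" for n unfolding J_def by (rule finite_subset[of _ "{- (4 ^ n) .. 4 ^ n}"]) auto
  have disj: "disjoint_family_on (cell n) (J n)" for n
  proof -
    have "i = j" if "x \<in> cell n i" "x \<in> cell n j" for x i j
    proof -
      have "real_of_int i < x * 2 ^ n" "x * 2 ^ n \<le> of_int i + 1" "real_of_int j < x * 2 ^ n" "x * 2 ^ n \<le> of_int j + 1"
        using that by (auto simp: cell_def field_simps)
      then show ?thesis by linarith
    qed
    then show ?thesis by (auto simp: disjoint_family_on_def)
  qed
  have cell_sets: "cell n j \<in> sets borel" for n j by (simp add: cell_def)
  have AU: "A n \<subseteq> U" for n by (auto simp: A_def J_def)
  have A_sets: "A n \<in> sets borel" for n unfolding A_def using J cell_sets by auto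
  have A_le: "emeasure N1 (A n) \<le> emeasure N2 U" for n
  proof -
    have "emeasure N1 (A n) = (\<Sum>j\<in>J n. emeasure N1 (cell n j))"
      unfolding A_def by (intro sum_emeasure[symmetric] disj J) (auto simp: sets cell_sets)
    also have "\<dots> \<le> (\<Sum>j\<in>J n. emeasure N2 (cell n j))"
      unfolding cell_def by (intro sum_mono le divide_right_mono) auto
    also have "\<dots> = emeasure N2 (A n)"
      unfolding A_def by (intro sum_emeasure disj J) (auto simp: sets cell_sets)
    also have "\<dots> \<le> emeasure N2 U" using AU U by (intro emeasure_mono) (auto simp: sets)
    finally show ?thesis .
  qed
  have ev: "\<forall>\<^sub>F n in sequentially. x \<in> A n" if x: "x \<in> U" for x
  proof -
    obtain e where e: "e > 0" "\<And>y. dist y x < e \<Longrightarrow> y \<in> U" using U x unfolding open_dist by blast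
    obtain n0 where n0: "(1/2) ^ n0 < e" using real_arch_pow_inv[OF e(1), of "1/2"] by auto
    obtain n1 :: nat where n1: "\<bar>x\<bar> + 1 < n1" using reals_Archimedean2 by blast
    have "x \<in> A n" if n: "n \<ge> max n0 n1" for n
    proof -
      define j where "j = \<lceil>2 ^ n * x\<rceil> - 1"
      have j: "real_of_int j < 2 ^ n * x" "2 ^ n * x \<le> real_of_int j + 1" unfolding j_def by linarith+
      then have xc: "x \<in> cell n j" by (auto simp: cell_def field_simps)
      have "(1/2::real) ^ n \<le> (1/2) ^ n0" using n by (intro power_decreasing) auto
      then have small: "1 / 2 ^ n < e" using n0 by (simp add: power_one_over)
      have "cell n j \<subseteq> U"
      proof
        fix y assume "y \<in> cell n j"
        then have "\<bar>y - x\<bar> < (of_int j + 1) / 2 ^ n - of_int j / 2 ^ n + 1 / 2 ^ n * 0 \<or> \<bar>y - x\<bar> \<le> (of_int j + 1) / 2 ^ n - of_int j / 2 ^ n"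
          using xc unfolding cell_def by auto
        then have "\<bar>y - x\<bar> \<le> 1 / 2 ^ n" by (auto simp: add_divide_distrib)
        then show "y \<in> U" using small by (intro e(2)) (simp add: dist_real_def)
      qed
      moreover have "j \<in> {- (4 ^ n) .. 4 ^ n}"
      proof -
        have "real n1 \<le> 2 ^ n1" using of_nat_less_two_power[of n1] by (simp add: less_imp_le)
        also have "(2::real) ^ n1 \<le> 2 ^ n" using n by (intro power_increasing) auto
        finally have "\<bar>x\<bar> + 1 \<le> 2 ^ n" using n1 by linarith
        then have "2 ^ n * (\<bar>x\<bar> + 1) \<le> 2 ^ n * (2::real) ^ n" by (intro mult_left_mono) auto
        then have "2 ^ n * \<bar>x\<bar> + 2 ^ n \<le> (4::real) ^ n" by (simp add: algebra_simps flip: power_mult_distrib)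
        moreover have "(1::real) \<le> 2 ^ n" by simp
        moreover have "2 ^ n * x \<le> 2 ^ n * \<bar>x\<bar>" "2 ^ n * (- x) \<le> 2 ^ n * \<bar>x\<bar>" by (intro mult_left_mono; simp)+
        ultimately have "real_of_int j \<le> 4 ^ n" "- (4 ^ n) \<le> real_of_int j" using j by (simp_all only: mult_minus_right)
        then have "real_of_int j \<le> real_of_int (4 ^ n)" "real_of_int (- (4 ^ n)) \<le> real_of_int j" by simp_all
        then show ?thesis unfolding of_int_le_iff by simp
      qed
      ultimately have "j \<in> J n" by (simp add: J_def)
      then show ?thesis using xc by (auto simp: A_def)
    qed
    then show ?thesis unfolding eventually_sequentially by blast
  qed
  have "emeasure N1 U = (\<integral>\<^sup>+ x. indicator U x \<partial>N1)" using U by (simp add: sets)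
  also have "\<dots> \<le> (\<integral>\<^sup>+ x. liminf (\<lambda>n. indicator (A n) x) \<partial>N1)"
  proof (rule nn_integral_mono)
    fix x
    show "indicator U x \<le> liminf (\<lambda>n. indicator (A n) x :: ennreal)"
    proof (cases "x \<in> U")
      case True
      have "1 \<le> liminf (\<lambda>n. indicator (A n) x :: ennreal)"
        by (rule Liminf_bounded) (use ev[OF True] in eventually_elim, simp)
      then show ?thesis using True by simp
    qed simp
  qed
  also have "\<dots> \<le> liminf (\<lambda>n. \<integral>\<^sup>+ x. indicator (A n) x \<partial>N1)"
    using A_sets by (intro nn_integral_liminf) (auto simp: sets intro!: borel_measurable_indicator)
  also have "\<dots> \<le> emeasure N2 U"
    using A_le A_sets by (intro Liminf_le) (auto simp: sets)
  finally show ?thesis .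
qed

text \<open>Outer regularity of the finite measure \<open>N2\<close> reduces Borel sets to open
  sets.\<close>

lemma measure_le_of_Ioc:
  fixes N1 N2 :: "real measure"
  assumes sets: "sets N1 = sets borel" "sets N2 = sets borel" and fin: "emeasure N2 UNIV \<noteq> \<infinity>"
    and le: "\<And>a b. a \<le> b \<Longrightarrow> emeasure N1 {a<..b} \<le> emeasure N2 {a<..b}" and A: "A \<in> sets borel"
  shows "emeasure N1 A \<le> emeasure N2 A"
proof -
  have sp: "space N2 = UNIV" using sets_eq_imp_space_eq[OF sets(2)] by simp
  have "emeasure N1 A \<le> emeasure N2 U" if "A \<subseteq> U" "open U" for U
  proof -
    have "emeasure N1 A \<le> emeasure N1 U" using that by (intro emeasure_mono) (auto simp: sets)
    also have "\<dots> \<le> emeasure N2 U" by (rule measure_le_of_Ioc_open[OF sets le that(2)])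
    finally show ?thesis .
  qed
  then show ?thesis using outer_regular[OF sets(2) _ A] fin sp by (auto intro!: INF_greatest)
qed

lemma emeasure_density_eq_integral:
  assumes g: "integrable M g" "\<And>x. 0 \<le> g x" and A: "A \<in> sets M"
  shows "emeasure (density M (\<lambda>x. ennreal (g x))) A = ennreal (\<integral>x. indicator A x * g x \<partial>M)"
proof -
  have "emeasure (density M (\<lambda>x. ennreal (g x))) A = (\<integral>\<^sup>+ x. ennreal (g x) * indicator A x \<partial>M)"
    using g A by (intro emeasure_density) auto
  also have "\<dots> = (\<integral>\<^sup>+ x. ennreal (indicator A x * g x) \<partial>M)"
    by (intro nn_integral_cong) (auto simp: indicator_def)
  also have "\<dots> = ennreal (\<integral>x. indicator A x * g x \<partial>M)"
    using integrable_mult_indicator[OF A g(1)] g by (intro nn_integral_eq_integral) auto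
  finally show ?thesis .
qed

text \<open>The measure with density the positive part of \<open>h\<close> on \<open>(s,t]\<close>
  is dominated on intervals, hence on all Borel sets, by the one with the negative part. On the set
  where \<open>h\<close> is positive the latter vanishes.\<close>

lemma AE_nonpos_of_Ioc:
  fixes \<mu> :: "real measure" and h :: "real \<Rightarrow> real"
  assumes sets: "sets \<mu> = sets borel" and h: "integrable \<mu> h"
    and le: "\<And>a b. \<lbrakk>s \<le> a; a \<le> b; b \<le> t\<rbrakk> \<Longrightarrow> (LINT r:{a<..b}|\<mu>. h r) \<le> 0"
  shows "AE r in \<mu>. s < r \<and> r \<le> t \<longrightarrow> h r \<le> 0"
proof -
  define g where "g r = indicator {s<..t} r * h r" for r
  have g: "integrable \<mu> g" using integrable_mult_indicator[OF _ h, of "{s<..t}"] by (simp add: g_def[abs_def] sets)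
  define gp gm where "gp r = max 0 (g r)" and "gm r = max 0 (- g r)" for r
  have gi: "integrable \<mu> gp" "integrable \<mu> gm" using g unfolding gp_def gm_def by auto
  have ind: "integrable \<mu> (\<lambda>r. indicator A r * f r)" if "integrable \<mu> f" "A \<in> sets borel" for A and f :: "real \<Rightarrow> real"
    using integrable_mult_indicator[OF _ that(1), of A] that(2) by (simp add: sets)
  let ?N1 = "density \<mu> (\<lambda>r. ennreal (gp r))" and ?N2 = "density \<mu> (\<lambda>r. ennreal (gm r))"
  have em: "emeasure ?N1 A = ennreal (\<integral>r. indicator A r * gp r \<partial>\<mu>)" "emeasure ?N2 A = ennreal (\<integral>r. indicator A r * gm r \<partial>\<mu>)"
    if "A \<in> sets borel" for A
    using emeasure_density_eq_integral[OF gi(1), of A] emeasure_density_eq_integral[OF gi(2), of A] that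
    by (auto simp only: sets gp_def gm_def max.cobounded1)
  have le': "emeasure ?N1 {a<..b} \<le> emeasure ?N2 {a<..b}" for a b
  proof -
    have "(\<integral>r. indicator {a<..b} r * gp r \<partial>\<mu>) - (\<integral>r. indicator {a<..b} r * gm r \<partial>\<mu>) =
      (\<integral>r. indicator {a<..b} r * gp r - indicator {a<..b} r * gm r \<partial>\<mu>)"
      by (intro Bochner_Integration.integral_diff[symmetric] ind gi) auto
    also have "\<dots> = (LINT r:{max a s<..min b t}|\<mu>. h r)"
      unfolding set_lebesgue_integral_def
      by (intro Bochner_Integration.integral_cong) (auto simp: gp_def gm_def g_def indicator_def)
    also have "\<dots> \<le> 0"
      using le[of "max a s" "min b t"] by (cases "max a s \<le> min b t") (auto simp: set_lebesgue_integral_def)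
    finally show ?thesis using em by (auto intro: ennreal_leI)
  qed
  define A where "A = {r. g r > 0}"
  have "g \<in> borel_measurable borel" using g sets by (metis borel_measurable_integrable measurable_cong_sets)
  then have A: "A \<in> sets borel" unfolding A_def by measurable
  have "emeasure ?N1 A \<le> emeasure ?N2 A"
    by (rule measure_le_of_Ioc[OF _ _ _ le' A]) (use em[of UNIV] in \<open>auto simp: sets\<close>)
  also have "\<dots> = 0"
  proof -
    have "(\<lambda>r. indicator A r * gm r) = (\<lambda>_. 0)" by (auto simp: A_def gm_def indicator_def)
    then show ?thesis using em[OF A] by simp
  qed
  finally have "(\<integral>r. indicator A r * gp r \<partial>\<mu>) \<le> 0" using em[OF A] by (simp add: ennreal_eq_0_iff)
  moreover have "0 \<le> (\<integral>r. indicator A r * gp r \<partial>\<mu>)" by (intro integral_nonneg_AE) (auto simp: gp_def)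
  ultimately have "(\<integral>r. indicator A r * gp r \<partial>\<mu>) = 0" by simp
  then have "AE r in \<mu>. indicator A r * gp r = 0"
    by (subst (asm) integral_nonneg_eq_0_iff_AE[OF ind[OF gi(1) A]]) (auto simp: gp_def)
  then show ?thesis by eventually_elim (auto simp: A_def gp_def g_def indicator_def split: if_splits)
qed

section \<open>Stieltjes measures of continuous functions and their densities\<close>

lemma continuous_on_of_majorant:
  fixes f :: "real \<Rightarrow> 'a::real_normed_vector"
  assumes F: "continuous_on S F" and f: "\<And>s t. \<lbrakk>s \<in> S; t \<in> S; s \<le> t\<rbrakk> \<Longrightarrow> norm (f t - f s) \<le> F t - (F s :: real)"
  shows "continuous_on S f"
proof (rule continuous_onI)
  fix t \<epsilon> :: real assume "t \<in> S" "\<epsilon> > 0"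
  then obtain d where d: "d > 0" "\<And>s. s \<in> S \<Longrightarrow> dist s t < d \<Longrightarrow> dist (F s) (F t) < \<epsilon>"
    using F unfolding continuous_on_iff by blast
  have "dist (f s) (f t) \<le> \<epsilon>" if "s \<in> S" "dist s t < d" for s
    using f[of s t] f[of t s] that \<open>t \<in> S\<close> d(2)[OF that]
    by (cases "s \<le> t") (auto simp: dist_norm norm_minus_commute)
  then show "\<exists>d>0. \<forall>s\<in>S. dist s t < d \<longrightarrow> dist (f s) (f t) \<le> \<epsilon>" using d(1) by blast
qed

lemma emeasure_interval_measure_cont:
  assumes "\<And>x y. x \<le> y \<Longrightarrow> F x \<le> F y" "continuous_on UNIV F" "a \<le> b"
  shows "emeasure (interval_measure F) {a<..b} = ennreal (F b - F a)"
proof (rule emeasure_interval_measure_Ioc)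
  show "continuous (at_right x) F" for x
  proof (rule continuous_at_imp_continuous_at_within)
    show "isCont F x" using assms(2) continuous_on_eq_continuous_at[OF open_UNIV, of F] by blast
  qed
  show "F x \<le> F y" if "x \<le> y" for x y using that by (rule assms(1))
qed (rule assms(3))

text \<open>The function \<open>f\<close> need not be monotone, but \<open>H = F - f\<close> is, and
  its increments are at most twice those of \<open>F\<close>. Its measure is therefore absolutely
  continuous, and one minus its Radon-Nikodym density is a density of \<open>f\<close>.\<close>

lemma dominated_density:
  fixes F f :: "real \<Rightarrow> real"
  assumes mono: "\<And>x y. x \<le> y \<Longrightarrow> F x \<le> F y" and cont: "continuous_on UNIV F"
    and fin: "finite_measure (interval_measure F)"
    and f: "\<And>a b. a \<le> b \<Longrightarrow> \<bar>f b - f a\<bar> \<le> F b - F a"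
  obtains g where "integrable (interval_measure F) g"
    "\<And>a b. a \<le> b \<Longrightarrow> f b - f a = (LINT r:{a<..b}|interval_measure F. g r)"
proof -
  let ?\<mu> = "interval_measure F"
  define H where "H x = F x - f x" for x
  interpret \<mu>: finite_measure ?\<mu> by (rule fin)
  have contf: "continuous_on UNIV f" by (rule continuous_on_of_majorant[OF cont]) (simp add: f)
  have H: "H x \<le> H y" if "x \<le> y" for x y using f[OF that] by (simp add: H_def)
  have contH: "continuous_on UNIV H" unfolding H_def[abs_def] by (intro continuous_intros cont contf)
  have le: "emeasure (interval_measure H) A \<le> emeasure (scale_measure 2 ?\<mu>) A" if "A \<in> sets borel" for A
  proof (rule measure_le_of_Ioc[OF _ _ _ _ that])
    show "emeasure (scale_measure 2 ?\<mu>) UNIV \<noteq> \<infinity>"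
      using \<mu>.emeasure_finite by (auto simp: ennreal_mult_eq_top_iff)
    fix a b :: real assume ab: "a \<le> b"
    have "H b - H a \<le> 2 * (F b - F a)" using f[OF ab] by (simp add: H_def)
    then have "ennreal (H b - H a) \<le> ennreal (2 * (F b - F a))" by (rule ennreal_leI)
    also have "\<dots> = 2 * ennreal (F b - F a)" by (subst ennreal_mult) (use mono[OF ab] in auto)
    finally show "emeasure (interval_measure H) {a<..b} \<le> emeasure (scale_measure 2 ?\<mu>) {a<..b}"
      by (simp add: emeasure_interval_measure_cont[OF mono cont ab] emeasure_interval_measure_cont[OF H contH ab])
  qed auto
  have Hfin: "finite_measure (interval_measure H)"
  proof
    have "emeasure (interval_measure H) UNIV \<le> emeasure (scale_measure 2 ?\<mu>) UNIV" by (rule le) simp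
    also have "\<dots> < \<infinity>"
      using top.not_eq_extremum[THEN iffD1, OF \<mu>.emeasure_finite[of UNIV]] by (simp add: ennreal_mult_less_top)
    finally show "emeasure (interval_measure H) (space (interval_measure H)) \<noteq> \<infinity>" by simp
  qed
  have ac: "absolutely_continuous ?\<mu> (interval_measure H)"
    unfolding absolutely_continuous_def
  proof
    fix A assume "A \<in> null_sets ?\<mu>"
    then have A: "A \<in> sets borel" "emeasure ?\<mu> A = 0" by auto
    then show "A \<in> null_sets (interval_measure H)" using le[OF A(1)] by auto
  qed
  obtain D where D: "D \<in> borel_measurable ?\<mu>" "AE x in ?\<mu>. RN_deriv ?\<mu> (interval_measure H) x = ennreal (D x)" "\<And>x. 0 \<le> D x"
    using \<mu>.real_RN_deriv[OF Hfin ac] by auto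
  have dens: "density ?\<mu> (\<lambda>x. ennreal (D x)) = interval_measure H"
    using \<mu>.density_RN_deriv[OF ac] D density_cong[of "RN_deriv ?\<mu> (interval_measure H)" ?\<mu> "\<lambda>x. ennreal (D x)"] by simp
  have Dint: "integrable ?\<mu> D"
  proof (rule integrableI_nonneg)
    have "(\<integral>\<^sup>+ x. ennreal (D x) \<partial>?\<mu>) = emeasure (density ?\<mu> (\<lambda>x. ennreal (D x))) UNIV"
      using D by (subst emeasure_density) auto
    also have "\<dots> < \<infinity>" unfolding dens using finite_measure.emeasure_finite[OF Hfin, of UNIV] by (simp add: less_top)
    finally show "(\<integral>\<^sup>+ x. ennreal (D x) \<partial>?\<mu>) < \<infinity>" .
  qed (use D in auto)
  have "f b - f a = (LINT r:{a<..b}|?\<mu>. 1 - D r)" if ab: "a \<le> b" for a b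
  proof -
    have "ennreal (H b - H a) = ennreal (\<integral>x. indicator {a<..b} x * D x \<partial>?\<mu>)"
      using emeasure_density_eq_integral[OF Dint D(3), of "{a<..b}"] dens emeasure_interval_measure_cont[OF H contH ab] by simp
    moreover have "0 \<le> (\<integral>x. indicator {a<..b} x * D x \<partial>?\<mu>)" using D by (intro integral_nonneg_AE) auto
    ultimately have "H b - H a = (LINT r:{a<..b}|?\<mu>. D r)"
      using H[OF ab] by (simp add: set_lebesgue_integral_def)
    moreover have "(LINT r:{a<..b}|?\<mu>. 1 - D r) = (LINT r:{a<..b}|?\<mu>. 1) - (LINT r:{a<..b}|?\<mu>. D r)"
    proof (rule set_integral_diff(2))
      show "set_integrable ?\<mu> {a<..b} (\<lambda>_. 1 :: real)"
        unfolding set_integrable_def by (intro integrable_mult_indicator) auto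
      show "set_integrable ?\<mu> {a<..b} D"
        unfolding set_integrable_def by (intro integrable_mult_indicator Dint) auto
    qed
    moreover have "(LINT r:{a<..b}|?\<mu>. 1::real) = F b - F a"
      using emeasure_interval_measure_cont[OF mono cont ab] mono[OF ab]
      by (simp add: set_lebesgue_integral_def measure_def)
    ultimately show ?thesis by (simp add: H_def)
  qed
  moreover have "integrable ?\<mu> (\<lambda>x. 1 - D x)" using Dint by (intro Bochner_Integration.integrable_diff) auto
  ultimately show ?thesis using that by blast
qed

text \<open>The distribution function is constant outside \<open>[0,T]\<close> and continuous, so
  the total mass is finite and neither the outside nor the two endpoints carry mass.\<close>

lemma interval_measure_clamped:
  fixes F :: "real \<Rightarrow> real"
  assumes mono: "\<And>x y. x \<le> y \<Longrightarrow> F x \<le> F y" and cont: "continuous_on UNIV F" and T: "0 \<le> T"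
    and clamp: "\<And>t. F t = F (max 0 (min T t))"
  shows "finite_measure (interval_measure F)" "AE r in interval_measure F. 0 < r \<and> r < T"
proof -
  let ?\<mu> = "interval_measure F"
  have F: "F 0 \<le> F t" "F t \<le> F T" for t using clamp[of t] mono[of 0 "max 0 (min T t)"] mono[of "max 0 (min T t)" T] T by auto
  have "emeasure ?\<mu> UNIV = emeasure ?\<mu> (\<Union>n. {- real n<..real n})"
  proof -
    have "UNIV = (\<Union>n. {- real n<..real n})"
    proof -
      have "\<exists>n. - real n < x \<and> x \<le> real n" for x
      proof -
        obtain n :: nat where "\<bar>x\<bar> < n" using reals_Archimedean2 by blast
        then show ?thesis by (intro exI[of _ n]) auto
      qed
      then show ?thesis by auto
    qed
    then show ?thesis by simp
  qed
  also have "\<dots> = (SUP n. emeasure ?\<mu> {- real n<..real n})"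
    by (intro SUP_emeasure_incseq[symmetric]) (auto simp: incseq_def)
  also have "\<dots> \<le> ennreal (F T - F 0)"
  proof (rule SUP_least)
    fix n show "emeasure ?\<mu> {- real n<..real n} \<le> ennreal (F T - F 0)"
      using emeasure_interval_measure_cont[OF mono cont, of "- real n" "real n"] F(1)[of "- real n"] F(2)[of "real n"]
      by (auto intro!: ennreal_leI)
  qed
  finally show "finite_measure ?\<mu>" by (intro finite_measureI) (auto simp: top_unique)
  have "AE r in ?\<mu>. \<not> (- real n < r \<and> r \<le> 0)" for n
  proof -
    have "F (- real n) = F 0" using clamp[of "- real n"] T by simp
    then have "emeasure ?\<mu> {- real n<..0} = 0" using emeasure_interval_measure_cont[OF mono cont, of "- real n" 0] by simp
    then have "{- real n<..0} \<in> null_sets ?\<mu>" by auto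
    then show ?thesis by (rule AE_I') auto
  qed
  then have "AE r in ?\<mu>. \<forall>n. \<not> (- real n < r \<and> r \<le> 0)" unfolding AE_all_countable by (rule allI)
  moreover have "AE r in ?\<mu>. \<not> (T \<le> r \<and> r \<le> T + real n)" for n
  proof -
    have "F (T + real n) = F T" using clamp[of "T + real n"] T by simp
    then have "emeasure ?\<mu> {T..T + real n} = 0" using emeasure_interval_measure_Icc[of T "T + real n" F] mono cont by simp
    then have "{T..T + real n} \<in> null_sets ?\<mu>" by auto
    then show ?thesis by (rule AE_I') auto
  qed
  then have "AE r in ?\<mu>. \<forall>n. \<not> (T \<le> r \<and> r \<le> T + real n)" unfolding AE_all_countable by (rule allI)
  ultimately show "AE r in ?\<mu>. 0 < r \<and> r < T"
  proof eventually_elim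
    case (elim r)
    obtain n :: nat where "\<bar>r\<bar> + \<bar>T\<bar> < n" using reals_Archimedean2 by blast
    then show ?case using elim(1)[rule_format, of n] elim(2)[rule_format, of n] T by auto
  qed
qed

section \<open>Solutions of the Skorokhod problem as reflected paths\<close>

context solid_polyhedron
begin

section \<open>Bounded variation from an interior point\<close>

lemma inner_offset_interior:
  obtains a r where "r > 0" "\<And>F. F facet_of D \<Longrightarrow> nrm F \<bullet> a + r \<le> off F"
proof -
  obtain a r where a: "r > 0" "cball a r \<subseteq> D" using solid mem_interior_cball by blast
  have "nrm F \<bullet> a + r \<le> off F" if F: "F facet_of D" for F
  proof -
    have "a + r *\<^sub>R nrm F \<in> cball a r" using a(1) norm_nrm[OF F] by (simp add: dist_norm)
    then have "nrm F \<bullet> (a + r *\<^sub>R nrm F) \<le> off F" using a(2) nrm_le[OF F] by blast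
    then show ?thesis using norm_nrm[OF F] by (simp add: inner_simps dot_square_norm)
  qed
  then show ?thesis using that a(1) by blast
qed

text \<open>While the path stays within \<open>r / 2\<close> of \<open>y\<close>, each facet it
  visits has a normal whose product with \<open>y - a\<close> is at least \<open>r / 2\<close>, the
  ball around \<open>a\<close> being at distance from all facets. So \<open>y - a\<close> dominates
  every vector of norm \<open>r / 2\<close> on the visited normals. The norm of the increment is
  thereby bounded by a linear form in it, and linear forms telescope.\<close>

lemma skorokhod_window_variation:
  assumes k: "skorokhod T u k" and r: "r > 0" "\<And>F. F facet_of D \<Longrightarrow> nrm F \<bullet> a + r \<le> off F"
    and st: "0 \<le> s" "s \<le> t" "t \<le> T"
    and y: "\<And>q. \<lbrakk>s \<le> q; q \<le> t\<rbrakk> \<Longrightarrow> norm (u q - k q - y) \<le> r / 2"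
  shows "norm (k t - k s) \<le> 2 / r * ((y - a) \<bullet> (k t - k s))"
proof -
  let ?d = "k t - k s"
  have "((r / 2) *\<^sub>R sgn ?d - (y - a)) \<bullet> ?d \<le> 0"
  proof (rule skorokhod_cone[OF k st])
    fix F q assume F: "F facet_of D" and q: "s \<le> q" "q \<le> t" "u q - k q \<in> F"
    have "\<bar>nrm F \<bullet> (u q - k q - y)\<bar> \<le> r / 2"
      using Cauchy_Schwarz_ineq2[of "nrm F" "u q - k q - y"] y[OF q(1,2)] norm_nrm[OF F] by simp
    moreover have "nrm F \<bullet> (u q - k q) = off F" using mem_facet_iff[OF F] q(3) by blast
    ultimately have 1: "off F - r / 2 \<le> nrm F \<bullet> y" unfolding inner_diff_right[of _ _ y] by linarith
    have "sgn ?d \<bullet> nrm F \<le> 1"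
      using norm_cauchy_schwarz[of "sgn ?d" "nrm F"] norm_nrm[OF F] by (auto simp: norm_sgn split: if_splits)
    then have "(r / 2) * (sgn ?d \<bullet> nrm F) \<le> r / 2 * 1" using r(1) by (intro mult_left_mono) auto
    then show "((r / 2) *\<^sub>R sgn ?d - (y - a)) \<bullet> nrm F \<le> 0"
      using 1 r(2)[OF F] by (simp add: inner_diff_left inner_commute[of y] inner_commute[of a])
  qed
  moreover have "sgn ?d \<bullet> ?d = norm ?d" by (cases "?d = 0") (simp_all add: sgn_div_norm dot_square_norm power2_eq_square)
  ultimately have "(r / 2) * norm ?d \<le> (y - a) \<bullet> ?d" by (simp add: inner_diff_left)
  then show ?thesis using r(1) by (simp add: field_simps)
qed

text \<open>Uniform continuity cuts \<open>[0,T]\<close> into finitely many windows in which the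
  path moves by less than \<open>r / 2\<close>. In each of them a linear form of \<open>k\<close>
  majorises the variation, and the sum of these forms is continuous because \<open>k\<close>
  is.\<close>

lemma skorokhod_majorant:
  assumes k: "skorokhod T u k" and u: "continuous_on {0..T} u" and T: "0 < T"
  obtains G where "continuous_on {0..T} G" "variation_majorant k 0 T G"
proof -
  obtain a r where r: "r > 0" "\<And>F. F facet_of D \<Longrightarrow> nrm F \<bullet> a + r \<le> off F"
    using inner_offset_interior by blast
  define x where "x t = u t - k t" for t
  have contk: "continuous_on {0..T} k" using k by (simp add: skorokhod_def)
  have "uniformly_continuous_on {0..T} x" unfolding x_def[abs_def]
    by (intro compact_uniformly_continuous continuous_intros u contk) simp
  moreover have "r / 2 > 0" using r by simp
  ultimately obtain d where d: "d > 0"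
    "\<forall>s\<in>{0..T}. \<forall>t\<in>{0..T}. dist t s < d \<longrightarrow> dist (x t) (x s) < r / 2"
    unfolding uniformly_continuous_on_def by meson
  obtain m :: nat where m: "T / d < m" using reals_Archimedean2 by blast
  moreover have "0 < T / d" using T d(1) by simp
  ultimately have m0: "0 < real m" by linarith
  have "T < m * d" using m d(1) by (simp add: pos_divide_less_eq)
  then have Tm: "T / m < d" using m0 by (simp add: pos_divide_less_eq mult.commute)
  define \<tau> where "\<tau> i = real i * T / m" for i
  have \<tau>0: "\<tau> 0 = 0" and \<tau>m: "\<tau> m = T" using m0 by (simp_all add: \<tau>_def)
  have \<tau>S: "\<tau> (Suc i) = \<tau> i + T / m" for i by (simp add: \<tau>_def add_divide_distrib algebra_simps)
  have Tmp: "0 < T / m" using T m0 by simp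
  have \<tau>nn: "0 \<le> \<tau> i" for i unfolding \<tau>_def using T m0 by simp
  have \<tau>le: "\<tau> i \<le> T" if "i \<le> m" for i
  proof -
    have "real i * T \<le> real m * T" using that T by (intro mult_right_mono) auto
    then show ?thesis using m0 by (simp add: \<tau>_def pos_divide_le_eq mult.commute)
  qed
  \<comment> \<open>The time \<open>t\<close> clamped to window \<open>i\<close>: increments of
    \<open>k\<close> over \<open>[s,t]\<close> split into increments between clamped times, one for
    each window.\<close>
  define cl where "cl i t = max (\<tau> i) (min (\<tau> (Suc i)) t)" for i t
  have cl: "\<tau> i \<le> cl i t" "cl i t \<le> \<tau> (Suc i)" for i t using Tmp \<tau>S[of i] by (auto simp: cl_def)
  have tele: "(\<Sum>i<j. k (cl i t) - k (\<tau> i)) = k (min (\<tau> j) t) - k 0" if "0 \<le> t" for j t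
  proof (induction j)
    case 0
    then show ?case using that by (simp add: \<tau>0 min_def)
  next
    case (Suc j)
    have eq: "k (min (\<tau> j) t) + (k (cl j t) - k (\<tau> j)) = k (min (\<tau> (Suc j)) t)"
      using Tmp \<tau>S[of j] by (auto simp: cl_def min_def max_def)
    have "(\<Sum>i<Suc j. k (cl i t) - k (\<tau> i)) = k (min (\<tau> j) t) + (k (cl j t) - k (\<tau> j)) - k 0"
      using Suc by simp
    then show ?case unfolding eq .
  qed
  define G where "G t = (\<Sum>i<m. 2 / r * ((x (\<tau> i) - a) \<bullet> k (cl i t)))" for t
  have inc: "norm (k (cl i t) - k (cl i s)) \<le> 2 / r * ((x (\<tau> i) - a) \<bullet> (k (cl i t) - k (cl i s)))"
    if i: "i < m" and st: "s \<le> t" for i s t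
  proof (rule skorokhod_window_variation[OF k r])
    show "0 \<le> cl i s" using cl(1)[of i s] \<tau>nn[of i] by linarith
    show "cl i s \<le> cl i t" using st by (auto simp: cl_def)
    show "cl i t \<le> T" using cl(2)[of i t] \<tau>le[of "Suc i"] i by linarith
    fix q assume q: "cl i s \<le> q" "q \<le> cl i t"
    then have "\<tau> i \<le> q" "q \<le> \<tau> (Suc i)" using cl(1)[of i s] cl(2)[of i t] by linarith+
    then have "q \<in> {0..T}" "\<tau> i \<in> {0..T}" "dist q (\<tau> i) < d"
      using \<tau>nn[of i] \<tau>le[of i] \<tau>le[of "Suc i"] i \<tau>S[of i] Tm by (auto simp: dist_real_def)
    then have "dist (x q) (x (\<tau> i)) < r / 2" using d(2) by blast
    then show "norm (u q - k q - x (\<tau> i)) \<le> r / 2" by (simp add: dist_norm x_def)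
  qed
  have "variation_majorant k 0 T G"
    unfolding variation_majorant_def
  proof (intro allI impI, elim conjE)
    fix s t assume st: "0 \<le> s" "s \<le> t" "t \<le> T"
    have "k t - k s = (\<Sum>i<m. k (cl i t) - k (\<tau> i)) - (\<Sum>i<m. k (cl i s) - k (\<tau> i))"
      using tele[of t m] tele[of s m] st by (simp add: \<tau>m min_def)
    also have "\<dots> = (\<Sum>i<m. k (cl i t) - k (cl i s))" by (simp flip: sum_subtractf)
    also have "norm \<dots> \<le> (\<Sum>i<m. 2 / r * ((x (\<tau> i) - a) \<bullet> (k (cl i t) - k (cl i s))))"
      using inc st by (intro sum_norm_le) auto
    also have "\<dots> = G t - G s" by (simp add: G_def inner_diff_right right_diff_distrib sum_subtractf)
    finally show "norm (k t - k s) \<le> G t - G s" .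
  qed
  moreover have "continuous_on {0..T} G"
    unfolding G_def
  proof (intro continuous_intros)
    fix i assume "i \<in> {..<m}"
    then have "cl i t \<in> {0..T}" for t using cl[of i t] \<tau>nn[of i] \<tau>le[of "Suc i"] by auto
    moreover have "continuous_on {0..T} (cl i)" unfolding cl_def[abs_def] by (intro continuous_intros)
    ultimately show "continuous_on {0..T} (\<lambda>t. k (cl i t))"
      by (intro continuous_on_compose2[OF contk]) auto
  qed
  ultimately show ?thesis using that by blast
qed

section \<open>Equivalence of the cone form and the Stieltjes form of reflection\<close>

lemma convex_cone_hull_subset_sums:
  assumes A: "A \<subseteq> {F. F facet_of D}"
  shows "convex_cone hull (nrm ` A) \<subseteq> {\<Sum>F\<in>A. \<alpha> F *\<^sub>R nrm F |\<alpha>. \<forall>F. 0 \<le> \<alpha> F}"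
proof (rule hull_minimal)
  have fin: "finite A" using A fin_facets finite_subset by blast
  show "nrm ` A \<subseteq> {\<Sum>F\<in>A. \<alpha> F *\<^sub>R nrm F |\<alpha>. \<forall>F. 0 \<le> \<alpha> F}"
  proof
    fix y assume "y \<in> nrm ` A"
    then obtain F where F: "F \<in> A" "y = nrm F" by blast
    have "y = (\<Sum>F'\<in>A. (if F' = F then 1 else 0) *\<^sub>R nrm F')"
      using F fin by (simp add: if_distrib[of "\<lambda>c. c *\<^sub>R _"] if_distribR sum.delta cong: if_cong)
    then show "y \<in> {\<Sum>F\<in>A. \<alpha> F *\<^sub>R nrm F |\<alpha>. \<forall>F. 0 \<le> \<alpha> F}"
      by (intro CollectI exI[of _ "\<lambda>F'. if F' = F then 1 else 0"]) auto
  qed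
  show "convex_cone {\<Sum>F\<in>A. \<alpha> F *\<^sub>R nrm F |\<alpha>. \<forall>F. 0 \<le> \<alpha> F}"
    unfolding convex_cone_iff
  proof (intro conjI ballI allI impI)
    show "0 \<in> {\<Sum>F\<in>A. \<alpha> F *\<^sub>R nrm F |\<alpha>. \<forall>F. 0 \<le> \<alpha> F}"
      by (intro CollectI exI[of _ "\<lambda>_. 0"]) auto
    fix v w assume "v \<in> {\<Sum>F\<in>A. \<alpha> F *\<^sub>R nrm F |\<alpha>. \<forall>F. 0 \<le> \<alpha> F}"
    then obtain \<alpha> where \<alpha>: "v = (\<Sum>F\<in>A. \<alpha> F *\<^sub>R nrm F)" "\<forall>F. 0 \<le> \<alpha> F" by blast
    { assume "w \<in> {\<Sum>F\<in>A. \<alpha> F *\<^sub>R nrm F |\<alpha>. \<forall>F. 0 \<le> \<alpha> F}"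
      then obtain \<beta> where \<beta>: "w = (\<Sum>F\<in>A. \<beta> F *\<^sub>R nrm F)" "\<forall>F. 0 \<le> \<beta> F" by blast
      show "v + w \<in> {\<Sum>F\<in>A. \<alpha> F *\<^sub>R nrm F |\<alpha>. \<forall>F. 0 \<le> \<alpha> F}"
        using \<alpha> \<beta> by (intro CollectI exI[of _ "\<lambda>F. \<alpha> F + \<beta> F"]) (auto simp: scaleR_add_left sum.distrib) }
    { fix c :: real assume "0 \<le> c"
      then show "c *\<^sub>R v \<in> {\<Sum>F\<in>A. \<alpha> F *\<^sub>R nrm F |\<alpha>. \<forall>F. 0 \<le> \<alpha> F}"
        using \<alpha> by (intro CollectI exI[of _ "\<lambda>F. c * \<alpha> F"]) (auto simp: scaleR_sum_right) }
  qed
qed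

text \<open>Farkas' lemma: a finitely generated convex cone is closed, so a vector outside it is
  strictly separated from it, and the negative of the separating functional is in the polar cone yet
  positive on the vector.\<close>

lemma normal_directions_of_polar:
  assumes A: "A \<subseteq> {F. F facet_of D \<and> x \<in> F}" and y: "norm y = 1"
    and polar: "\<And>v. (\<And>F. F \<in> A \<Longrightarrow> v \<bullet> nrm F \<le> 0) \<Longrightarrow> v \<bullet> y \<le> 0"
  shows "y \<in> normal_directions D x"
proof -
  have A': "A \<subseteq> {F. F facet_of D}" using A by blast
  then have fin: "finite A" using fin_facets finite_subset by blast
  let ?C = "convex_cone hull (nrm ` A)"
  have "y \<in> ?C"
  proof (rule ccontr)
    assume "y \<notin> ?C"
    then obtain a b where ab: "a \<bullet> y < b" "\<And>z. z \<in> ?C \<Longrightarrow> b < a \<bullet> z"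
      using separating_hyperplane_closed_point[OF convex_convex_cone_hull closed_convex_cone_hull[OF finite_imageI[OF fin]]]
      by metis
    have b: "b < 0" using ab(2)[OF convex_cone_hull_contains_0] by simp
    have "(- a) \<bullet> nrm F \<le> 0" if F: "F \<in> A" for F
    proof (rule ccontr)
      assume "\<not> ?thesis"
      then have neg: "a \<bullet> nrm F < 0" by simp
      have "nrm F \<in> ?C" using F by (intro hull_inc) auto
      \<comment> \<open>A functional negative on a generator would reach the separating level
        \<open>b < 0\<close> exactly at this positive multiple of the generator, which strict
        separation forbids.\<close>
      then have "(b / (a \<bullet> nrm F)) *\<^sub>R nrm F \<in> ?C"
        using b neg by (intro convex_cone_hull_mul) (auto simp: divide_nonpos_neg)
      from ab(2)[OF this] show False using neg by simp
    qed
    then have "(- a) \<bullet> y \<le> 0" by (rule polar)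
    then show False using ab(1) b by simp
  qed
  then obtain \<alpha> where \<alpha>: "y = (\<Sum>F\<in>A. \<alpha> F *\<^sub>R nrm F)" "\<And>F. 0 \<le> \<alpha> F"
    using convex_cone_hull_subset_sums[OF A'] by blast
  have "y = (\<Sum>F | F facet_of D \<and> x \<in> F. (if F \<in> A then \<alpha> F else 0) *\<^sub>R nrm F)"
    unfolding \<alpha>(1) using A fin_facets
    by (intro sum.mono_neutral_cong_left) (auto intro: finite_subset)
  then show ?thesis unfolding normal_directions_def using y \<alpha>(2)
    by (intro CollectI conjI exI[of _ "\<lambda>F. if F \<in> A then \<alpha> F else 0"]) auto
qed

text \<open>A vector \<open>v\<close> in the polar cone of the visited normals has nonpositive
  product with \<open>\<gamma> r\<close> for almost every \<open>r\<close> in \<open>(s,t]\<close>;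
  integrating against \<open>d|k|\<close> gives the cone condition.\<close>

lemma skorokhod_of_reflects:
  assumes refl: "reflects_along_normals T D x k" and k0: "k 0 = 0" and contk: "continuous_on {0..T} k"
    and x: "\<And>t. t \<in> {0..T} \<Longrightarrow> x t = u t - k t" "\<And>t. t \<in> {0..T} \<Longrightarrow> x t \<in> D"
  shows "skorokhod T u k"
proof -
  let ?\<mu> = "variation_measure T k"
  obtain \<gamma> where \<gamma>: "\<And>s t. \<lbrakk>0 \<le> s; s \<le> t; t \<le> T\<rbrakk> \<Longrightarrow> set_integrable ?\<mu> {s<..t} \<gamma>"
      "\<And>s t. \<lbrakk>0 \<le> s; s \<le> t; t \<le> T\<rbrakk> \<Longrightarrow> k t - k s = (LINT r:{s<..t}|?\<mu>. \<gamma> r)"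
      "AE t in ?\<mu>. \<gamma> t \<in> normal_directions D (x t)"
    using refl unfolding reflects_along_normals_def by blast
  have cone: "v \<bullet> (k t - k s) \<le> 0"
    if st: "0 \<le> s" "s \<le> t" "t \<le> T"
      and v: "\<And>F r. \<lbrakk>F facet_of D; s \<le> r; r \<le> t; u r - k r \<in> F\<rbrakk> \<Longrightarrow> v \<bullet> nrm F \<le> 0" for s t v
  proof -
    have int: "integrable ?\<mu> (\<lambda>r. indicator {s<..t} r *\<^sub>R \<gamma> r)" using \<gamma>(1)[OF st] by (simp add: set_integrable_def)
    have "v \<bullet> (k t - k s) = (\<integral>r. v \<bullet> (indicator {s<..t} r *\<^sub>R \<gamma> r) \<partial>?\<mu>)"
      unfolding \<gamma>(2)[OF st] set_lebesgue_integral_def by (intro integral_inner_right[symmetric] int)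
    also have "\<dots> \<le> (\<integral>r. 0 \<partial>?\<mu>)"
    proof (rule integral_mono_AE)
      show "AE r in ?\<mu>. v \<bullet> (indicator {s<..t} r *\<^sub>R \<gamma> r) \<le> 0"
        using \<gamma>(3)
      proof eventually_elim
        case (elim r)
        show ?case
        proof (cases "r \<in> {s<..t}")
          case True
          obtain \<alpha> where \<alpha>: "\<And>F. 0 \<le> \<alpha> F" "\<gamma> r = (\<Sum>F | F facet_of D \<and> x r \<in> F. \<alpha> F *\<^sub>R nrm F)"
            using elim unfolding normal_directions_def by blast
          have "v \<bullet> \<gamma> r = (\<Sum>F | F facet_of D \<and> x r \<in> F. \<alpha> F * (v \<bullet> nrm F))"
            unfolding \<alpha>(2) by (simp add: inner_sum_right)
          also have "\<dots> \<le> 0"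
          proof (rule sum_nonpos)
            fix F assume F: "F \<in> {F. F facet_of D \<and> x r \<in> F}"
            have "x r = u r - k r" using True st by (intro x) auto
            then have "v \<bullet> nrm F \<le> 0" using F True by (intro v[of F r]) auto
            then show "\<alpha> F * (v \<bullet> nrm F) \<le> 0" using \<alpha>(1)[of F] by (simp add: mult_nonneg_nonpos)
          qed
          finally show ?thesis using True by simp
        qed simp
      qed
    qed (auto intro!: integrable_inner_right int simp del: inner_scaleR_right)
    finally show ?thesis by simp
  qed
  have "u t - k t \<in> D" if "t \<in> {0..T}" for t using x[OF that] by simp
  moreover have "v \<bullet> (k t - k s) \<le> 0"
    if H: "0 \<le> s \<and> s \<le> t \<and> t \<le> T \<and> (\<forall>F. F facet_of D \<and> (\<exists>r\<in>{s..t}. u r - k r \<in> F) \<longrightarrow> v \<bullet> nrm F \<le> 0)" for s t v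
    by (rule cone) (use H in fastforce)+
  ultimately show ?thesis using k0 contk unfolding skorokhod_def by blast
qed

text \<open>The continuous majorant makes \<open>d|k|\<close> a finite measure without atoms, and
  each coordinate of \<open>k\<close> has a density with respect to it, which together give
  \<open>\<gamma>\<close>. Uncountably many inequalities hold almost everywhere at once because
  countable dense families of test vectors suffice.\<close>

lemma skorokhod_reflects:
  assumes k: "skorokhod T u k" and u: "continuous_on {0..T} u" and T: "0 < T"
    and x: "\<And>t. t \<in> {0..T} \<Longrightarrow> x t = u t - k t" "continuous_on UNIV x"
    and k_clamp: "\<And>t. k t = k (max 0 (min T t))"
  shows "bounded_variation_on k 0 T" "reflects_along_normals T D x k"
    "variation_measure T k = density (variation_measure T k) (\<lambda>t. indicator (frontier D) (x t))"
proof -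
  obtain G where G: "continuous_on {0..T} G" and maj: "variation_majorant k 0 T G"
    using skorokhod_majorant[OF k u T] by blast
  show "bounded_variation_on k 0 T" using maj T by (intro bounded_variation_of_majorant[OF maj]) auto
  define V where "V t = total_variation k 0 t" for t
  define F where "F t = V (max 0 (min T t))" for t
  let ?\<mu> = "variation_measure T k"
  have \<mu>: "?\<mu> = interval_measure F" by (simp add: variation_measure_def F_def[abs_def] V_def)
  have V_ge: "norm (k t - k s) \<le> V t - V s" if "0 \<le> s" "s \<le> t" "t \<le> T" for s t
    unfolding V_def using total_variation_increment_ge[OF maj that] .
  have V_le: "V t - V s \<le> G' t - G' s" if "variation_majorant k 0 T G'" "0 \<le> s" "s \<le> t" "t \<le> T" for G' s t
    unfolding V_def using total_variation_increment_le[OF that] .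
  have Vmono: "V s \<le> V t" if "0 \<le> s" "s \<le> t" "t \<le> T" for s t
    using V_ge[OF that] norm_ge_zero[of "k t - k s"] by linarith
  have contV: "continuous_on {0..T} V"
    using V_le[OF maj] Vmono by (intro continuous_on_of_majorant[OF G]) auto
  have F_ge: "norm (k t - k s) \<le> F t - F s" if "s \<le> t" for s t
    using V_ge[of "max 0 (min T s)" "max 0 (min T t)"] that T k_clamp[of t] k_clamp[of s] by (auto simp: F_def)
  have Fmono: "F s \<le> F t" if "s \<le> t" for s t using F_ge[OF that] norm_ge_zero[of "k t - k s"] by linarith
  have contF: "continuous_on UNIV F" unfolding F_def[abs_def]
    by (rule continuous_on_compose2[OF contV]) (use T in \<open>auto intro!: continuous_intros\<close>)
  have F_clamp: "F t = F (max 0 (min T t))" for t using T by (simp add: F_def)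
  have fin: "finite_measure ?\<mu>" and inside: "AE r in ?\<mu>. 0 < r \<and> r < T"
    unfolding \<mu> using interval_measure_clamped[OF Fmono contF _ F_clamp] T by auto
  interpret \<mu>: finite_measure ?\<mu> by (rule fin)
  have sets\<mu>: "sets ?\<mu> = sets borel" by (simp add: \<mu>)
  have em: "measure ?\<mu> {a<..b} = F b - F a" if "a \<le> b" for a b
    using emeasure_interval_measure_cont[OF Fmono contF that] Fmono[OF that] by (simp add: \<mu> measure_def)

  have "\<exists>g. integrable ?\<mu> g \<and> (\<forall>a b. a \<le> b \<longrightarrow> k b \<bullet> e - k a \<bullet> e = (LINT r:{a<..b}|?\<mu>. g r))" if e: "e \<in> Basis" for e
  proof -
    have "\<bar>k b \<bullet> e - k a \<bullet> e\<bar> \<le> F b - F a" if "a \<le> b" for a b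
      using Basis_le_norm[OF e, of "k b - k a"] F_ge[OF that] by (simp add: inner_diff_left)
    from dominated_density[OF Fmono contF fin[unfolded \<mu>] this]
    obtain g where "integrable (interval_measure F) g"
      "\<And>a b. a \<le> b \<Longrightarrow> k b \<bullet> e - k a \<bullet> e = (LINT r:{a<..b}|interval_measure F. g r)" by blast
    then show ?thesis unfolding \<mu> by blast
  qed
  then obtain g where g: "\<And>e. e \<in> Basis \<Longrightarrow> integrable ?\<mu> (g e)"
    "\<And>e a b. e \<in> Basis \<Longrightarrow> a \<le> b \<Longrightarrow> k b \<bullet> e - k a \<bullet> e = (LINT r:{a<..b}|?\<mu>. g e r)" by metis
  define \<gamma> where "\<gamma> r = (\<Sum>e\<in>Basis. g e r *\<^sub>R e)" for r
  have \<gamma>int: "integrable ?\<mu> \<gamma>" unfolding \<gamma>_def[abs_def] using g(1) by auto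
  have ind: "integrable ?\<mu> (\<lambda>r. indicator A r *\<^sub>R f r)" if "integrable ?\<mu> f" "A \<in> sets borel"
    for A and f :: "real \<Rightarrow> 'b::{banach, second_countable_topology}"
    using integrable_mult_indicator[OF _ that(1), of A] that(2) by (simp add: sets\<mu>)
  have k\<gamma>: "k b - k a = (LINT r:{a<..b}|?\<mu>. \<gamma> r)" if ab: "a \<le> b" for a b
  proof (rule euclidean_eqI)
    fix e :: 'a assume e: "e \<in> Basis"
    have "(LINT r:{a<..b}|?\<mu>. \<gamma> r) \<bullet> e = (\<integral>r. (indicator {a<..b} r *\<^sub>R \<gamma> r) \<bullet> e \<partial>?\<mu>)"
      unfolding set_lebesgue_integral_def by (intro integral_inner_left[symmetric] ind \<gamma>int) auto
    also have "\<dots> = (LINT r:{a<..b}|?\<mu>. g e r)"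
      unfolding set_lebesgue_integral_def using e by (simp add: \<gamma>_def)
    also have "\<dots> = (k b - k a) \<bullet> e" using g(2)[OF e ab] by (simp add: inner_diff_left)
    finally show "(k b - k a) \<bullet> e = (LINT r:{a<..b}|?\<mu>. \<gamma> r) \<bullet> e" by simp
  qed
  have inner_int: "integrable ?\<mu> (\<lambda>r. v \<bullet> \<gamma> r)" for v using \<gamma>int by auto
  have inner_k: "(LINT r:{a<..b}|?\<mu>. v \<bullet> \<gamma> r) = v \<bullet> (k b - k a)" if "a \<le> b" for a b v
  proof -
    have "(LINT r:{a<..b}|?\<mu>. v \<bullet> \<gamma> r) = (\<integral>r. v \<bullet> (indicator {a<..b} r *\<^sub>R \<gamma> r) \<partial>?\<mu>)"
      by (simp add: set_lebesgue_integral_def)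
    also have "\<dots> = v \<bullet> (LINT r:{a<..b}|?\<mu>. \<gamma> r)"
      unfolding set_lebesgue_integral_def by (intro integral_inner_right ind \<gamma>int) auto
    finally show ?thesis using k\<gamma>[OF that] by simp
  qed

  \<comment> \<open>The norm of \<open>\<gamma> r\<close> is at most 1 as soon as its product with
    each \<open>e\<close> is at most \<open>norm e\<close>; by continuity in \<open>e\<close> a
    countable dense set of \<open>e\<close> is enough.\<close>
  obtain Q :: "'a set" where Q: "countable Q" "UNIV \<subseteq> closure Q" using separable[of "UNIV :: 'a set"] by metis
  have "AE r in ?\<mu>. 0 < r \<and> r \<le> T \<longrightarrow> e \<bullet> \<gamma> r - norm e \<le> 0" for e
  proof (rule AE_nonpos_of_Ioc[OF sets\<mu>])
    show "integrable ?\<mu> (\<lambda>r. e \<bullet> \<gamma> r - norm e)" using inner_int by (intro Bochner_Integration.integrable_diff) auto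
    fix a b :: real assume ab: "a \<le> b"
    have "(LINT r:{a<..b}|?\<mu>. e \<bullet> \<gamma> r - norm e) = (LINT r:{a<..b}|?\<mu>. e \<bullet> \<gamma> r) - (LINT r:{a<..b}|?\<mu>. norm e)"
      by (rule set_integral_diff(2)) (unfold set_integrable_def, (rule ind; simp add: inner_int)+)
    also have "(LINT r:{a<..b}|?\<mu>. norm e) = norm e * (F b - F a)"
      using em[OF ab] sets\<mu> by (simp add: set_lebesgue_integral_def)
    also have "(LINT r:{a<..b}|?\<mu>. e \<bullet> \<gamma> r) = e \<bullet> (k b - k a)" by (rule inner_k[OF ab])
    also have "e \<bullet> (k b - k a) \<le> norm e * (F b - F a)"
      using norm_cauchy_schwarz[of e "k b - k a"] F_ge[OF ab] by (meson mult_left_mono norm_ge_zero order_trans)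
    finally show "(LINT r:{a<..b}|?\<mu>. e \<bullet> \<gamma> r - norm e) \<le> 0" by simp
  qed
  then have "AE r in ?\<mu>. \<forall>e\<in>Q. 0 < r \<and> r \<le> T \<longrightarrow> e \<bullet> \<gamma> r - norm e \<le> 0" by (intro AE_ball_countable' Q)
  then have le1: "AE r in ?\<mu>. norm (\<gamma> r) \<le> 1"
    using inside
  proof eventually_elim
    case (elim r)
    have "closed {e. e \<bullet> \<gamma> r - norm e \<le> 0}" by (intro closed_Collect_le continuous_intros)
    moreover have "Q \<subseteq> {e. e \<bullet> \<gamma> r - norm e \<le> 0}" using elim by auto
    ultimately have "closure Q \<subseteq> {e. e \<bullet> \<gamma> r - norm e \<le> 0}" by (rule closure_minimal[rotated])
    then have "\<gamma> r \<bullet> \<gamma> r - norm (\<gamma> r) \<le> 0" using Q by blast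
    then have "norm (\<gamma> r) * norm (\<gamma> r) \<le> norm (\<gamma> r) * 1" by (simp add: dot_square_norm power2_eq_square)
    then show ?case by (cases "norm (\<gamma> r) = 0") (auto simp: mult_le_cancel_left)
  qed
  have norm_int: "integrable ?\<mu> (\<lambda>r. norm (\<gamma> r))" using \<gamma>int by (rule integrable_norm)
  \<comment> \<open>The integral of \<open>norm (\<gamma> r)\<close> majorises \<open>k\<close> as
    well, so the total variation, the least majorant, has no more mass. As the integrand is at most
    1, it equals 1 almost everywhere.\<close>
  define H where "H t = (LINT r:{0<..t}|?\<mu>. norm (\<gamma> r))" for t
  have Hinc: "H t - H s = (LINT r:{s<..t}|?\<mu>. norm (\<gamma> r))" if "0 \<le> s" "s \<le> t" for s t
  proof -
    have "{0<..t} = {0<..s} \<union> {s<..t}" using that by auto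
    then have "H t = (LINT r:{0<..s} \<union> {s<..t}|?\<mu>. norm (\<gamma> r))" by (simp add: H_def)
    also have "\<dots> = H s + (LINT r:{s<..t}|?\<mu>. norm (\<gamma> r))"
      unfolding H_def by (rule set_integral_Un) (auto simp: set_integrable_def intro!: ind[OF norm_int, simplified])
    finally show ?thesis by simp
  qed
  have "variation_majorant k 0 T H"
    unfolding variation_majorant_def
  proof (intro allI impI, elim conjE)
    fix s t assume st: "0 \<le> s" "s \<le> t" "t \<le> T"
    have "set_integrable ?\<mu> {s<..t} \<gamma>" unfolding set_integrable_def by (rule ind[OF \<gamma>int]) simp
    then have "norm (LINT r:{s<..t}|?\<mu>. \<gamma> r) \<le> (LINT r:{s<..t}|?\<mu>. norm (\<gamma> r))" by (rule set_integral_norm_bound)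
    then show "norm (k t - k s) \<le> H t - H s" using k\<gamma>[OF st(2)] Hinc[OF st(1,2)] by simp
  qed
  then have "V T - V 0 \<le> H T - H 0" using T by (intro V_le) auto
  moreover have "F T - F 0 = V T - V 0" using T by (simp add: F_def)
  moreover have "H 0 = 0" by (simp add: H_def set_lebesgue_integral_def)
  ultimately have HT: "F T - F 0 \<le> H T" by simp
  have "AE r in ?\<mu>. indicator {0<..T} r * (1 - norm (\<gamma> r)) = 0"
  proof -
    have i: "integrable ?\<mu> (\<lambda>r. indicator {0<..T} r * (1 - norm (\<gamma> r)))"
      using ind[of "\<lambda>r. 1 - norm (\<gamma> r)" "{0<..T}"] norm_int by simp
    have nn: "AE r in ?\<mu>. 0 \<le> indicator {0<..T} r * (1 - norm (\<gamma> r))" using le1 by eventually_elim simp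
    have "(\<integral>r. indicator {0<..T} r * (1 - norm (\<gamma> r)) \<partial>?\<mu>) = (LINT r:{0<..T}|?\<mu>. 1 - norm (\<gamma> r))"
      by (simp add: set_lebesgue_integral_def)
    also have "\<dots> = (LINT r:{0<..T}|?\<mu>. 1) - H T" unfolding H_def
      by (rule set_integral_diff(2)) (unfold set_integrable_def, (rule ind; simp add: norm_int)+)
    also have "(LINT r:{0<..T}|?\<mu>. 1::real) = F T - F 0"
      using em[of 0 T] T sets\<mu> by (simp add: set_lebesgue_integral_def)
    finally have "(\<integral>r. indicator {0<..T} r * (1 - norm (\<gamma> r)) \<partial>?\<mu>) \<le> 0" using HT by simp
    moreover have "0 \<le> (\<integral>r. indicator {0<..T} r * (1 - norm (\<gamma> r)) \<partial>?\<mu>)" using nn by (rule integral_nonneg_AE)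
    ultimately show ?thesis using integral_nonneg_eq_0_iff_AE[OF i nn] by linarith
  qed
  then have norm1: "AE r in ?\<mu>. norm (\<gamma> r) = 1" using inside by eventually_elim auto

  \<comment> \<open>\<open>A p q\<close> collects the facets visited during \<open>[p,q]\<close> and
    \<open>P p q\<close> is the polar cone of their normals. Only rational windows and a countable
    dense subset \<open>S p q\<close> of each polar cone are tested, so the exceptional null sets
    can be united.\<close>
  define A where "A p q = {F. F facet_of D \<and> (\<exists>r\<in>{p..q}. x r \<in> F)}" for p q
  define P where "P p q = {v. \<forall>F\<in>A p q. v \<bullet> nrm F \<le> 0}" for p q
  have "\<exists>S. countable S \<and> S \<subseteq> P p q \<and> P p q \<subseteq> closure S" for p q
    using separable[of "P p q"] by metis
  then obtain S where S: "\<And>p q. countable (S p q)" "\<And>p q. S p q \<subseteq> P p q" "\<And>p q. P p q \<subseteq> closure (S p q)" by metis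
  have loc: "AE r in ?\<mu>. p < r \<and> r \<le> q \<longrightarrow> v \<bullet> \<gamma> r \<le> 0" if pq: "0 \<le> p" "q \<le> T" and v: "v \<in> P p q" for p q v
  proof (rule AE_nonpos_of_Ioc[OF sets\<mu> inner_int])
    fix a b assume ab: "p \<le> a" "a \<le> b" "b \<le> q"
    have "v \<bullet> (k b - k a) \<le> 0"
    proof (rule skorokhod_cone[OF k])
      fix F' r assume F': "F' facet_of D" "a \<le> r" "r \<le> b" "u r - k r \<in> F'"
      have "x r = u r - k r" using F' ab pq by (intro x) auto
      then have "F' \<in> A p q" using F' ab unfolding A_def by (auto intro!: bexI[of _ r])
      then show "v \<bullet> nrm F' \<le> 0" using v by (auto simp: P_def)
    qed (use ab pq in auto)
    then show "(LINT r:{a<..b}|?\<mu>. v \<bullet> \<gamma> r) \<le> 0" using inner_k[OF ab(2)] by simp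
  qed
  define I where "I = (SIGMA pq : (\<rat> \<inter> {0..T}) \<times> (\<rat> \<inter> {0..T}). S (fst pq) (snd pq))"
  have "countable I" unfolding I_def using S(1) countable_rat by (intro countable_SIGMA countable_Int1) auto
  then have "AE r in ?\<mu>. \<forall>i\<in>I. fst (fst i) < r \<and> r \<le> snd (fst i) \<longrightarrow> snd i \<bullet> \<gamma> r \<le> 0"
  proof (intro AE_ball_countable' loc)
    fix i assume "i \<in> I"
    then show "0 \<le> fst (fst i)" "snd (fst i) \<le> T" by (auto simp: I_def)
    have "snd i \<in> S (fst (fst i)) (snd (fst i))" using \<open>i \<in> I\<close> by (auto simp: I_def)
    then show "snd i \<in> P (fst (fst i)) (snd (fst i))" using S(2) by blast
  qed
  then have normal: "AE r in ?\<mu>. \<gamma> r \<in> normal_directions D (x r)"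
    using inside norm1
  proof eventually_elim
    case (elim r)
    \<comment> \<open>Facets are closed and finitely many, so near \<open>r\<close> the path visits
      only facets that contain \<open>x r\<close>. A rational window inside this neighbourhood then
      has all its visited normals active at \<open>x r\<close>.\<close>
    have "\<exists>d>0. \<forall>F. F facet_of D \<longrightarrow> x r \<notin> F \<longrightarrow> (\<forall>q. \<bar>q - r\<bar> < d \<longrightarrow> x q \<notin> F)"
    proof -
      have "\<forall>\<^sub>F q in nhds r. \<forall>F\<in>{F. F facet_of D \<and> x r \<notin> F}. x q \<notin> F"
      proof (rule eventually_ball_finite)
        show "finite {F. F facet_of D \<and> x r \<notin> F}" using fin_facets by (rule rev_finite_subset) auto
        show "\<forall>F\<in>{F. F facet_of D \<and> x r \<notin> F}. \<forall>\<^sub>F q in nhds r. x q \<notin> F"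
        proof clarify
          fix F' assume F': "F' facet_of D" "x r \<notin> F'"
          have "closed F'" using F'(1) facet_of_imp_face_of face_of_imp_closed D_convex D_closed by blast
          then have "open (x -` (- F'))" using x(2) by (intro open_vimage) auto
          then show "\<forall>\<^sub>F q in nhds r. x q \<notin> F'" using F'(2) by (auto simp: eventually_nhds)
        qed
      qed
      then show ?thesis unfolding eventually_nhds_metric dist_real_def by blast
    qed
    then obtain d where d: "d > 0" "\<And>F q. \<lbrakk>F facet_of D; x r \<notin> F; \<bar>q - r\<bar> < d\<rbrakk> \<Longrightarrow> x q \<notin> F" by blast
    obtain p where p: "p \<in> \<rat>" "max 0 (r - d) < p" "p < r" using Rats_dense_in_real[of "max 0 (r - d)" r] elim d by auto
    obtain q where q: "q \<in> \<rat>" "r < q" "q < min T (r + d)" using Rats_dense_in_real[of r "min T (r + d)"] elim d by auto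
    have "v \<bullet> \<gamma> r \<le> 0" if "v \<in> S p q" for v
    proof -
      have "((p, q), v) \<in> I" using p q elim that by (auto simp: I_def)
      then show ?thesis using elim p q by fastforce
    qed
    then have "S p q \<subseteq> {v. v \<bullet> \<gamma> r \<le> 0}" by auto
    moreover have "closed {v. v \<bullet> \<gamma> r \<le> 0}" by (intro closed_Collect_le continuous_intros)
    ultimately have "closure (S p q) \<subseteq> {v. v \<bullet> \<gamma> r \<le> 0}" by (rule closure_minimal)
    then have pol: "v \<bullet> \<gamma> r \<le> 0" if "v \<in> P p q" for v using S(3) that by blast
    show ?case
    proof (rule normal_directions_of_polar[where A = "A p q"])
      show "A p q \<subseteq> {F. F facet_of D \<and> x r \<in> F}"
      proof
        fix F' assume "F' \<in> A p q"
        then obtain r' where "F' facet_of D" "r' \<in> {p..q}" "x r' \<in> F'" by (auto simp: A_def)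
        moreover have "\<bar>r' - r\<bar> < d" using p q \<open>r' \<in> {p..q}\<close> by auto
        ultimately show "F' \<in> {F. F facet_of D \<and> x r \<in> F}" using d(2)[of F' r'] by blast
      qed
      show "norm (\<gamma> r) = 1" using elim by simp
      show "v \<bullet> \<gamma> r \<le> 0" if "\<And>F. F \<in> A p q \<Longrightarrow> v \<bullet> nrm F \<le> 0" for v using pol that by (auto simp: P_def)
    qed
  qed
  have \<gamma>b: "\<gamma> \<in> borel_measurable borel"
    using borel_measurable_integrable[OF \<gamma>int] measurable_cong_sets[OF sets\<mu> refl] by blast
  have "set_integrable ?\<mu> {s<..t} \<gamma>" for s t unfolding set_integrable_def by (rule ind[OF \<gamma>int]) simp
  then show "reflects_along_normals T D x k"
    unfolding reflects_along_normals_def using \<gamma>b k\<gamma> normal by (intro bexI[of _ \<gamma>]) auto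
  have xb: "x \<in> borel_measurable borel" using x(2) by (rule borel_measurable_continuous_onI)
  have "density ?\<mu> (\<lambda>t. indicator (frontier D) (x t)) = density ?\<mu> (\<lambda>_. 1)"
  proof (rule density_cong)
    have "(\<lambda>t. indicator (frontier D) (x t) :: ennreal) \<in> borel_measurable borel"
      using measurable_compose[OF xb, of "indicator (frontier D) :: 'a \<Rightarrow> ennreal" borel] frontier_closed[of D] by simp
    then show "(\<lambda>t. indicator (frontier D) (x t) :: ennreal) \<in> borel_measurable ?\<mu>"
      using measurable_cong_sets[OF sets\<mu> refl] by blast
    show "AE t in ?\<mu>. indicator (frontier D) (x t) = (1 :: ennreal)"
      using normal
    proof eventually_elim
      case (elim t)
      have "{F. F facet_of D \<and> x t \<in> F} \<noteq> {}"
      proof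
        assume empty: "{F. F facet_of D \<and> x t \<in> F} = {}"
        obtain \<alpha> where \<alpha>: "norm (\<gamma> t) = 1" "\<gamma> t = (\<Sum>F | F facet_of D \<and> x t \<in> F. \<alpha> F *\<^sub>R nrm F)"
          using elim unfolding normal_directions_def by blast
        have "\<gamma> t = 0" unfolding \<alpha>(2) empty by simp
        then show False using \<alpha>(1) by simp
      qed
      then show ?case using facet_subset_frontier by auto
    qed
  qed auto
  then show "?\<mu> = density ?\<mu> (\<lambda>t. indicator (frontier D) (x t))" by (simp add: density_1)
qed

end

section \<open>Path spaces\<close>

text \<open>Meaningful when \<open>f\<close> is continuous on \<open>[0,T]\<close>; otherwise
  \<open>Bcontfun\<close> may be applied to a function outside its range of validity.\<close>

definition cpath_of :: "real \<Rightarrow> (real \<Rightarrow> 'a) \<Rightarrow> 'a::metric_space cpath" where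
  "cpath_of T f = Bcontfun (\<lambda>t. f (max 0 (min T t)))"

lemma cpath_of_apply:
  assumes "0 \<le> T" "continuous_on {0..T} f"
  shows "cpath_of T f t = f (max 0 (min T t))"
proof -
  have "continuous_on UNIV (\<lambda>t. f (max 0 (min T t)))"
    by (rule continuous_on_compose2[OF assms(2)]) (use assms(1) in \<open>auto intro!: continuous_intros\<close>)
  moreover have "range (\<lambda>t. f (max 0 (min T t))) \<subseteq> f ` {0..T}" using assms(1) by auto
  then have "bounded (range (\<lambda>t. f (max 0 (min T t))))"
    using compact_imp_bounded[OF compact_continuous_image[OF assms(2)]] bounded_subset by blast
  ultimately show ?thesis unfolding cpath_of_def by (subst Bcontfun_inverse) (auto simp: bcontfun_def)
qed

lemma cpath_of_mem:
  assumes "0 \<le> T" "continuous_on {0..T} f" "\<And>t. t \<in> {0..T} \<Longrightarrow> f t \<in> S"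
  shows "cpath_of T f \<in> cpaths T S"
  using assms unfolding cpaths_def by (auto simp: cpath_of_apply[OF assms(1,2)] min_def max_def)

lemma cpathsD:
  assumes "f \<in> cpaths T S"
  shows "t \<in> {0..T} \<Longrightarrow> f t \<in> S" "f t = f (max 0 (min T t))"
  using assms by (auto simp: cpaths_def)

lemma cpaths_mem_all: "f \<in> cpaths T S \<Longrightarrow> 0 \<le> T \<Longrightarrow> f t \<in> S"
  using cpathsD(2)[of f T S t] cpathsD(1)[of f T S "max 0 (min T t)"] by auto

lemma cpaths_mono: "f \<in> cpaths T S \<Longrightarrow> S \<subseteq> S' \<Longrightarrow> f \<in> cpaths T S'"
  by (auto simp: cpaths_def)

lemma dist_cpaths_le:
  assumes "f \<in> cpaths T S" "g \<in> cpaths T S'" "0 \<le> T" "\<And>t. t \<in> {0..T} \<Longrightarrow> dist (f t) (g t) \<le> c"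
  shows "dist f g \<le> c"
proof (rule dist_bound)
  fix t show "dist (f t) (g t) \<le> c"
    using assms(4)[of "max 0 (min T t)"] cpathsD(2)[OF assms(1), of t] cpathsD(2)[OF assms(2), of t] assms(3) by auto
qed

lemma cpaths_eqI:
  assumes "f \<in> cpaths T S" "g \<in> cpaths T S'" "0 \<le> T" "\<And>t. t \<in> {0..T} \<Longrightarrow> f t = g t"
  shows "f = g"
  using dist_cpaths_le[OF assms(1-3), of 0] assms(4) by simp

lemma continuous_on_eval_bcontfun: "continuous_on UNIV (\<lambda>f :: 'a::topological_space \<Rightarrow>\<^sub>C 'b::metric_space. f t)"
  unfolding continuous_on_iff using dist_bounded[of _ t] by (meson UNIV_I le_less_trans)

lemma measurable_eval_bcontfun:
  fixes X :: "'w \<Rightarrow> 'a::metric_space cpath"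
  assumes "X \<in> M \<rightarrow>\<^sub>M restrict_space borel S"
  shows "(\<lambda>\<omega>. X \<omega> t) \<in> borel_measurable M"
proof -
  have "X \<in> borel_measurable M" using assms by (simp add: measurable_restrict_space2_iff)
  from measurable_compose[OF this borel_measurable_continuous_onI[OF continuous_on_eval_bcontfun]] show ?thesis .
qed

section \<open>Piecewise linear interpolation of paths\<close>

lemma hat_sum:
  fixes s :: real
  assumes "0 \<le> s" "s \<le> n"
  shows "(\<Sum>i\<le>n. max 0 (1 - \<bar>s - real i\<bar>)) = 1"
proof -
  define j where "j = nat \<lfloor>s\<rfloor>"
  have j: "real j \<le> s" "s < real j + 1" using assms by (auto simp: j_def)
  have zero: "max 0 (1 - \<bar>s - real i\<bar>) = 0" if "i \<noteq> j" "i \<noteq> Suc j" for i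
  proof (cases "i < j")
    case True
    then have "real i + 1 \<le> real j" by linarith
    then show ?thesis using j by auto
  next
    case False
    then have "real j + 2 \<le> real i" using that by linarith
    then show ?thesis using j by auto
  qed
  have jn: "j \<le> n" using j assms by linarith
  show ?thesis
  proof (cases "j = n")
    case True
    then have "s = n" using j assms by linarith
    have "(\<Sum>i\<le>n. max 0 (1 - \<bar>s - real i\<bar>)) = (\<Sum>i\<in>{j}. max 0 (1 - \<bar>s - real i\<bar>))"
      using True by (intro sum.mono_neutral_right) (auto intro!: zero)
    then show ?thesis using True \<open>s = n\<close> by simp
  next
    case False
    then have "(\<Sum>i\<le>n. max 0 (1 - \<bar>s - real i\<bar>)) = (\<Sum>i\<in>{j, Suc j}. max 0 (1 - \<bar>s - real i\<bar>))"
      using jn by (intro sum.mono_neutral_right) (auto intro!: zero)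
    then show ?thesis using j by auto
  qed
qed

text \<open>The piecewise linear path with value \<open>c i\<close> at node
  \<open>i * T / n\<close>, written as a sum of hat functions. For Euclidean values the coefficient
  space \<open>nat \<Rightarrow> 'a\<close> is second countable, which makes the interpolant the
  factorisation used for measurability.\<close>

definition interpolate :: "real \<Rightarrow> nat \<Rightarrow> (nat \<Rightarrow> 'a) \<Rightarrow> 'a::real_normed_vector cpath" where
  "interpolate T n c = cpath_of T (\<lambda>t. \<Sum>i\<le>n. max 0 (1 - \<bar>real n * t / T - real i\<bar>) *\<^sub>R c i)"

lemma interpolate_apply:
  assumes "0 \<le> T"
  shows "interpolate T n c t = (\<Sum>i\<le>n. max 0 (1 - \<bar>real n * max 0 (min T t) / T - real i\<bar>) *\<^sub>R c i)"
  unfolding interpolate_def by (rule cpath_of_apply[OF assms]) (cases "T = 0"; auto intro!: continuous_intros)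

lemma continuous_on_interpolate:
  assumes "0 \<le> T" shows "continuous_on UNIV (interpolate T n :: (nat \<Rightarrow> 'a::real_normed_vector) \<Rightarrow> _)"
  unfolding continuous_on_def
proof
  fix c0 :: "nat \<Rightarrow> 'a"
  have le: "dist (interpolate T n c) (interpolate T n c0) \<le> (\<Sum>i\<le>n. dist (c i) (c0 i))" for c
  proof (rule dist_bound)
    fix t
    have "dist (interpolate T n c t) (interpolate T n c0 t) =
      norm (\<Sum>i\<le>n. max 0 (1 - \<bar>real n * max 0 (min T t) / T - real i\<bar>) *\<^sub>R (c i - c0 i))"
      by (simp add: interpolate_apply[OF assms] dist_norm scaleR_diff_right flip: sum_subtractf)
    also have "\<dots> \<le> (\<Sum>i\<le>n. dist (c i) (c0 i))"
      by (intro sum_norm_le) (auto simp: dist_norm intro!: mult_left_le_one_le)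
    finally show "dist (interpolate T n c t) (interpolate T n c0 t) \<le> (\<Sum>i\<le>n. dist (c i) (c0 i))" .
  qed
  have "continuous_on UNIV (\<lambda>c. \<Sum>i\<le>n. dist (c i) (c0 i))" by (intro continuous_intros continuous_on_product_coordinates)
  then have "((\<lambda>c. \<Sum>i\<le>n. dist (c i) (c0 i)) \<longlongrightarrow> (\<Sum>i\<le>n. dist (c0 i) (c0 i))) (at c0)"
    unfolding continuous_on_def by blast
  then have "((\<lambda>c. \<Sum>i\<le>n. dist (c i) (c0 i)) \<longlongrightarrow> 0) (at c0)" by simp
  then have "((\<lambda>c. dist (interpolate T n c) (interpolate T n c0)) \<longlongrightarrow> 0) (at c0)"
    by (rule Lim_null_comparison[rotated]) (use le in auto)
  then show "(interpolate T n \<longlongrightarrow> interpolate T n c0) (at c0 within UNIV)" by (simp add: tendsto_dist_iff[symmetric])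
qed

text \<open>The hat functions form a partition of unity, so the value at \<open>t\<close> is an
  average of values of \<open>f\<close> at nodes less than \<open>T / n\<close> away, and uniform
  continuity of \<open>f\<close> on \<open>[0,T]\<close> bounds the error.\<close>

lemma interpolate_tendsto:
  fixes f :: "'a::real_normed_vector cpath"
  assumes T: "0 < T" and f: "f \<in> cpaths T UNIV"
  shows "(\<lambda>n. interpolate T n (\<lambda>i. f (real i * T / n))) \<longlonglongrightarrow> f"
proof (rule metric_LIMSEQ_I)
  fix \<epsilon> :: real assume \<epsilon>: "\<epsilon> > 0"
  have "uniformly_continuous_on {0..T} f" by (rule compact_uniformly_continuous) auto
  moreover have "\<epsilon> / 2 > 0" using \<epsilon> by simp
  ultimately obtain d where d: "d > 0" "\<forall>s\<in>{0..T}. \<forall>t\<in>{0..T}. dist t s < d \<longrightarrow> dist (f t) (f s) < \<epsilon> / 2"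
    unfolding uniformly_continuous_on_def by meson
  obtain N :: nat where N: "T / d < N" using reals_Archimedean2 by blast
  have "dist (interpolate T n (\<lambda>i. f (real i * T / n))) f < \<epsilon>" if n: "n \<ge> N" for n
  proof -
    have "0 < T / d" using T d(1) by simp
    then have n0: "0 < real n" and nd: "T / d < real n" using N n by linarith+
    have "T < real n * d" using nd d(1) by (simp add: pos_divide_less_eq)
    then have Tn: "T / n < d" using n0 by (simp add: pos_divide_less_eq mult.commute)
    have "dist (interpolate T n (\<lambda>i. f (real i * T / n)) t) (f t) \<le> \<epsilon> / 2" for t
    proof -
      define t' where "t' = max 0 (min T t)"
      have t': "0 \<le> t'" "t' \<le> T" using T by (auto simp: t'_def)
      define h where "h i = max 0 (1 - \<bar>real n * t' / T - real i\<bar>)" for i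
      have "real n * t' \<le> real n * T" using t' by (intro mult_left_mono) auto
      then have "real n * t' / T \<le> n" using T by (simp add: pos_divide_le_eq)
      then have sum1: "(\<Sum>i\<le>n. h i) = 1" unfolding h_def using t' T by (intro hat_sum) auto
      have ft: "f t = f t'" unfolding t'_def by (rule cpathsD(2)[OF f])
      have "interpolate T n (\<lambda>i. f (real i * T / n)) t - f t = (\<Sum>i\<le>n. h i *\<^sub>R f (real i * T / n)) - (\<Sum>i\<le>n. h i) *\<^sub>R f t'"
        unfolding sum1 ft using T by (simp add: interpolate_apply h_def t'_def)
      also have "\<dots> = (\<Sum>i\<le>n. h i *\<^sub>R (f (real i * T / n) - f t'))"
        by (simp add: scaleR_sum_left scaleR_diff_right sum_subtractf)
      also have "norm \<dots> \<le> (\<Sum>i\<le>n. h i * (\<epsilon> / 2))"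
      proof (rule sum_norm_le)
        fix i assume i: "i \<in> {..n}"
        show "norm (h i *\<^sub>R (f (real i * T / n) - f t')) \<le> h i * (\<epsilon> / 2)"
        proof (cases "h i = 0")
          case False
          then have "\<bar>real n * t' / T - real i\<bar> < 1" by (auto simp: h_def)
          then have "\<bar>real n * t' / T - real i\<bar> * (T / n) < 1 * (T / n)" using T n0 by (intro mult_strict_right_mono) auto
          moreover have "\<bar>real n * t' / T - real i\<bar> * (T / n) = \<bar>(real n * t' / T - real i) * (T / n)\<bar>" using T n0 by (simp add: abs_mult)
          moreover have "(real n * t' / T - real i) * (T / n) = t' - real i * T / n" using T n0 by (simp add: field_simps)
          ultimately have "\<bar>t' - real i * T / n\<bar> < T / n" by (simp only: mult_1)
          then have "dist (real i * T / n) t' < d" using Tn by (simp add: dist_real_def)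
          moreover have "real i * T \<le> real n * T" using i T by (intro mult_right_mono) auto
          then have "real i * T / n \<in> {0..T}" using T n0 by (auto simp: pos_divide_le_eq mult.commute)
          ultimately have "dist (f (real i * T / n)) (f t') < \<epsilon> / 2" using d(2) t' by auto
          then have "norm (f (real i * T / n) - f t') \<le> \<epsilon> / 2" by (simp add: dist_norm)
          moreover have hi: "0 \<le> h i" by (simp add: h_def)
          ultimately have "h i * norm (f (real i * T / n) - f t') \<le> h i * (\<epsilon> / 2)" by (rule mult_left_mono)
          then show ?thesis using hi by simp
        qed simp
      qed
      also have "\<dots> = \<epsilon> / 2" unfolding sum_distrib_right[symmetric] sum1 by simp
      finally show ?thesis by (simp add: dist_norm)
    qed
    then have "dist (interpolate T n (\<lambda>i. f (real i * T / n))) f \<le> \<epsilon> / 2" by (rule dist_bound)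
    then show ?thesis using \<epsilon> by simp
  qed
  then show "\<exists>N. \<forall>n\<ge>N. dist (interpolate T n (\<lambda>i. f (real i * T / n))) f < \<epsilon>" by blast
qed

text \<open>
  Spaces of paths on the line are not second countable, so measurability into products of path
  spaces is obtained from approximations that factor through second countable spaces.
\<close>

lemma borel_measurable_Pair_of_approx:
  fixes E :: "nat \<Rightarrow> 'w \<Rightarrow> 'b::second_countable_topology" and E' :: "nat \<Rightarrow> 'w \<Rightarrow> 'c::second_countable_topology"
    and X :: "'w \<Rightarrow> 'd::metric_space" and Y :: "'w \<Rightarrow> 'e::metric_space"
  assumes S: "\<And>n. continuous_on UNIV (S n)" "\<And>n. continuous_on UNIV (S' n)"
    and E: "\<And>n. E n \<in> borel_measurable M" "\<And>n. E' n \<in> borel_measurable M"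
    and lim: "\<And>\<omega>. \<omega> \<in> space M \<Longrightarrow> (\<lambda>n. S n (E n \<omega>)) \<longlonglongrightarrow> X \<omega>"
      "\<And>\<omega>. \<omega> \<in> space M \<Longrightarrow> (\<lambda>n. S' n (E' n \<omega>)) \<longlonglongrightarrow> Y \<omega>"
  shows "(\<lambda>\<omega>. (X \<omega>, Y \<omega>)) \<in> borel_measurable M"
proof (rule borel_measurable_LIMSEQ_metric)
  fix n
  have 1: "(\<lambda>\<omega>. (E n \<omega>, E' n \<omega>)) \<in> borel_measurable M"
    using E[of n] unfolding borel_prod[symmetric] by (rule measurable_Pair)
  have 2: "continuous_on UNIV (\<lambda>p. (S n (fst p), S' n (snd p)))"
    by (intro continuous_on_Pair continuous_on_compose2[OF S(1)] continuous_on_compose2[OF S(2)]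
        continuous_on_fst continuous_on_snd continuous_on_id) auto
  from measurable_compose[OF 1 borel_measurable_continuous_onI[OF 2]]
  show "(\<lambda>\<omega>. (S n (E n \<omega>), S' n (E' n \<omega>))) \<in> borel_measurable M" by simp
  show "(\<lambda>n. (S n (E n \<omega>), S' n (E' n \<omega>))) \<longlonglongrightarrow> (X \<omega>, Y \<omega>)" if "\<omega> \<in> space M" for \<omega>
    by (rule tendsto_Pair[OF lim(1)[OF that] lim(2)[OF that]])
qed

section \<open>Measurability of path-valued maps\<close>

lemma borel_measurable_samples:
  fixes X :: "'w \<Rightarrow> 'a::euclidean_space cpath"
  assumes "\<And>t. (\<lambda>\<omega>. X \<omega> t) \<in> borel_measurable M"
  shows "(\<lambda>\<omega> i. X \<omega> (real i * T / real n)) \<in> borel_measurable M"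
  by (rule measurable_coordinatewise_then_product) (rule assms)

lemma borel_measurable_cpath_Pair:
  fixes X Y :: "'w \<Rightarrow> 'a::euclidean_space cpath"
  assumes T: "0 < T"
    and X: "\<And>t. (\<lambda>\<omega>. X \<omega> t) \<in> borel_measurable M" "\<And>\<omega>. \<omega> \<in> space M \<Longrightarrow> X \<omega> \<in> cpaths T UNIV"
    and Y: "\<And>t. (\<lambda>\<omega>. Y \<omega> t) \<in> borel_measurable M" "\<And>\<omega>. \<omega> \<in> space M \<Longrightarrow> Y \<omega> \<in> cpaths T UNIV"
  shows "(\<lambda>\<omega>. (X \<omega>, Y \<omega>)) \<in> borel_measurable M"
proof (rule borel_measurable_Pair_of_approx[where S = "interpolate T" and S' = "interpolate T"
        and E = "\<lambda>n \<omega> i. X \<omega> (real i * T / real n)" and E' = "\<lambda>n \<omega> i. Y \<omega> (real i * T / real n)"])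
  show "continuous_on UNIV (interpolate T n :: (nat \<Rightarrow> 'a) \<Rightarrow> _)" for n
    by (rule continuous_on_interpolate) (use T in simp)
  then show "continuous_on UNIV (interpolate T n :: (nat \<Rightarrow> 'a) \<Rightarrow> _)" for n .
qed (rule borel_measurable_samples X Y interpolate_tendsto[OF T] | assumption)+

lemma borel_measurable_cpath:
  fixes X :: "'w \<Rightarrow> 'a::euclidean_space cpath"
  assumes T: "0 < T"
    and X: "\<And>t. (\<lambda>\<omega>. X \<omega> t) \<in> borel_measurable M" "\<And>\<omega>. \<omega> \<in> space M \<Longrightarrow> X \<omega> \<in> cpaths T UNIV"
  shows "X \<in> borel_measurable M"
  using measurable_compose[OF borel_measurable_cpath_Pair[OF T X X]
      borel_measurable_continuous_onI[OF continuous_on_fst[OF continuous_on_id]]] by simp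

text \<open>The pair of paths is measurable into the Borel sets of the product space, not merely
  into the product sigma-algebra, and there the distance is continuous.\<close>

lemma borel_measurable_dist_cpath:
  fixes X Y :: "'w \<Rightarrow> 'a::euclidean_space cpath"
  assumes T: "0 < T"
    and X: "X \<in> M \<rightarrow>\<^sub>M restrict_space borel (cpaths T S)" and Y: "Y \<in> M \<rightarrow>\<^sub>M restrict_space borel (cpaths T S')"
  shows "(\<lambda>\<omega>. dist (X \<omega>) (Y \<omega>)) \<in> borel_measurable M"
proof -
  have "X \<omega> \<in> cpaths T UNIV" "Y \<omega> \<in> cpaths T UNIV" if "\<omega> \<in> space M" for \<omega>
    using X Y that by (auto simp: measurable_restrict_space2_iff intro: cpaths_mono)
  then have 1: "(\<lambda>\<omega>. (X \<omega>, Y \<omega>)) \<in> borel_measurable M"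
    by (intro borel_measurable_cpath_Pair[OF T] measurable_eval_bcontfun[OF X] measurable_eval_bcontfun[OF Y])
  have 2: "continuous_on UNIV (\<lambda>p :: 'a cpath \<times> 'a cpath. dist (fst p) (snd p))" by (intro continuous_intros)
  from measurable_compose[OF 1 borel_measurable_continuous_onI[OF 2]] show ?thesis by simp
qed

section \<open>Laws and Wasserstein distances\<close>

lemma sets_law [simp, measurable_cong]: "sets (law M E Z) = sets (restrict_space borel E)"
  by (simp add: law_def)

lemma space_law [simp]: "space (law M E Z) = E"
  by (simp add: law_def space_restrict_space)

lemma nn_integral_law:
  assumes "Z \<in> M \<rightarrow>\<^sub>M restrict_space borel E" "f \<in> borel_measurable (restrict_space borel E)"
  shows "(\<integral>\<^sup>+ x. f x \<partial>law M E Z) = (\<integral>\<^sup>+ \<omega>. f (Z \<omega>) \<partial>M)"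
  unfolding law_def using assms by (intro nn_integral_distr) simp_all

lemma prob_space_law:
  assumes "prob_space M" "Z \<in> M \<rightarrow>\<^sub>M restrict_space borel E" shows "prob_space (law M E Z)"
  unfolding law_def by (rule prob_space.prob_space_distr[OF assms])

lemma law_distr:
  assumes "Z \<in> M \<rightarrow>\<^sub>M N" "Y \<in> N \<rightarrow>\<^sub>M restrict_space borel E"
  shows "law (distr M N Z) E Y = law M E (\<lambda>\<omega>. Y (Z \<omega>))"
  unfolding law_def using distr_distr[OF assms(2,1)] by (simp add: o_def)

lemma law_cong_AE:
  assumes "AE \<omega> in M. Z \<omega> = Z' \<omega>" "Z \<in> M \<rightarrow>\<^sub>M restrict_space borel E" "Z' \<in> M \<rightarrow>\<^sub>M restrict_space borel E"
  shows "law M E Z = law M E Z'"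
  unfolding law_def using assms by (intro distr_cong_AE) auto

lemma borel_measurable_dist_to:
  fixes x0 :: "'e::metric_space"
  shows "(\<lambda>x. ennreal (dist x x0 powr p)) \<in> borel_measurable (restrict_space borel E)"
proof (rule measurable_restrict_space1)
  have "continuous_on UNIV (\<lambda>x. dist x x0)" by (intro continuous_intros)
  then have "(\<lambda>x. dist x x0) \<in> borel_measurable borel" by (rule borel_measurable_continuous_onI)
  then show "(\<lambda>x. ennreal (dist x x0 powr p)) \<in> borel_measurable borel" by measurable
qed

lemma law_prob_moment:
  assumes "prob_space M" "Z \<in> M \<rightarrow>\<^sub>M restrict_space borel E" "x0 \<in> E"
    "(\<integral>\<^sup>+ \<omega>. ennreal (dist (Z \<omega>) x0 powr p) \<partial>M) < \<infinity>"
  shows "law M E Z \<in> prob_moment p E"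
  using assms nn_integral_law[OF assms(2) borel_measurable_dist_to[of x0 p E]]
  by (auto simp: prob_moment_def prob_space_law intro!: bexI[of _ x0])

section \<open>Couplings and their costs\<close>

lemma measurable_couplings:
  assumes "\<pi> \<in> couplings \<mu> \<nu>"
  shows "fst \<in> \<pi> \<rightarrow>\<^sub>M \<mu>" "snd \<in> \<pi> \<rightarrow>\<^sub>M \<nu>"
proof -
  have "sets \<pi> = sets (\<mu> \<Otimes>\<^sub>M \<nu>)" using assms by (simp add: couplings_def)
  then show "fst \<in> \<pi> \<rightarrow>\<^sub>M \<mu>" "snd \<in> \<pi> \<rightarrow>\<^sub>M \<nu>"
    using measurable_cong_sets[of \<pi> "\<mu> \<Otimes>\<^sub>M \<nu>" \<mu> \<mu>] measurable_cong_sets[of \<pi> "\<mu> \<Otimes>\<^sub>M \<nu>" \<nu> \<nu>] by auto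
qed

lemma nn_integral_couplings:
  assumes \<pi>: "\<pi> \<in> couplings \<mu> \<nu>"
  shows "f \<in> borel_measurable \<mu> \<Longrightarrow> (\<integral>\<^sup>+ z. f (fst z) \<partial>\<pi>) = (\<integral>\<^sup>+ x. f x \<partial>\<mu>)"
    "g \<in> borel_measurable \<nu> \<Longrightarrow> (\<integral>\<^sup>+ z. g (snd z) \<partial>\<pi>) = (\<integral>\<^sup>+ y. g y \<partial>\<nu>)"
proof -
  assume "f \<in> borel_measurable \<mu>"
  then have "(\<integral>\<^sup>+ x. f x \<partial>distr \<pi> \<mu> fst) = (\<integral>\<^sup>+ z. f (fst z) \<partial>\<pi>)"
    by (intro nn_integral_distr measurable_couplings[OF \<pi>]) simp
  moreover have "distr \<pi> \<mu> fst = \<mu>" using \<pi> by (simp add: couplings_def)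
  ultimately show "(\<integral>\<^sup>+ z. f (fst z) \<partial>\<pi>) = (\<integral>\<^sup>+ x. f x \<partial>\<mu>)" by simp
next
  assume "g \<in> borel_measurable \<nu>"
  then have "(\<integral>\<^sup>+ x. g x \<partial>distr \<pi> \<nu> snd) = (\<integral>\<^sup>+ z. g (snd z) \<partial>\<pi>)"
    by (intro nn_integral_distr measurable_couplings[OF \<pi>]) simp
  moreover have "distr \<pi> \<nu> snd = \<nu>" using \<pi> by (simp add: couplings_def)
  ultimately show "(\<integral>\<^sup>+ z. g (snd z) \<partial>\<pi>) = (\<integral>\<^sup>+ y. g y \<partial>\<nu>)" by simp
qed

lemma prob_space_couplings:
  assumes "\<pi> \<in> couplings \<mu> \<nu>" "prob_space \<mu>" shows "prob_space \<pi>"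
proof -
  have "distr \<pi> \<mu> fst = \<mu>" using assms by (simp add: couplings_def)
  then have "prob_space (distr \<pi> \<mu> fst)" using assms(2) by simp
  then show ?thesis by (rule prob_space_distrD[OF measurable_couplings(1)[OF assms(1)]])
qed

lemma pair_measure_coupling:
  assumes "prob_space \<mu>" "prob_space \<nu>"
  shows "\<mu> \<Otimes>\<^sub>M \<nu> \<in> couplings \<mu> \<nu>"
proof -
  interpret \<mu>: prob_space \<mu> by fact
  interpret \<nu>: prob_space \<nu> by fact
  interpret pair_sigma_finite \<mu> \<nu> ..
  have "distr (\<mu> \<Otimes>\<^sub>M \<nu>) \<nu> snd = distr (distr (\<nu> \<Otimes>\<^sub>M \<mu>) (\<mu> \<Otimes>\<^sub>M \<nu>) (\<lambda>(x, y). (y, x))) \<nu> snd"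
    using distr_pair_swap by simp
  also have "\<dots> = distr (\<nu> \<Otimes>\<^sub>M \<mu>) \<nu> (snd \<circ> (\<lambda>(x, y). (y, x)))" by (rule distr_distr) auto
  also have "snd \<circ> (\<lambda>(x, y). (y, x)) = (fst :: 'b \<times> 'a \<Rightarrow> 'b)" by auto
  finally show ?thesis by (simp add: couplings_def \<nu>.distr_pair_fst \<mu>.distr_pair_fst)
qed

text \<open>The joint law on a common space. Only the sigma-algebras of the two laws with
  \<open>Y1\<close> and \<open>Y2\<close> enter; leaving these free allows the target space to be
  written in whichever form the application has at hand.\<close>

lemma law_pair_coupling:
  assumes Z: "Z1 \<in> M \<rightarrow>\<^sub>M restrict_space borel E1" "Z2 \<in> M \<rightarrow>\<^sub>M restrict_space borel E2"
  shows "distr M (law M1 E1 Y1 \<Otimes>\<^sub>M law M2 E2 Y2) (\<lambda>\<omega>. (Z1 \<omega>, Z2 \<omega>)) \<in> couplings (law M E1 Z1) (law M E2 Z2)"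
proof -
  let ?N = "law M1 E1 Y1 \<Otimes>\<^sub>M law M2 E2 Y2"
  have Z': "Z1 \<in> M \<rightarrow>\<^sub>M law M1 E1 Y1" "Z2 \<in> M \<rightarrow>\<^sub>M law M2 E2 Y2"
    using Z by (simp_all add: law_def)
  have m: "(\<lambda>\<omega>. (Z1 \<omega>, Z2 \<omega>)) \<in> M \<rightarrow>\<^sub>M ?N" using Z' by (rule measurable_Pair)
  have s: "sets ?N = sets (law M E1 Z1 \<Otimes>\<^sub>M law M E2 Z2)" by (intro sets_pair_measure_cong) auto
  have "distr (distr M ?N (\<lambda>\<omega>. (Z1 \<omega>, Z2 \<omega>))) (law M E1 Z1) fst = distr M (law M E1 Z1) Z1"
    using m by (subst distr_distr) (auto simp: o_def law_def)
  also have "\<dots> = law M E1 Z1" unfolding law_def[of M E1 Z1] by (intro distr_cong) auto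
  finally have 1: "distr (distr M ?N (\<lambda>\<omega>. (Z1 \<omega>, Z2 \<omega>))) (law M E1 Z1) fst = law M E1 Z1" .
  have "distr (distr M ?N (\<lambda>\<omega>. (Z1 \<omega>, Z2 \<omega>))) (law M E2 Z2) snd = distr M (law M E2 Z2) Z2"
    using m by (subst distr_distr) (auto simp: o_def law_def)
  also have "\<dots> = law M E2 Z2" unfolding law_def[of M E2 Z2] by (intro distr_cong) auto
  finally have 2: "distr (distr M ?N (\<lambda>\<omega>. (Z1 \<omega>, Z2 \<omega>))) (law M E2 Z2) snd = law M E2 Z2" .
  show ?thesis using 1 2 s by (simp add: couplings_def)
qed

lemma wasserstein_le:
  fixes \<mu> \<nu> :: "'e::metric_space measure"
  assumes "\<pi> \<in> couplings \<mu> \<nu>" "(\<integral>\<^sup>+ (x, y). ennreal (dist x y powr p) \<partial>\<pi>) \<le> ennreal (c powr p)"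
    and "0 \<le> c" "1 \<le> p"
  shows "wasserstein p \<mu> \<nu> \<le> c"
proof -
  have "(INF \<pi>\<in>couplings \<mu> \<nu>. \<integral>\<^sup>+ (x, y). ennreal (dist x y powr p) \<partial>\<pi>) \<le> ennreal (c powr p)"
    using assms(1,2) by (intro INF_lower2)
  then have "enn2real (INF \<pi>\<in>couplings \<mu> \<nu>. \<integral>\<^sup>+ (x, y). ennreal (dist x y powr p) \<partial>\<pi>) \<le> c powr p"
    by (intro enn2real_leI) auto
  then have "wasserstein p \<mu> \<nu> \<le> (c powr p) powr (1 / p)"
    unfolding wasserstein_def using assms by (intro powr_mono2) auto
  also have "\<dots> = c" using assms by (simp add: powr_powr)
  finally show ?thesis .
qed

lemma wasserstein_nonneg: "0 \<le> wasserstein p \<mu> \<nu>"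
  by (simp add: wasserstein_def)

lemma wasserstein_law_le:
  fixes Z1 Z2 :: "'w \<Rightarrow> 'e::metric_space"
  assumes Z: "Z1 \<in> M \<rightarrow>\<^sub>M restrict_space borel E" "Z2 \<in> M \<rightarrow>\<^sub>M restrict_space borel E"
    and d: "(\<lambda>(x, y). dist x y) \<in> borel_measurable (restrict_space borel E \<Otimes>\<^sub>M restrict_space borel E)"
    and le: "(\<integral>\<^sup>+ \<omega>. ennreal (dist (Z1 \<omega>) (Z2 \<omega>) powr p) \<partial>M) \<le> ennreal (c powr p)" and c: "0 \<le> c" "1 \<le> p"
  shows "wasserstein p (law M E Z1) (law M E Z2) \<le> c"
proof (rule wasserstein_le[OF law_pair_coupling[OF Z, of M Z1 M Z2] _ c])
  let ?N = "law M E Z1 \<Otimes>\<^sub>M law M E Z2"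
  have s: "sets ?N = sets (restrict_space borel E \<Otimes>\<^sub>M restrict_space borel E)" by (intro sets_pair_measure_cong) auto
  have "(\<lambda>(x, y). dist x y) \<in> borel_measurable ?N" using d measurable_cong_sets[OF s refl] by blast
  then have m: "(\<lambda>(x, y). ennreal (dist x y powr p)) \<in> borel_measurable ?N"
    by (simp add: case_prod_beta)
  have "(\<lambda>\<omega>. (Z1 \<omega>, Z2 \<omega>)) \<in> M \<rightarrow>\<^sub>M ?N" using Z by (intro measurable_Pair) (simp_all add: law_def)
  then have "(\<integral>\<^sup>+ (x, y). ennreal (dist x y powr p) \<partial>distr M ?N (\<lambda>\<omega>. (Z1 \<omega>, Z2 \<omega>))) =
    (\<integral>\<^sup>+ \<omega>. ennreal (dist (Z1 \<omega>) (Z2 \<omega>) powr p) \<partial>M)"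
    using m by (subst nn_integral_distr) auto
  then show "(\<integral>\<^sup>+ (x, y). ennreal (dist x y powr p) \<partial>distr M ?N (\<lambda>\<omega>. (Z1 \<omega>, Z2 \<omega>))) \<le> ennreal (c powr p)"
    using le by simp
qed

lemma powr_add2_le:
  fixes a b :: real
  assumes "0 \<le> a" "0 \<le> b" "0 \<le> p"
  shows "(a + b) powr p \<le> 2 powr p * (a powr p + b powr p)"
proof -
  have "(a + b) powr p \<le> (2 * max a b) powr p" using assms by (intro powr_mono2) auto
  also have "\<dots> = 2 powr p * (max a b) powr p" using assms by (intro powr_mult)
  also have "(max a b) powr p \<le> a powr p + b powr p" by (simp add: max_def)
  finally show ?thesis by (simp add: mult_left_mono)
qed

lemma powr_add3_le:
  fixes a b c :: real
  assumes "0 \<le> a" "0 \<le> b" "0 \<le> c" "0 \<le> p"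
  shows "(a + b + c) powr p \<le> 3 powr p * (a powr p + b powr p + c powr p)"
proof -
  have "(a + b + c) powr p \<le> (3 * max a (max b c)) powr p" using assms by (intro powr_mono2) auto
  also have "\<dots> = 3 powr p * (max a (max b c)) powr p" using assms by (intro powr_mult)
  also have "(max a (max b c)) powr p \<le> a powr p + b powr p + c powr p" by (simp add: max_def)
  finally show ?thesis by (simp add: mult_left_mono)
qed

text \<open>After the triangle inequality only functions of a single coordinate remain, which are
  measurable. The distance itself need not be measurable on the coupling, since monotonicity of
  \<open>nn_integral\<close> does not ask for it.\<close>

lemma coupling_cost_le:
  fixes \<mu> \<nu> :: "'e::metric_space measure"
  assumes \<pi>: "\<pi> \<in> couplings \<mu> \<nu>" and s: "sets \<mu> = sets (restrict_space borel E)" "sets \<nu> = sets (restrict_space borel E)"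
    and pr: "prob_space \<mu>" and p: "0 \<le> p"
  shows "(\<integral>\<^sup>+ (x, y). ennreal (dist x y powr p) \<partial>\<pi>) \<le>
    ennreal (3 powr p) * ((\<integral>\<^sup>+ x. ennreal (dist x x0 powr p) \<partial>\<mu>) + ennreal (dist x0 y0 powr p)
      + (\<integral>\<^sup>+ y. ennreal (dist y y0 powr p) \<partial>\<nu>))"
proof -
  interpret \<pi>: prob_space \<pi> by (rule prob_space_couplings[OF \<pi> pr])
  have f: "(\<lambda>x. ennreal (dist x x0 powr p)) \<in> borel_measurable \<mu>" "(\<lambda>x. ennreal (dist x y0 powr p)) \<in> borel_measurable \<nu>"
    using borel_measurable_dist_to[of x0 p E] borel_measurable_dist_to[of y0 p E] s measurable_cong_sets by blast+
  have g: "(\<lambda>z. ennreal (dist (fst z) x0 powr p)) \<in> borel_measurable \<pi>" "(\<lambda>z. ennreal (dist (snd z) y0 powr p)) \<in> borel_measurable \<pi>"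
    using measurable_compose[OF measurable_couplings(1)[OF \<pi>] f(1)] measurable_compose[OF measurable_couplings(2)[OF \<pi>] f(2)] .
  have "(\<integral>\<^sup>+ (x, y). ennreal (dist x y powr p) \<partial>\<pi>) \<le>
    (\<integral>\<^sup>+ z. ennreal (3 powr p) * (ennreal (dist (fst z) x0 powr p) + ennreal (dist x0 y0 powr p) + ennreal (dist (snd z) y0 powr p)) \<partial>\<pi>)"
  proof (rule nn_integral_mono)
    fix z :: "'e \<times> 'e"
    obtain x y where z: "z = (x, y)" by (cases z)
    have "dist x y \<le> dist x x0 + dist x0 y0 + dist y y0"
      by (smt (verit) dist_commute dist_triangle)
    then have "dist x y powr p \<le> (dist x x0 + dist x0 y0 + dist y y0) powr p" using p by (intro powr_mono2) auto
    also have "\<dots> \<le> 3 powr p * (dist x x0 powr p + dist x0 y0 powr p + dist y y0 powr p)"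
      using p by (intro powr_add3_le) auto
    finally have "ennreal (dist x y powr p) \<le> ennreal (3 powr p * (dist x x0 powr p + dist x0 y0 powr p + dist y y0 powr p))"
      by (rule ennreal_leI)
    then show "(case z of (x, y) \<Rightarrow> ennreal (dist x y powr p)) \<le>
      ennreal (3 powr p) * (ennreal (dist (fst z) x0 powr p) + ennreal (dist x0 y0 powr p) + ennreal (dist (snd z) y0 powr p))"
      by (simp add: z ennreal_mult flip: ennreal_plus)
  qed
  also have "\<dots> = ennreal (3 powr p) * ((\<integral>\<^sup>+ z. ennreal (dist (fst z) x0 powr p) \<partial>\<pi>) + ennreal (dist x0 y0 powr p)
      + (\<integral>\<^sup>+ z. ennreal (dist (snd z) y0 powr p) \<partial>\<pi>))"
    using g by (simp add: nn_integral_cmult nn_integral_add \<pi>.emeasure_space_1)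
  also have "(\<integral>\<^sup>+ z. ennreal (dist (fst z) x0 powr p) \<partial>\<pi>) = (\<integral>\<^sup>+ x. ennreal (dist x x0 powr p) \<partial>\<mu>)"
    by (rule nn_integral_couplings(1)[OF \<pi> f(1)])
  also have "(\<integral>\<^sup>+ z. ennreal (dist (snd z) y0 powr p) \<partial>\<pi>) = (\<integral>\<^sup>+ x. ennreal (dist x y0 powr p) \<partial>\<nu>)"
    by (rule nn_integral_couplings(2)[OF \<pi> f(2)])
  finally show ?thesis .
qed

lemma coupling_cost_finite:
  fixes \<mu> \<nu> :: "'e::metric_space measure"
  assumes \<pi>: "\<pi> \<in> couplings \<mu> \<nu>" and \<mu>: "\<mu> \<in> prob_moment p E" "\<nu> \<in> prob_moment p E" and p: "0 \<le> p"
  shows "(\<integral>\<^sup>+ (x, y). ennreal (dist x y powr p) \<partial>\<pi>) < \<infinity>"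
proof -
  obtain x0 y0 :: 'e where x0: "(\<integral>\<^sup>+ x. ennreal (dist x x0 powr p) \<partial>\<mu>) < \<infinity>" "(\<integral>\<^sup>+ y. ennreal (dist y y0 powr p) \<partial>\<nu>) < \<infinity>"
    using \<mu> by (auto simp: prob_moment_def)
  have "(\<integral>\<^sup>+ (x, y). ennreal (dist x y powr p) \<partial>\<pi>) \<le>
    ennreal (3 powr p) * ((\<integral>\<^sup>+ x. ennreal (dist x x0 powr p) \<partial>\<mu>) + ennreal (dist x0 y0 powr p)
      + (\<integral>\<^sup>+ y. ennreal (dist y y0 powr p) \<partial>\<nu>))"
    using \<mu> p by (intro coupling_cost_le[OF \<pi>, of E]) (auto simp: prob_moment_def)
  also have "\<dots> < \<infinity>" using x0 by (simp add: ennreal_mult_less_top)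
  finally show ?thesis .
qed

text \<open>Transferring each coupling compares the two infima in \<open>ennreal\<close>. The
  product coupling has finite cost, so passing to reals and taking \<open>p\<close>-th roots
  preserves the inequality; an infinite right-hand side would become 0 under
  \<open>enn2real\<close>.\<close>

lemma wasserstein_le_of_transfer:
  fixes \<mu> \<nu> :: "'e::metric_space measure" and \<mu>' \<nu>' :: "'f::metric_space measure"
  assumes tr: "\<And>\<pi>. \<pi> \<in> couplings \<mu> \<nu> \<Longrightarrow> \<exists>\<pi>'\<in>couplings \<mu>' \<nu>'.
      (\<integral>\<^sup>+ (x, y). ennreal (dist x y powr p) \<partial>\<pi>') \<le> ennreal (C powr p) * (\<integral>\<^sup>+ (x, y). ennreal (dist x y powr p) \<partial>\<pi>)"
    and \<mu>: "\<mu> \<in> prob_moment p E" "\<nu> \<in> prob_moment p E" and p: "1 \<le> p" and C: "0 < C"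
  shows "wasserstein p \<mu>' \<nu>' \<le> C * wasserstein p \<mu> \<nu>"
proof -
  let ?I = "INF \<pi>\<in>couplings \<mu> \<nu>. \<integral>\<^sup>+ (x, y). ennreal (dist x y powr p) \<partial>\<pi>"
  let ?I' = "INF \<pi>\<in>couplings \<mu>' \<nu>'. \<integral>\<^sup>+ (x, y). ennreal (dist x y powr p) \<partial>\<pi>"
  let ?c = "C powr p"
  have c: "?c > 0" using C by simp
  have inv: "ennreal ?c * (ennreal (1 / ?c) * a) = a" "ennreal (1 / ?c) * (ennreal ?c * a) = a" for a
    using c C by (simp_all add: mult.assoc[symmetric] ennreal_mult[symmetric])
  have "ennreal (1 / ?c) * ?I' \<le> ?I"
  proof (rule INF_greatest)
    fix \<pi> assume "\<pi> \<in> couplings \<mu> \<nu>"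
    then obtain \<pi>' where \<pi>': "\<pi>' \<in> couplings \<mu>' \<nu>'"
      "(\<integral>\<^sup>+ (x, y). ennreal (dist x y powr p) \<partial>\<pi>') \<le> ennreal ?c * (\<integral>\<^sup>+ (x, y). ennreal (dist x y powr p) \<partial>\<pi>)"
      using tr by blast
    then have "?I' \<le> ennreal ?c * (\<integral>\<^sup>+ (x, y). ennreal (dist x y powr p) \<partial>\<pi>)" by (intro INF_lower2)
    then have "ennreal (1 / ?c) * ?I' \<le> ennreal (1 / ?c) * (ennreal ?c * (\<integral>\<^sup>+ (x, y). ennreal (dist x y powr p) \<partial>\<pi>))"
      by (intro mult_left_mono) auto
    then show "ennreal (1 / ?c) * ?I' \<le> (\<integral>\<^sup>+ (x, y). ennreal (dist x y powr p) \<partial>\<pi>)" unfolding inv .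
  qed
  then have "ennreal ?c * (ennreal (1 / ?c) * ?I') \<le> ennreal ?c * ?I" by (intro mult_left_mono) auto
  then have le: "?I' \<le> ennreal ?c * ?I" unfolding inv .
  have pr: "prob_space \<mu>" "prob_space \<nu>" using \<mu> by (auto simp: prob_moment_def)
  have "?I \<le> (\<integral>\<^sup>+ (x, y). ennreal (dist x y powr p) \<partial>(\<mu> \<Otimes>\<^sub>M \<nu>))"
    by (rule INF_lower[OF pair_measure_coupling[OF pr]])
  also have "\<dots> < \<infinity>" using p by (intro coupling_cost_finite[OF pair_measure_coupling[OF pr] \<mu>]) auto
  finally have fin: "?I < \<infinity>" .
  then have "enn2real ?I' \<le> enn2real (ennreal ?c * ?I)" using le by (intro enn2real_mono) (auto simp: ennreal_mult_less_top)
  also have "\<dots> = ?c * enn2real ?I" using c by (simp add: enn2real_mult)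
  finally have "enn2real ?I' powr (1 / p) \<le> (?c * enn2real ?I) powr (1 / p)" using p by (intro powr_mono2) auto
  also have "\<dots> = ?c powr (1 / p) * enn2real ?I powr (1 / p)" using c by (intro powr_mult)
  also have "?c powr (1 / p) = C" using p C by (simp add: powr_powr)
  finally show ?thesis unfolding wasserstein_def .
qed

section \<open>The McKean-Vlasov problem: a priori estimates\<close>

text \<open>A crude Minkowski inequality: one factor 2 comes from \<open>powr_add2_le\<close>, the
  other from bounding a sum of two \<open>p\<close>-th powers by that of the sum. The resulting
  factor 4 is absorbed later by the choice of \<open>lam\<close>.\<close>

lemma moment_add_const:
  fixes f :: "'w \<Rightarrow> real"
  assumes M: "prob_space M" and f: "f \<in> borel_measurable M" "\<And>\<omega>. \<omega> \<in> space M \<Longrightarrow> 0 \<le> f \<omega>" and p: "1 \<le> p"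
    and J: "0 \<le> J" "(\<integral>\<^sup>+ \<omega>. ennreal (f \<omega> powr p) \<partial>M) \<le> ennreal (J powr p)" and r: "0 \<le> r"
  shows "(\<integral>\<^sup>+ \<omega>. ennreal ((f \<omega> + r) powr p) \<partial>M) \<le> ennreal ((4 * (J + r)) powr p)"
proof -
  interpret prob_space M by fact
  have "(\<integral>\<^sup>+ \<omega>. ennreal ((f \<omega> + r) powr p) \<partial>M) \<le> (\<integral>\<^sup>+ \<omega>. ennreal (2 powr p) * (ennreal (f \<omega> powr p) + ennreal (r powr p)) \<partial>M)"
  proof (rule nn_integral_mono)
    fix \<omega> assume "\<omega> \<in> space M"
    then have "(f \<omega> + r) powr p \<le> 2 powr p * (f \<omega> powr p + r powr p)" using f(2) r p by (intro powr_add2_le) auto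
    then have "ennreal ((f \<omega> + r) powr p) \<le> ennreal (2 powr p * (f \<omega> powr p + r powr p))" by (rule ennreal_leI)
    then show "ennreal ((f \<omega> + r) powr p) \<le> ennreal (2 powr p) * (ennreal (f \<omega> powr p) + ennreal (r powr p))"
      by (simp add: ennreal_mult flip: ennreal_plus)
  qed
  also have "\<dots> = ennreal (2 powr p) * ((\<integral>\<^sup>+ \<omega>. ennreal (f \<omega> powr p) \<partial>M) + ennreal (r powr p))"
    using f(1) by (simp add: nn_integral_cmult nn_integral_add emeasure_space_1)
  also have "\<dots> \<le> ennreal (2 powr p) * (ennreal (J powr p) + ennreal (r powr p))"
    using J by (intro mult_left_mono add_right_mono) auto
  also have "\<dots> = ennreal (2 powr p * (J powr p + r powr p))" by (simp add: ennreal_mult flip: ennreal_plus)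
  also have "\<dots> \<le> ennreal ((4 * (J + r)) powr p)"
  proof (rule ennreal_leI)
    have "(2::real) powr 1 \<le> 2 powr p" using p by (intro powr_mono) auto
    moreover have "J powr p \<le> (J + r) powr p" "r powr p \<le> (J + r) powr p" using J r p by (auto intro!: powr_mono2)
    ultimately have "J powr p + r powr p \<le> 2 powr p * (J + r) powr p"
      using mult_right_mono[of 2 "2 powr p" "(J + r) powr p"] by simp
    then have "2 powr p * (J powr p + r powr p) \<le> 2 powr p * (2 powr p * (J + r) powr p)" by (intro mult_left_mono) auto
    also have "\<dots> = (2 * 2) powr p * (J + r) powr p" by (simp only: mult.assoc powr_mult)
    also have "\<dots> = ((2 * 2) * (J + r)) powr p" by (simp only: powr_mult)
    also have "(2 * 2) * (J + r) = 4 * (J + r)" by simp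
    finally show "2 powr p * (J powr p + r powr p) \<le> (4 * (J + r)) powr p" .
  qed
  finally show ?thesis .
qed

lemma enn2real_powr_root:
  assumes "I < \<infinity>" "1 \<le> p" shows "ennreal ((enn2real I powr (1 / p)) powr p) = I"
  using assms by (simp add: powr_powr)

text \<open>The integral of the weight is smaller than its end value by a factor of at least
  \<open>l\<close>; this is the gain behind all contractions. The first part with
  \<open>l = 0\<close> serves for constants.\<close>

lemma set_integrable_exp:
  "set_integrable lebesgue {0..t} (\<lambda>s. c * exp (l * s) :: real)"
  "0 < l \<Longrightarrow> 0 \<le> c \<Longrightarrow> 0 \<le> t \<Longrightarrow> (LINT s:{0..t}|lebesgue. c * exp (l * s)) \<le> c * exp (l * t) / l"
proof -
  have m: "(\<lambda>s. indicator {0..t} s *\<^sub>R (c * exp (l * s))) \<in> borel_measurable lborel" by measurable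
  have "integrable lborel (\<lambda>s. indicator {0..t} s *\<^sub>R (c * exp (l * s)))"
    by (rule borel_integrable_compact) (auto intro!: continuous_intros)
  then show "set_integrable lebesgue {0..t} (\<lambda>s. c * exp (l * s))"
    unfolding set_integrable_def using integrable_completion[OF m] by simp
  assume l: "0 < l" and c: "0 \<le> c" and t: "0 \<le> t"
  have "(LINT s:{0..t}|lebesgue. c * exp (l * s)) = (\<integral>s. indicator {0..t} s *\<^sub>R (c * exp (l * s)) \<partial>lborel)"
    unfolding set_lebesgue_integral_def by (rule integral_completion[OF m])
  also have "\<dots> = c * exp (l * t) / l - c * exp (l * 0) / l"
    using l by (intro integral_FTC_atLeastAtMost t)
      (auto intro!: derivative_eq_intros continuous_intros simp flip: has_real_derivative_iff_has_vector_derivative)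
  also have "\<dots> \<le> c * exp (l * t) / l" using l c by simp
  finally show "(LINT s:{0..t}|lebesgue. c * exp (l * s)) \<le> c * exp (l * t) / l" .
qed

lemma borel_measurable_dist_restrict:
  fixes E :: "'e::{metric_space, second_countable_topology} set"
  shows "(\<lambda>(x, y). dist x y) \<in> borel_measurable (restrict_space borel E \<Otimes>\<^sub>M restrict_space borel E)"
proof -
  have "(\<lambda>x. x) \<in> restrict_space borel E \<rightarrow>\<^sub>M (borel :: 'e measure)" by (rule measurable_restrict_space1) simp
  from measurable_compose[OF measurable_fst this] measurable_compose[OF measurable_snd this]
  have "(\<lambda>z. dist (fst z) (snd z)) \<in> borel_measurable (restrict_space borel E \<Otimes>\<^sub>M restrict_space borel E)"
    by (intro borel_measurable_dist)
  then show ?thesis by (simp add: case_prod_beta)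
qed

section \<open>States, pairs of paths and inputs\<close>

lemma measurable_state:
  fixes X k :: "'w \<Rightarrow> 'a::euclidean_space cpath"
  assumes "0 \<le> T" "X \<in> M \<rightarrow>\<^sub>M restrict_space borel (cpaths T S)" "k \<in> M \<rightarrow>\<^sub>M restrict_space borel (cpaths T UNIV)"
  shows "(\<lambda>\<omega>. (X \<omega> s, k \<omega> s)) \<in> M \<rightarrow>\<^sub>M restrict_space borel (S \<times> UNIV)"
proof (rule measurable_restrict_space2)
  have "X \<omega> \<in> cpaths T S" if "\<omega> \<in> space M" for \<omega> using measurable_space[OF assms(2) that] by (simp add: space_restrict_space)
  then show "(\<lambda>\<omega>. (X \<omega> s, k \<omega> s)) \<in> space M \<rightarrow> S \<times> UNIV" using cpaths_mem_all[OF _ assms(1)] by auto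
  show "(\<lambda>\<omega>. (X \<omega> s, k \<omega> s)) \<in> borel_measurable M"
    unfolding borel_prod[symmetric]
    by (intro measurable_Pair measurable_eval_bcontfun[OF assms(2)] measurable_eval_bcontfun[OF assms(3)])
qed

lemma measurable_paths:
  fixes X k :: "'w \<Rightarrow> 'a::euclidean_space cpath"
  assumes T: "0 < T" and X: "X \<in> M \<rightarrow>\<^sub>M restrict_space borel (cpaths T S)" and k: "k \<in> M \<rightarrow>\<^sub>M restrict_space borel (cpaths T S')"
  shows "(\<lambda>\<omega>. (X \<omega>, k \<omega>)) \<in> M \<rightarrow>\<^sub>M restrict_space borel (cpaths T S \<times> cpaths T S')"
proof (rule measurable_restrict_space2)
  have mem: "X \<omega> \<in> cpaths T S" "k \<omega> \<in> cpaths T S'" if "\<omega> \<in> space M" for \<omega>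
    using measurable_space[OF X that] measurable_space[OF k that] by (simp_all add: space_restrict_space)
  then show "(\<lambda>\<omega>. (X \<omega>, k \<omega>)) \<in> space M \<rightarrow> cpaths T S \<times> cpaths T S'" by auto
  show "(\<lambda>\<omega>. (X \<omega>, k \<omega>)) \<in> borel_measurable M"
    using mem by (intro borel_measurable_cpath_Pair[OF T] measurable_eval_bcontfun[OF X] measurable_eval_bcontfun[OF k])
      (auto intro: cpaths_mono)
qed

lemma dist_prod_le: "dist (x, y) (x', y') \<le> dist x x' + dist y y'"
  by (simp add: dist_Pair_Pair sqrt_sum_squares_le_sum)

lemma mv_inputD:
  assumes "mv_input p T D M \<zeta> W"
  shows "prob_space M" "\<And>\<omega>. \<omega> \<in> space M \<Longrightarrow> \<zeta> \<omega> \<in> D" "\<And>\<omega>. \<omega> \<in> space M \<Longrightarrow> W \<omega> \<in> cpaths T UNIV"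
    "\<zeta> \<in> borel_measurable M" "W \<in> M \<rightarrow>\<^sub>M restrict_space borel (cpaths T UNIV)"
    "(\<lambda>\<omega>. (\<zeta> \<omega>, W \<omega>)) \<in> M \<rightarrow>\<^sub>M restrict_space borel (D \<times> cpaths T UNIV)"
proof -
  show "prob_space M" and m: "(\<lambda>\<omega>. (\<zeta> \<omega>, W \<omega>)) \<in> M \<rightarrow>\<^sub>M restrict_space borel (D \<times> cpaths T UNIV)"
    using assms by (auto simp: mv_input_def)
  then have b: "(\<lambda>\<omega>. (\<zeta> \<omega>, W \<omega>)) \<in> borel_measurable M" by (simp add: measurable_restrict_space2_iff)
  show mem: "\<zeta> \<omega> \<in> D" "W \<omega> \<in> cpaths T UNIV" if "\<omega> \<in> space M" for \<omega>
    using measurable_space[OF m that] by (simp_all add: space_restrict_space)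
  show "\<zeta> \<in> borel_measurable M"
    using measurable_compose[OF b borel_measurable_continuous_onI[OF continuous_on_fst[OF continuous_on_id]]] by simp
  have "W \<in> borel_measurable M"
    using measurable_compose[OF b borel_measurable_continuous_onI[OF continuous_on_snd[OF continuous_on_id]]] by simp
  then show "W \<in> M \<rightarrow>\<^sub>M restrict_space borel (cpaths T UNIV)"
    using mem by (intro measurable_restrict_space2) auto
qed

lemma mv_input_moment:
  fixes W :: "'w \<Rightarrow> 'a::euclidean_space cpath"
  assumes inp: "mv_input p T D M \<zeta> W" and p: "1 \<le> p" and a: "0 \<le> a" "0 \<le> c"
  shows "(\<integral>\<^sup>+ \<omega>. ennreal ((a + c * norm (W \<omega>)) powr p) \<partial>M) < \<infinity>"
proof -
  note m = mv_inputD(6)[OF inp]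
  interpret prob_space M by (rule mv_inputD(1)[OF inp])
  obtain z0 where z0: "(\<integral>\<^sup>+ x. ennreal (dist x z0 powr p) \<partial>law M (D \<times> cpaths T UNIV) (\<lambda>\<omega>. (\<zeta> \<omega>, W \<omega>))) < \<infinity>"
    using inp unfolding mv_input_def prob_moment_def by blast
  define d where "d \<omega> = dist (\<zeta> \<omega>, W \<omega>) z0" for \<omega>
  have fin: "(\<integral>\<^sup>+ \<omega>. ennreal (d \<omega> powr p) \<partial>M) < \<infinity>"
    using z0 by (simp add: nn_integral_law[OF m borel_measurable_dist_to] d_def)
  have dm: "(\<lambda>\<omega>. ennreal (d \<omega> powr p)) \<in> borel_measurable M"
    using measurable_compose[OF m borel_measurable_dist_to[of z0 p]] by (simp add: d_def)
  let ?e = "a + c * norm (snd z0)"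
  have "(\<integral>\<^sup>+ \<omega>. ennreal ((a + c * norm (W \<omega>)) powr p) \<partial>M) \<le>
    (\<integral>\<^sup>+ \<omega>. ennreal (2 powr p) * (ennreal (?e powr p) + ennreal (c powr p) * ennreal (d \<omega> powr p)) \<partial>M)"
  proof (rule nn_integral_mono)
    fix \<omega>
    have "norm (W \<omega>) \<le> norm (snd z0) + dist (W \<omega>) (snd z0)"
      using norm_triangle_sub[of "W \<omega>" "snd z0"] by (simp add: dist_norm)
    also have "dist (W \<omega>) (snd z0) \<le> d \<omega>" using dist_snd_le[of "(\<zeta> \<omega>, W \<omega>)" z0] by (simp add: d_def)
    finally have "c * norm (W \<omega>) \<le> c * (norm (snd z0) + d \<omega>)" using a by (intro mult_left_mono) auto
    then have "(a + c * norm (W \<omega>)) powr p \<le> (?e + c * d \<omega>) powr p"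
      using a p by (intro powr_mono2) (auto simp: algebra_simps)
    also have "\<dots> \<le> 2 powr p * (?e powr p + (c * d \<omega>) powr p)" using a p by (intro powr_add2_le) (auto simp: d_def)
    also have "(c * d \<omega>) powr p = c powr p * d \<omega> powr p" by (rule powr_mult)
    finally have "ennreal ((a + c * norm (W \<omega>)) powr p) \<le> ennreal (2 powr p * (?e powr p + c powr p * d \<omega> powr p))"
      by (rule ennreal_leI)
    then show "ennreal ((a + c * norm (W \<omega>)) powr p) \<le>
      ennreal (2 powr p) * (ennreal (?e powr p) + ennreal (c powr p) * ennreal (d \<omega> powr p))"
      by (simp add: ennreal_mult)
  qed
  also have "\<dots> = ennreal (2 powr p) * (ennreal (?e powr p) + ennreal (c powr p) * (\<integral>\<^sup>+ \<omega>. ennreal (d \<omega> powr p) \<partial>M))"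
    using dm by (simp add: nn_integral_cmult nn_integral_add emeasure_space_1)
  also have "\<dots> < \<infinity>" using fin by (simp add: ennreal_mult_less_top)
  finally show ?thesis .
qed

text \<open>The Lipschitz condition compares values of \<open>b\<close> at one time only and leaves
  its size in \<open>t\<close> open. \<open>b_integrable\<close> fixes one integrable section, from
  which integrability along every relevant flow follows.\<close>

locale mv_problem = solid_polyhedron D for D :: "'a::euclidean_space set" +
  fixes T p K :: real and b :: "'a mv_drift"
  assumes T: "0 < T" and p: "1 \<le> p" and D_bounded: "bounded D"
    and b_measurable: "(\<lambda>(t, x, \<mu>). b t x \<mu>) \<in>
      restrict_space borel {0..T} \<Otimes>\<^sub>M (restrict_space borel D \<Otimes>\<^sub>M wasserstein_borel p (D \<times> UNIV)) \<rightarrow>\<^sub>M borel"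
    and b_lipschitz: "\<And>t x x' \<mu> \<mu>'. \<lbrakk>t \<in> {0..T}; x \<in> D; x' \<in> D;
        \<mu> \<in> prob_moment p (D \<times> UNIV); \<mu>' \<in> prob_moment p (D \<times> UNIV)\<rbrakk> \<Longrightarrow>
      norm (b t x \<mu> - b t x' \<mu>') powr p \<le> K * (norm (x - x') powr p + wasserstein p \<mu> \<mu>' powr p)"
    and b_integrable: "\<exists>x\<in>D. \<exists>\<mu>\<in>prob_moment p (D \<times> UNIV). set_integrable lebesgue {0..T} (\<lambda>t. b t x \<mu>)"
begin

text \<open>Lipschitz constant of \<open>b\<close> in the sum of the two distances: a sum of two
  \<open>p\<close>-th powers is at most twice that of the sum, and then a \<open>p\<close>-th root
  is taken. Adding 1 makes it positive also for \<open>K = 0\<close>.\<close>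

definition L :: real where "L = (2 * \<bar>K\<bar>) powr (1 / p) + 1"
text \<open>With drivers at distance \<open>e\<close>, the pushes differ by at most
  \<open>lip * e\<close> and the positions by at most \<open>e\<close> more than that.\<close>

definition C1 :: real where "C1 = 1 + 2 * lip"
text \<open>Chosen so that \<open>C1 * L / lam = 1 / 32\<close>.\<close>

definition lam :: real where "lam = 32 * C1 * L"

lemma L_pos: "0 < L" unfolding L_def by (rule add_nonneg_pos) auto
lemma C1_pos: "0 < C1" using lip_pos by (simp add: C1_def)
lemma lam_pos: "0 < lam" using L_pos C1_pos by (simp add: lam_def)

lemma b_lip:
  assumes "t \<in> {0..T}" "x \<in> D" "x' \<in> D" "\<mu> \<in> prob_moment p (D \<times> UNIV)" "\<mu>' \<in> prob_moment p (D \<times> UNIV)"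
  shows "norm (b t x \<mu> - b t x' \<mu>') \<le> L * (norm (x - x') + wasserstein p \<mu> \<mu>')"
proof -
  let ?n = "norm (b t x \<mu> - b t x' \<mu>')" and ?a = "norm (x - x')" and ?w = "wasserstein p \<mu> \<mu>'"
  have w: "0 \<le> ?w" by (rule wasserstein_nonneg)
  have "?a powr p \<le> (?a + ?w) powr p" "?w powr p \<le> (?a + ?w) powr p" using w p by (auto intro!: powr_mono2)
  then have "?a powr p + ?w powr p \<le> 2 * (?a + ?w) powr p" by simp
  moreover have "?n powr p \<le> \<bar>K\<bar> * (?a powr p + ?w powr p)"
    by (intro order_trans[OF b_lipschitz[OF assms]] mult_right_mono) auto
  ultimately have "?n powr p \<le> \<bar>K\<bar> * (2 * (?a + ?w) powr p)" by (meson abs_ge_zero mult_left_mono order_trans)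
  then have "(?n powr p) powr (1 / p) \<le> ((2 * \<bar>K\<bar>) * (?a + ?w) powr p) powr (1 / p)"
    using p by (intro powr_mono2) (auto simp: algebra_simps)
  also have "\<dots> = (2 * \<bar>K\<bar>) powr (1 / p) * ((?a + ?w) powr p) powr (1 / p)" by (intro powr_mult)
  also have "((?a + ?w) powr p) powr (1 / p) = ?a + ?w" using p w by (simp add: powr_powr)
  also have "(?n powr p) powr (1 / p) = ?n" using p by (simp add: powr_powr)
  also have "(2 * \<bar>K\<bar>) powr (1 / p) * (?a + ?w) \<le> L * (?a + ?w)" using w by (intro mult_right_mono) (auto simp: L_def)
  finally show ?thesis .
qed

section \<open>Curves of marginal laws\<close>

abbreviation "dm \<equiv> diameter D"

lemma norm_diff_D: "x \<in> D \<Longrightarrow> y \<in> D \<Longrightarrow> norm (x - y) \<le> dm"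
  using diameter_bounded_bound[OF D_bounded] by (simp add: dist_norm)

lemma dm_nonneg: "0 \<le> dm"
  using diameter_ge_0[OF D_bounded] .

definition flow :: "'w measure \<Rightarrow> ('w \<Rightarrow> 'a cpath) \<Rightarrow> ('w \<Rightarrow> 'a cpath) \<Rightarrow> real \<Rightarrow> ('a \<times> 'a) measure" where
  "flow M X k s = law M (D \<times> UNIV) (\<lambda>\<omega>. (X \<omega> s, k \<omega> s))"

text \<open>The joint law on \<open>M\<close> is the coupling. Different times \<open>s\<close> and
  \<open>s'\<close> are allowed, so the same bound serves to compare two solutions and to prove
  continuity in time.\<close>

lemma flow_wasserstein_le:
  assumes X: "X \<in> M \<rightarrow>\<^sub>M restrict_space borel (cpaths T D)" "k \<in> M \<rightarrow>\<^sub>M restrict_space borel (cpaths T UNIV)"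
    "X' \<in> M \<rightarrow>\<^sub>M restrict_space borel (cpaths T D)" "k' \<in> M \<rightarrow>\<^sub>M restrict_space borel (cpaths T UNIV)"
    and le: "(\<integral>\<^sup>+ \<omega>. ennreal ((norm (X \<omega> s - X' \<omega> s') + norm (k \<omega> s - k' \<omega> s')) powr p) \<partial>M) \<le> ennreal (c powr p)" and c: "0 \<le> c"
  shows "wasserstein p (flow M X k s) (flow M X' k' s') \<le> c"
  unfolding flow_def
proof (rule wasserstein_law_le[OF _ _ borel_measurable_dist_restrict _ c p])
  show "(\<lambda>\<omega>. (X \<omega> s, k \<omega> s)) \<in> M \<rightarrow>\<^sub>M restrict_space borel (D \<times> UNIV)"
    "(\<lambda>\<omega>. (X' \<omega> s', k' \<omega> s')) \<in> M \<rightarrow>\<^sub>M restrict_space borel (D \<times> UNIV)"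
    by (rule measurable_state[OF less_imp_le[OF T]]; rule X)+
  have "(\<integral>\<^sup>+ \<omega>. ennreal (dist (X \<omega> s, k \<omega> s) (X' \<omega> s', k' \<omega> s') powr p) \<partial>M) \<le>
    (\<integral>\<^sup>+ \<omega>. ennreal ((norm (X \<omega> s - X' \<omega> s') + norm (k \<omega> s - k' \<omega> s')) powr p) \<partial>M)"
    using p dist_prod_le by (intro nn_integral_mono ennreal_leI powr_mono2) (auto simp flip: dist_norm)
  also note le
  finally show "(\<integral>\<^sup>+ \<omega>. ennreal (dist (X \<omega> s, k \<omega> s) (X' \<omega> s', k' \<omega> s') powr p) \<partial>M) \<le> ennreal (c powr p)" .
qed

lemma flow_wasserstein_le_AE:
  assumes M: "prob_space M"
    and X: "X \<in> M \<rightarrow>\<^sub>M restrict_space borel (cpaths T D)" "k \<in> M \<rightarrow>\<^sub>M restrict_space borel (cpaths T UNIV)"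
    "X' \<in> M \<rightarrow>\<^sub>M restrict_space borel (cpaths T D)" "k' \<in> M \<rightarrow>\<^sub>M restrict_space borel (cpaths T UNIV)"
    and le: "AE \<omega> in M. norm (X \<omega> s - X' \<omega> s') + norm (k \<omega> s - k' \<omega> s') \<le> c" and c: "0 \<le> c"
  shows "wasserstein p (flow M X k s) (flow M X' k' s') \<le> c"
proof (rule flow_wasserstein_le[OF X _ c])
  interpret prob_space M by fact
  have "(\<integral>\<^sup>+ \<omega>. ennreal ((norm (X \<omega> s - X' \<omega> s') + norm (k \<omega> s - k' \<omega> s')) powr p) \<partial>M) \<le> (\<integral>\<^sup>+ \<omega>. ennreal (c powr p) \<partial>M)"
    using le
  proof (intro nn_integral_mono_AE, eventually_elim)
    case (elim \<omega>)
    then show ?case using p by (intro ennreal_leI powr_mono2) auto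
  qed
  then show "(\<integral>\<^sup>+ \<omega>. ennreal ((norm (X \<omega> s - X' \<omega> s') + norm (k \<omega> s - k' \<omega> s')) powr p) \<partial>M) \<le> ennreal (c powr p)"
    by (simp add: emeasure_space_1)
qed

subsection \<open>Pathwise estimates\<close>

definition driver :: "'a \<Rightarrow> 'a cpath \<Rightarrow> (real \<Rightarrow> 'a) \<Rightarrow> real \<Rightarrow> 'a" where
  "driver z w \<beta> t = z + (LINT s:{0..t}|lebesgue. \<beta> s) + w t - w 0"

text \<open>The equation for a single sample with the drift frozen as a function of time, which
  makes it a deterministic Skorokhod problem for the path \<open>driver z w \<beta>\<close>.\<close>

definition path_solution :: "'a \<Rightarrow> 'a cpath \<Rightarrow> (real \<Rightarrow> 'a) \<Rightarrow> 'a cpath \<Rightarrow> 'a cpath \<Rightarrow> bool" where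
  "path_solution z w \<beta> x k \<longleftrightarrow> set_integrable lebesgue {0..T} \<beta> \<and> skorokhod T (driver z w \<beta>) k \<and>
     (\<forall>t\<in>{0..T}. x t = driver z w \<beta> t - k t)"

lemma continuous_driver:
  assumes "set_integrable lebesgue {0..T} \<beta>" shows "continuous_on {0..T} (driver z w \<beta>)"
proof -
  have int: "\<beta> integrable_on {0..T}" using set_lebesgue_integral_eq_integral(1)[OF assms] .
  have eq: "(LINT s:{0..t}|lebesgue. \<beta> s) = integral {0..t} \<beta>" if "t \<in> {0..T}" for t
    using that by (intro set_lebesgue_integral_eq_integral(2) set_integrable_subset[OF assms]) auto
  have "continuous_on {0..T} (\<lambda>t. LINT s:{0..t}|lebesgue. \<beta> s)"
    by (rule continuous_on_eq[OF indefinite_integral_continuous_1[OF int]]) (rule eq[symmetric])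
  then show ?thesis unfolding driver_def[abs_def] by (intro continuous_intros) auto
qed

lemma path_solution_diff:
  assumes s: "path_solution z w \<beta> x k" "path_solution z' w' \<beta>' x' k'" and t: "t \<in> {0..T}"
    and e: "\<And>s. s \<in> {0..t} \<Longrightarrow> norm (driver z w \<beta> s - driver z' w' \<beta>' s) \<le> e"
  shows "norm (x t - x' t) + norm (k t - k' t) \<le> C1 * e"
proof -
  have "norm (k t - k' t) \<le> lip * e"
    using s t e by (intro skorokhod_lipschitz[of T "driver z w \<beta>" _ "driver z' w' \<beta>'"])
      (auto simp: path_solution_def intro!: continuous_driver)
  moreover have "x t - x' t = (driver z w \<beta> t - driver z' w' \<beta>' t) - (k t - k' t)"
    using s t by (simp add: path_solution_def)
  then have "norm (x t - x' t) \<le> e + norm (k t - k' t)"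
    using norm_triangle_ineq4[of "driver z w \<beta> t - driver z' w' \<beta>' t" "k t - k' t"] e[of t] t by auto
  ultimately show ?thesis by (simp add: C1_def algebra_simps)
qed

lemma driver_diff:
  assumes \<beta>: "set_integrable lebesgue {0..T} \<beta>" "set_integrable lebesgue {0..T} \<beta>'" and s: "s \<in> {0..T}"
    and e: "norm ((LINT r:{0..s}|lebesgue. \<beta> r) - (LINT r:{0..s}|lebesgue. \<beta>' r)) \<le> e"
  shows "norm (driver z w \<beta> s - driver z' w' \<beta>' s) \<le> norm (z - z') + 2 * dist w w' + e"
proof -
  have w: "norm (w s - w' s) \<le> dist w w'" "norm (w 0 - w' 0) \<le> dist w w'"
    using dist_bounded[of w s w'] dist_bounded[of w 0 w'] by (simp_all add: dist_norm)
  have "driver z w \<beta> s - driver z' w' \<beta>' s = (z - z') + ((w s - w' s) - (w 0 - w' 0)) +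
      ((LINT r:{0..s}|lebesgue. \<beta> r) - (LINT r:{0..s}|lebesgue. \<beta>' r))"
    by (simp add: driver_def)
  also have "norm \<dots> \<le> norm (z - z') + norm ((w s - w' s) - (w 0 - w' 0)) +
      norm ((LINT r:{0..s}|lebesgue. \<beta> r) - (LINT r:{0..s}|lebesgue. \<beta>' r))"
    by (meson add_right_mono norm_triangle_ineq order_trans)
  also have "norm ((w s - w' s) - (w 0 - w' 0)) \<le> 2 * dist w w'"
    using norm_triangle_ineq4[of "w s - w' s" "w 0 - w' 0"] w by linarith
  finally show ?thesis using e by linarith
qed

lemma integral_diff_exp:
  fixes \<beta> \<beta>' :: "real \<Rightarrow> 'a"
  assumes \<beta>: "set_integrable lebesgue {0..T} \<beta>" "set_integrable lebesgue {0..T} \<beta>'" and s: "s \<in> {0..T}"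
    and c: "0 \<le> c" "\<And>r. r \<in> {0..T} \<Longrightarrow> norm (\<beta> r - \<beta>' r) \<le> c * exp (lam * r)"
  shows "norm ((LINT r:{0..s}|lebesgue. \<beta> r) - (LINT r:{0..s}|lebesgue. \<beta>' r)) \<le> c * exp (lam * s) / lam"
proof -
  have i: "set_integrable lebesgue {0..s} \<beta>" "set_integrable lebesgue {0..s} \<beta>'"
    using s by (auto intro!: set_integrable_subset[OF \<beta>(1)] set_integrable_subset[OF \<beta>(2)])
  then have d: "set_integrable lebesgue {0..s} (\<lambda>r. \<beta> r - \<beta>' r)" by (rule set_integral_diff(1))
  have "norm ((LINT r:{0..s}|lebesgue. \<beta> r) - (LINT r:{0..s}|lebesgue. \<beta>' r)) = norm (LINT r:{0..s}|lebesgue. \<beta> r - \<beta>' r)"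
    using set_integral_diff(2)[OF i] by simp
  also have "\<dots> \<le> (LINT r:{0..s}|lebesgue. norm (\<beta> r - \<beta>' r))" using d by (rule set_integral_norm_bound)
  also have "\<dots> \<le> (LINT r:{0..s}|lebesgue. c * exp (lam * r))"
    using s c by (intro set_integral_mono set_integrable_exp set_integrable_norm[OF d]) auto
  also have "\<dots> \<le> c * exp (lam * s) / lam" using s c lam_pos by (intro set_integrable_exp(2)) auto
  finally show ?thesis .
qed

text \<open>Integrating the weight gains \<open>1 / lam\<close>, the drift costs \<open>L\<close>
  and the Skorokhod map \<open>C1\<close>; their product is 1/32. The factor 2 at
  \<open>dist w w'\<close> stems from subtracting the initial value of \<open>w\<close>.\<close>

lemma path_solution_estimate:
  assumes s: "path_solution z w \<beta> x k" "path_solution z' w' \<beta>' x' k'" and t: "t \<in> {0..T}"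
    and m: "0 \<le> m" "\<And>r. r \<in> {0..T} \<Longrightarrow> norm (\<beta> r - \<beta>' r) \<le> L * (m * exp (lam * r))"
  shows "norm (x t - x' t) + norm (k t - k' t) \<le> C1 * (norm (z - z') + 2 * dist w w') + m / 32 * exp (lam * t)"
proof -
  have \<beta>: "set_integrable lebesgue {0..T} \<beta>" "set_integrable lebesgue {0..T} \<beta>'" using s by (auto simp: path_solution_def)
  have "norm (driver z w \<beta> r - driver z' w' \<beta>' r) \<le> norm (z - z') + 2 * dist w w' + (L * m) * exp (lam * t) / lam"
    if r: "r \<in> {0..t}" for r
  proof (rule driver_diff[OF \<beta>])
    show rT: "r \<in> {0..T}" using r t by auto
    have "norm ((LINT r:{0..r}|lebesgue. \<beta> r) - (LINT r:{0..r}|lebesgue. \<beta>' r)) \<le> (L * m) * exp (lam * r) / lam"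
      using m L_pos by (intro integral_diff_exp[OF \<beta> rT]) (auto simp: mult.assoc)
    also have "\<dots> \<le> (L * m) * exp (lam * t) / lam"
      using r lam_pos m L_pos by (intro divide_right_mono mult_left_mono) auto
    finally show "norm ((LINT r:{0..r}|lebesgue. \<beta> r) - (LINT r:{0..r}|lebesgue. \<beta>' r)) \<le> (L * m) * exp (lam * t) / lam" .
  qed
  from path_solution_diff[OF s t this]
  have "norm (x t - x' t) + norm (k t - k' t) \<le> C1 * (norm (z - z') + 2 * dist w w' + (L * m) * exp (lam * t) / lam)" .
  also have "\<dots> = C1 * (norm (z - z') + 2 * dist w w') + C1 * ((L * m) * exp (lam * t) / lam)"
    by (rule distrib_left)
  also have "C1 * ((L * m) * exp (lam * t) / lam) = m / 32 * exp (lam * t)"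
    using C1_pos L_pos by (simp add: lam_def)
  finally show ?thesis .
qed

text \<open>
  Where the difference weighted by \<open>exp (- lam t)\<close> is largest, the drift contributes at most
  \<open>1/32\<close> of that maximum, which is absorbed.
\<close>

lemma path_solution_gronwall:
  assumes s: "path_solution z w \<beta> x k" "path_solution z' w' \<beta>' x' k'"
    and \<beta>: "\<And>r. r \<in> {0..T} \<Longrightarrow> norm (\<beta> r - \<beta>' r) \<le> L * (norm (x r - x' r) + v r)"
    and n: "0 \<le> n" "\<And>r. r \<in> {0..T} \<Longrightarrow> v r \<le> n * exp (lam * r)" and t: "t \<in> {0..T}"
  shows "norm (x t - x' t) + norm (k t - k' t) \<le> (2 * C1 * (norm (z - z') + 2 * dist w w') + n / 16) * exp (lam * t)"
proof -
  define \<delta> where "\<delta> r = norm (x r - x' r) + norm (k r - k' r)" for r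
  have "continuous_on {0..T} (\<lambda>r. exp (- (lam * r)) * \<delta> r)" unfolding \<delta>_def by (intro continuous_intros) auto
  then obtain r0 where r0: "r0 \<in> {0..T}" "\<And>r. r \<in> {0..T} \<Longrightarrow> exp (- (lam * r)) * \<delta> r \<le> exp (- (lam * r0)) * \<delta> r0"
    using continuous_attains_sup[of "{0..T}" "\<lambda>r. exp (- (lam * r)) * \<delta> r"] T by auto
  define m where "m = exp (- (lam * r0)) * \<delta> r0"
  have m0: "0 \<le> m" by (simp add: m_def \<delta>_def)
  have \<delta>m: "\<delta> r \<le> m * exp (lam * r)" if "r \<in> {0..T}" for r
  proof -
    have "exp (lam * r) * (exp (- (lam * r)) * \<delta> r) \<le> exp (lam * r) * m" using r0(2)[OF that] by (simp add: m_def)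
    then show ?thesis by (simp add: mult.assoc[symmetric] mult.commute[of m] flip: exp_add)
  qed
  have \<beta>m: "norm (\<beta> r - \<beta>' r) \<le> L * ((m + n) * exp (lam * r))" if r: "r \<in> {0..T}" for r
  proof -
    have "norm (x r - x' r) + v r \<le> (m + n) * exp (lam * r)"
      using \<delta>m[OF r] n(2)[OF r] by (simp add: \<delta>_def algebra_simps) (smt (verit) norm_ge_zero)
    then show ?thesis using \<beta>[OF r] L_pos by (meson mult_left_mono less_imp_le order_trans)
  qed
  let ?in = "C1 * (norm (z - z') + 2 * dist w w')"
  have in0: "0 \<le> ?in" using C1_pos by simp
  have "\<delta> r0 \<le> ?in + (m + n) / 32 * exp (lam * r0)"
    unfolding \<delta>_def using m0 n(1) by (intro path_solution_estimate[OF s r0(1) _ \<beta>m]) auto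
  then have "m \<le> exp (- (lam * r0)) * (?in + (m + n) / 32 * exp (lam * r0))" by (simp add: m_def)
  also have "\<dots> = exp (- (lam * r0)) * ?in + (m + n) / 32" by (simp add: distrib_left exp_minus)
  also have "\<dots> \<le> 1 * ?in + (m + n) / 32" using in0 r0(1) lam_pos by (intro add_right_mono mult_right_mono) auto
  \<comment> \<open>The term \<open>m / 32\<close> is absorbed on the left: 32/31 is at most 2 and
    1/31 at most 1/16.\<close>
  finally have "m \<le> 2 * ?in + n / 16" using in0 n(1) by (simp add: field_simps)
  then have "m * exp (lam * t) \<le> (2 * ?in + n / 16) * exp (lam * t)" by (intro mult_right_mono) auto
  from order_trans[OF \<delta>m[OF t] this] show ?thesis by (simp add: \<delta>_def mult.assoc)
qed

subsection \<open>Moments of solutions\<close>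

definition drift :: "'w measure \<Rightarrow> ('w \<Rightarrow> 'a cpath) \<Rightarrow> ('w \<Rightarrow> 'a cpath) \<Rightarrow> 'w \<Rightarrow> real \<Rightarrow> 'a" where
  "drift M X k \<omega> s = b s (X \<omega> s) (flow M X k s)"

lemma solution_measurable:
  assumes "mv_solution p T D b M \<zeta> W X k"
  shows "X \<in> M \<rightarrow>\<^sub>M restrict_space borel (cpaths T D)" "k \<in> M \<rightarrow>\<^sub>M restrict_space borel (cpaths T UNIV)"
    "\<And>\<omega>. \<omega> \<in> space M \<Longrightarrow> X \<omega> \<in> cpaths T D" "\<And>\<omega>. \<omega> \<in> space M \<Longrightarrow> k \<omega> \<in> cpaths T UNIV"
proof -
  show 1: "X \<in> M \<rightarrow>\<^sub>M restrict_space borel (cpaths T D)" "k \<in> M \<rightarrow>\<^sub>M restrict_space borel (cpaths T UNIV)"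
    using assms by (auto simp: mv_solution_def)
  show "X \<omega> \<in> cpaths T D" "k \<omega> \<in> cpaths T UNIV" if "\<omega> \<in> space M" for \<omega>
    using measurable_space[OF 1(1) that] measurable_space[OF 1(2) that] by (simp_all add: space_restrict_space)
qed

lemma solution_path:
  assumes sol: "mv_solution p T D b M \<zeta> W X k"
  shows "AE \<omega> in M. path_solution (\<zeta> \<omega>) (W \<omega>) (drift M X k \<omega>) (X \<omega>) (k \<omega>)"
proof -
  have "AE \<omega> in M. bounded_variation_on (k \<omega>) 0 T \<and> k \<omega> 0 = 0 \<and> set_integrable lebesgue {0..T} (drift M X k \<omega>) \<and>
        (\<forall>t\<in>{0..T}. X \<omega> t = \<zeta> \<omega> + (LINT s:{0..t}|lebesgue. drift M X k \<omega> s) + W \<omega> t - W \<omega> 0 - k \<omega> t) \<and>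
        variation_measure T (k \<omega>) = density (variation_measure T (k \<omega>)) (\<lambda>t. indicator (frontier D) (X \<omega> t)) \<and>
        reflects_along_normals T D (X \<omega>) (k \<omega>)"
    using sol unfolding mv_solution_def flow_def drift_def[abs_def] by blast
  then show ?thesis
    using AE_space
  proof eventually_elim
    case (elim \<omega>)
    then have x: "X \<omega> t = driver (\<zeta> \<omega>) (W \<omega>) (drift M X k \<omega>) t - k \<omega> t" if "t \<in> {0..T}" for t
      using that by (simp add: driver_def)
    have "skorokhod T (driver (\<zeta> \<omega>) (W \<omega>) (drift M X k \<omega>)) (k \<omega>)"
    proof (rule skorokhod_of_reflects[where x = "X \<omega>", OF _ _ _ x])
      show "X \<omega> t \<in> D" if "t \<in> {0..T}" for t
        using cpathsD(1)[OF solution_measurable(3)[OF sol elim(2)] that] .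
    qed (use elim in auto)
    then show ?case using elim x by (simp add: path_solution_def)
  qed
qed

lemma flow_prob_moment:
  assumes inp: "mv_input p T D M \<zeta> W" and X: "X \<in> M \<rightarrow>\<^sub>M restrict_space borel (cpaths T D)"
      "k \<in> M \<rightarrow>\<^sub>M restrict_space borel (cpaths T UNIV)"
    and A: "0 \<le> A" "AE \<omega> in M. norm (k \<omega>) \<le> A + 2 * norm (W \<omega>)"
  shows "flow M X k s \<in> prob_moment p (D \<times> UNIV)"
proof -
  obtain x0 where x0: "x0 \<in> D" using D_ne by blast
  show ?thesis
    unfolding flow_def
  proof (rule law_prob_moment[where ?x0.0 = "(x0, 0)"])
    show "prob_space M" by (rule mv_inputD(1)[OF inp])
    show "(\<lambda>\<omega>. (X \<omega> s, k \<omega> s)) \<in> M \<rightarrow>\<^sub>M restrict_space borel (D \<times> UNIV)" by (rule measurable_state[OF less_imp_le[OF T] X])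
    have "(\<integral>\<^sup>+ \<omega>. ennreal (dist (X \<omega> s, k \<omega> s) (x0, 0) powr p) \<partial>M) \<le>
      (\<integral>\<^sup>+ \<omega>. ennreal (((dm + A) + 2 * norm (W \<omega>)) powr p) \<partial>M)"
    proof (rule nn_integral_mono_AE)
      show "AE \<omega> in M. ennreal (dist (X \<omega> s, k \<omega> s) (x0, 0) powr p) \<le> ennreal (((dm + A) + 2 * norm (W \<omega>)) powr p)"
        using A(2) AE_space[of M]
      proof eventually_elim
      case (elim \<omega>)
      have "X \<omega> \<in> cpaths T D" using measurable_space[OF X(1) elim(2)] by (simp add: space_restrict_space)
      then have "X \<omega> s \<in> D" using T by (intro cpaths_mem_all) auto
      then have "dist (X \<omega> s) x0 \<le> dm" using x0 norm_diff_D by (simp add: dist_norm)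
      moreover have "norm (k \<omega> s) \<le> norm (k \<omega>)" by (rule norm_bounded)
      ultimately show ?case
        using dist_prod_le[of "X \<omega> s" "k \<omega> s" x0 0] elim(1) p by (intro ennreal_leI powr_mono2) auto
      qed
    qed
    also have "\<dots> < \<infinity>" using A dm_nonneg by (intro mv_input_moment[OF inp p]) auto
    finally show "(\<integral>\<^sup>+ \<omega>. ennreal (dist (X \<omega> s, k \<omega> s) (x0, 0) powr p) \<partial>M) < \<infinity>" .
  qed (use x0 in auto)
qed

text \<open>Solving the equation for \<open>k\<close> leaves the displacement of the path, bounded
  by the diameter of \<open>D\<close>, the integrated drift, and an increment of
  \<open>w\<close>.\<close>

lemma path_solution_norm_le:
  assumes s: "path_solution z w \<beta> x k" and z: "z \<in> D" and k: "k \<in> cpaths T UNIV" and x: "x \<in> cpaths T D"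
    and A: "\<And>t. t \<in> {0..T} \<Longrightarrow> norm (LINT r:{0..t}|lebesgue. \<beta> r) \<le> A"
  shows "norm k \<le> dm + A + 2 * norm w"
proof -
  have "dist k 0 \<le> dm + A + 2 * norm w"
  proof (rule dist_cpaths_le[OF k _ less_imp_le[OF T]])
    show "0 \<in> cpaths T (UNIV :: 'a set)" by (simp add: cpaths_def)
    fix t assume t: "t \<in> {0..T}"
    have "k t = (z - x t) + (LINT r:{0..t}|lebesgue. \<beta> r) + (w t - w 0)"
      using s t by (simp add: path_solution_def driver_def)
    also have "norm \<dots> \<le> norm (z - x t) + norm (LINT r:{0..t}|lebesgue. \<beta> r) + norm (w t - w 0)"
      by (meson add_right_mono norm_triangle_ineq order_trans)
    also have "norm (z - x t) \<le> dm" using cpathsD(1)[OF x t] z by (intro norm_diff_D)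
    also have "norm (w t - w 0) \<le> 2 * norm w"
      using norm_triangle_ineq4[of "w t" "w 0"] norm_bounded[of w t] norm_bounded[of w 0] by linarith
    finally show "dist (k t) ((0 :: 'a cpath) t) \<le> dm + A + 2 * norm w" using A[OF t] by simp
  qed
  then show ?thesis by simp
qed

text \<open>The integrated drift is bounded by a deterministic constant: at almost every time the
  drifts of two samples see the same law and positions at distance at most \<open>dm\<close>, so
  they differ by at most \<open>L * dm\<close>, and for one sample the drift is integrable. This
  turns moments at almost every time into moments at all times and on path space.\<close>

lemma solution_bound:
  assumes inp: "mv_input p T D M \<zeta> W" and sol: "mv_solution p T D b M \<zeta> W X k"
  obtains A where "0 \<le> A" "AE \<omega> in M. norm (k \<omega>) \<le> A + 2 * norm (W \<omega>)"
proof -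
  interpret prob_space M by (rule mv_inputD(1)[OF inp])
  note X = solution_measurable[OF sol]
  have "AE \<omega> in M. path_solution (\<zeta> \<omega>) (W \<omega>) (drift M X k \<omega>) (X \<omega>) (k \<omega>) \<and> \<omega> \<in> space M"
    using solution_path[OF sol] AE_space by eventually_elim auto
  then obtain \<omega>0 where \<omega>0: "path_solution (\<zeta> \<omega>0) (W \<omega>0) (drift M X k \<omega>0) (X \<omega>0) (k \<omega>0)" "\<omega>0 \<in> space M"
    using eventually_happens'[OF ae_filter_bot] by blast
  define A where "A = (LINT s:{0..T}|lebesgue. norm (drift M X k \<omega>0 s) + L * dm)"
  have i0: "set_integrable lebesgue {0..T} (drift M X k \<omega>0)" using \<omega>0 by (simp add: path_solution_def)
  have i1: "set_integrable lebesgue {0..T} (\<lambda>s. norm (drift M X k \<omega>0 s) + L * dm)"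
    using set_integrable_norm[OF i0] set_integrable_exp(1)[of T "L * dm" 0] by (intro set_integral_add(1)) auto
  have mom: "AE s in lebesgue. s \<in> {0..T} \<longrightarrow> flow M X k s \<in> prob_moment p (D \<times> UNIV)"
    using sol by (simp add: mv_solution_def flow_def)
  have "AE \<omega> in M. norm (k \<omega>) \<le> (dm + A) + 2 * norm (W \<omega>)"
    using solution_path[OF sol] AE_space
  proof eventually_elim
    case (elim \<omega>)
    have i: "set_integrable lebesgue {0..T} (drift M X k \<omega>)" using elim(1) by (simp add: path_solution_def)
    have le: "AE s in lebesgue. s \<in> {0..T} \<longrightarrow> norm (drift M X k \<omega> s) \<le> norm (drift M X k \<omega>0 s) + L * dm"
    proof (rule AE_mp[OF mom AE_I2], intro impI)
      fix s assume mom_s: "s \<in> {0..T} \<longrightarrow> flow M X k s \<in> prob_moment p (D \<times> UNIV)"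
      { assume s: "s \<in> {0..T}"
        have D: "X \<omega> s \<in> D" "X \<omega>0 s \<in> D" using X(3) cpathsD(1) s \<open>\<omega> \<in> space M\<close> \<omega>0(2) by blast+
        \<comment> \<open>The diagonal coupling has cost zero, which removes the law term from the
          Lipschitz bound.\<close>
        have "wasserstein p (flow M X k s) (flow M X k s) \<le> 0"
          by (rule flow_wasserstein_le_AE[OF prob_space_axioms X(1,2,1,2)]) auto
        then have w0: "wasserstein p (flow M X k s) (flow M X k s) = 0" using wasserstein_nonneg antisym by blast
        have "norm (drift M X k \<omega> s - drift M X k \<omega>0 s) \<le> L * (norm (X \<omega> s - X \<omega>0 s) + 0)"
          using b_lip[OF s D] mom_s s unfolding drift_def w0[symmetric] by blast
        also have "\<dots> \<le> L * dm" using norm_diff_D[OF D] L_pos by (intro mult_left_mono) auto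
        finally have "norm (drift M X k \<omega> s) \<le> norm (drift M X k \<omega>0 s) + L * dm"
          using norm_triangle_sub[of "drift M X k \<omega> s" "drift M X k \<omega>0 s"] by linarith }
      moreover assume "s \<in> {0..T}"
      ultimately show "norm (drift M X k \<omega> s) \<le> norm (drift M X k \<omega>0 s) + L * dm" by blast
    qed
    show ?case
    proof (rule path_solution_norm_le[OF elim(1)])
      show "\<zeta> \<omega> \<in> D" "k \<omega> \<in> cpaths T UNIV" "X \<omega> \<in> cpaths T D" using mv_inputD(2)[OF inp] X elim(2) by auto
      fix t assume t: "t \<in> {0..T}"
      have it: "set_integrable lebesgue {0..t} (drift M X k \<omega>)" using t by (intro set_integrable_subset[OF i]) auto
      then have "norm (LINT r:{0..t}|lebesgue. drift M X k \<omega> r) \<le> (LINT r:{0..t}|lebesgue. norm (drift M X k \<omega> r))"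
        by (rule set_integral_norm_bound)
      also have "\<dots> \<le> (LINT r:{0..T}|lebesgue. norm (drift M X k \<omega> r))"
        unfolding set_lebesgue_integral_def
        using set_integrable_norm[OF it] set_integrable_norm[OF i] t
        by (intro integral_mono) (auto simp: set_integrable_def indicator_def)
      also have "\<dots> \<le> A"
        unfolding A_def using le by (intro set_integral_mono_AE set_integrable_norm[OF i] i1) auto
      finally show "norm (LINT r:{0..t}|lebesgue. drift M X k \<omega> r) \<le> A" .
    qed
  qed
  moreover have "0 \<le> A" unfolding A_def set_lebesgue_integral_def
    using L_pos dm_nonneg by (intro integral_nonneg_AE) auto
  ultimately show ?thesis using that[of "dm + A"] dm_nonneg by simp
qed

lemma solution_law_prob_moment:
  assumes inp: "mv_input p T D M \<zeta> W" and sol: "mv_solution p T D b M \<zeta> W X k"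
  shows "law M (cpaths T D \<times> cpaths T UNIV) (\<lambda>\<omega>. (X \<omega>, k \<omega>)) \<in> prob_moment p (cpaths T D \<times> cpaths T UNIV)"
proof -
  obtain A where A: "0 \<le> A" "AE \<omega> in M. norm (k \<omega>) \<le> A + 2 * norm (W \<omega>)" by (rule solution_bound[OF inp sol])
  note X = solution_measurable[OF sol]
  obtain x0 where x0: "x0 \<in> D" using D_ne by blast
  have x0': "const_bcontfun x0 \<in> cpaths T D" using x0 by (simp add: cpaths_def)
  show ?thesis
  proof (rule law_prob_moment[where ?x0.0 = "(const_bcontfun x0, 0)"])
    show "prob_space M" by (rule mv_inputD(1)[OF inp])
    show "(\<lambda>\<omega>. (X \<omega>, k \<omega>)) \<in> M \<rightarrow>\<^sub>M restrict_space borel (cpaths T D \<times> cpaths T UNIV)" using T X by (intro measurable_paths) auto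
    have "(\<integral>\<^sup>+ \<omega>. ennreal (dist (X \<omega>, k \<omega>) (const_bcontfun x0, 0) powr p) \<partial>M) \<le>
      (\<integral>\<^sup>+ \<omega>. ennreal (((dm + A) + 2 * norm (W \<omega>)) powr p) \<partial>M)"
    proof (rule nn_integral_mono_AE)
      show "AE \<omega> in M. ennreal (dist (X \<omega>, k \<omega>) (const_bcontfun x0, 0) powr p) \<le> ennreal (((dm + A) + 2 * norm (W \<omega>)) powr p)"
        using A(2) AE_space[of M]
      proof eventually_elim
      case (elim \<omega>)
      have "dist (X \<omega>) (const_bcontfun x0) \<le> dm"
        using T norm_diff_D x0 cpathsD(1)[OF X(3)[OF elim(2)]]
        by (intro dist_cpaths_le[OF X(3)[OF elim(2)] x0']) (auto simp: dist_norm)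
      then show ?case
        using dist_prod_le[of "X \<omega>" "k \<omega>" "const_bcontfun x0" 0] elim(1) p by (intro ennreal_leI powr_mono2) auto
      qed
    qed
    also have "\<dots> < \<infinity>" using A dm_nonneg by (intro mv_input_moment[OF inp p]) auto
    finally show "(\<integral>\<^sup>+ \<omega>. ennreal (dist (X \<omega>, k \<omega>) (const_bcontfun x0, 0) powr p) \<partial>M) < \<infinity>" .
  qed (use x0' in \<open>auto simp: cpaths_def\<close>)
qed

end

section \<open>The Wasserstein metric\<close>

text \<open>The function \<open>f\<close> is arbitrary: simple functions below it are measurable and
  transform with equality, and the supremum over them leaves an inequality in this direction. It is
  applied to distances that need not be measurable on a product of path spaces.\<close>

lemma nn_integral_distr_le:
  assumes T: "T \<in> M \<rightarrow>\<^sub>M N"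
  shows "(\<integral>\<^sup>+ x. f x \<partial>distr M N T) \<le> (\<integral>\<^sup>+ x. f (T x) \<partial>M)"
  unfolding nn_integral_def[of "distr M N T"]
proof (rule SUP_least)
  fix g assume "g \<in> {g. simple_function (distr M N T) g \<and> g \<le> f}"
  then have g: "simple_function (distr M N T) g" "\<And>x. g x \<le> f x" by (auto simp: le_fun_def)
  then have "integral\<^sup>S (distr M N T) g = (\<integral>\<^sup>+ x. g x \<partial>distr M N T)"
    by (intro nn_integral_eq_simple_integral[symmetric])
  also have "\<dots> = (\<integral>\<^sup>+ x. g (T x) \<partial>M)"
    using borel_measurable_simple_function[OF g(1)] by (intro nn_integral_distr[OF T]) simp
  also have "\<dots> \<le> (\<integral>\<^sup>+ x. f (T x) \<partial>M)" using g by (intro nn_integral_mono) auto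
  finally show "integral\<^sup>S (distr M N T) g \<le> (\<integral>\<^sup>+ x. f (T x) \<partial>M)" .
qed

lemma couplings_swap:
  assumes \<pi>: "\<pi> \<in> couplings \<mu> \<nu>"
  shows "distr \<pi> (\<nu> \<Otimes>\<^sub>M \<mu>) (\<lambda>z. (snd z, fst z)) \<in> couplings \<nu> \<mu>"
proof -
  have m: "(\<lambda>z. (snd z, fst z)) \<in> \<pi> \<rightarrow>\<^sub>M \<nu> \<Otimes>\<^sub>M \<mu>"
    by (rule measurable_Pair[OF measurable_couplings(2)[OF \<pi>] measurable_couplings(1)[OF \<pi>]])
  have "distr (distr \<pi> (\<nu> \<Otimes>\<^sub>M \<mu>) (\<lambda>z. (snd z, fst z))) \<nu> fst = distr \<pi> \<nu> snd"
    using m by (subst distr_distr) (auto simp: o_def)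
  moreover have "distr (distr \<pi> (\<nu> \<Otimes>\<^sub>M \<mu>) (\<lambda>z. (snd z, fst z))) \<mu> snd = distr \<pi> \<mu> fst"
    using m by (subst distr_distr) (auto simp: o_def)
  ultimately show ?thesis using \<pi> by (simp add: couplings_def)
qed

lemma wasserstein_commute: "wasserstein p \<mu> \<nu> = wasserstein p \<nu> (\<mu> :: 'e::metric_space measure)"
proof -
  have le: "(INF \<pi>\<in>couplings \<nu> \<mu>. \<integral>\<^sup>+ (x, y). ennreal (dist x y powr p) \<partial>\<pi>) \<le>
      (INF \<pi>\<in>couplings \<mu> \<nu>. \<integral>\<^sup>+ (x, y). ennreal (dist x y powr p) \<partial>\<pi>)" for \<mu> \<nu> :: "'e measure"
  proof (rule INF_greatest)
    fix \<pi> assume \<pi>: "\<pi> \<in> couplings \<mu> \<nu>"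
    let ?\<pi>' = "distr \<pi> (\<nu> \<Otimes>\<^sub>M \<mu>) (\<lambda>z. (snd z, fst z))"
    have "(INF \<pi>\<in>couplings \<nu> \<mu>. \<integral>\<^sup>+ (x, y). ennreal (dist x y powr p) \<partial>\<pi>) \<le> (\<integral>\<^sup>+ (x, y). ennreal (dist x y powr p) \<partial>?\<pi>')"
      by (rule INF_lower[OF couplings_swap[OF \<pi>]])
    also have "\<dots> \<le> (\<integral>\<^sup>+ z. (case (snd z, fst z) of (x, y) \<Rightarrow> ennreal (dist x y powr p)) \<partial>\<pi>)"
      by (rule nn_integral_distr_le)
        (rule measurable_Pair[OF measurable_couplings(2)[OF \<pi>] measurable_couplings(1)[OF \<pi>]])
    also have "\<dots> = (\<integral>\<^sup>+ (x, y). ennreal (dist x y powr p) \<partial>\<pi>)"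
      by (intro nn_integral_cong) (auto simp: dist_commute)
    finally show "(INF \<pi>\<in>couplings \<nu> \<mu>. \<integral>\<^sup>+ (x, y). ennreal (dist x y powr p) \<partial>\<pi>) \<le> (\<integral>\<^sup>+ (x, y). ennreal (dist x y powr p) \<partial>\<pi>)" .
  qed
  show ?thesis unfolding wasserstein_def using le[of \<mu> \<nu>] le[of \<nu> \<mu>] by (simp add: antisym)
qed

lemma wasserstein_finite:
  assumes \<mu>: "\<mu> \<in> prob_moment p E" "\<nu> \<in> prob_moment p E" and p: "1 \<le> p"
  shows "(INF \<pi>\<in>couplings \<mu> \<nu>. \<integral>\<^sup>+ (x, y). ennreal (dist x y powr p) \<partial>\<pi>) < (\<infinity> :: ennreal)"
proof -
  have pr: "prob_space \<mu>" "prob_space \<nu>" using \<mu> by (auto simp: prob_moment_def)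
  have "(INF \<pi>\<in>couplings \<mu> \<nu>. \<integral>\<^sup>+ (x, y). ennreal (dist x y powr p) \<partial>\<pi>)
    \<le> (\<integral>\<^sup>+ (x, y). ennreal (dist x y powr p) \<partial>(\<mu> \<Otimes>\<^sub>M \<nu>))"
    by (rule INF_lower[OF pair_measure_coupling[OF pr]])
  also have "\<dots> < \<infinity>" using p by (intro coupling_cost_finite[OF pair_measure_coupling[OF pr] \<mu>]) auto
  finally show ?thesis .
qed

lemma wasserstein_approx:
  assumes \<mu>: "\<mu> \<in> prob_moment p E" "\<nu> \<in> prob_moment p E" and p: "1 \<le> p" and \<epsilon>: "0 < \<epsilon>"
  obtains \<pi> where "\<pi> \<in> couplings \<mu> \<nu>"
    "(\<integral>\<^sup>+ (x, y). ennreal (dist x y powr p) \<partial>\<pi>) \<le> ennreal ((wasserstein p \<mu> \<nu> + \<epsilon>) powr p)"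
proof -
  let ?I = "INF \<pi>\<in>couplings \<mu> \<nu>. \<integral>\<^sup>+ (x, y). ennreal (dist x y powr p) \<partial>\<pi>"
  have "?I = ennreal (wasserstein p \<mu> \<nu> powr p)"
    unfolding wasserstein_def using enn2real_powr_root[OF wasserstein_finite[OF \<mu> p] p] by simp
  also have "\<dots> < ennreal ((wasserstein p \<mu> \<nu> + \<epsilon>) powr p)"
    using wasserstein_nonneg[of p \<mu> \<nu>] p \<epsilon> by (intro ennreal_lessI powr_less_mono2) auto
  finally obtain \<pi> where "\<pi> \<in> couplings \<mu> \<nu>"
    "(\<integral>\<^sup>+ (x, y). ennreal (dist x y powr p) \<partial>\<pi>) < ennreal ((wasserstein p \<mu> \<nu> + \<epsilon>) powr p)"
    by (auto simp: INF_less_iff)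
  then show ?thesis using that by auto
qed

subsection \<open>Separation of points\<close>

text \<open>For \<open>t\<close> above \<open>\<epsilon>\<close>, the factor
  \<open>t powr (1 - p)\<close> is at most its value at \<open>\<epsilon>\<close>. It bounds a
  linear cost by the \<open>p\<close>-th power cost up to an arbitrarily small constant.\<close>

lemma linear_le_powr:
  fixes t :: real
  assumes "0 \<le> t" "0 < \<epsilon>" "1 \<le> p" shows "t \<le> \<epsilon> + \<epsilon> powr (1 - p) * t powr p"
proof (cases "t \<le> \<epsilon>")
  case True
  moreover have "0 \<le> \<epsilon> powr (1 - p) * t powr p" by simp
  ultimately show ?thesis by linarith
next
  case False
  then have "t = t powr (1 - p) * t powr p" using assms by (simp flip: powr_add)
  also have "\<dots> \<le> \<epsilon> powr (1 - p) * t powr p" using False assms by (intro mult_right_mono powr_mono2') auto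
  finally show ?thesis using assms by linarith
qed

lemma nn_integral_lipschitz_le_coupling:
  fixes f :: "'e::metric_space \<Rightarrow> real"
  assumes \<pi>: "\<pi> \<in> couplings \<mu> \<nu>" and s: "sets \<mu> = sets (restrict_space borel E)" "sets \<nu> = sets (restrict_space borel E)"
    and pr: "prob_space \<mu>" and f: "f \<in> borel_measurable borel" "\<And>x. 0 \<le> f x" and lip: "\<And>x y. f x \<le> f y + n * dist x y" "0 \<le> n"
    and p: "1 \<le> p" and \<epsilon>: "0 < \<epsilon>"
    and d: "(\<lambda>(x, y). dist x y) \<in> borel_measurable (restrict_space borel E \<Otimes>\<^sub>M restrict_space borel E)"
  shows "(\<integral>\<^sup>+ x. ennreal (f x) \<partial>\<mu>) \<le> (\<integral>\<^sup>+ y. ennreal (f y) \<partial>\<nu>) + ennreal (n * \<epsilon>)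
    + ennreal (n * \<epsilon> powr (1 - p)) * (\<integral>\<^sup>+ (x, y). ennreal (dist x y powr p) \<partial>\<pi>)"
proof -
  interpret \<pi>: prob_space \<pi> by (rule prob_space_couplings[OF \<pi> pr])
  have "sets \<pi> = sets (\<mu> \<Otimes>\<^sub>M \<nu>)" using \<pi> by (simp add: couplings_def)
  also have "\<dots> = sets (restrict_space borel E \<Otimes>\<^sub>M restrict_space borel E)" using s by (intro sets_pair_measure_cong)
  finally have "(\<lambda>(x, y). dist x y) \<in> borel_measurable \<pi>" using d measurable_cong_sets by blast
  then have "(\<lambda>z. dist (fst z) (snd z)) \<in> borel_measurable \<pi>" unfolding case_prod_beta .
  then have "(\<lambda>z. ennreal (dist (fst z) (snd z) powr p)) \<in> borel_measurable \<pi>" by measurable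
  then have dm: "(\<lambda>(x, y). ennreal (dist x y powr p)) \<in> borel_measurable \<pi>" unfolding case_prod_beta .
  have fr: "f \<in> borel_measurable (restrict_space borel E)" using f(1) by (rule measurable_restrict_space1)
  then have fm: "f \<in> borel_measurable \<mu>" "f \<in> borel_measurable \<nu>" using s measurable_cong_sets by blast+
  then have fm': "(\<lambda>x. ennreal (f x)) \<in> borel_measurable \<mu>" "(\<lambda>x. ennreal (f x)) \<in> borel_measurable \<nu>" by measurable
  have fs: "(\<lambda>z. ennreal (f (snd z))) \<in> borel_measurable \<pi>"
    using measurable_compose[OF measurable_couplings(2)[OF \<pi>] fm'(2)] .
  have "(\<integral>\<^sup>+ x. ennreal (f x) \<partial>\<mu>) = (\<integral>\<^sup>+ z. ennreal (f (fst z)) \<partial>\<pi>)" by (rule nn_integral_couplings(1)[OF \<pi> fm'(1), symmetric])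
  also have "\<dots> \<le> (\<integral>\<^sup>+ z. ennreal (f (snd z)) + ennreal (n * \<epsilon>)
    + ennreal (n * \<epsilon> powr (1 - p)) * (case z of (x, y) \<Rightarrow> ennreal (dist x y powr p)) \<partial>\<pi>)"
  proof (rule nn_integral_mono)
    fix z :: "'e \<times> 'e"
    obtain x y where z: "z = (x, y)" by (cases z)
    have "n * dist x y \<le> n * (\<epsilon> + \<epsilon> powr (1 - p) * dist x y powr p)"
      using lip(2) linear_le_powr[OF _ \<epsilon> p, of "dist x y"] by (intro mult_left_mono) auto
    then have "f x \<le> f y + n * \<epsilon> + n * \<epsilon> powr (1 - p) * dist x y powr p"
      using lip(1)[of x y] by (simp add: algebra_simps)
    then have "ennreal (f x) \<le> ennreal (f y + n * \<epsilon> + n * \<epsilon> powr (1 - p) * dist x y powr p)" by (rule ennreal_leI)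
    then show "ennreal (f (fst z)) \<le> ennreal (f (snd z)) + ennreal (n * \<epsilon>)
      + ennreal (n * \<epsilon> powr (1 - p)) * (case z of (x, y) \<Rightarrow> ennreal (dist x y powr p))"
      using f(2) lip(2) \<epsilon> by (simp add: z ennreal_mult)
  qed
  also have "\<dots> = (\<integral>\<^sup>+ z. ennreal (f (snd z)) \<partial>\<pi>) + ennreal (n * \<epsilon>)
    + ennreal (n * \<epsilon> powr (1 - p)) * (\<integral>\<^sup>+ (x, y). ennreal (dist x y powr p) \<partial>\<pi>)"
    using fs dm by (simp add: nn_integral_add nn_integral_cmult \<pi>.emeasure_space_1)
  also have "(\<integral>\<^sup>+ z. ennreal (f (snd z)) \<partial>\<pi>) = (\<integral>\<^sup>+ y. ennreal (f y) \<partial>\<nu>)" by (rule nn_integral_couplings(2)[OF \<pi> fm'(2)])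
  finally show ?thesis .
qed

text \<open>Distance zero provides couplings of arbitrarily small cost, and attainment of the
  infimum is avoided. The truncation level \<open>\<epsilon>\<close> is fixed first; its possibly
  large factor \<open>c\<close> is then compensated by the accuracy \<open>\<eta>\<close> of the
  coupling.\<close>

lemma nn_integral_lipschitz_le:
  fixes f :: "'e::{metric_space, second_countable_topology} \<Rightarrow> real"
  assumes \<mu>: "\<mu> \<in> prob_moment p E" "\<nu> \<in> prob_moment p E" and W: "wasserstein p \<mu> \<nu> = 0" and p: "1 \<le> p"
    and f: "f \<in> borel_measurable borel" "\<And>x. 0 \<le> f x" and lip: "\<And>x y. f x \<le> f y + n * dist x y" "0 \<le> n"
  shows "(\<integral>\<^sup>+ x. ennreal (f x) \<partial>\<mu>) \<le> (\<integral>\<^sup>+ y. ennreal (f y) \<partial>\<nu>)"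
proof (rule ennreal_le_epsilon)
  fix e :: real assume e: "0 < e"
  define \<epsilon> where "\<epsilon> = e / (2 * (n + 1))"
  have \<epsilon>: "0 < \<epsilon>" using e lip(2) by (simp add: \<epsilon>_def)
  have "n * \<epsilon> \<le> (n + 1) * \<epsilon>" using \<epsilon> by (intro mult_right_mono) auto
  moreover have "(n + 1) * \<epsilon> = e / 2" using lip(2) by (simp add: \<epsilon>_def divide_simps)
  ultimately have n\<epsilon>: "n * \<epsilon> \<le> e / 2" by simp
  define c where "c = n * \<epsilon> powr (1 - p)"
  have c: "0 \<le> c" using lip(2) by (simp add: c_def)
  define \<eta> where "\<eta> = (e / (2 * (c + 1))) powr (1 / p)"
  have \<eta>: "0 < \<eta>" using e c by (simp add: \<eta>_def)
  have \<eta>p: "\<eta> powr p = e / (2 * (c + 1))" using p e c by (simp add: \<eta>_def powr_powr)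
  obtain \<pi> where \<pi>: "\<pi> \<in> couplings \<mu> \<nu>" "(\<integral>\<^sup>+ (x, y). ennreal (dist x y powr p) \<partial>\<pi>) \<le> ennreal ((wasserstein p \<mu> \<nu> + \<eta>) powr p)"
    using wasserstein_approx[OF \<mu> p \<eta>] by blast
  have "(\<integral>\<^sup>+ x. ennreal (f x) \<partial>\<mu>) \<le> (\<integral>\<^sup>+ y. ennreal (f y) \<partial>\<nu>) + ennreal (n * \<epsilon>)
    + ennreal c * (\<integral>\<^sup>+ (x, y). ennreal (dist x y powr p) \<partial>\<pi>)"
    unfolding c_def using \<mu>
    by (intro nn_integral_lipschitz_le_coupling[OF \<pi>(1), of E] f lip p \<epsilon> borel_measurable_dist_restrict) (auto simp: prob_moment_def)
  also have "\<dots> \<le> (\<integral>\<^sup>+ y. ennreal (f y) \<partial>\<nu>) + ennreal (e / 2) + ennreal c * ennreal (e / (2 * (c + 1)))"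
    using \<pi>(2) n\<epsilon> by (intro add_mono mult_left_mono order_refl ennreal_leI) (auto simp: W \<eta>p)
  also have "\<dots> \<le> (\<integral>\<^sup>+ y. ennreal (f y) \<partial>\<nu>) + ennreal (e / 2) + ennreal (e / 2)"
  proof (intro add_left_mono)
    have "c * (e / (2 * (c + 1))) \<le> e / 2" using c e by (simp add: divide_simps)
    then show "ennreal c * ennreal (e / (2 * (c + 1))) \<le> ennreal (e / 2)"
      using c e by (simp add: ennreal_leI flip: ennreal_mult)
  qed
  also have "\<dots> = (\<integral>\<^sup>+ y. ennreal (f y) \<partial>\<nu>) + ennreal e"
    using e by (simp add: add.assoc flip: ennreal_plus)
  finally show "(\<integral>\<^sup>+ x. ennreal (f x) \<partial>\<mu>) \<le> (\<integral>\<^sup>+ y. ennreal (f y) \<partial>\<nu>) + ennreal e" .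
qed

text \<open>The indicator of a closed set is the limit of the Lipschitz functions
  \<open>max 0 (1 - n * infdist x F)\<close>, which dominate it; dominated convergence is used under
  \<open>\<nu>\<close> only.\<close>

lemma wasserstein_eq_0_imp_closed_le:
  fixes F :: "'e::{metric_space, second_countable_topology} set"
  assumes \<mu>: "\<mu> \<in> prob_moment p E" "\<nu> \<in> prob_moment p E" and W: "wasserstein p \<mu> \<nu> = 0" and p: "1 \<le> p"
    and F: "closed F" "F \<noteq> {}"
  shows "emeasure \<mu> (E \<inter> F) \<le> emeasure \<nu> (E \<inter> F)"
proof -
  have s: "sets \<mu> = sets (restrict_space borel E)" "sets \<nu> = sets (restrict_space borel E)" and pr: "prob_space \<nu>"
    using \<mu> by (auto simp: prob_moment_def)
  interpret \<nu>: prob_space \<nu> by fact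
  have sp: "space \<mu> = E" "space \<nu> = E" using s[THEN sets_eq_imp_space_eq] by (simp_all add: space_restrict_space)
  have EF: "E \<inter> F \<in> sets \<mu>" "E \<inter> F \<in> sets \<nu>" using F s by (auto simp: sets_restrict_space)
  define f where "f n x = max 0 (1 - real n * infdist x F)" for n x
  have fm: "f n \<in> borel_measurable borel" for n unfolding f_def[abs_def]
    by (intro borel_measurable_continuous_onI continuous_intros)
  have "f n \<in> borel_measurable (restrict_space borel E)" for n using fm by (rule measurable_restrict_space1)
  then have fm': "f n \<in> borel_measurable \<nu>" for n using s measurable_cong_sets by blast
  have lip: "f n x \<le> f n y + real n * dist x y" for n x y
  proof -
    have "real n * infdist y F \<le> real n * (infdist x F + dist x y)"
      using infdist_triangle[of y F x] by (intro mult_left_mono) (auto simp: dist_commute)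
    then show ?thesis by (auto simp: f_def algebra_simps max_def)
  qed
  have le: "emeasure \<mu> (E \<inter> F) \<le> (\<integral>\<^sup>+ x. ennreal (f n x) \<partial>\<nu>)" for n
  proof -
    have "emeasure \<mu> (E \<inter> F) = (\<integral>\<^sup>+ x. indicator (E \<inter> F) x \<partial>\<mu>)" using EF by simp
    also have "\<dots> \<le> (\<integral>\<^sup>+ x. ennreal (f n x) \<partial>\<mu>)"
      by (intro nn_integral_mono) (auto simp: f_def indicator_def)
    also have "\<dots> \<le> (\<integral>\<^sup>+ x. ennreal (f n x) \<partial>\<nu>)"
      using lip by (intro nn_integral_lipschitz_le[OF \<mu> W p fm]) (auto simp: f_def)
    finally show ?thesis .
  qed
  have "(\<lambda>n. \<integral>\<^sup>+ x. ennreal (f n x) \<partial>\<nu>) \<longlonglongrightarrow> (\<integral>\<^sup>+ x. indicator (E \<inter> F) x \<partial>\<nu>)"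
  proof (rule nn_integral_dominated_convergence[where w = "\<lambda>_. 1"])
    show "AE x in \<nu>. (\<lambda>n. ennreal (f n x)) \<longlonglongrightarrow> indicator (E \<inter> F) x"
    proof (rule AE_I2)
      fix x assume x: "x \<in> space \<nu>"
      show "(\<lambda>n. ennreal (f n x)) \<longlonglongrightarrow> indicator (E \<inter> F) x"
      proof (cases "x \<in> F")
        case True
        then show ?thesis using x sp by (simp add: f_def)
      next
        case False
        then have pos: "0 < infdist x F" using F in_closed_iff_infdist_zero[OF F, of x] infdist_nonneg[of x F] by auto
        obtain N :: nat where N: "1 / infdist x F < N" using reals_Archimedean2 by blast
        have "f n x = 0" if "n \<ge> N" for n
        proof -
          have "1 / infdist x F < real n" using N that by linarith
          then have "1 < real n * infdist x F" using pos by (simp add: pos_divide_less_eq)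
          then show ?thesis by (simp add: f_def)
        qed
        then have "\<forall>\<^sub>F n in sequentially. ennreal (f n x) = 0" unfolding eventually_sequentially by (intro exI[of _ N]) simp
        then show ?thesis using False by (simp add: tendsto_eventually)
      qed
    qed
    show "AE x in \<nu>. ennreal (f n x) \<le> 1" for n
      by (intro AE_I2) (simp add: f_def infdist_nonneg)
    show "(\<integral>\<^sup>+ x. 1 \<partial>\<nu>) < \<infinity>" by (simp add: \<nu>.emeasure_space_1)
  qed (use fm' EF in auto)
  moreover have "(\<integral>\<^sup>+ x. indicator (E \<inter> F) x \<partial>\<nu>) = emeasure \<nu> (E \<inter> F)" using EF by simp
  ultimately show ?thesis using le by (intro LIMSEQ_le_const) auto
qed

text \<open>Closed sets are stable under intersection and generate the Borel sets; both measures are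
  first pushed to the whole space, where this generator is available.\<close>

lemma prob_moment_eqI_closed:
  assumes \<mu>: "\<mu> \<in> prob_moment p E" "\<nu> \<in> prob_moment p E"
    and eq: "\<And>F. closed F \<Longrightarrow> F \<noteq> {} \<Longrightarrow> emeasure \<mu> (E \<inter> F) = emeasure \<nu> (E \<inter> F)"
  shows "\<mu> = \<nu>"
proof -
  have s: "sets \<mu> = sets (restrict_space borel E)" "sets \<nu> = sets (restrict_space borel E)"
    and pr: "prob_space \<mu>" "prob_space \<nu>"
    using \<mu> by (auto simp: prob_moment_def)
  interpret \<mu>: prob_space \<mu> by fact
  have sp: "space \<mu> = E" "space \<nu> = E" using s[THEN sets_eq_imp_space_eq] by (simp_all add: space_restrict_space)
  have "(\<lambda>x. x) \<in> restrict_space borel E \<rightarrow>\<^sub>M (borel :: 'a measure)" by (rule measurable_restrict_space1) simp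
  then have id: "(\<lambda>x. x) \<in> \<mu> \<rightarrow>\<^sub>M borel" "(\<lambda>x. x) \<in> \<nu> \<rightarrow>\<^sub>M borel"
    using measurable_cong_sets[OF s(1) refl] measurable_cong_sets[OF s(2) refl] by blast+
  have em: "emeasure (distr \<mu> borel (\<lambda>x. x)) B = emeasure \<mu> (E \<inter> B)" "emeasure (distr \<nu> borel (\<lambda>x. x)) B = emeasure \<nu> (E \<inter> B)"
    if "B \<in> sets borel" for B
    using that id sp by (simp_all add: emeasure_distr Int_commute)
  have "distr \<mu> borel (\<lambda>x. x) = distr \<nu> borel (\<lambda>x. x)"
  proof (rule measure_eqI_generator_eq[where E = "Collect closed" and \<Omega> = UNIV and A = "\<lambda>_. UNIV"])
    show "emeasure (distr \<mu> borel (\<lambda>x. x)) X = emeasure (distr \<nu> borel (\<lambda>x. x)) X" if "X \<in> Collect closed" for X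
      using that em[of X] eq[of X] by (cases "X = {}") auto
    show "sets (distr \<mu> borel (\<lambda>x. x)) = sigma_sets UNIV (Collect closed)" "sets (distr \<nu> borel (\<lambda>x. x)) = sigma_sets UNIV (Collect closed)"
      by (simp_all add: borel_eq_closed)
    show "emeasure (distr \<mu> borel (\<lambda>x. x)) UNIV \<noteq> \<infinity>" using em[of UNIV] by simp
  qed (auto simp: Int_stable_def)
  then have eqB: "emeasure \<mu> (E \<inter> B) = emeasure \<nu> (E \<inter> B)" if "B \<in> sets borel" for B using em[OF that] by simp
  show ?thesis
  proof (rule measure_eqI)
    fix A assume "A \<in> sets \<mu>"
    then obtain B where "B \<in> sets borel" "A = E \<inter> B" using s by (auto simp: sets_restrict_space)
    then show "emeasure \<mu> A = emeasure \<nu> A" using eqB by simp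
  qed (simp add: s)
qed

subsection \<open>The triangle inequality\<close>

text \<open>Extends convexity from positive arguments to the boundary point 0, where it reduces to
  \<open>c powr p \<le> c\<close> for \<open>c\<close> in \<open>[0,1]\<close>.\<close>

lemma powr_convex_nonneg:
  fixes x y t :: real
  assumes "0 \<le> x" "0 \<le> y" "0 \<le> t" "t \<le> 1" "1 \<le> p"
  shows "((1 - t) * x + t * y) powr p \<le> (1 - t) * x powr p + t * y powr p"
proof -
  have shrink: "(c * z) powr p \<le> c * z powr p" if "0 \<le> c" "c \<le> 1" for c z :: real
  proof -
    have "c powr p \<le> c powr 1" using powr_mono'[OF assms(5) that] .
    then show ?thesis using that by (simp add: powr_mult mult_right_mono)
  qed
  consider "x = 0" | "y = 0" | "0 < x" "0 < y" using assms by force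
  then show ?thesis
  proof cases
    case 1
    then show ?thesis using shrink[of t y] assms by simp
  next
    case 2
    then show ?thesis using shrink[of "1 - t" x] assms by simp
  next
    case 3
    then show ?thesis using convex_onD[OF powr_convex[OF assms(5)], of t x y] assms by simp
  qed
qed

text \<open>With \<open>t = b / (a + b)\<close>, the sum \<open>u + v\<close> is
  \<open>a + b\<close> times a convex combination of \<open>u / a\<close> and \<open>v / b\<close>,
  so convexity of the power suffices. The numbers \<open>a\<close> and \<open>b\<close> are positive
  bounds for the norms, which avoids division by zero.\<close>

lemma nn_integral_Minkowski:
  fixes u v :: "'w \<Rightarrow> real"
  assumes u: "u \<in> borel_measurable M" "\<And>x. x \<in> space M \<Longrightarrow> 0 \<le> u x" and v: "v \<in> borel_measurable M" "\<And>x. x \<in> space M \<Longrightarrow> 0 \<le> v x"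
    and a: "0 < a" "(\<integral>\<^sup>+ x. ennreal (u x powr p) \<partial>M) \<le> ennreal (a powr p)"
    and b: "0 < b" "(\<integral>\<^sup>+ x. ennreal (v x powr p) \<partial>M) \<le> ennreal (b powr p)" and p: "1 \<le> p"
  shows "(\<integral>\<^sup>+ x. ennreal ((u x + v x) powr p) \<partial>M) \<le> ennreal ((a + b) powr p)"
proof -
  define t where "t = b / (a + b)"
  have t: "0 \<le> t" "t \<le> 1" "1 - t = a / (a + b)" using a b by (auto simp: t_def field_simps)
  define \<alpha> \<beta> where "\<alpha> = (a + b) powr p * (1 - t) / a powr p" and "\<beta> = (a + b) powr p * t / b powr p"
  have \<alpha>: "0 \<le> \<alpha>" "0 \<le> \<beta>" unfolding \<alpha>_def \<beta>_def using t(1,2)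
    by (auto intro!: divide_nonneg_nonneg mult_nonneg_nonneg)
  have sum: "\<alpha> * a powr p + \<beta> * b powr p = (a + b) powr p"
  proof -
    have "\<alpha> * a powr p = (a + b) powr p * (1 - t)" using a by (simp add: \<alpha>_def)
    moreover have "\<beta> * b powr p = (a + b) powr p * t" using b by (simp add: \<beta>_def)
    ultimately show ?thesis by (simp add: algebra_simps)
  qed
  have "(\<integral>\<^sup>+ x. ennreal ((u x + v x) powr p) \<partial>M) \<le> (\<integral>\<^sup>+ x. ennreal \<alpha> * ennreal (u x powr p) + ennreal \<beta> * ennreal (v x powr p) \<partial>M)"
  proof (rule nn_integral_mono)
    fix x assume x: "x \<in> space M"
    note nn = u(2)[OF x] v(2)[OF x]
    have "(1 - t) * (u x / a) = u x / (a + b)" "t * (v x / b) = v x / (a + b)"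
      using a b unfolding t(3) by (simp_all add: t_def)
    then have e: "u x + v x = (a + b) * ((1 - t) * (u x / a) + t * (v x / b))"
      using a b by (simp flip: add_divide_distrib)
    have "(u x + v x) powr p = (a + b) powr p * ((1 - t) * (u x / a) + t * (v x / b)) powr p"
      unfolding e by (rule powr_mult)
    also have "\<dots> \<le> (a + b) powr p * ((1 - t) * (u x / a) powr p + t * (v x / b) powr p)"
      using nn a b t p by (intro mult_left_mono powr_convex_nonneg) auto
    also have "\<dots> = \<alpha> * u x powr p + \<beta> * v x powr p"
      using nn a b by (simp add: \<alpha>_def \<beta>_def powr_divide algebra_simps)
    finally have "ennreal ((u x + v x) powr p) \<le> ennreal (\<alpha> * u x powr p + \<beta> * v x powr p)" by (rule ennreal_leI)
    then show "ennreal ((u x + v x) powr p) \<le> ennreal \<alpha> * ennreal (u x powr p) + ennreal \<beta> * ennreal (v x powr p)"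
      using \<alpha> by (simp add: ennreal_mult)
  qed
  also have "\<dots> = ennreal \<alpha> * (\<integral>\<^sup>+ x. ennreal (u x powr p) \<partial>M) + ennreal \<beta> * (\<integral>\<^sup>+ x. ennreal (v x powr p) \<partial>M)"
    using u(1) v(1) by (simp add: nn_integral_add nn_integral_cmult)
  also have "\<dots> \<le> ennreal \<alpha> * ennreal (a powr p) + ennreal \<beta> * ennreal (b powr p)"
    using a b by (intro add_mono mult_left_mono) auto
  also have "\<dots> = ennreal ((a + b) powr p)" using \<alpha> by (simp add: sum[symmetric] ennreal_mult)
  finally show ?thesis .
qed

text \<open>Each point is labelled by the first member of a dense sequence within
  \<open>\<epsilon> / 2\<close>; points with the same label are
  \<open>\<epsilon>\<close>-close.\<close>

lemma small_cells:
  fixes \<epsilon> :: real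
  assumes "0 < \<epsilon>"
  obtains c :: "'e::{metric_space, second_countable_topology} \<Rightarrow> nat"
  where "c \<in> borel \<rightarrow>\<^sub>M count_space UNIV" "\<And>x y. c x = c y \<Longrightarrow> dist x y \<le> \<epsilon>"
proof -
  obtain Q :: "'e set" where Q: "countable Q" "UNIV \<subseteq> closure Q" using separable[of "UNIV :: 'e set"] by metis
  then have Qne: "Q \<noteq> {}" by auto
  define q where "q = from_nat_into Q"
  have ex: "\<exists>i. dist x (q i) < \<epsilon> / 2" for x
  proof -
    have "x \<in> closure Q" using Q by blast
    then obtain y where "y \<in> Q" "dist y x < \<epsilon> / 2" using assms unfolding closure_approachable by (meson half_gt_zero)
    then show ?thesis using range_from_nat_into[OF Qne Q(1)] unfolding q_def by (metis dist_commute rangeE)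
  qed
  define c where "c x = (LEAST i. dist x (q i) < \<epsilon> / 2)" for x
  have c: "dist x (q (c x)) < \<epsilon> / 2" for x unfolding c_def by (rule LeastI_ex[OF ex])
  have "c \<in> borel \<rightarrow>\<^sub>M count_space UNIV" unfolding c_def[abs_def] by measurable
  moreover have "dist x y \<le> \<epsilon>" if "c x = c y" for x y
    using c[of x] c[of y] that dist_triangle2[of x y "q (c x)"] by simp
  ultimately show ?thesis using that by blast
qed

text \<open>
  Two couplings sharing a marginal are glued over a partition into small cells: conditionally on
  the cell of the shared coordinate, the two pairs are taken independent.
\<close>

lemma glued_coupling:
  fixes \<mu>1 \<mu>2 \<mu>3 :: "'e::{metric_space, second_countable_topology} measure"
  assumes s: "sets \<mu>1 = sets (restrict_space borel E)" "sets \<mu>2 = sets (restrict_space borel E)" "sets \<mu>3 = sets (restrict_space borel E)"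
    and pr: "prob_space \<mu>1" "prob_space \<mu>2" "prob_space \<mu>3"
    and \<pi>: "\<pi>12 \<in> couplings \<mu>1 \<mu>2" "\<pi>23 \<in> couplings \<mu>2 \<mu>3" and \<epsilon>: "0 < \<epsilon>" and p: "1 \<le> p"
    and a: "0 < a" "(\<integral>\<^sup>+ (x, y). ennreal (dist x y powr p) \<partial>\<pi>12) \<le> ennreal (a powr p)"
    and b: "0 < b" "(\<integral>\<^sup>+ (x, y). ennreal (dist x y powr p) \<partial>\<pi>23) \<le> ennreal (b powr p)"
  shows "\<exists>\<pi>\<in>couplings \<mu>1 \<mu>3. (\<integral>\<^sup>+ (x, y). ennreal (dist x y powr p) \<partial>\<pi>) \<le> ennreal ((a + b + \<epsilon>) powr p)"
proof -
  interpret \<mu>2: prob_space \<mu>2 by fact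
  interpret \<pi>12: prob_space \<pi>12 by (rule prob_space_couplings[OF \<pi>(1) pr(1)])
  interpret \<pi>23: prob_space \<pi>23 by (rule prob_space_couplings[OF \<pi>(2) pr(2)])
  interpret P: pair_sigma_finite \<pi>12 \<pi>23 ..
  note m12 = measurable_couplings[OF \<pi>(1)] and m23 = measurable_couplings[OF \<pi>(2)]
  obtain c :: "'e \<Rightarrow> nat" where c: "c \<in> borel \<rightarrow>\<^sub>M count_space UNIV" "\<And>x y. c x = c y \<Longrightarrow> dist x y \<le> \<epsilon>"
    using small_cells[OF \<epsilon>] by metis
  have "c \<in> restrict_space borel E \<rightarrow>\<^sub>M count_space UNIV" using c(1) by (rule measurable_restrict_space1)
  then have c2: "c \<in> \<mu>2 \<rightarrow>\<^sub>M count_space UNIV" using s(2) measurable_cong_sets by blast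
  have c12: "(\<lambda>z. c (snd z)) \<in> \<pi>12 \<rightarrow>\<^sub>M count_space UNIV" using measurable_compose[OF m12(2) c2] .
  have c23: "(\<lambda>z. c (fst z)) \<in> \<pi>23 \<rightarrow>\<^sub>M count_space UNIV" using measurable_compose[OF m23(1) c2] .
  define m where "m i = measure \<mu>2 (c -` {i} \<inter> space \<mu>2)" for i
  have cell: "c -` {i} \<inter> space \<mu>2 \<in> sets \<mu>2" for i using c2 by (rule measurable_sets) simp
  have em12: "emeasure \<pi>12 {z \<in> space \<pi>12. c (snd z) = i} = ennreal (m i)" for i
  proof -
    have "emeasure (distr \<pi>12 \<mu>2 snd) (c -` {i} \<inter> space \<mu>2) = emeasure \<pi>12 (snd -` (c -` {i} \<inter> space \<mu>2) \<inter> space \<pi>12)"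
      by (rule emeasure_distr[OF m12(2) cell])
    also have "snd -` (c -` {i} \<inter> space \<mu>2) \<inter> space \<pi>12 = {z \<in> space \<pi>12. c (snd z) = i}"
      using measurable_space[OF m12(2)] by auto
    finally show ?thesis using \<pi>(1) by (simp add: couplings_def m_def \<mu>2.emeasure_eq_measure)
  qed
  have em23: "emeasure \<pi>23 {z \<in> space \<pi>23. c (fst z) = i} = ennreal (m i)" for i
  proof -
    have "emeasure (distr \<pi>23 \<mu>2 fst) (c -` {i} \<inter> space \<mu>2) = emeasure \<pi>23 (fst -` (c -` {i} \<inter> space \<mu>2) \<inter> space \<pi>23)"
      by (rule emeasure_distr[OF m23(1) cell])
    also have "fst -` (c -` {i} \<inter> space \<mu>2) \<inter> space \<pi>23 = {z \<in> space \<pi>23. c (fst z) = i}"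
      using measurable_space[OF m23(1)] by auto
    finally show ?thesis using \<pi>(2) by (simp add: couplings_def m_def \<mu>2.emeasure_eq_measure)
  qed
  \<comment> \<open>Cells of mass zero are null for both couplings, so the division in the density
    \<open>g\<close> matters only outside a null set.\<close>
  have pos: "AE z in M. 0 < m (f z)"
    if "\<And>i. emeasure M {z \<in> space M. f z = i} = ennreal (m i)" "f \<in> M \<rightarrow>\<^sub>M count_space UNIV"
    for M :: "('e \<times> 'e) measure" and f :: "'e \<times> 'e \<Rightarrow> nat"
  proof -
    have "AE z in M. m i = 0 \<longrightarrow> f z \<noteq> i" for i
    proof (cases "m i = 0")
      case True
      have "{z \<in> space M. f z = i} = f -` {i} \<inter> space M" by auto
      then have "{z \<in> space M. f z = i} \<in> sets M" using measurable_sets[OF that(2), of "{i}"] by simp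
      then have "{z \<in> space M. f z = i} \<in> null_sets M" using that(1)[of i] True by (simp add: null_sets_def)
      then show ?thesis by (rule AE_I') auto
    qed simp
    then have "AE z in M. \<forall>i. m i = 0 \<longrightarrow> f z \<noteq> i" unfolding AE_all_countable by (rule allI)
    then show ?thesis
    proof eventually_elim
      case (elim z)
      then have "m (f z) \<noteq> 0" by blast
      moreover have "0 \<le> m (f z)" by (simp add: m_def)
      ultimately show ?case by simp
    qed
  qed
  \<comment> \<open>Density with respect to the independent product: it keeps only pairs whose
    middle coordinates fall in the same cell and normalises by the mass of that cell, which restores
    both couplings as marginals.\<close>
  define g where "g w = (if c (snd (fst w)) = c (fst (snd w)) then ennreal (1 / m (c (snd (fst w)))) else 0)" for w :: "('e \<times> 'e) \<times> ('e \<times> 'e)"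
  have cc: "(\<lambda>w. c (snd (fst w))) \<in> \<pi>12 \<Otimes>\<^sub>M \<pi>23 \<rightarrow>\<^sub>M count_space UNIV" "(\<lambda>w. c (fst (snd w))) \<in> \<pi>12 \<Otimes>\<^sub>M \<pi>23 \<rightarrow>\<^sub>M count_space UNIV"
    using measurable_compose[OF measurable_fst c12] measurable_compose[OF measurable_snd c23] .
  have gm: "g \<in> borel_measurable (\<pi>12 \<Otimes>\<^sub>M \<pi>23)"
  proof -
    have "(\<lambda>(i, j). if i = j then ennreal (1 / m i) else 0) \<in> borel_measurable (count_space UNIV \<Otimes>\<^sub>M count_space UNIV)"
      by (simp add: pair_measure_countable)
    from measurable_compose[OF measurable_Pair[OF cc] this] show ?thesis by (simp add: g_def[abs_def])
  qed
  have int1: "(\<integral>\<^sup>+ z'. g (z, z') \<partial>\<pi>23) = 1" if "0 < m (c (snd z))" for z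
  proof -
    have "(\<integral>\<^sup>+ z'. g (z, z') \<partial>\<pi>23) = (\<integral>\<^sup>+ z'. ennreal (1 / m (c (snd z))) * indicator {z' \<in> space \<pi>23. c (fst z') = c (snd z)} z' \<partial>\<pi>23)"
      by (intro nn_integral_cong) (auto simp: g_def indicator_def)
    also have "\<dots> = ennreal (1 / m (c (snd z))) * emeasure \<pi>23 {z' \<in> space \<pi>23. c (fst z') = c (snd z)}"
    proof (rule nn_integral_cmult_indicator)
      have "{z' \<in> space \<pi>23. c (fst z') = c (snd z)} = (\<lambda>z. c (fst z)) -` {c (snd z)} \<inter> space \<pi>23" by auto
      then show "{z' \<in> space \<pi>23. c (fst z') = c (snd z)} \<in> sets \<pi>23" using measurable_sets[OF c23, of "{c (snd z)}"] by simp
    qed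
    also have "\<dots> = 1" using that by (simp add: em23 flip: ennreal_mult)
    finally show ?thesis .
  qed
  have int2: "(\<integral>\<^sup>+ z. g (z, z') \<partial>\<pi>12) = 1" if "0 < m (c (fst z'))" for z'
  proof -
    have "(\<integral>\<^sup>+ z. g (z, z') \<partial>\<pi>12) = (\<integral>\<^sup>+ z. ennreal (1 / m (c (fst z'))) * indicator {z \<in> space \<pi>12. c (snd z) = c (fst z')} z \<partial>\<pi>12)"
      by (intro nn_integral_cong) (auto simp: g_def indicator_def)
    also have "\<dots> = ennreal (1 / m (c (fst z'))) * emeasure \<pi>12 {z \<in> space \<pi>12. c (snd z) = c (fst z')}"
    proof (rule nn_integral_cmult_indicator)
      have "{z \<in> space \<pi>12. c (snd z) = c (fst z')} = (\<lambda>z. c (snd z)) -` {c (fst z')} \<inter> space \<pi>12" by auto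
      then show "{z \<in> space \<pi>12. c (snd z) = c (fst z')} \<in> sets \<pi>12" using measurable_sets[OF c12, of "{c (fst z')}"] by simp
    qed
    also have "\<dots> = 1" using that by (simp add: em12 flip: ennreal_mult)
    finally show ?thesis .
  qed
  define Q where "Q = density (\<pi>12 \<Otimes>\<^sub>M \<pi>23) g"
  have setsQ: "sets Q = sets (\<pi>12 \<Otimes>\<^sub>M \<pi>23)" by (simp add: Q_def)
  have spQ: "space Q = space \<pi>12 \<times> space \<pi>23" by (simp add: Q_def space_pair_measure)
  have fQ: "fst \<in> Q \<rightarrow>\<^sub>M \<pi>12" "snd \<in> Q \<rightarrow>\<^sub>M \<pi>23" by (simp_all add: Q_def)
  have Q1: "distr Q \<pi>12 fst = \<pi>12"
  proof (rule measure_eqI)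
    fix A assume "A \<in> sets (distr Q \<pi>12 fst)"
    then have A: "A \<in> sets \<pi>12" by simp
    have sA: "fst -` A \<inter> space Q \<in> sets (\<pi>12 \<Otimes>\<^sub>M \<pi>23)" using measurable_sets[OF fQ(1) A] setsQ by simp
    have "emeasure (distr Q \<pi>12 fst) A = emeasure Q (fst -` A \<inter> space Q)" by (rule emeasure_distr[OF fQ(1) A])
    also have "\<dots> = (\<integral>\<^sup>+ w. g w * indicator (fst -` A \<inter> space Q) w \<partial>(\<pi>12 \<Otimes>\<^sub>M \<pi>23))"
      unfolding Q_def by (rule emeasure_density[OF gm sA[unfolded Q_def]])
    also have "\<dots> = (\<integral>\<^sup>+ w. g w * indicator A (fst w) \<partial>(\<pi>12 \<Otimes>\<^sub>M \<pi>23))"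
      by (intro nn_integral_cong) (auto simp: spQ space_pair_measure indicator_def)
    also have "\<dots> = (\<integral>\<^sup>+ z. \<integral>\<^sup>+ z'. g (z, z') * indicator A (fst (z, z')) \<partial>\<pi>23 \<partial>\<pi>12)"
      using gm A by (intro \<pi>23.nn_integral_fst[symmetric] borel_measurable_times_ennreal)
        (auto intro!: measurable_compose[OF measurable_fst] borel_measurable_indicator)
    also have "\<dots> = (\<integral>\<^sup>+ z. indicator A z \<partial>\<pi>12)"
    proof (rule nn_integral_cong_AE)
      show "AE z in \<pi>12. (\<integral>\<^sup>+ z'. g (z, z') * indicator A (fst (z, z')) \<partial>\<pi>23) = indicator A z"
        using pos[OF em12 c12]
      proof eventually_elim
        case (elim z)
        show ?case
        proof (cases "z \<in> A")
          case True
          then show ?thesis using int1[OF elim] by simp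
        qed simp
      qed
    qed
    also have "\<dots> = emeasure \<pi>12 A" using A by simp
    finally show "emeasure (distr Q \<pi>12 fst) A = emeasure \<pi>12 A" .
  qed simp
  have Q2: "distr Q \<pi>23 snd = \<pi>23"
  proof (rule measure_eqI)
    fix A assume "A \<in> sets (distr Q \<pi>23 snd)"
    then have A: "A \<in> sets \<pi>23" by simp
    have sA: "snd -` A \<inter> space Q \<in> sets (\<pi>12 \<Otimes>\<^sub>M \<pi>23)" using measurable_sets[OF fQ(2) A] setsQ by simp
    have "emeasure (distr Q \<pi>23 snd) A = emeasure Q (snd -` A \<inter> space Q)" by (rule emeasure_distr[OF fQ(2) A])
    also have "\<dots> = (\<integral>\<^sup>+ w. g w * indicator (snd -` A \<inter> space Q) w \<partial>(\<pi>12 \<Otimes>\<^sub>M \<pi>23))"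
      unfolding Q_def by (rule emeasure_density[OF gm sA[unfolded Q_def]])
    also have "\<dots> = (\<integral>\<^sup>+ w. g w * indicator A (snd w) \<partial>(\<pi>12 \<Otimes>\<^sub>M \<pi>23))"
      by (intro nn_integral_cong) (auto simp: spQ space_pair_measure indicator_def)
    also have "\<dots> = (\<integral>\<^sup>+ z'. \<integral>\<^sup>+ z. g (z, z') * indicator A (snd (z, z')) \<partial>\<pi>12 \<partial>\<pi>23)"
      using gm A by (intro P.nn_integral_snd[symmetric] borel_measurable_times_ennreal)
        (auto intro!: measurable_compose[OF measurable_snd] borel_measurable_indicator)
    also have "\<dots> = (\<integral>\<^sup>+ z'. indicator A z' \<partial>\<pi>23)"
    proof (rule nn_integral_cong_AE)
      show "AE z' in \<pi>23. (\<integral>\<^sup>+ z. g (z, z') * indicator A (snd (z, z')) \<partial>\<pi>12) = indicator A z'"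
        using pos[OF em23 c23]
      proof eventually_elim
        case (elim z')
        show ?case
        proof (cases "z' \<in> A")
          case True
          then show ?thesis using int2[OF elim] by simp
        qed simp
      qed
    qed
    also have "\<dots> = emeasure \<pi>23 A" using A by simp
    finally show "emeasure (distr Q \<pi>23 snd) A = emeasure \<pi>23 A" .
  qed simp
  define R where "R w = (fst (fst w), snd (snd w))" for w :: "('e \<times> 'e) \<times> ('e \<times> 'e)"
  have Rm: "R \<in> Q \<rightarrow>\<^sub>M \<mu>1 \<Otimes>\<^sub>M \<mu>3" unfolding R_def[abs_def]
    using measurable_compose[OF fQ(1) m12(1)] measurable_compose[OF fQ(2) m23(2)] by (rule measurable_Pair)
  have R1: "distr (distr Q (\<mu>1 \<Otimes>\<^sub>M \<mu>3) R) \<mu>1 fst = \<mu>1"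
  proof -
    have "distr (distr Q (\<mu>1 \<Otimes>\<^sub>M \<mu>3) R) \<mu>1 fst = distr Q \<mu>1 (\<lambda>w. fst (fst w))"
      using Rm by (subst distr_distr) (auto simp: o_def R_def)
    also have "\<dots> = distr (distr Q \<pi>12 fst) \<mu>1 fst" using fQ m12 by (subst distr_distr) (auto simp: o_def)
    also have "\<dots> = \<mu>1" using \<pi>(1) by (simp add: Q1 couplings_def)
    finally show ?thesis .
  qed
  have R2: "distr (distr Q (\<mu>1 \<Otimes>\<^sub>M \<mu>3) R) \<mu>3 snd = \<mu>3"
  proof -
    have "distr (distr Q (\<mu>1 \<Otimes>\<^sub>M \<mu>3) R) \<mu>3 snd = distr Q \<mu>3 (\<lambda>w. snd (snd w))"
      using Rm by (subst distr_distr) (auto simp: o_def R_def)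
    also have "\<dots> = distr (distr Q \<pi>23 snd) \<mu>3 snd" using fQ m23 by (subst distr_distr) (auto simp: o_def)
    also have "\<dots> = \<mu>3" using \<pi>(2) by (simp add: Q2 couplings_def)
    finally show ?thesis .
  qed
  have "distr Q (\<mu>1 \<Otimes>\<^sub>M \<mu>3) R \<in> couplings \<mu>1 \<mu>3" using R1 R2 by (simp add: couplings_def)
  moreover have "(\<integral>\<^sup>+ (x, y). ennreal (dist x y powr p) \<partial>distr Q (\<mu>1 \<Otimes>\<^sub>M \<mu>3) R) \<le> ennreal ((a + b + \<epsilon>) powr p)"
  proof -
    interpret Q: prob_space Q using prob_space_distrD[OF fQ(1)] Q1 \<pi>12.prob_space_axioms by simp
    have dm: "(\<lambda>z. dist (fst z) (snd z)) \<in> borel_measurable N"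
      if "sets N = sets (\<mu> \<Otimes>\<^sub>M \<nu>)" "sets \<mu> = sets (restrict_space borel E)" "sets \<nu> = sets (restrict_space borel E)"
      for N and \<mu> \<nu> :: "'e measure"
    proof -
      have "sets N = sets (restrict_space borel E \<Otimes>\<^sub>M restrict_space borel E)"
        using that sets_pair_measure_cong by blast
      then show ?thesis using borel_measurable_dist_restrict[of E] measurable_cong_sets by (fastforce simp: case_prod_beta)
    qed
    have d12: "(\<lambda>z. dist (fst z) (snd z)) \<in> borel_measurable \<pi>12" using \<pi>(1) s by (intro dm) (auto simp: couplings_def)
    have d23: "(\<lambda>z. dist (fst z) (snd z)) \<in> borel_measurable \<pi>23" using \<pi>(2) s by (intro dm) (auto simp: couplings_def)
    define u v where "u w = dist (fst (fst w)) (snd (fst w))" and "v w = dist (fst (snd w)) (snd (snd w))" for w :: "('e \<times> 'e) \<times> ('e \<times> 'e)"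
    have um: "u \<in> borel_measurable Q" "v \<in> borel_measurable Q"
      unfolding u_def[abs_def] v_def[abs_def] using measurable_compose[OF fQ(1) d12] measurable_compose[OF fQ(2) d23] .
    have "(\<integral>\<^sup>+ z. ennreal (dist (fst z) (snd z) powr p) \<partial>distr Q \<pi>12 fst) = (\<integral>\<^sup>+ w. ennreal (u w powr p) \<partial>Q)"
      unfolding u_def by (intro nn_integral_distr fQ) (use d12 in simp)
    then have ua: "(\<integral>\<^sup>+ w. ennreal (u w powr p) \<partial>Q) \<le> ennreal (a powr p)" using a(2) unfolding Q1 case_prod_beta by simp
    have "(\<integral>\<^sup>+ z. ennreal (dist (fst z) (snd z) powr p) \<partial>distr Q \<pi>23 snd) = (\<integral>\<^sup>+ w. ennreal (v w powr p) \<partial>Q)"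
      unfolding v_def by (intro nn_integral_distr fQ) (use d23 in simp)
    then have vb: "(\<integral>\<^sup>+ w. ennreal (v w powr p) \<partial>Q) \<le> ennreal (b powr p)" using b(2) unfolding Q2 case_prod_beta by simp
    have uv: "(\<integral>\<^sup>+ w. ennreal ((u w + v w) powr p) \<partial>Q) \<le> ennreal ((a + b) powr p)"
      by (rule nn_integral_Minkowski[OF um(1) _ um(2) _ a(1) ua b(1) vb p]) (auto simp: u_def v_def)
    have uve: "(\<integral>\<^sup>+ w. ennreal ((u w + v w + \<epsilon>) powr p) \<partial>Q) \<le> ennreal ((a + b + \<epsilon>) powr p)"
    proof (rule nn_integral_Minkowski[where v = "\<lambda>_. \<epsilon>"])
      show "(\<lambda>w. u w + v w) \<in> borel_measurable Q" using um by measurable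
      show "0 < a + b" using a(1) b(1) by simp
    qed (use \<epsilon> uv p Q.emeasure_space_1 in \<open>auto simp: u_def v_def\<close>)
    \<comment> \<open>The two middle coordinates lie in one cell, so chaining through them costs at
      most \<open>\<epsilon>\<close>.\<close>
    have ae: "AE w in Q. dist (fst (R w)) (snd (R w)) \<le> u w + v w + \<epsilon>"
      unfolding Q_def AE_density[OF gm]
    proof (intro AE_I2 impI)
      fix w assume "0 < g w"
      then have "c (snd (fst w)) = c (fst (snd w))" by (auto simp: g_def split: if_splits)
      then have "dist (snd (fst w)) (fst (snd w)) \<le> \<epsilon>" by (rule c(2))
      then show "dist (fst (R w)) (snd (R w)) \<le> u w + v w + \<epsilon>"
        using dist_triangle[of "fst (fst w)" "snd (snd w)" "snd (fst w)"] dist_triangle[of "snd (fst w)" "snd (snd w)" "fst (snd w)"]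
        by (simp add: R_def u_def v_def)
    qed
    have "(\<integral>\<^sup>+ (x, y). ennreal (dist x y powr p) \<partial>distr Q (\<mu>1 \<Otimes>\<^sub>M \<mu>3) R) \<le> (\<integral>\<^sup>+ w. (case R w of (x, y) \<Rightarrow> ennreal (dist x y powr p)) \<partial>Q)"
      by (rule nn_integral_distr_le[OF Rm])
    also have "\<dots> \<le> (\<integral>\<^sup>+ w. ennreal ((u w + v w + \<epsilon>) powr p) \<partial>Q)"
      using ae
    proof (intro nn_integral_mono_AE, eventually_elim)
      case (elim w)
      then show ?case using p by (auto simp: case_prod_beta intro!: ennreal_leI powr_mono2)
    qed
    also note uve
    finally show ?thesis .
  qed
  ultimately show ?thesis by blast
qed

lemma wasserstein_triangle:
  fixes \<mu>1 \<mu>2 \<mu>3 :: "'e::{metric_space, second_countable_topology} measure"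
  assumes \<mu>: "\<mu>1 \<in> prob_moment p E" "\<mu>2 \<in> prob_moment p E" "\<mu>3 \<in> prob_moment p E" and p: "1 \<le> p"
  shows "wasserstein p \<mu>1 \<mu>3 \<le> wasserstein p \<mu>1 \<mu>2 + wasserstein p \<mu>2 \<mu>3"
proof (rule field_le_epsilon)
  fix e :: real assume e: "0 < e"
  let ?W12 = "wasserstein p \<mu>1 \<mu>2" and ?W23 = "wasserstein p \<mu>2 \<mu>3"
  have e3: "0 < e / 3" using e by simp
  note nn = wasserstein_nonneg[of p \<mu>1 \<mu>2] wasserstein_nonneg[of p \<mu>2 \<mu>3]
  obtain \<pi>12 where \<pi>12: "\<pi>12 \<in> couplings \<mu>1 \<mu>2" "(\<integral>\<^sup>+ (x, y). ennreal (dist x y powr p) \<partial>\<pi>12) \<le> ennreal ((?W12 + e / 3) powr p)"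
    using wasserstein_approx[OF \<mu>(1,2) p e3] by blast
  obtain \<pi>23 where \<pi>23: "\<pi>23 \<in> couplings \<mu>2 \<mu>3" "(\<integral>\<^sup>+ (x, y). ennreal (dist x y powr p) \<partial>\<pi>23) \<le> ennreal ((?W23 + e / 3) powr p)"
    using wasserstein_approx[OF \<mu>(2,3) p e3] by blast
  have "\<exists>\<pi>\<in>couplings \<mu>1 \<mu>3.
    (\<integral>\<^sup>+ (x, y). ennreal (dist x y powr p) \<partial>\<pi>) \<le> ennreal (((?W12 + e / 3) + (?W23 + e / 3) + e / 3) powr p)"
    by (rule glued_coupling[where E = E, OF _ _ _ _ _ _ \<pi>12(1) \<pi>23(1) e3 p _ \<pi>12(2) _ \<pi>23(2)])
      (use \<mu> nn e in \<open>auto simp: prob_moment_def add_nonneg_pos\<close>)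
  then obtain \<pi> where \<pi>: "\<pi> \<in> couplings \<mu>1 \<mu>3"
    "(\<integral>\<^sup>+ (x, y). ennreal (dist x y powr p) \<partial>\<pi>) \<le> ennreal (((?W12 + e / 3) + (?W23 + e / 3) + e / 3) powr p)"
    by blast
  have "wasserstein p \<mu>1 \<mu>3 \<le> (?W12 + e / 3) + (?W23 + e / 3) + e / 3"
    using nn e p by (intro wasserstein_le[OF \<pi>]) auto
  then show "wasserstein p \<mu>1 \<mu>3 \<le> ?W12 + ?W23 + e" by simp
qed

lemma wasserstein_self:
  fixes \<mu> :: "'e::{metric_space, second_countable_topology} measure"
  assumes \<mu>: "\<mu> \<in> prob_moment p E" and p: "1 \<le> p"
  shows "wasserstein p \<mu> \<mu> = 0"
proof -
  have s: "sets \<mu> = sets (restrict_space borel E)" using \<mu> by (simp add: prob_moment_def)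
  then have id: "(\<lambda>x. x) \<in> \<mu> \<rightarrow>\<^sub>M restrict_space borel E" by (rule measurable_ident_sets)
  have "law \<mu> E (\<lambda>x. x) = \<mu>" unfolding law_def using s by (intro distr_id2) auto
  moreover have "wasserstein p (law \<mu> E (\<lambda>x. x)) (law \<mu> E (\<lambda>x. x)) \<le> 0"
    using p by (intro wasserstein_law_le[OF id id borel_measurable_dist_restrict]) auto
  ultimately show ?thesis using wasserstein_nonneg[of p \<mu> \<mu>] by simp
qed

text \<open>\<open>wasserstein_borel\<close> is generated by metrically open sets; the metric
  structure makes balls available when continuity of a curve of laws is turned into measurability,
  and its triangle inequality bounds drifts.\<close>

lemma Metric_space_wasserstein:
  fixes E :: "'e::{metric_space, second_countable_topology} set"
  assumes p: "1 \<le> p"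
  shows "Metric_space (prob_moment p E) (wasserstein p)"
proof
  fix \<mu> \<nu> \<rho> :: "'e measure"
  show "0 \<le> wasserstein p \<mu> \<nu>" by (rule wasserstein_nonneg)
  show "wasserstein p \<mu> \<nu> = wasserstein p \<nu> \<mu>" by (rule wasserstein_commute)
  assume \<mu>: "\<mu> \<in> prob_moment p E" "\<nu> \<in> prob_moment p E"
  show "wasserstein p \<mu> \<nu> = 0 \<longleftrightarrow> \<mu> = \<nu>"
  proof
    assume W: "wasserstein p \<mu> \<nu> = 0"
    then have W': "wasserstein p \<nu> \<mu> = 0" by (simp add: wasserstein_commute)
    show "\<mu> = \<nu>"
      by (rule prob_moment_eqI_closed[OF \<mu>], rule antisym)
        (rule wasserstein_eq_0_imp_closed_le[OF \<mu> W p], assumption+, rule wasserstein_eq_0_imp_closed_le[OF \<mu>(2,1) W' p], assumption+)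
  qed (use wasserstein_self[OF \<mu>(1) p] in auto)
  assume "\<rho> \<in> prob_moment p E"
  with \<mu> show "wasserstein p \<mu> \<rho> \<le> wasserstein p \<mu> \<nu> + wasserstein p \<nu> \<rho>" by (intro wasserstein_triangle p) auto
qed

section \<open>Stability and uniqueness\<close>

text \<open>The map \<open>n \<mapsto> c + n / 4\<close> has fixed point \<open>4 * c / 3\<close>,
  below \<open>2 * c\<close>; the slack lets the simple bound with \<open>2 * c\<close> reproduce
  itself.\<close>

lemma iterate_quarter:
  fixes P :: "real \<Rightarrow> bool"
  assumes "P n0" "\<And>n. 0 \<le> n \<Longrightarrow> P n \<Longrightarrow> P (c + n / 4)" "0 \<le> n0" "0 \<le> c"
    and mono: "\<And>n n'. P n \<Longrightarrow> n \<le> n' \<Longrightarrow> P n'"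
  shows "P (2 * c + n0 / 4 ^ j)"
proof (induction j)
  case 0
  show ?case by (rule mono[OF assms(1)]) (use assms(4) in simp)
next
  case (Suc j)
  have "0 \<le> 2 * c + n0 / 4 ^ j" using assms(3,4) by simp
  then have "P (c + (2 * c + n0 / 4 ^ j) / 4)" using Suc by (rule assms(2))
  moreover have "c + (2 * c + n0 / 4 ^ j) / 4 \<le> 2 * c + n0 / 4 ^ Suc j" using assms(4) by (simp add: field_simps)
  ultimately show ?case by (rule mono)
qed

context mv_problem
begin

text \<open>Exactly the way in which the two inputs enter
  \<open>path_solution_estimate\<close>.\<close>

definition input_diff :: "('w \<Rightarrow> 'a) \<Rightarrow> ('w \<Rightarrow> 'a cpath) \<Rightarrow> ('w \<Rightarrow> 'a) \<Rightarrow> ('w \<Rightarrow> 'a cpath) \<Rightarrow> 'w \<Rightarrow> real" where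
  "input_diff \<zeta> W \<zeta>' W' \<omega> = norm (\<zeta> \<omega> - \<zeta>' \<omega>) + 2 * dist (W \<omega>) (W' \<omega>)"

lemma input_diff_nonneg: "0 \<le> input_diff \<zeta> W \<zeta>' W' \<omega>"
  by (simp add: input_diff_def)

lemma input_diff_measurable:
  assumes "mv_input p T D M \<zeta> W" "mv_input p T D M \<zeta>' W'"
  shows "input_diff \<zeta> W \<zeta>' W' \<in> borel_measurable M"
proof -
  note [measurable] = mv_inputD(4)[OF assms(1)] mv_inputD(4)[OF assms(2)]
    borel_measurable_dist_cpath[OF T mv_inputD(5)[OF assms(1)] mv_inputD(5)[OF assms(2)]]
  show ?thesis unfolding input_diff_def[abs_def] by measurable
qed

lemma two_input_moment:
  assumes inp: "mv_input p T D M \<zeta> W" "mv_input p T D M \<zeta>' W'" and a: "0 \<le> a" "0 \<le> c"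
  shows "(\<integral>\<^sup>+ \<omega>. ennreal ((a + c * norm (W \<omega>) + c * norm (W' \<omega>)) powr p) \<partial>M) < \<infinity>"
proof -
  have m: "(\<lambda>\<omega>. norm (V \<omega>)) \<in> borel_measurable M" if "V \<in> M \<rightarrow>\<^sub>M restrict_space borel (cpaths T UNIV)" for V :: "'b \<Rightarrow> 'a cpath"
  proof -
    have "V \<in> borel_measurable M" using that by (simp add: measurable_restrict_space2_iff)
    from measurable_compose[OF this borel_measurable_continuous_onI[OF continuous_on_norm[OF continuous_on_id]]] show ?thesis by simp
  qed
  note [measurable] = m[OF mv_inputD(5)[OF inp(1)]] m[OF mv_inputD(5)[OF inp(2)]]
  have "(\<integral>\<^sup>+ \<omega>. ennreal ((a + c * norm (W \<omega>) + c * norm (W' \<omega>)) powr p) \<partial>M) \<le>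
    (\<integral>\<^sup>+ \<omega>. ennreal (2 powr p) * (ennreal ((a + c * norm (W \<omega>)) powr p) + ennreal ((0 + c * norm (W' \<omega>)) powr p)) \<partial>M)"
  proof (rule nn_integral_mono)
    fix \<omega>
    have "(a + c * norm (W \<omega>) + c * norm (W' \<omega>)) powr p \<le> 2 powr p * ((a + c * norm (W \<omega>)) powr p + (c * norm (W' \<omega>)) powr p)"
      using a p by (intro powr_add2_le) auto
    then have "ennreal ((a + c * norm (W \<omega>) + c * norm (W' \<omega>)) powr p) \<le>
      ennreal (2 powr p * ((a + c * norm (W \<omega>)) powr p + (c * norm (W' \<omega>)) powr p))" by (rule ennreal_leI)
    then show "ennreal ((a + c * norm (W \<omega>) + c * norm (W' \<omega>)) powr p) \<le>
      ennreal (2 powr p) * (ennreal ((a + c * norm (W \<omega>)) powr p) + ennreal ((0 + c * norm (W' \<omega>)) powr p))"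
      by (simp add: ennreal_mult)
  qed
  also have "\<dots> = ennreal (2 powr p) * ((\<integral>\<^sup>+ \<omega>. ennreal ((a + c * norm (W \<omega>)) powr p) \<partial>M) + (\<integral>\<^sup>+ \<omega>. ennreal ((0 + c * norm (W' \<omega>)) powr p) \<partial>M))"
    by (simp add: nn_integral_cmult nn_integral_add)
  also have "\<dots> < \<infinity>"
    using mv_input_moment[OF inp(1) p a] mv_input_moment[OF inp(2) p order_refl a(2)] by (simp add: ennreal_mult_less_top)
  finally show ?thesis .
qed

lemma input_diff_moment:
  assumes inp: "mv_input p T D M \<zeta> W" "mv_input p T D M \<zeta>' W'"
  shows "(\<integral>\<^sup>+ \<omega>. ennreal (input_diff \<zeta> W \<zeta>' W' \<omega> powr p) \<partial>M) < \<infinity>"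
proof -
  have "(\<integral>\<^sup>+ \<omega>. ennreal (input_diff \<zeta> W \<zeta>' W' \<omega> powr p) \<partial>M) \<le>
    (\<integral>\<^sup>+ \<omega>. ennreal ((dm + 2 * norm (W \<omega>) + 2 * norm (W' \<omega>)) powr p) \<partial>M)"
  proof (intro nn_integral_mono ennreal_leI powr_mono2)
    fix \<omega> assume "\<omega> \<in> space M"
    then have "norm (\<zeta> \<omega> - \<zeta>' \<omega>) \<le> dm" using mv_inputD(2)[OF inp(1)] mv_inputD(2)[OF inp(2)] norm_diff_D by blast
    then show "input_diff \<zeta> W \<zeta>' W' \<omega> \<le> dm + 2 * norm (W \<omega>) + 2 * norm (W' \<omega>)"
      using norm_triangle_ineq4[of "W \<omega>" "W' \<omega>"] by (simp add: input_diff_def dist_norm)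
  qed (use p input_diff_nonneg in auto)
  also have "\<dots> < \<infinity>" using dm_nonneg by (intro two_input_moment[OF inp]) auto
  finally show ?thesis .
qed

text \<open>Flows and paths control each other: closeness of the flows bounds the drifts, hence the
  paths, hence the flows again, with a factor 1/4. The argument starts from a finite but
  uncontrolled bound and is iterated until only the contribution of the inputs is left.\<close>

lemma same_space_estimate:
  assumes inp: "mv_input p T D M \<zeta> W" "mv_input p T D M \<zeta>' W'"
    and sol: "mv_solution p T D b M \<zeta> W X k" "mv_solution p T D b M \<zeta>' W' X' k'"
  defines "J \<equiv> enn2real (\<integral>\<^sup>+ \<omega>. ennreal (input_diff \<zeta> W \<zeta>' W' \<omega> powr p) \<partial>M) powr (1 / p)"
  shows "AE \<omega> in M. \<forall>t\<in>{0..T}. norm (X \<omega> t - X' \<omega> t) + norm (k \<omega> t - k' \<omega> t) \<le>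
    (2 * C1 * input_diff \<zeta> W \<zeta>' W' \<omega> + C1 * J) * exp (lam * T)"
proof -
  interpret prob_space M by (rule mv_inputD(1)[OF inp(1)])
  let ?d = "input_diff \<zeta> W \<zeta>' W'"
  note X = solution_measurable[OF sol(1)] and X' = solution_measurable[OF sol(2)]
  obtain A where A: "0 \<le> A" "AE \<omega> in M. norm (k \<omega>) \<le> A + 2 * norm (W \<omega>)" by (rule solution_bound[OF inp(1) sol(1)])
  obtain A' where A': "0 \<le> A'" "AE \<omega> in M. norm (k' \<omega>) \<le> A' + 2 * norm (W' \<omega>)" by (rule solution_bound[OF inp(2) sol(2)])
  let ?\<mu> = "flow M X k" and ?\<mu>' = "flow M X' k'"
  have pm: "?\<mu> s \<in> prob_moment p (D \<times> UNIV)" "?\<mu>' s \<in> prob_moment p (D \<times> UNIV)" for s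
    using flow_prob_moment[OF inp(1) X(1,2) A] flow_prob_moment[OF inp(2) X'(1,2) A'] .
  \<comment> \<open>Closeness of the two flows in the exponentially weighted supremum. One step
    turns \<open>n\<close> into \<open>8 * C1 * J + n / 4\<close>: the pathwise bound has
    \<open>n / 16\<close>, and \<open>moment_add_const\<close> multiplies by 4.\<close>
  define P where "P n \<longleftrightarrow> (\<forall>s\<in>{0..T}. wasserstein p (?\<mu> s) (?\<mu>' s) \<le> n * exp (lam * s))" for n
  have key: "AE \<omega> in M. \<forall>t\<in>{0..T}. norm (X \<omega> t - X' \<omega> t) + norm (k \<omega> t - k' \<omega> t) \<le> (2 * C1 * ?d \<omega> + n / 16) * exp (lam * t)"
    if n: "0 \<le> n" "P n" for n
    using solution_path[OF sol(1)] solution_path[OF sol(2)] AE_space[of M]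
  proof eventually_elim
    case (elim \<omega>)
    show ?case
    proof
      fix t assume t: "t \<in> {0..T}"
      show "norm (X \<omega> t - X' \<omega> t) + norm (k \<omega> t - k' \<omega> t) \<le> (2 * C1 * ?d \<omega> + n / 16) * exp (lam * t)"
        unfolding input_diff_def
      proof (rule path_solution_gronwall[OF elim(1,2) _ n(1) _ t, where v = "\<lambda>s. wasserstein p (?\<mu> s) (?\<mu>' s)"])
        fix r assume r: "r \<in> {0..T}"
        show "norm (drift M X k \<omega> r - drift M X' k' \<omega> r) \<le> L * (norm (X \<omega> r - X' \<omega> r) + wasserstein p (?\<mu> r) (?\<mu>' r))"
          unfolding drift_def using r cpathsD(1)[OF X(3)[OF elim(3)] r] cpathsD(1)[OF X'(3)[OF elim(3)] r] pm by (intro b_lip) auto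
        show "wasserstein p (?\<mu> r) (?\<mu>' r) \<le> n * exp (lam * r)" using n(2) r by (simp add: P_def)
      qed
    qed
  qed
  have J0: "0 \<le> J" by (simp add: J_def)
  have I: "(\<integral>\<^sup>+ \<omega>. ennreal (?d \<omega> powr p) \<partial>M) = ennreal (J powr p)"
    unfolding J_def using enn2real_powr_root[OF input_diff_moment[OF inp] p] by simp
  note dmeas = input_diff_measurable[OF inp]
  have step: "P (8 * C1 * J + n / 4)" if n: "0 \<le> n" "P n" for n
    unfolding P_def
  proof
    fix t assume t: "t \<in> {0..T}"
    let ?e = "exp (lam * t)"
    have "wasserstein p (?\<mu> t) (?\<mu>' t) \<le> 4 * (2 * C1 * ?e * J + ?e * (n / 16))"
    proof (rule flow_wasserstein_le[OF X(1,2) X'(1,2)])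
      have "(\<integral>\<^sup>+ \<omega>. ennreal ((norm (X \<omega> t - X' \<omega> t) + norm (k \<omega> t - k' \<omega> t)) powr p) \<partial>M) \<le>
        (\<integral>\<^sup>+ \<omega>. ennreal ((2 * C1 * ?e * ?d \<omega> + ?e * (n / 16)) powr p) \<partial>M)"
      proof (rule nn_integral_mono_AE)
        show "AE \<omega> in M. ennreal ((norm (X \<omega> t - X' \<omega> t) + norm (k \<omega> t - k' \<omega> t)) powr p) \<le> ennreal ((2 * C1 * ?e * ?d \<omega> + ?e * (n / 16)) powr p)"
          using key[OF n]
        proof eventually_elim
          case (elim \<omega>)
          then have "norm (X \<omega> t - X' \<omega> t) + norm (k \<omega> t - k' \<omega> t) \<le> (2 * C1 * ?d \<omega> + n / 16) * ?e" using t by blast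
          also have "\<dots> = 2 * C1 * ?e * ?d \<omega> + ?e * (n / 16)" by (simp add: algebra_simps)
          finally show ?case using p by (intro ennreal_leI powr_mono2) auto
        qed
      qed
      also have "\<dots> \<le> ennreal ((4 * (2 * C1 * ?e * J + ?e * (n / 16))) powr p)"
      proof (rule moment_add_const[OF prob_space_axioms _ _ p])
        show "(\<lambda>\<omega>. 2 * C1 * ?e * ?d \<omega>) \<in> borel_measurable M" using dmeas by measurable
        have c0: "0 \<le> 2 * C1 * ?e" using C1_pos by simp
        then show "0 \<le> 2 * C1 * ?e * ?d \<omega>" for \<omega> using input_diff_nonneg by (rule mult_nonneg_nonneg)
        show "0 \<le> 2 * C1 * ?e * J" using c0 J0 by (rule mult_nonneg_nonneg)
        have "(\<integral>\<^sup>+ \<omega>. ennreal ((2 * C1 * ?e * ?d \<omega>) powr p) \<partial>M) = (\<integral>\<^sup>+ \<omega>. ennreal ((2 * C1 * ?e) powr p) * ennreal (?d \<omega> powr p) \<partial>M)"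
          by (simp only: powr_mult[of "2 * C1 * ?e"] ennreal_mult powr_ge_zero)
        also have "\<dots> = ennreal ((2 * C1 * ?e) powr p) * ennreal (J powr p)"
          using dmeas I by (simp add: nn_integral_cmult)
        also have "\<dots> = ennreal ((2 * C1 * ?e * J) powr p)"
          by (simp only: powr_mult[of "2 * C1 * ?e"] ennreal_mult powr_ge_zero)
        finally show "(\<integral>\<^sup>+ \<omega>. ennreal ((2 * C1 * ?e * ?d \<omega>) powr p) \<partial>M) \<le> ennreal ((2 * C1 * ?e * J) powr p)" by simp
      qed (use n in auto)
      finally show "(\<integral>\<^sup>+ \<omega>. ennreal ((norm (X \<omega> t - X' \<omega> t) + norm (k \<omega> t - k' \<omega> t)) powr p) \<partial>M) \<le>
        ennreal ((4 * (2 * C1 * ?e * J + ?e * (n / 16))) powr p)" .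
      show "0 \<le> 4 * (2 * C1 * ?e * J + ?e * (n / 16))" using C1_pos J0 n by simp
    qed
    also have "\<dots> = (8 * C1 * J + n / 4) * ?e" by (simp add: algebra_simps)
    finally show "wasserstein p (?\<mu> t) (?\<mu>' t) \<le> (8 * C1 * J + n / 4) * ?e" .
  qed
  \<comment> \<open>A finite starting value: by \<open>solution_bound\<close> both solutions are
    dominated by the norms of the inputs, which have finite \<open>p\<close>-th moments.\<close>
  define R where "R \<omega> = (dm + A + A') + 2 * norm (W \<omega>) + 2 * norm (W' \<omega>)" for \<omega>
  define n0 where "n0 = enn2real (\<integral>\<^sup>+ \<omega>. ennreal (R \<omega> powr p) \<partial>M) powr (1 / p)"
  have n0: "0 \<le> n0" by (simp add: n0_def)
  have Rfin: "(\<integral>\<^sup>+ \<omega>. ennreal (R \<omega> powr p) \<partial>M) < \<infinity>"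
    unfolding R_def using A A' dm_nonneg by (intro two_input_moment[OF inp]) auto
  have "P n0"
    unfolding P_def
  proof
    fix t assume t: "t \<in> {0..T}"
    have "wasserstein p (?\<mu> t) (?\<mu>' t) \<le> n0"
    proof (rule flow_wasserstein_le[OF X(1,2) X'(1,2) _ n0])
      have "(\<integral>\<^sup>+ \<omega>. ennreal ((norm (X \<omega> t - X' \<omega> t) + norm (k \<omega> t - k' \<omega> t)) powr p) \<partial>M) \<le> (\<integral>\<^sup>+ \<omega>. ennreal (R \<omega> powr p) \<partial>M)"
      proof (rule nn_integral_mono_AE)
        show "AE \<omega> in M. ennreal ((norm (X \<omega> t - X' \<omega> t) + norm (k \<omega> t - k' \<omega> t)) powr p) \<le> ennreal (R \<omega> powr p)"
          using A(2) A'(2) AE_space[of M]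
        proof eventually_elim
          case (elim \<omega>)
          have "norm (X \<omega> t - X' \<omega> t) \<le> dm"
            using cpathsD(1)[OF X(3)[OF elim(3)] t] cpathsD(1)[OF X'(3)[OF elim(3)] t] by (rule norm_diff_D)
          moreover have "norm (k \<omega> t - k' \<omega> t) \<le> norm (k \<omega>) + norm (k' \<omega>)"
            using norm_triangle_ineq4[of "k \<omega> t" "k' \<omega> t"] norm_bounded[of "k \<omega>" t] norm_bounded[of "k' \<omega>" t] by linarith
          ultimately show ?case using elim(1,2) p unfolding R_def by (intro ennreal_leI powr_mono2) auto
        qed
      qed
      also have "\<dots> = ennreal (n0 powr p)" unfolding n0_def using enn2real_powr_root[OF Rfin p] by simp
      finally show "(\<integral>\<^sup>+ \<omega>. ennreal ((norm (X \<omega> t - X' \<omega> t) + norm (k \<omega> t - k' \<omega> t)) powr p) \<partial>M) \<le> ennreal (n0 powr p)" .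
    qed
    also have "n0 * 1 \<le> n0 * exp (lam * t)" using n0 t lam_pos by (intro mult_left_mono) auto
    finally show "wasserstein p (?\<mu> t) (?\<mu>' t) \<le> n0 * exp (lam * t)" by simp
  qed
  have mono: "P n'" if "P n" "n \<le> n'" for n n'
    using that unfolding P_def by (meson exp_ge_zero mult_right_mono order_trans)
  have cJ: "0 \<le> 8 * C1 * J" using C1_pos J0 by simp
  have Pj: "P (2 * (8 * C1 * J) + n0 / 4 ^ j)" for j
    by (rule iterate_quarter[where P = P, OF \<open>P n0\<close> step n0 cJ mono])
  have "P (16 * C1 * J)"
    unfolding P_def
  proof
    fix t assume t: "t \<in> {0..T}"
    have lim: "(\<lambda>j. (1 / 4 :: real) ^ j) \<longlonglongrightarrow> 0" by (rule LIMSEQ_realpow_zero) auto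
    have lim': "(\<lambda>j. (2 * (8 * C1 * J) + n0 * (1 / 4) ^ j) * exp (lam * t)) \<longlonglongrightarrow> (2 * (8 * C1 * J) + n0 * 0) * exp (lam * t)"
      by (intro tendsto_mult tendsto_add tendsto_const lim)
    have "wasserstein p (?\<mu> t) (?\<mu>' t) \<le> (2 * (8 * C1 * J) + n0 * (1 / 4) ^ j) * exp (lam * t)" for j
      using Pj[of j] t by (simp add: P_def power_one_over)
    then have "wasserstein p (?\<mu> t) (?\<mu>' t) \<le> (2 * (8 * C1 * J) + n0 * 0) * exp (lam * t)"
      by (intro LIMSEQ_le_const[OF lim'] exI[of _ 0] allI impI)
    then show "wasserstein p (?\<mu> t) (?\<mu>' t) \<le> 16 * C1 * J * exp (lam * t)" by simp
  qed
  moreover have "0 \<le> 16 * C1 * J" using cJ by simp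
  ultimately have "AE \<omega> in M. \<forall>t\<in>{0..T}. norm (X \<omega> t - X' \<omega> t) + norm (k \<omega> t - k' \<omega> t) \<le> (2 * C1 * ?d \<omega> + 16 * C1 * J / 16) * exp (lam * t)"
    by (intro key)
  then show ?thesis
  proof eventually_elim
    case (elim \<omega>)
    show ?case
    proof
      fix t assume t: "t \<in> {0..T}"
      have "(2 * C1 * ?d \<omega> + C1 * J) * exp (lam * t) \<le> (2 * C1 * ?d \<omega> + C1 * J) * exp (lam * T)"
        using t lam_pos C1_pos J0 input_diff_nonneg[of \<zeta> W \<zeta>' W' \<omega>] by (intro mult_left_mono) auto
      then show "norm (X \<omega> t - X' \<omega> t) + norm (k \<omega> t - k' \<omega> t) \<le> (2 * C1 * ?d \<omega> + C1 * J) * exp (lam * T)"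
        using elim t by fastforce
    qed
  qed
qed

lemma solution_unique:
  assumes inp: "mv_input p T D M \<zeta> W"
    and sol: "mv_solution p T D b M \<zeta> W X k" "mv_solution p T D b M \<zeta> W X' k'"
  shows "AE \<omega> in M. X' \<omega> = X \<omega> \<and> k' \<omega> = k \<omega>"
proof -
  note X = solution_measurable[OF sol(1)] and X' = solution_measurable[OF sol(2)]
  have d0: "input_diff \<zeta> W \<zeta> W \<omega> = 0" for \<omega> by (simp add: input_diff_def)
  have "AE \<omega> in M. \<forall>t\<in>{0..T}. norm (X \<omega> t - X' \<omega> t) + norm (k \<omega> t - k' \<omega> t) \<le> 0"
    using same_space_estimate[OF inp inp sol] p by (simp add: d0)
  then show ?thesis
    using AE_space[of M]
  proof eventually_elim
    case (elim \<omega>)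
    have "norm (X \<omega> t - X' \<omega> t) = 0 \<and> norm (k \<omega> t - k' \<omega> t) = 0" if "t \<in> {0..T}" for t
    proof -
      have "norm (X \<omega> t - X' \<omega> t) + norm (k \<omega> t - k' \<omega> t) \<le> 0" using elim(1) that by blast
      then show ?thesis using norm_ge_zero[of "X \<omega> t - X' \<omega> t"] norm_ge_zero[of "k \<omega> t - k' \<omega> t"] by linarith
    qed
    then have eq: "X' \<omega> t = X \<omega> t" "k' \<omega> t = k \<omega> t" if "t \<in> {0..T}" for t using that by auto
    show ?case
      by (intro conjI cpaths_eqI[OF X'(3)[OF elim(2)] X(3)[OF elim(2)] less_imp_le[OF T] eq(1)]
          cpaths_eqI[OF X'(4)[OF elim(2)] X(4)[OF elim(2)] less_imp_le[OF T] eq(2)])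
  qed
qed

text \<open>The pair distance doubles the uniform bound, giving coefficients 4 and 2; taking the
  moment yields 4 * (4 + 2) = 24, and \<open>input_diff\<close> is at most three times the distance
  of the inputs, whence 72.\<close>

lemma same_space_cost:
  assumes inp: "mv_input p T D M \<zeta> W" "mv_input p T D M \<zeta>' W'"
    and sol: "mv_solution p T D b M \<zeta> W X k" "mv_solution p T D b M \<zeta>' W' X' k'"
  shows "(\<integral>\<^sup>+ \<omega>. ennreal (dist (X \<omega>, k \<omega>) (X' \<omega>, k' \<omega>) powr p) \<partial>M) \<le>
    ennreal ((72 * C1 * exp (lam * T)) powr p) * (\<integral>\<^sup>+ \<omega>. ennreal (dist (\<zeta> \<omega>, W \<omega>) (\<zeta>' \<omega>, W' \<omega>) powr p) \<partial>M)"
proof -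
  interpret prob_space M by (rule mv_inputD(1)[OF inp(1)])
  let ?d = "input_diff \<zeta> W \<zeta>' W'"
  note X = solution_measurable[OF sol(1)] and X' = solution_measurable[OF sol(2)]
  let ?I = "\<integral>\<^sup>+ \<omega>. ennreal (?d \<omega> powr p) \<partial>M"
  define J where "J = enn2real ?I powr (1 / p)"
  have J0: "0 \<le> J" by (simp add: J_def)
  have I: "?I = ennreal (J powr p)"
    unfolding J_def using enn2real_powr_root[OF input_diff_moment[OF inp] p] by simp
  note dmeas = input_diff_measurable[OF inp]
  define e where "e = C1 * exp (lam * T)"
  have e: "0 < e" using C1_pos by (simp add: e_def)
  have "(\<integral>\<^sup>+ \<omega>. ennreal (dist (X \<omega>, k \<omega>) (X' \<omega>, k' \<omega>) powr p) \<partial>M) \<le> (\<integral>\<^sup>+ \<omega>. ennreal ((4 * e * ?d \<omega> + 2 * e * J) powr p) \<partial>M)"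
  proof (rule nn_integral_mono_AE)
    show "AE \<omega> in M. ennreal (dist (X \<omega>, k \<omega>) (X' \<omega>, k' \<omega>) powr p) \<le> ennreal ((4 * e * ?d \<omega> + 2 * e * J) powr p)"
      using same_space_estimate[OF inp sol, folded J_def] AE_space[of M]
    proof eventually_elim
      case (elim \<omega>)
      let ?s = "2 * e * ?d \<omega> + e * J"
      have "norm (X \<omega> t - X' \<omega> t) + norm (k \<omega> t - k' \<omega> t) \<le> ?s" if "t \<in> {0..T}" for t
        using elim(1) that by (simp add: e_def algebra_simps)
      then have le: "dist (X \<omega> t) (X' \<omega> t) \<le> ?s" "dist (k \<omega> t) (k' \<omega> t) \<le> ?s" if "t \<in> {0..T}" for t
        using that norm_ge_zero[of "X \<omega> t - X' \<omega> t"] norm_ge_zero[of "k \<omega> t - k' \<omega> t"]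
        unfolding dist_norm by (meson add_increasing add_increasing2 order_refl order_trans)+
      have "dist (X \<omega>) (X' \<omega>) \<le> ?s"
        by (rule dist_cpaths_le[OF X(3)[OF elim(2)] X'(3)[OF elim(2)] less_imp_le[OF T] le(1)])
      moreover have "dist (k \<omega>) (k' \<omega>) \<le> ?s"
        by (rule dist_cpaths_le[OF X(4)[OF elim(2)] X'(4)[OF elim(2)] less_imp_le[OF T] le(2)])
      ultimately have "dist (X \<omega>, k \<omega>) (X' \<omega>, k' \<omega>) \<le> 4 * e * ?d \<omega> + 2 * e * J"
        using dist_prod_le[of "X \<omega>" "k \<omega>" "X' \<omega>" "k' \<omega>"] by simp
      then show ?case using p by (intro ennreal_leI powr_mono2) auto
    qed
  qed
  also have "\<dots> \<le> ennreal ((4 * (4 * e * J + 2 * e * J)) powr p)"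
  proof (rule moment_add_const[OF prob_space_axioms _ _ p])
    show "(\<lambda>\<omega>. 4 * e * ?d \<omega>) \<in> borel_measurable M" using dmeas by measurable
    show "0 \<le> 4 * e * ?d \<omega>" for \<omega> using e input_diff_nonneg by (intro mult_nonneg_nonneg) auto
    have "(\<integral>\<^sup>+ \<omega>. ennreal ((4 * e * ?d \<omega>) powr p) \<partial>M) = (\<integral>\<^sup>+ \<omega>. ennreal ((4 * e) powr p) * ennreal (?d \<omega> powr p) \<partial>M)"
      by (simp only: powr_mult[of "4 * e"] ennreal_mult powr_ge_zero)
    also have "\<dots> = ennreal ((4 * e) powr p) * ennreal (J powr p)" using dmeas I by (simp add: nn_integral_cmult)
    also have "\<dots> = ennreal ((4 * e * J) powr p)" by (simp only: powr_mult[of "4 * e"] ennreal_mult powr_ge_zero)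
    finally show "(\<integral>\<^sup>+ \<omega>. ennreal ((4 * e * ?d \<omega>) powr p) \<partial>M) \<le> ennreal ((4 * e * J) powr p)" by simp
  qed (use e J0 in auto)
  also have "\<dots> = ennreal ((24 * e) powr p) * ?I"
  proof -
    have "4 * (4 * e * J + 2 * e * J) = 24 * e * J" by simp
    then show ?thesis unfolding I by (simp only: powr_mult[of "24 * e"] ennreal_mult powr_ge_zero)
  qed
  also have "?I \<le> (\<integral>\<^sup>+ \<omega>. ennreal (3 powr p) * ennreal (dist (\<zeta> \<omega>, W \<omega>) (\<zeta>' \<omega>, W' \<omega>) powr p) \<partial>M)"
  proof (rule nn_integral_mono)
    fix \<omega>
    have "?d \<omega> \<le> 3 * dist (\<zeta> \<omega>, W \<omega>) (\<zeta>' \<omega>, W' \<omega>)"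
      using dist_fst_le[of "(\<zeta> \<omega>, W \<omega>)" "(\<zeta>' \<omega>, W' \<omega>)"] dist_snd_le[of "(\<zeta> \<omega>, W \<omega>)" "(\<zeta>' \<omega>, W' \<omega>)"]
      by (simp add: input_diff_def dist_norm)
    then have "?d \<omega> powr p \<le> (3 * dist (\<zeta> \<omega>, W \<omega>) (\<zeta>' \<omega>, W' \<omega>)) powr p"
      using p input_diff_nonneg by (intro powr_mono2) auto
    then show "ennreal (?d \<omega> powr p) \<le> ennreal (3 powr p) * ennreal (dist (\<zeta> \<omega>, W \<omega>) (\<zeta>' \<omega>, W' \<omega>) powr p)"
      by (simp add: powr_mult ennreal_leI flip: ennreal_mult)
  qed
  also have "\<dots> = ennreal (3 powr p) * (\<integral>\<^sup>+ \<omega>. ennreal (dist (\<zeta> \<omega>, W \<omega>) (\<zeta>' \<omega>, W' \<omega>) powr p) \<partial>M)"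
  proof (rule nn_integral_cmult)
    have "(\<lambda>\<omega>. dist (\<zeta> \<omega>, W \<omega>) (\<zeta>' \<omega>, W' \<omega>)) \<in> borel_measurable M"
    proof -
      note [measurable] = mv_inputD(4)[OF inp(1)] mv_inputD(4)[OF inp(2)]
        borel_measurable_dist_cpath[OF T mv_inputD(5)[OF inp(1)] mv_inputD(5)[OF inp(2)]]
      show ?thesis unfolding dist_Pair_Pair by measurable
    qed
    then show "(\<lambda>\<omega>. ennreal (dist (\<zeta> \<omega>, W \<omega>) (\<zeta>' \<omega>, W' \<omega>) powr p)) \<in> borel_measurable M" by measurable
  qed
  also have "ennreal ((24 * e) powr p) * (ennreal (3 powr p) * (\<integral>\<^sup>+ \<omega>. ennreal (dist (\<zeta> \<omega>, W \<omega>) (\<zeta>' \<omega>, W' \<omega>) powr p) \<partial>M)) =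
    ennreal ((72 * C1 * exp (lam * T)) powr p) * (\<integral>\<^sup>+ \<omega>. ennreal (dist (\<zeta> \<omega>, W \<omega>) (\<zeta>' \<omega>, W' \<omega>) powr p) \<partial>M)"
  proof -
    have 1: "72 * C1 * exp (lam * T) = (24 * e) * 3" by (simp add: e_def)
    have 2: "ennreal (((24 * e) * 3) powr p) = ennreal ((24 * e) powr p) * ennreal (3 powr p)"
      by (simp only: powr_mult[of "24 * e" 3] ennreal_mult powr_ge_zero)
    show ?thesis unfolding 1 2 by (rule mult.assoc[symmetric])
  qed
  finally show ?thesis by (simp add: mult_left_mono)
qed

end

section \<open>Existence\<close>

text \<open>The constant \<open>2 * c\<close> leaves room for the remaining tail, so the partial
  sums telescope against \<open>2 * c / 16 ^ n\<close>.\<close>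

lemma geometric_limit:
  fixes f :: "nat \<Rightarrow> 'e::complete_space"
  assumes d: "\<And>n. dist (f n) (f (Suc n)) \<le> c / 16 ^ n"
  shows "f \<longlonglongrightarrow> lim f" "dist (f n) (lim f) \<le> 2 * c / 16 ^ n"
proof -
  have c: "0 \<le> c" using order_trans[OF zero_le_dist d[of 0]] by simp
  have sum: "dist (f n) (f (n + m)) \<le> 2 * c / 16 ^ n - 2 * c / 16 ^ (n + m)" for n m
  proof (induction m)
    case (Suc m)
    have "dist (f n) (f (n + Suc m)) \<le> dist (f n) (f (n + m)) + c / 16 ^ (n + m)"
      using dist_triangle[of "f n" "f (n + Suc m)" "f (n + m)"] d[of "n + m"] by simp
    also have "\<dots> \<le> 2 * c / 16 ^ n - 2 * c / 16 ^ (n + m) + c / 16 ^ (n + m)" using Suc by simp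
    also have "\<dots> \<le> 2 * c / 16 ^ n - 2 * c / 16 ^ (n + Suc m)"
    proof -
      have "2 * c / 16 ^ (n + Suc m) = (c / 16 ^ (n + m)) / 8" by simp
      moreover have "0 \<le> c / 16 ^ (n + m)" using c by simp
      ultimately show ?thesis by simp
    qed
    finally show ?case .
  qed simp
  have le: "dist (f n) (f m) \<le> 2 * c / 16 ^ n" if "n \<le> m" for n m
  proof -
    have "0 \<le> 2 * c / 16 ^ m" using c by simp
    then show ?thesis using sum[of n "m - n"] that by simp
  qed
  have "Cauchy f"
  proof (rule CauchyI')
    fix e :: real assume e: "0 < e"
    have "(\<lambda>n. 2 * c * (1 / 16) ^ n) \<longlonglongrightarrow> 2 * c * 0" by (intro tendsto_mult tendsto_const LIMSEQ_realpow_zero) auto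
    then have "\<forall>\<^sub>F n in sequentially. 2 * c * (1 / 16) ^ n < e" using e by (intro order_tendstoD(2)) auto
    then obtain N where N: "\<And>n. n \<ge> N \<Longrightarrow> 2 * c * (1 / 16) ^ n < e" unfolding eventually_sequentially by blast
    have "dist (f m) (f n) < e" if "m \<ge> N" "n > m" for m n
    proof -
      have "dist (f m) (f n) \<le> 2 * c * (1 / 16) ^ m" using le[of m n] that by (simp add: power_one_over)
      also have "\<dots> < e" using that by (intro N)
      finally show ?thesis .
    qed
    then show "\<exists>M. \<forall>m\<ge>M. \<forall>n>m. dist (f m) (f n) < e" by blast
  qed
  then show lim: "f \<longlonglongrightarrow> lim f" using Cauchy_convergent convergent_LIMSEQ_iff by blast
  have "(\<lambda>m. dist (f n) (f m)) \<longlonglongrightarrow> dist (f n) (lim f)" by (intro tendsto_intros lim)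
  then show "dist (f n) (lim f) \<le> 2 * c / 16 ^ n" using le by (intro LIMSEQ_le_const2) auto
qed

lemma tendsto_eval_bcontfun:
  fixes f :: "nat \<Rightarrow> 'a::metric_space cpath"
  assumes "f \<longlonglongrightarrow> l" shows "(\<lambda>n. f n t) \<longlonglongrightarrow> l t"
  using continuous_on_tendsto_compose[OF continuous_on_eval_bcontfun assms] by auto

lemma isCont_apply_bcontfun: "isCont (apply_bcontfun f) t"
  using continuous_on_eq_continuous_at[OF open_UNIV] continuous_on_apply_bcontfun by blast

lemma cpaths_closed:
  fixes f :: "nat \<Rightarrow> 'a::metric_space cpath"
  assumes "\<And>n. f n \<in> cpaths T S" "f \<longlonglongrightarrow> l" "closed S"
  shows "l \<in> cpaths T S"
  unfolding cpaths_def
proof (intro CollectI conjI ballI allI)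
  fix t assume "t \<in> {0..T}"
  then show "l t \<in> S" using cpathsD(1)[OF assms(1)] by (intro closed_sequentially[OF assms(3) _ tendsto_eval_bcontfun[OF assms(2)]])
next
  fix t
  have "(\<lambda>n. f n t) \<longlonglongrightarrow> l (max 0 (min T t))"
    using tendsto_eval_bcontfun[OF assms(2), of "max 0 (min T t)"] cpathsD(2)[OF assms(1), of _ t] by simp
  then show "l t = l (max 0 (min T t))" using tendsto_eval_bcontfun[OF assms(2)] LIMSEQ_unique by blast
qed

lemma (in solid_polyhedron) skorokhod_cong:
  assumes k: "skorokhod T u k" and eq: "\<And>t. t \<in> {0..T} \<Longrightarrow> u t = u' t" "\<And>t. t \<in> {0..T} \<Longrightarrow> k t = k' t" and T: "0 \<le> T"
  shows "skorokhod T u' k'"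
  unfolding skorokhod_def
proof (intro conjI ballI allI impI)
  show "continuous_on {0..T} k'"
    by (rule continuous_on_eq[of _ k]) (use k eq in \<open>auto simp: skorokhod_def\<close>)
  show "k' 0 = 0" using k eq(2)[of 0] T by (simp add: skorokhod_def)
  show "u' t - k' t \<in> D" if "t \<in> {0..T}" for t
  proof -
    have "u t - k t \<in> D" using k that unfolding skorokhod_def by blast
    then show ?thesis by (simp only: eq(1)[OF that] eq(2)[OF that])
  qed
  fix s t v
  assume H: "0 \<le> s \<and> s \<le> t \<and> t \<le> T \<and> (\<forall>F. F facet_of D \<and> (\<exists>r\<in>{s..t}. u' r - k' r \<in> F) \<longrightarrow> v \<bullet> nrm F \<le> 0)"
  have "v \<bullet> (k t - k s) \<le> 0"
  proof (rule skorokhod_cone[OF k])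
    fix F r assume F: "F facet_of D" "s \<le> r" "r \<le> t" "u r - k r \<in> F"
    then have "u' r - k' r \<in> F" using eq[of r] H by auto
    then have "\<exists>r\<in>{s..t}. u' r - k' r \<in> F" using F by auto
    then show "v \<bullet> nrm F \<le> 0" using H F(1) by blast
  qed (use H in auto)
  then show "v \<bullet> (k' t - k' s) \<le> 0" using eq(2)[of t] eq(2)[of s] H by auto
qed

context mv_problem
begin

text \<open>The Skorokhod map on path space, chosen separately for each path. Measurability cannot
  come from the choice; it comes from the Lipschitz bound, which makes the map continuous on paths
  starting in \<open>D\<close>.\<close>

definition reflect :: "'a cpath \<Rightarrow> 'a cpath" where
  "reflect u = cpath_of T (SOME k. skorokhod T u k)"

lemma reflect_props:
  fixes u :: "'a cpath"
  assumes "u 0 \<in> D"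
  shows "skorokhod T u (reflect u)" "reflect u \<in> cpaths T UNIV"
proof -
  have "\<exists>k. skorokhod T u k" using T assms by (intro skorokhod_exists) auto
  then have k: "skorokhod T u (SOME k. skorokhod T u k)" by (rule someI_ex)
  then have cont: "continuous_on {0..T} (SOME k. skorokhod T u k)" by (simp add: skorokhod_def)
  note T0 = less_imp_le[OF T]
  show "reflect u \<in> cpaths T UNIV" unfolding reflect_def by (rule cpath_of_mem[OF T0 cont]) simp
  show "skorokhod T u (reflect u)"
    by (rule skorokhod_cong[OF k _ _ T0]) (auto simp: reflect_def cpath_of_apply[OF T0 cont] min_def max_def)
qed

lemma reflect_lipschitz:
  fixes u u' :: "'a cpath"
  assumes "u 0 \<in> D" "u' 0 \<in> D"
  shows "dist (reflect u) (reflect u') \<le> lip * dist u u'"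
proof (rule dist_cpaths_le[OF reflect_props(2)[OF assms(1)] reflect_props(2)[OF assms(2)] less_imp_le[OF T]])
  fix t assume t: "t \<in> {0..T}"
  have "norm (reflect u t - reflect u' t) \<le> lip * dist u u'"
    using t dist_bounded[of u _ u']
    by (intro skorokhod_lipschitz[OF reflect_props(1)[OF assms(1)] reflect_props(1)[OF assms(2)]]) (auto simp: dist_norm)
  then show "dist (reflect u t) (reflect u' t) \<le> lip * dist u u'" by (simp add: dist_norm)
qed

lemma continuous_on_reflect: "continuous_on {u :: 'a cpath. u 0 \<in> D} reflect"
proof (rule lipschitz_on_continuous_on)
  show "lip-lipschitz_on {u :: 'a cpath. u 0 \<in> D} reflect"
    using reflect_lipschitz lip_pos by (intro lipschitz_onI) auto
qed

section \<open>Solutions for a frozen drift\<close>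

definition solK :: "'a \<Rightarrow> 'a cpath \<Rightarrow> (real \<Rightarrow> 'a) \<Rightarrow> 'a cpath" where
  "solK z w \<beta> = reflect (cpath_of T (driver z w \<beta>))"

definition solX :: "'a \<Rightarrow> 'a cpath \<Rightarrow> (real \<Rightarrow> 'a) \<Rightarrow> 'a cpath" where
  "solX z w \<beta> = cpath_of T (\<lambda>t. driver z w \<beta> t - solK z w \<beta> t)"

lemma driver_path:
  assumes "set_integrable lebesgue {0..T} \<beta>"
  shows "cpath_of T (driver z w \<beta>) t = driver z w \<beta> (max 0 (min T t))" "cpath_of T (driver z w \<beta>) \<in> cpaths T UNIV"
    "cpath_of T (driver z w \<beta>) 0 = z"
proof -
  note T0 = less_imp_le[OF T] and c = continuous_driver[OF assms, of z w]
  show ap: "cpath_of T (driver z w \<beta>) t = driver z w \<beta> (max 0 (min T t))" for t by (rule cpath_of_apply[OF T0 c])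
  show "cpath_of T (driver z w \<beta>) \<in> cpaths T UNIV" by (rule cpath_of_mem[OF T0 c]) simp
  have "(LINT s:{0..0}|lebesgue. \<beta> s) = integral {0..0} \<beta>"
    using T by (intro set_lebesgue_integral_eq_integral(2) set_integrable_subset[OF assms]) auto
  then have "(LINT s:{0..0}|lebesgue. \<beta> s) = 0" by simp
  then show "cpath_of T (driver z w \<beta>) 0 = z" using T by (simp add: ap driver_def)
qed

lemma sol_path:
  assumes z: "z \<in> D" and \<beta>: "set_integrable lebesgue {0..T} \<beta>"
  shows "path_solution z w \<beta> (solX z w \<beta>) (solK z w \<beta>)" "solX z w \<beta> \<in> cpaths T D" "solK z w \<beta> \<in> cpaths T UNIV"
    "solX z w \<beta> t = driver z w \<beta> (max 0 (min T t)) - solK z w \<beta> (max 0 (min T t))"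
proof -
  note T0 = less_imp_le[OF T] and c = continuous_driver[OF \<beta>, of z w]
  let ?u = "cpath_of T (driver z w \<beta>)"
  have u0: "?u 0 \<in> D" using driver_path(3)[OF \<beta>] z by simp
  show kc: "solK z w \<beta> \<in> cpaths T UNIV" unfolding solK_def by (rule reflect_props(2)[OF u0])
  have "skorokhod T ?u (solK z w \<beta>)" unfolding solK_def by (rule reflect_props(1)[OF u0])
  then have sk: "skorokhod T (driver z w \<beta>) (solK z w \<beta>)"
    by (rule skorokhod_cong[OF _ _ _ T0]) (auto simp: driver_path(1)[OF \<beta>] min_def max_def)
  have cx: "continuous_on {0..T} (\<lambda>t. driver z w \<beta> t - solK z w \<beta> t)" by (intro continuous_intros c) auto
  show ap: "solX z w \<beta> t = driver z w \<beta> (max 0 (min T t)) - solK z w \<beta> (max 0 (min T t))" for t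
    unfolding solX_def by (rule cpath_of_apply[OF T0 cx])
  show "solX z w \<beta> \<in> cpaths T D" unfolding solX_def
    using sk by (intro cpath_of_mem[OF T0 cx]) (auto simp: skorokhod_def)
  show "path_solution z w \<beta> (solX z w \<beta>) (solK z w \<beta>)"
    unfolding path_solution_def using \<beta> sk by (auto simp: ap min_def max_def)
qed

text \<open>The drift enters only through its time integrals, so their measurability in
  \<open>\<omega>\<close> at each fixed time is all that is asked of it. The driver is then
  measurable as a path, and \<open>reflect\<close> is continuous.\<close>

lemma sol_measurable:
  assumes inp: "mv_input p T D M \<zeta> W"
    and \<beta>: "\<And>\<omega>. \<omega> \<in> space M \<Longrightarrow> set_integrable lebesgue {0..T} (\<beta> \<omega>)"
    and J: "\<And>t. t \<in> {0..T} \<Longrightarrow> (\<lambda>\<omega>. LINT s:{0..t}|lebesgue. \<beta> \<omega> s) \<in> borel_measurable M"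
  shows "(\<lambda>\<omega>. solK (\<zeta> \<omega>) (W \<omega>) (\<beta> \<omega>)) \<in> M \<rightarrow>\<^sub>M restrict_space borel (cpaths T UNIV)"
    "(\<lambda>\<omega>. solX (\<zeta> \<omega>) (W \<omega>) (\<beta> \<omega>)) \<in> M \<rightarrow>\<^sub>M restrict_space borel (cpaths T D)"
proof -
  note z = mv_inputD(2)[OF inp]
  define U where "U \<omega> = cpath_of T (driver (\<zeta> \<omega>) (W \<omega>) (\<beta> \<omega>))" for \<omega>
  have drm: "(\<lambda>\<omega>. driver (\<zeta> \<omega>) (W \<omega>) (\<beta> \<omega>) t) \<in> borel_measurable M" if "t \<in> {0..T}" for t
  proof -
    note [measurable] = J[OF that] mv_inputD(4)[OF inp] measurable_eval_bcontfun[OF mv_inputD(5)[OF inp], of t]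
      measurable_eval_bcontfun[OF mv_inputD(5)[OF inp], of 0]
    show ?thesis unfolding driver_def by measurable
  qed
  have clamp: "max 0 (min T t) \<in> {0..T}" for t using T by auto
  have Um: "U \<in> borel_measurable M"
  proof (rule borel_measurable_cpath[OF T])
    show "(\<lambda>\<omega>. U \<omega> t) \<in> borel_measurable M" for t
      using drm[OF clamp, of t] by (rule measurable_cong[THEN iffD2, rotated]) (simp add: U_def driver_path(1)[OF \<beta>])
    show "U \<omega> \<in> cpaths T UNIV" if "\<omega> \<in> space M" for \<omega> unfolding U_def using \<beta>[OF that] by (rule driver_path(2))
  qed
  have "U \<in> M \<rightarrow>\<^sub>M restrict_space borel {u :: 'a cpath. u 0 \<in> D}"
    using Um z \<beta> by (intro measurable_restrict_space2) (auto simp: U_def driver_path(3))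
  from measurable_compose[OF this borel_measurable_continuous_on_restrict[OF continuous_on_reflect]]
  have Km: "(\<lambda>\<omega>. solK (\<zeta> \<omega>) (W \<omega>) (\<beta> \<omega>)) \<in> borel_measurable M" by (simp add: solK_def U_def)
  then show K: "(\<lambda>\<omega>. solK (\<zeta> \<omega>) (W \<omega>) (\<beta> \<omega>)) \<in> M \<rightarrow>\<^sub>M restrict_space borel (cpaths T UNIV)"
    using sol_path(3)[OF z \<beta>] by (intro measurable_restrict_space2) auto
  have "(\<lambda>\<omega>. solX (\<zeta> \<omega>) (W \<omega>) (\<beta> \<omega>)) \<in> borel_measurable M"
  proof (rule borel_measurable_cpath[OF T])
    fix t
    let ?t = "max 0 (min T t)"
    have "(\<lambda>\<omega>. driver (\<zeta> \<omega>) (W \<omega>) (\<beta> \<omega>) ?t - solK (\<zeta> \<omega>) (W \<omega>) (\<beta> \<omega>) ?t) \<in> borel_measurable M"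
      by (intro borel_measurable_diff drm[OF clamp] measurable_eval_bcontfun[OF K])
    then show "(\<lambda>\<omega>. solX (\<zeta> \<omega>) (W \<omega>) (\<beta> \<omega>) t) \<in> borel_measurable M"
      by (rule measurable_cong[THEN iffD2, rotated]) (rule sol_path(4)[OF z \<beta>])
    show "solX (\<zeta> \<omega>) (W \<omega>) (\<beta> \<omega>) \<in> cpaths T UNIV" if "\<omega> \<in> space M" for \<omega>
      using sol_path(2)[OF z[OF that] \<beta>[OF that]] cpaths_mono by blast
  qed
  then show "(\<lambda>\<omega>. solX (\<zeta> \<omega>) (W \<omega>) (\<beta> \<omega>)) \<in> M \<rightarrow>\<^sub>M restrict_space borel (cpaths T D)"
    using sol_path(2)[OF z \<beta>] by (intro measurable_restrict_space2) auto
qed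

lemma path_solution_reflects:
  assumes s: "path_solution z w \<beta> x k" and x: "x \<in> cpaths T D" and k: "k \<in> cpaths T UNIV"
  shows "bounded_variation_on k 0 T" "k 0 = 0" "reflects_along_normals T D x k"
    "variation_measure T k = density (variation_measure T k) (\<lambda>t. indicator (frontier D) (x t))"
proof -
  have sk: "skorokhod T (driver z w \<beta>) k" and eq: "\<And>t. t \<in> {0..T} \<Longrightarrow> x t = driver z w \<beta> t - k t"
    and \<beta>: "set_integrable lebesgue {0..T} \<beta>"
    using s by (auto simp: path_solution_def)
  note r = skorokhod_reflects[OF sk continuous_driver[OF \<beta>] T eq _ cpathsD(2)[OF k]]
  show "bounded_variation_on k 0 T" "reflects_along_normals T D x k"
    "variation_measure T k = density (variation_measure T k) (\<lambda>t. indicator (frontier D) (x t))"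
    by (rule r; simp)+
  show "k 0 = 0" using sk by (simp add: skorokhod_def)
qed

text \<open>A class of processes preserved by the Picard map. The bound by the norm of
  \<open>W\<close> holds at every sample point and gives moments at all times as well as the
  domination behind continuity of the flow.\<close>

definition admissible :: "'w measure \<Rightarrow> ('w \<Rightarrow> 'a cpath) \<Rightarrow> ('w \<Rightarrow> 'a cpath) \<Rightarrow> ('w \<Rightarrow> 'a cpath) \<Rightarrow> bool" where
  "admissible M W X k \<longleftrightarrow> X \<in> M \<rightarrow>\<^sub>M restrict_space borel (cpaths T D) \<and> k \<in> M \<rightarrow>\<^sub>M restrict_space borel (cpaths T UNIV) \<and>
     (\<exists>A\<ge>0. \<forall>\<omega>\<in>space M. norm (k \<omega>) \<le> A + 2 * norm (W \<omega>))"

lemma admissibleD: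
  assumes "admissible M W X k"
  shows "X \<in> M \<rightarrow>\<^sub>M restrict_space borel (cpaths T D)" "k \<in> M \<rightarrow>\<^sub>M restrict_space borel (cpaths T UNIV)"
    "\<And>\<omega>. \<omega> \<in> space M \<Longrightarrow> X \<omega> \<in> cpaths T D" "\<And>\<omega>. \<omega> \<in> space M \<Longrightarrow> k \<omega> \<in> cpaths T UNIV"
proof -
  show 1: "X \<in> M \<rightarrow>\<^sub>M restrict_space borel (cpaths T D)" "k \<in> M \<rightarrow>\<^sub>M restrict_space borel (cpaths T UNIV)"
    using assms by (auto simp: admissible_def)
  show "X \<omega> \<in> cpaths T D" "k \<omega> \<in> cpaths T UNIV" if "\<omega> \<in> space M" for \<omega>
    using measurable_space[OF 1(1) that] measurable_space[OF 1(2) that] by (simp_all add: space_restrict_space)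
qed

lemma admissible_flow:
  assumes inp: "mv_input p T D M \<zeta> W" and adm: "admissible M W X k"
  shows "flow M X k s \<in> prob_moment p (D \<times> UNIV)"
proof -
  obtain A where "0 \<le> A" "\<forall>\<omega>\<in>space M. norm (k \<omega>) \<le> A + 2 * norm (W \<omega>)" using adm by (auto simp: admissible_def)
  then show ?thesis by (intro flow_prob_moment[OF inp admissibleD(1,2)[OF adm], of A]) (auto intro!: AE_I2)
qed

lemma admissible_increment:
  assumes inp: "mv_input p T D M \<zeta> W" and adm: "admissible M W X k"
  obtains A where "0 \<le> A" "\<And>\<omega> s t. \<omega> \<in> space M \<Longrightarrow> norm (X \<omega> s - X \<omega> t) + norm (k \<omega> s - k \<omega> t) \<le> A + 4 * norm (W \<omega>)"
proof -
  obtain A where A: "0 \<le> A" "\<And>\<omega>. \<omega> \<in> space M \<Longrightarrow> norm (k \<omega>) \<le> A + 2 * norm (W \<omega>)" using adm by (auto simp: admissible_def)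
  have "norm (X \<omega> s - X \<omega> t) + norm (k \<omega> s - k \<omega> t) \<le> (dm + 2 * A) + 4 * norm (W \<omega>)" if "\<omega> \<in> space M" for \<omega> s t
  proof -
    have "norm (X \<omega> s - X \<omega> t) \<le> dm" using cpaths_mem_all[OF admissibleD(3)[OF adm that]] T by (intro norm_diff_D) auto
    moreover have "norm (k \<omega> s - k \<omega> t) \<le> norm (k \<omega>) + norm (k \<omega>)"
      using norm_triangle_ineq4[of "k \<omega> s" "k \<omega> t"] norm_bounded[of "k \<omega>" t] norm_bounded[of "k \<omega>" s] by linarith
    ultimately show ?thesis using A(2)[OF that] by linarith
  qed
  then show ?thesis using that[of "dm + 2 * A"] A(1) dm_nonneg by simp
qed

text \<open>Paths are continuous and their increments are dominated by
  \<open>A + 4 * norm (W \<omega>)\<close>, which has a finite \<open>p\<close>-th moment; dominated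
  convergence along sequences of times gives continuity in the Wasserstein distance.\<close>

lemma flow_continuous:
  assumes inp: "mv_input p T D M \<zeta> W" and adm: "admissible M W X k" and \<epsilon>: "0 < \<epsilon>"
  shows "\<exists>d>0. \<forall>t. dist t s < d \<longrightarrow> wasserstein p (flow M X k s) (flow M X k t) \<le> \<epsilon>"
proof -
  interpret prob_space M by (rule mv_inputD(1)[OF inp])
  note X = admissibleD[OF adm]
  obtain A where A: "0 \<le> A" "\<And>\<omega> s t. \<omega> \<in> space M \<Longrightarrow> norm (X \<omega> s - X \<omega> t) + norm (k \<omega> s - k \<omega> t) \<le> A + 4 * norm (W \<omega>)"
    using admissible_increment[OF inp adm] by blast
  define \<delta> where "\<delta> t \<omega> = norm (X \<omega> s - X \<omega> t) + norm (k \<omega> s - k \<omega> t)" for t \<omega>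
  have \<delta>m: "\<delta> t \<in> borel_measurable M" for t
  proof -
    note [measurable] = measurable_eval_bcontfun[OF X(1), of s] measurable_eval_bcontfun[OF X(2), of s]
      measurable_eval_bcontfun[OF X(1), of t] measurable_eval_bcontfun[OF X(2), of t]
    show ?thesis unfolding \<delta>_def[abs_def] by measurable
  qed
  have WM: "W \<in> borel_measurable M" using mv_inputD(5)[OF inp] by (simp add: measurable_restrict_space2_iff)
  have Wm: "(\<lambda>\<omega>. norm (W \<omega>)) \<in> borel_measurable M"
    using measurable_compose[OF WM borel_measurable_continuous_onI[OF continuous_on_norm[OF continuous_on_id]]] by simp
  have "((\<lambda>t. \<integral>\<^sup>+ \<omega>. ennreal (\<delta> t \<omega> powr p) \<partial>M) \<longlongrightarrow> 0) (at s within UNIV)"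
    unfolding tendsto_at_iff_sequentially
  proof (intro allI impI)
    fix t :: "nat \<Rightarrow> real" assume t: "\<forall>i. t i \<in> UNIV - {s}" "t \<longlonglongrightarrow> s"
    have "(\<lambda>n. \<integral>\<^sup>+ \<omega>. ennreal (\<delta> (t n) \<omega> powr p) \<partial>M) \<longlonglongrightarrow> (\<integral>\<^sup>+ \<omega>. 0 \<partial>M)"
    proof (rule nn_integral_dominated_convergence[where w = "\<lambda>\<omega>. ennreal ((A + 4 * norm (W \<omega>)) powr p)"])
      show "(\<lambda>\<omega>. ennreal (\<delta> (t n) \<omega> powr p)) \<in> borel_measurable M" for n using \<delta>m by measurable
      show "(\<lambda>\<omega>. ennreal ((A + 4 * norm (W \<omega>)) powr p)) \<in> borel_measurable M" using Wm by measurable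
      show "AE \<omega> in M. ennreal (\<delta> (t n) \<omega> powr p) \<le> ennreal ((A + 4 * norm (W \<omega>)) powr p)" for n
        using A(2) p by (intro AE_I2 ennreal_leI powr_mono2) (auto simp: \<delta>_def)
      show "(\<integral>\<^sup>+ \<omega>. ennreal ((A + 4 * norm (W \<omega>)) powr p) \<partial>M) < \<infinity>" using A by (intro mv_input_moment[OF inp p]) auto
      show "AE \<omega> in M. (\<lambda>n. ennreal (\<delta> (t n) \<omega> powr p)) \<longlonglongrightarrow> 0"
      proof (rule AE_I2)
        fix \<omega>
        have cont: "isCont (X \<omega>) s" "isCont (k \<omega>) s" by (rule isCont_apply_bcontfun)+
        have "(\<lambda>n. \<delta> (t n) \<omega>) \<longlonglongrightarrow> norm (X \<omega> s - X \<omega> s) + norm (k \<omega> s - k \<omega> s)"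
          unfolding \<delta>_def by (intro tendsto_intros isCont_tendsto_compose[OF cont(1)] isCont_tendsto_compose[OF cont(2)] t)
        then have l0: "(\<lambda>n. \<delta> (t n) \<omega>) \<longlonglongrightarrow> 0" by simp
        have "(\<lambda>n. \<delta> (t n) \<omega> powr p) \<longlonglongrightarrow> 0 powr p"
          using p by (intro tendsto_powr' l0 tendsto_const) (auto simp: \<delta>_def)
        then have "(\<lambda>n. ennreal (\<delta> (t n) \<omega> powr p)) \<longlonglongrightarrow> ennreal (0 powr p)" by (rule tendsto_ennrealI)
        then show "(\<lambda>n. ennreal (\<delta> (t n) \<omega> powr p)) \<longlonglongrightarrow> 0" using p by simp
      qed
    qed simp
    then show "((\<lambda>t. \<integral>\<^sup>+ \<omega>. ennreal (\<delta> t \<omega> powr p) \<partial>M) \<circ> t) \<longlonglongrightarrow> 0" by (simp add: o_def)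
  qed
  moreover have "0 < ennreal (\<epsilon> powr p)" using \<epsilon> by simp
  ultimately have "\<forall>\<^sub>F t in at s. (\<integral>\<^sup>+ \<omega>. ennreal (\<delta> t \<omega> powr p) \<partial>M) < ennreal (\<epsilon> powr p)"
    by (intro order_tendstoD(2)) auto
  then obtain d where d: "d > 0" "\<And>t. t \<noteq> s \<Longrightarrow> dist t s < d \<Longrightarrow> (\<integral>\<^sup>+ \<omega>. ennreal (\<delta> t \<omega> powr p) \<partial>M) < ennreal (\<epsilon> powr p)"
    unfolding eventually_at by auto
  have "wasserstein p (flow M X k s) (flow M X k t) \<le> \<epsilon>" if "dist t s < d" for t
  proof (rule flow_wasserstein_le[OF X(1,2) X(1,2) _ less_imp_le[OF \<epsilon>]])
    show "(\<integral>\<^sup>+ \<omega>. ennreal ((norm (X \<omega> s - X \<omega> t) + norm (k \<omega> s - k \<omega> t)) powr p) \<partial>M) \<le> ennreal (\<epsilon> powr p)"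
      using d(2)[OF _ that] p by (cases "t = s") (auto simp: \<delta>_def less_imp_le)
  qed
  then show ?thesis using d(1) by blast
qed

lemma flow_measurable:
  assumes inp: "mv_input p T D M \<zeta> W" and adm: "admissible M W X k"
  shows "flow M X k \<in> borel \<rightarrow>\<^sub>M wasserstein_borel p (D \<times> UNIV)"
  unfolding wasserstein_borel_def
proof (rule measurable_measure_of)
  interpret W: Metric_space "prob_moment p (D \<times> (UNIV :: 'a set))" "wasserstein p" by (rule Metric_space_wasserstein[OF p])
  show "{U. W.mopen U} \<subseteq> Pow (prob_moment p (D \<times> UNIV))" by (auto simp: W.mopen_def)
  show "flow M X k \<in> space borel \<rightarrow> prob_moment p (D \<times> UNIV)" using admissible_flow[OF inp adm] by auto
  fix U assume "U \<in> {U. W.mopen U}"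
  then have U: "W.mopen U" by simp
  have "open (flow M X k -` U)"
    unfolding open_dist
  proof
    fix s assume "s \<in> flow M X k -` U"
    then obtain r where r: "r > 0" "W.mball (flow M X k s) r \<subseteq> U" using U unfolding W.mopen_def by blast
    have "0 < r / 2" using r by simp
    from flow_continuous[OF inp adm this, of s]
    obtain d where d: "d > 0" "\<And>t. dist t s < d \<Longrightarrow> wasserstein p (flow M X k s) (flow M X k t) \<le> r / 2" by blast
    have "flow M X k t \<in> U" if "dist t s < d" for t
    proof -
      have "flow M X k t \<in> W.mball (flow M X k s) r"
        using d(2)[OF that] r(1) admissible_flow[OF inp adm] by (simp add: W.in_mball)
      then show ?thesis using r(2) by blast
    qed
    then show "\<exists>e>0. \<forall>y. dist y s < e \<longrightarrow> y \<in> flow M X k -` U" using d(1) by auto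
  qed
  then show "flow M X k -` U \<inter> space borel \<in> sets borel" by simp
qed

text \<open>The path at time \<open>s\<close> is the limit of its values at the dyadic times below
  \<open>s\<close>, and each approximation selects among countably many measurable
  evaluations.\<close>

lemma path_jointly_measurable:
  fixes X :: "'w \<Rightarrow> 'a cpath"
  assumes X: "X \<in> M \<rightarrow>\<^sub>M restrict_space borel (cpaths T S)"
  shows "(\<lambda>(\<omega>, s). X \<omega> s) \<in> borel_measurable (M \<Otimes>\<^sub>M borel)"
proof (rule borel_measurable_LIMSEQ_metric)
  fix n :: nat
  have 1: "(\<lambda>z :: 'w \<times> real. X (fst z) (real_of_int i / 2 ^ n)) \<in> borel_measurable (M \<Otimes>\<^sub>M borel)" for i
    using measurable_compose[OF measurable_fst measurable_eval_bcontfun[OF X]] .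
  have 2: "(\<lambda>z :: 'w \<times> real. \<lfloor>2 ^ n * snd z\<rfloor>) \<in> M \<Otimes>\<^sub>M borel \<rightarrow>\<^sub>M count_space UNIV" by measurable
  show "(\<lambda>z :: 'w \<times> real. X (fst z) (real_of_int \<lfloor>2 ^ n * snd z\<rfloor> / 2 ^ n)) \<in> borel_measurable (M \<Otimes>\<^sub>M borel)"
    using measurable_compose_countable[OF 1 2] .
next
  fix z :: "'w \<times> real"
  have "(\<lambda>n. real_of_int \<lfloor>2 ^ n * snd z\<rfloor> / 2 ^ n) \<longlonglongrightarrow> snd z"
  proof (rule LIMSEQ_I)
    fix e :: real assume e: "0 < e"
    obtain n0 where n0: "(1/2) ^ n0 < e" using real_arch_pow_inv[OF e, of "1/2"] by auto
    have "norm (real_of_int \<lfloor>2 ^ n * snd z\<rfloor> / 2 ^ n - snd z) < e" if "n \<ge> n0" for n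
    proof -
      have "(1/2::real) ^ n \<le> (1/2) ^ n0" using that by (intro power_decreasing) auto
      then have "1 / 2 ^ n < e" using n0 by (simp add: power_one_over)
      moreover have "\<bar>real_of_int \<lfloor>2 ^ n * snd z\<rfloor> - 2 ^ n * snd z\<bar> \<le> 1" by linarith
      then have "\<bar>real_of_int \<lfloor>2 ^ n * snd z\<rfloor> - 2 ^ n * snd z\<bar> / 2 ^ n \<le> 1 / 2 ^ n" by (intro divide_right_mono) auto
      moreover have "\<bar>real_of_int \<lfloor>2 ^ n * snd z\<rfloor> - 2 ^ n * snd z\<bar> / 2 ^ n = \<bar>(real_of_int \<lfloor>2 ^ n * snd z\<rfloor> - 2 ^ n * snd z) / 2 ^ n\<bar>"
        by (simp only: abs_divide power_abs abs_numeral)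
      moreover have "(real_of_int \<lfloor>2 ^ n * snd z\<rfloor> - 2 ^ n * snd z) / 2 ^ n = real_of_int \<lfloor>2 ^ n * snd z\<rfloor> / 2 ^ n - snd z"
        by (simp add: diff_divide_distrib)
      ultimately show ?thesis unfolding real_norm_def by linarith
    qed
    then show "\<exists>no. \<forall>n\<ge>no. norm (real_of_int \<lfloor>2 ^ n * snd z\<rfloor> / 2 ^ n - snd z) < e" by blast
  qed
  moreover have "isCont (X (fst z)) (snd z)" by (rule isCont_apply_bcontfun)+
  ultimately show "(\<lambda>n. X (fst z) (real_of_int \<lfloor>2 ^ n * snd z\<rfloor> / 2 ^ n)) \<longlonglongrightarrow> (case z of (\<omega>, s) \<Rightarrow> X \<omega> s)"
    unfolding case_prod_beta by (rule isCont_tendsto_compose[rotated])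
qed

text \<open>Joint measurability of \<open>b\<close> is composed with time, position and flow.
  Clamping the time makes \<open>s\<close> range over the line, while \<open>b\<close> is measurable
  on \<open>[0,T]\<close>.\<close>

lemma drift_measurable:
  fixes M :: "'w measure"
  assumes inp: "mv_input p T D M \<zeta> W" and adm: "admissible M W X k"
  shows "(\<lambda>(\<omega>, s). drift M X k \<omega> (max 0 (min T s))) \<in> borel_measurable (M \<Otimes>\<^sub>M borel)"
proof -
  note X = admissibleD[OF adm]
  have clamp: "(\<lambda>s. max 0 (min T s)) \<in> borel \<rightarrow>\<^sub>M restrict_space borel {0..T}"
    using T by (intro measurable_restrict_space2) auto
  have clamp': "(\<lambda>s. max 0 (min T s)) \<in> borel_measurable borel" by measurable
  have 1: "(\<lambda>z :: 'w \<times> real. max 0 (min T (snd z))) \<in> M \<Otimes>\<^sub>M borel \<rightarrow>\<^sub>M restrict_space borel {0..T}"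
    using measurable_compose[OF measurable_snd clamp] .
  have "(\<lambda>z :: 'w \<times> real. (fst z, max 0 (min T (snd z)))) \<in> M \<Otimes>\<^sub>M borel \<rightarrow>\<^sub>M M \<Otimes>\<^sub>M borel"
    using measurable_fst measurable_compose[OF measurable_snd clamp'] by (rule measurable_Pair)
  from measurable_compose[OF this path_jointly_measurable[OF X(1)]]
  have "(\<lambda>z. X (fst z) (max 0 (min T (snd z)))) \<in> borel_measurable (M \<Otimes>\<^sub>M borel)" by simp
  then have 2: "(\<lambda>z. X (fst z) (max 0 (min T (snd z)))) \<in> M \<Otimes>\<^sub>M borel \<rightarrow>\<^sub>M restrict_space borel D"
    using cpaths_mem_all[OF X(3)] T by (intro measurable_restrict_space2) (auto simp: space_pair_measure)
  have 3: "(\<lambda>z :: 'w \<times> real. flow M X k (max 0 (min T (snd z)))) \<in> M \<Otimes>\<^sub>M borel \<rightarrow>\<^sub>M wasserstein_borel p (D \<times> UNIV)"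
    using measurable_compose[OF measurable_compose[OF measurable_snd clamp'] flow_measurable[OF inp adm]] .
  from measurable_compose[OF measurable_Pair[OF 1 measurable_Pair[OF 2 3]] b_measurable]
  show ?thesis by (simp add: drift_def case_prod_beta)
qed

text \<open>The section of \<open>b\<close> at the reference pair \<open>(x0, \<nu>)\<close> is
  integrable in time. Positions stay within \<open>dm\<close> of \<open>x0\<close>, and the flow
  stays within a fixed distance of \<open>\<nu>\<close>, by the triangle inequality through the law
  at time 0. The resulting bound is the same for all samples.\<close>

lemma drift_bound:
  assumes inp: "mv_input p T D M \<zeta> W" and adm: "admissible M W X k"
  obtains B where "set_integrable lebesgue {0..T} B"
    "\<And>\<omega> s. \<omega> \<in> space M \<Longrightarrow> s \<in> {0..T} \<Longrightarrow> norm (drift M X k \<omega> s) \<le> (B s :: real)"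
proof -
  note X = admissibleD[OF adm]
  obtain x0 \<nu> where x0: "x0 \<in> D" "\<nu> \<in> prob_moment p (D \<times> UNIV)" "set_integrable lebesgue {0..T} (\<lambda>t. b t x0 \<nu>)"
    using b_integrable by blast
  obtain A where A: "0 \<le> A" "\<And>\<omega> s t. \<omega> \<in> space M \<Longrightarrow> norm (X \<omega> s - X \<omega> t) + norm (k \<omega> s - k \<omega> t) \<le> A + 4 * norm (W \<omega>)"
    using admissible_increment[OF inp adm] by blast
  let ?I = "\<integral>\<^sup>+ \<omega>. ennreal ((A + 4 * norm (W \<omega>)) powr p) \<partial>M"
  have fin: "?I < \<infinity>" using A by (intro mv_input_moment[OF inp p]) auto
  define n0 where "n0 = enn2real ?I powr (1 / p)"
  have W0: "wasserstein p (flow M X k s) (flow M X k 0) \<le> n0" for s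
  proof (rule flow_wasserstein_le[OF X(1,2) X(1,2)])
    have "(\<integral>\<^sup>+ \<omega>. ennreal ((norm (X \<omega> s - X \<omega> 0) + norm (k \<omega> s - k \<omega> 0)) powr p) \<partial>M) \<le> ?I"
      using A(2) p by (intro nn_integral_mono ennreal_leI powr_mono2) auto
    also have "?I = ennreal (n0 powr p)" unfolding n0_def using enn2real_powr_root[OF fin p] by simp
    finally show "(\<integral>\<^sup>+ \<omega>. ennreal ((norm (X \<omega> s - X \<omega> 0) + norm (k \<omega> s - k \<omega> 0)) powr p) \<partial>M) \<le> ennreal (n0 powr p)" .
  qed (simp add: n0_def)
  define c where "c = n0 + wasserstein p (flow M X k 0) \<nu>"
  have Wc: "wasserstein p (flow M X k s) \<nu> \<le> c" for s
    using wasserstein_triangle[OF admissible_flow[OF inp adm, of s] admissible_flow[OF inp adm, of 0] x0(2) p] W0[of s]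
    by (simp add: c_def)
  have "norm (drift M X k \<omega> s) \<le> norm (b s x0 \<nu>) + L * (dm + c)" if \<omega>: "\<omega> \<in> space M" and s: "s \<in> {0..T}" for \<omega> s
  proof -
    have Xs: "X \<omega> s \<in> D" using cpathsD(1)[OF X(3)[OF \<omega>] s] .
    have "norm (drift M X k \<omega> s - b s x0 \<nu>) \<le> L * (norm (X \<omega> s - x0) + wasserstein p (flow M X k s) \<nu>)"
      unfolding drift_def by (rule b_lip[OF s Xs x0(1) admissible_flow[OF inp adm] x0(2)])
    also have "\<dots> \<le> L * (dm + c)" using norm_diff_D[OF Xs x0(1)] Wc[of s] L_pos by (intro mult_left_mono add_mono) auto
    finally show ?thesis using norm_triangle_sub[of "drift M X k \<omega> s" "b s x0 \<nu>"] by linarith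
  qed
  moreover have "set_integrable lebesgue {0..T} (\<lambda>s. norm (b s x0 \<nu>) + L * (dm + c))"
    using set_integrable_norm[OF x0(3)] set_integrable_exp(1)[of T "L * (dm + c)" 0] by (intro set_integral_add(1)) auto
  ultimately show ?thesis using that by blast
qed

lemma drift_integrable:
  assumes inp: "mv_input p T D M \<zeta> W" and adm: "admissible M W X k"
  shows "\<omega> \<in> space M \<Longrightarrow> set_integrable lebesgue {0..T} (drift M X k \<omega>)"
    "t \<in> {0..T} \<Longrightarrow> (\<lambda>\<omega>. LINT s:{0..t}|lebesgue. drift M X k \<omega> s) \<in> borel_measurable M"
proof -
  note dr = drift_measurable[OF inp adm]
  have sec: "(\<lambda>s. drift M X k \<omega> (max 0 (min T s))) \<in> borel_measurable borel" if "\<omega> \<in> space M" for \<omega>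
    using measurable_compose[OF measurable_Pair1'[OF that] dr] by simp
  have ind: "indicator {0..t} s *\<^sub>R drift M X k \<omega> s = indicator {0..t} s *\<^sub>R drift M X k \<omega> (max 0 (min T s))"
    if "t \<le> T" for t s \<omega> using that by (auto simp: indicator_def)
  have meas: "(\<lambda>s. indicator {0..t} s *\<^sub>R drift M X k \<omega> s) \<in> borel_measurable lborel" if "\<omega> \<in> space M" "t \<le> T" for t \<omega>
    unfolding ind[OF that(2)] using sec[OF that(1)] by measurable
  { assume \<omega>: "\<omega> \<in> space M"
    obtain B where B: "set_integrable lebesgue {0..T} B"
      "\<And>\<omega> s. \<omega> \<in> space M \<Longrightarrow> s \<in> {0..T} \<Longrightarrow> norm (drift M X k \<omega> s) \<le> B s"
      using drift_bound[OF inp adm] by blast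
    show "set_integrable lebesgue {0..T} (drift M X k \<omega>)"
    proof (rule set_integrable_bound[OF B(1)])
      show "set_borel_measurable lebesgue {0..T} (drift M X k \<omega>)"
        unfolding set_borel_measurable_def using meas[OF \<omega> order_refl] by (rule measurable_completion)
      show "AE s in lebesgue. s \<in> {0..T} \<longrightarrow> norm (drift M X k \<omega> s) \<le> norm (B s)"
        using B(2)[OF \<omega>] unfolding real_norm_def by (intro AE_I2 impI order_trans[OF _ abs_ge_self])
    qed }
  assume t: "t \<in> {0..T}"
  \<comment> \<open>Completed Lebesgue measure is traded for \<open>lborel\<close>, on which the
    integrand is Borel; measurability of the parameter integral then follows from joint
    measurability and sigma-finiteness.\<close>
  have eq: "(LINT s:{0..t}|lebesgue. drift M X k \<omega> s) = (\<integral>s. indicator {0..t} s *\<^sub>R drift M X k \<omega> (max 0 (min T s)) \<partial>lborel)"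
    if "\<omega> \<in> space M" for \<omega>
  proof -
    have "t \<le> T" using t by simp
    show ?thesis unfolding ind[OF \<open>t \<le> T\<close>, symmetric] set_lebesgue_integral_def
      by (rule integral_completion[OF meas[OF that \<open>t \<le> T\<close>]])
  qed
  have "(\<lambda>(\<omega>, s). drift M X k \<omega> (max 0 (min T s))) \<in> borel_measurable (M \<Otimes>\<^sub>M lborel)"
    using dr measurable_cong_sets[OF sets_pair_measure_cong[OF refl sets_lborel] refl, of M borel] by blast
  then have "(\<lambda>(\<omega>, s). indicator {0..t} s *\<^sub>R drift M X k \<omega> (max 0 (min T s))) \<in> borel_measurable (M \<Otimes>\<^sub>M lborel)"
    unfolding case_prod_beta by (intro borel_measurable_scaleR) auto
  then have "(\<lambda>\<omega>. \<integral>s. indicator {0..t} s *\<^sub>R drift M X k \<omega> (max 0 (min T s)) \<partial>lborel) \<in> borel_measurable M"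
    by (rule lborel.borel_measurable_lebesgue_integral)
  then show "(\<lambda>\<omega>. LINT s:{0..t}|lebesgue. drift M X k \<omega> s) \<in> borel_measurable M"
    by (rule measurable_cong[THEN iffD2, rotated]) (rule eq)
qed

section \<open>Picard iteration\<close>

definition picardX :: "'w measure \<Rightarrow> ('w \<Rightarrow> 'a) \<Rightarrow> ('w \<Rightarrow> 'a cpath) \<Rightarrow> ('w \<Rightarrow> 'a cpath) \<Rightarrow> ('w \<Rightarrow> 'a cpath) \<Rightarrow> 'w \<Rightarrow> 'a cpath" where
  "picardX M \<zeta> W X k \<omega> = solX (\<zeta> \<omega>) (W \<omega>) (drift M X k \<omega>)"

definition picardK :: "'w measure \<Rightarrow> ('w \<Rightarrow> 'a) \<Rightarrow> ('w \<Rightarrow> 'a cpath) \<Rightarrow> ('w \<Rightarrow> 'a cpath) \<Rightarrow> ('w \<Rightarrow> 'a cpath) \<Rightarrow> 'w \<Rightarrow> 'a cpath" where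
  "picardK M \<zeta> W X k \<omega> = solK (\<zeta> \<omega>) (W \<omega>) (drift M X k \<omega>)"

lemma integral_norm_le_bound:
  assumes \<beta>: "set_integrable lebesgue {0..T} \<beta>" and B: "set_integrable lebesgue {0..T} B"
    and le: "\<And>s. s \<in> {0..T} \<Longrightarrow> norm (\<beta> s :: 'a) \<le> B s" and t: "t \<in> {0..T}"
  shows "norm (LINT s:{0..t}|lebesgue. \<beta> s) \<le> (LINT s:{0..T}|lebesgue. B s)"
proof -
  have it: "set_integrable lebesgue {0..t} \<beta>" using t by (intro set_integrable_subset[OF \<beta>]) auto
  then have "norm (LINT s:{0..t}|lebesgue. \<beta> s) \<le> (LINT s:{0..t}|lebesgue. norm (\<beta> s))" by (rule set_integral_norm_bound)
  also have "\<dots> \<le> (LINT s:{0..T}|lebesgue. B s)"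
    unfolding set_lebesgue_integral_def
  proof (rule integral_mono)
    show "integrable lebesgue (\<lambda>s. indicator {0..t} s *\<^sub>R norm (\<beta> s))" using set_integrable_norm[OF it] by (simp add: set_integrable_def)
    show "integrable lebesgue (\<lambda>s. indicator {0..T} s *\<^sub>R B s)" using B by (simp add: set_integrable_def)
    fix s show "indicator {0..t} s *\<^sub>R norm (\<beta> s) \<le> indicator {0..T} s *\<^sub>R B s"
    proof (cases "s \<in> {0..T}")
      case True
      then have "norm (\<beta> s) \<le> B s" "0 \<le> B s" using le[OF True] order_trans[OF norm_ge_zero] by auto
      then show ?thesis using True by (auto simp: indicator_def)
    next
      case False
      then show ?thesis using t by (auto simp: indicator_def)
    qed
  qed
  finally show ?thesis .
qed

lemma picard_admissible:
  assumes inp: "mv_input p T D M \<zeta> W" and adm: "admissible M W X k"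
  shows "admissible M W (picardX M \<zeta> W X k) (picardK M \<zeta> W X k)"
proof -
  obtain B where B: "set_integrable lebesgue {0..T} B"
    "\<And>\<omega> s. \<omega> \<in> space M \<Longrightarrow> s \<in> {0..T} \<Longrightarrow> norm (drift M X k \<omega> s) \<le> B s"
    using drift_bound[OF inp adm] by blast
  note di = drift_integrable[OF inp adm] and z = mv_inputD(2)[OF inp]
  define A where "A = (LINT s:{0..T}|lebesgue. B s)"
  have le: "norm (LINT s:{0..t}|lebesgue. drift M X k \<omega> s) \<le> A" if "\<omega> \<in> space M" "t \<in> {0..T}" for \<omega> t
    unfolding A_def by (rule integral_norm_le_bound[OF di(1)[OF that(1)] B(1) B(2)[OF that(1)] that(2)])
  have "norm (picardK M \<zeta> W X k \<omega>) \<le> dm + A + 2 * norm (W \<omega>)" if "\<omega> \<in> space M" for \<omega>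
    unfolding picardK_def
    using le[OF that] by (intro path_solution_norm_le[OF sol_path(1)[OF z[OF that] di(1)[OF that]] z[OF that]]
        sol_path(2,3)[OF z[OF that] di(1)[OF that]])
  then have "norm (picardK M \<zeta> W X k \<omega>) \<le> \<bar>dm + A\<bar> + 2 * norm (W \<omega>)" if "\<omega> \<in> space M" for \<omega> using that by force
  then show ?thesis
    unfolding admissible_def picardX_def[abs_def] picardK_def[abs_def]
    using sol_measurable[OF inp di] by (auto intro!: exI[of _ "\<bar>dm + A\<bar>"])
qed

text \<open>A bound \<open>m\<close> valid at every sample also bounds the distance of the flows, so
  position and law together contribute \<open>2 * m\<close> to the difference of the drifts, and
  2/32 is 1/16. Uniformity in \<open>\<omega>\<close> spares any moment inequality here.\<close>

lemma picard_contraction: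
  assumes inp: "mv_input p T D M \<zeta> W" and adm: "admissible M W X k" "admissible M W X' k'"
    and m: "0 \<le> m" "\<And>\<omega> s. \<omega> \<in> space M \<Longrightarrow> s \<in> {0..T} \<Longrightarrow> norm (X \<omega> s - X' \<omega> s) + norm (k \<omega> s - k' \<omega> s) \<le> m * exp (lam * s)"
    and \<omega>: "\<omega> \<in> space M" and t: "t \<in> {0..T}"
  shows "norm (picardX M \<zeta> W X k \<omega> t - picardX M \<zeta> W X' k' \<omega> t) + norm (picardK M \<zeta> W X k \<omega> t - picardK M \<zeta> W X' k' \<omega> t) \<le> m / 16 * exp (lam * t)"
proof -
  note X = admissibleD[OF adm(1)] and X' = admissibleD[OF adm(2)]
  have W: "wasserstein p (flow M X k s) (flow M X' k' s) \<le> m * exp (lam * s)" if "s \<in> {0..T}" for s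
    using m that by (intro flow_wasserstein_le_AE[OF mv_inputD(1)[OF inp] X(1,2) X'(1,2)]) (auto intro!: AE_I2)
  have "norm (drift M X k \<omega> s - drift M X' k' \<omega> s) \<le> L * (2 * m * exp (lam * s))" if s: "s \<in> {0..T}" for s
  proof -
    have "norm (drift M X k \<omega> s - drift M X' k' \<omega> s) \<le> L * (norm (X \<omega> s - X' \<omega> s) + wasserstein p (flow M X k s) (flow M X' k' s))"
      unfolding drift_def using cpathsD(1)[OF X(3)[OF \<omega>] s] cpathsD(1)[OF X'(3)[OF \<omega>] s] s
      by (intro b_lip admissible_flow[OF inp adm(1)] admissible_flow[OF inp adm(2)])
    also have "\<dots> \<le> L * (2 * m * exp (lam * s))"
    proof (rule mult_left_mono)
      show "norm (X \<omega> s - X' \<omega> s) + wasserstein p (flow M X k s) (flow M X' k' s) \<le> 2 * m * exp (lam * s)"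
        using m(2)[OF \<omega> s] W[OF s] norm_ge_zero[of "k \<omega> s - k' \<omega> s"] by linarith
    qed (use L_pos in simp)
    finally show ?thesis .
  qed
  then have "norm (solX (\<zeta> \<omega>) (W \<omega>) (drift M X k \<omega>) t - solX (\<zeta> \<omega>) (W \<omega>) (drift M X' k' \<omega>) t) +
      norm (solK (\<zeta> \<omega>) (W \<omega>) (drift M X k \<omega>) t - solK (\<zeta> \<omega>) (W \<omega>) (drift M X' k' \<omega>) t)
    \<le> C1 * (norm (\<zeta> \<omega> - \<zeta> \<omega>) + 2 * dist (W \<omega>) (W \<omega>)) + 2 * m / 32 * exp (lam * t)"
    using m(1) \<omega> by (intro path_solution_estimate[OF sol_path(1) sol_path(1) t] mv_inputD(2)[OF inp]
        drift_integrable(1)[OF inp adm(1)] drift_integrable(1)[OF inp adm(2)]) auto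
  then show ?thesis by (simp add: picardX_def picardK_def)
qed

lemma solution_of_fixed_point:
  assumes inp: "mv_input p T D M \<zeta> W" and adm: "admissible M W X k"
    and fp: "\<And>\<omega>. \<omega> \<in> space M \<Longrightarrow> X \<omega> = picardX M \<zeta> W X k \<omega>" "\<And>\<omega>. \<omega> \<in> space M \<Longrightarrow> k \<omega> = picardK M \<zeta> W X k \<omega>"
  shows "mv_solution p T D b M \<zeta> W X k"
proof -
  note X = admissibleD[OF adm]
  have "bounded_variation_on (k \<omega>) 0 T \<and> k \<omega> 0 = 0 \<and> set_integrable lebesgue {0..T} (drift M X k \<omega>) \<and>
        (\<forall>t\<in>{0..T}. X \<omega> t = \<zeta> \<omega> + (LINT s:{0..t}|lebesgue. drift M X k \<omega> s) + W \<omega> t - W \<omega> 0 - k \<omega> t) \<and>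
        variation_measure T (k \<omega>) = density (variation_measure T (k \<omega>)) (\<lambda>t. indicator (frontier D) (X \<omega> t)) \<and>
        reflects_along_normals T D (X \<omega>) (k \<omega>)" if \<omega>: "\<omega> \<in> space M" for \<omega>
  proof -
    have "path_solution (\<zeta> \<omega>) (W \<omega>) (drift M X k \<omega>) (picardX M \<zeta> W X k \<omega>) (picardK M \<zeta> W X k \<omega>)"
      unfolding picardX_def picardK_def using \<omega> by (intro sol_path(1) mv_inputD(2)[OF inp] drift_integrable(1)[OF inp adm])
    then have ps: "path_solution (\<zeta> \<omega>) (W \<omega>) (drift M X k \<omega>) (X \<omega>) (k \<omega>)" using fp[OF \<omega>] by simp
    show ?thesis
      using path_solution_reflects[OF ps X(3)[OF \<omega>] X(4)[OF \<omega>]] ps by (auto simp: path_solution_def driver_def)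
  qed
  then have "AE \<omega> in M. bounded_variation_on (k \<omega>) 0 T \<and> k \<omega> 0 = 0 \<and> set_integrable lebesgue {0..T} (drift M X k \<omega>) \<and>
        (\<forall>t\<in>{0..T}. X \<omega> t = \<zeta> \<omega> + (LINT s:{0..t}|lebesgue. drift M X k \<omega> s) + W \<omega> t - W \<omega> 0 - k \<omega> t) \<and>
        variation_measure T (k \<omega>) = density (variation_measure T (k \<omega>)) (\<lambda>t. indicator (frontier D) (X \<omega> t)) \<and>
        reflects_along_normals T D (X \<omega>) (k \<omega>)" by (rule AE_I2)
  moreover have "AE t in lebesgue. t \<in> {0..T} \<longrightarrow> flow M X k t \<in> prob_moment p (D \<times> UNIV)"
    using admissible_flow[OF inp adm] by (intro AE_I2) blast
  ultimately show ?thesis using X(1,2) unfolding mv_solution_def flow_def drift_def[abs_def] by blast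
qed

text \<open>Consecutive iterates differ by a deterministic multiple of \<open>16 ^ -n\<close>,
  uniformly in time and sample, so the limit exists everywhere, is measurable, inherits the
  admissibility bound, and is a fixed point at every sample.\<close>

lemma solution_exists:
  assumes inp: "mv_input p T D M \<zeta> W"
  shows "\<exists>X k. mv_solution p T D b M \<zeta> W X k"
proof -
  note z = mv_inputD(2)[OF inp] and T0 = less_imp_le[OF T]
  have i0: "set_integrable lebesgue {0..T} (\<lambda>_. 0 :: 'a)" by (simp add: set_integrable_def)
  \<comment> \<open>Starting from zero drift makes the first iterate a reflected path of an input
    with a known driver, hence admissible and comparable with the next iterate.\<close>
  define X0 k0 where "X0 \<omega> = solX (\<zeta> \<omega>) (W \<omega>) (\<lambda>_. 0)" and "k0 \<omega> = solK (\<zeta> \<omega>) (W \<omega>) (\<lambda>_. 0)" for \<omega>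
  have p0: "path_solution (\<zeta> \<omega>) (W \<omega>) (\<lambda>_. 0) (X0 \<omega>) (k0 \<omega>)" if "\<omega> \<in> space M" for \<omega>
    unfolding X0_def k0_def by (rule sol_path(1)[OF z[OF that] i0])
  have adm0: "admissible M W X0 k0"
  proof -
    have "norm (k0 \<omega>) \<le> dm + 0 + 2 * norm (W \<omega>)" if "\<omega> \<in> space M" for \<omega>
      by (rule path_solution_norm_le[OF p0[OF that] z[OF that]])
        (use sol_path(2,3)[OF z[OF that] i0] in \<open>auto simp: X0_def k0_def set_lebesgue_integral_def\<close>)
    moreover have "k0 \<in> M \<rightarrow>\<^sub>M restrict_space borel (cpaths T UNIV)" "X0 \<in> M \<rightarrow>\<^sub>M restrict_space borel (cpaths T D)"
      unfolding X0_def[abs_def] k0_def[abs_def]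
      by (rule sol_measurable[OF inp i0]; simp add: set_lebesgue_integral_def)+
    ultimately show ?thesis unfolding admissible_def using dm_nonneg by (auto intro!: exI[of _ dm])
  qed
  define Y where "Y = rec_nat (X0, k0) (\<lambda>_ Y. (picardX M \<zeta> W (fst Y) (snd Y), picardK M \<zeta> W (fst Y) (snd Y)))"
  define Xs ks where "Xs n = fst (Y n)" and "ks n = snd (Y n)" for n
  have Y0: "Xs 0 = X0" "ks 0 = k0" by (simp_all add: Xs_def ks_def Y_def)
  have YS: "Xs (Suc n) = picardX M \<zeta> W (Xs n) (ks n)" "ks (Suc n) = picardK M \<zeta> W (Xs n) (ks n)" for n
    by (simp_all add: Xs_def ks_def Y_def)
  have adm: "admissible M W (Xs n) (ks n)" for n
    by (induction n) (simp_all add: Y0 YS adm0 picard_admissible[OF inp])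
  note Xn = admissibleD(3,4)[OF adm]
  obtain B where B: "set_integrable lebesgue {0..T} B"
    "\<And>\<omega> s. \<omega> \<in> space M \<Longrightarrow> s \<in> {0..T} \<Longrightarrow> norm (drift M X0 k0 \<omega> s) \<le> B s"
    using drift_bound[OF inp adm0] by blast
  \<comment> \<open>The first two drivers differ only by the integrated drift, for which
    \<open>drift_bound\<close> has a bound free of \<open>\<omega>\<close>.\<close>
  define m0 where "m0 = C1 * \<bar>LINT s:{0..T}|lebesgue. B s\<bar>"
  have m0: "0 \<le> m0" using C1_pos by (simp add: m0_def)
  have diff: "norm (Xs n \<omega> t - Xs (Suc n) \<omega> t) + norm (ks n \<omega> t - ks (Suc n) \<omega> t) \<le> m0 / 16 ^ n * exp (lam * t)"
    if \<omega>: "\<omega> \<in> space M" and t: "t \<in> {0..T}" for n \<omega> t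
    using that
  proof (induction n arbitrary: \<omega> t)
    case 0
    note di = drift_integrable(1)[OF inp adm0 0(1)]
    have "norm (X0 \<omega> t - solX (\<zeta> \<omega>) (W \<omega>) (drift M X0 k0 \<omega>) t) + norm (k0 \<omega> t - solK (\<zeta> \<omega>) (W \<omega>) (drift M X0 k0 \<omega>) t)
      \<le> C1 * \<bar>LINT s:{0..T}|lebesgue. B s\<bar>"
    proof (rule path_solution_diff[OF p0[OF 0(1)] sol_path(1)[OF z[OF 0(1)] di] 0(2)])
      fix s assume "s \<in> {0..t}"
      then have s: "s \<in> {0..T}" using 0 by auto
      have "norm (LINT r:{0..s}|lebesgue. drift M X0 k0 \<omega> r) \<le> (LINT r:{0..T}|lebesgue. B r)"
        by (rule integral_norm_le_bound[OF di B(1) B(2)[OF 0(1)] s])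
      then have "norm ((LINT r:{0..s}|lebesgue. 0) - (LINT r:{0..s}|lebesgue. drift M X0 k0 \<omega> r)) \<le> \<bar>LINT r:{0..T}|lebesgue. B r\<bar>"
        by (simp add: set_lebesgue_integral_def)
      from driver_diff[OF i0 di s this, of "\<zeta> \<omega>" "W \<omega>" "\<zeta> \<omega>" "W \<omega>"]
      show "norm (driver (\<zeta> \<omega>) (W \<omega>) (\<lambda>_. 0) s - driver (\<zeta> \<omega>) (W \<omega>) (drift M X0 k0 \<omega>) s) \<le> \<bar>LINT s:{0..T}|lebesgue. B s\<bar>"
        by simp
    qed
    also have "\<dots> = m0 * 1" by (simp add: m0_def)
    also have "\<dots> \<le> m0 * exp (lam * t)" using m0 0 lam_pos by (intro mult_left_mono) auto
    finally show ?case by (simp add: Y0 YS picardX_def picardK_def)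
  next
    case (Suc n)
    have "norm (picardX M \<zeta> W (Xs n) (ks n) \<omega> t - picardX M \<zeta> W (Xs (Suc n)) (ks (Suc n)) \<omega> t) +
        norm (picardK M \<zeta> W (Xs n) (ks n) \<omega> t - picardK M \<zeta> W (Xs (Suc n)) (ks (Suc n)) \<omega> t) \<le> m0 / 16 ^ n / 16 * exp (lam * t)"
      using m0 by (intro picard_contraction[OF inp adm adm _ Suc.IH Suc.prems]) auto
    then show ?case by (simp add: YS mult.commute)
  qed
  define c where "c = m0 * exp (lam * T)"
  have c0: "0 \<le> c" using m0 by (simp add: c_def)
  have le: "norm (Xs n \<omega> t - Xs (Suc n) \<omega> t) + norm (ks n \<omega> t - ks (Suc n) \<omega> t) \<le> c / 16 ^ n"
    if "\<omega> \<in> space M" "t \<in> {0..T}" for n \<omega> t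
  proof -
    have "m0 / 16 ^ n * exp (lam * t) \<le> m0 / 16 ^ n * exp (lam * T)" using m0 that lam_pos by (intro mult_left_mono) auto
    then show ?thesis using diff[OF that, of n] by (simp add: c_def)
  qed
  have dX: "dist (Xs n \<omega>) (Xs (Suc n) \<omega>) \<le> c / 16 ^ n" if "\<omega> \<in> space M" for n \<omega>
  proof (rule dist_cpaths_le[OF Xn(1)[OF that] Xn(1)[OF that] T0])
    fix t assume "t \<in> {0..T}"
    then show "dist (Xs n \<omega> t) (Xs (Suc n) \<omega> t) \<le> c / 16 ^ n"
      using le[OF that, of t n] norm_ge_zero[of "ks n \<omega> t - ks (Suc n) \<omega> t"] unfolding dist_norm by linarith
  qed
  have dk: "dist (ks n \<omega>) (ks (Suc n) \<omega>) \<le> c / 16 ^ n" if "\<omega> \<in> space M" for n \<omega>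
  proof (rule dist_cpaths_le[OF Xn(2)[OF that] Xn(2)[OF that] T0])
    fix t assume "t \<in> {0..T}"
    then show "dist (ks n \<omega> t) (ks (Suc n) \<omega> t) \<le> c / 16 ^ n"
      using le[OF that, of t n] norm_ge_zero[of "Xs n \<omega> t - Xs (Suc n) \<omega> t"] unfolding dist_norm by linarith
  qed
  define X k where "X \<omega> = lim (\<lambda>n. Xs n \<omega>)" and "k \<omega> = lim (\<lambda>n. ks n \<omega>)" for \<omega>
  have lX: "(\<lambda>n. Xs n \<omega>) \<longlonglongrightarrow> X \<omega>" "dist (Xs n \<omega>) (X \<omega>) \<le> 2 * c / 16 ^ n" if "\<omega> \<in> space M" for \<omega> n
    using geometric_limit[of "\<lambda>n. Xs n \<omega>" c, OF dX[OF that]] by (simp_all add: X_def)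
  have lk: "(\<lambda>n. ks n \<omega>) \<longlonglongrightarrow> k \<omega>" "dist (ks n \<omega>) (k \<omega>) \<le> 2 * c / 16 ^ n" if "\<omega> \<in> space M" for \<omega> n
    using geometric_limit[of "\<lambda>n. ks n \<omega>" c, OF dk[OF that]] by (simp_all add: k_def)
  have memX: "X \<omega> \<in> cpaths T D" if "\<omega> \<in> space M" for \<omega> by (rule cpaths_closed[OF Xn(1)[OF that] lX(1)[OF that] D_closed])
  have memk: "k \<omega> \<in> cpaths T UNIV" if "\<omega> \<in> space M" for \<omega> by (rule cpaths_closed[OF Xn(2)[OF that] lk(1)[OF that] closed_UNIV])
  have Xsm: "Xs n \<in> borel_measurable M" "ks n \<in> borel_measurable M" for n
    using admissibleD(1,2)[OF adm] by (simp_all add: measurable_restrict_space2_iff)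
  have admL: "admissible M W X k"
    unfolding admissible_def
  proof (intro conjI)
    show "X \<in> M \<rightarrow>\<^sub>M restrict_space borel (cpaths T D)"
      using memX borel_measurable_LIMSEQ_metric[OF Xsm(1) lX(1)] by (intro measurable_restrict_space2) auto
    show "k \<in> M \<rightarrow>\<^sub>M restrict_space borel (cpaths T UNIV)"
      using memk borel_measurable_LIMSEQ_metric[OF Xsm(2) lk(1)] by (intro measurable_restrict_space2) auto
    obtain A where A: "0 \<le> A" "\<And>\<omega>. \<omega> \<in> space M \<Longrightarrow> norm (k0 \<omega>) \<le> A + 2 * norm (W \<omega>)" using adm0 by (auto simp: admissible_def)
    have "norm (k \<omega>) \<le> (A + 2 * c) + 2 * norm (W \<omega>)" if "\<omega> \<in> space M" for \<omega>
    proof -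
      have "norm (k \<omega>) \<le> norm (k0 \<omega>) + dist (k0 \<omega>) (k \<omega>)"
        using norm_triangle_sub[of "k \<omega>" "k0 \<omega>"] by (simp add: dist_norm norm_minus_commute)
      then show ?thesis using A(2)[OF that] lk(2)[OF that, of 0] by (simp add: Y0)
    qed
    then show "\<exists>A\<ge>0. \<forall>\<omega>\<in>space M. norm (k \<omega>) \<le> A + 2 * norm (W \<omega>)" using A(1) c0 by (intro exI[of _ "A + 2 * c"]) auto
  qed
  have close: "norm (X \<omega> t - Xs n \<omega> t) + norm (k \<omega> t - ks n \<omega> t) \<le> 4 * c / 16 ^ n * exp (lam * t)"
    if "\<omega> \<in> space M" "t \<in> {0..T}" for \<omega> t n
  proof -
    have "norm (X \<omega> t - Xs n \<omega> t) \<le> 2 * c / 16 ^ n"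
      using dist_bounded[of "Xs n \<omega>" t "X \<omega>"] lX(2)[OF that(1), of n] by (simp add: dist_norm norm_minus_commute)
    moreover have "norm (k \<omega> t - ks n \<omega> t) \<le> 2 * c / 16 ^ n"
      using dist_bounded[of "ks n \<omega>" t "k \<omega>"] lk(2)[OF that(1), of n] by (simp add: dist_norm norm_minus_commute)
    moreover have "4 * c / 16 ^ n * 1 \<le> 4 * c / 16 ^ n * exp (lam * t)" using c0 that lam_pos by (intro mult_left_mono) auto
    ultimately show ?thesis by simp
  qed
  \<comment> \<open>The image of the limit is within a vanishing distance of iterate
    \<open>Suc n\<close>, by the contraction applied to the limit and iterate \<open>n\<close>;
    these iterates also converge to the limit itself.\<close>
  have fix_eq: "picardX M \<zeta> W X k \<omega> t = X \<omega> t" "picardK M \<zeta> W X k \<omega> t = k \<omega> t" if \<omega>: "\<omega> \<in> space M" and t: "t \<in> {0..T}" for \<omega> t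
  proof -
    have le: "norm (picardX M \<zeta> W X k \<omega> t - Xs (Suc n) \<omega> t) + norm (picardK M \<zeta> W X k \<omega> t - ks (Suc n) \<omega> t)
        \<le> 4 * c * exp (lam * t) / 16 * (1 / 16) ^ n" for n
    proof -
      have "norm (picardX M \<zeta> W X k \<omega> t - picardX M \<zeta> W (Xs n) (ks n) \<omega> t) + norm (picardK M \<zeta> W X k \<omega> t - picardK M \<zeta> W (Xs n) (ks n) \<omega> t)
        \<le> 4 * c / 16 ^ n / 16 * exp (lam * t)"
        using c0 by (intro picard_contraction[OF inp admL adm _ close \<omega> t]) auto
      then show ?thesis by (simp add: YS power_one_over mult.commute)
    qed
    have "(\<lambda>n. 4 * c * exp (lam * t) / 16 * (1 / 16) ^ n) \<longlonglongrightarrow> 4 * c * exp (lam * t) / 16 * 0"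
      by (intro tendsto_mult tendsto_const LIMSEQ_realpow_zero) auto
    then have z0: "(\<lambda>n. 4 * c * exp (lam * t) / 16 * (1 / 16) ^ n) \<longlonglongrightarrow> 0" by simp
    have "(\<lambda>n. picardX M \<zeta> W X k \<omega> t - Xs (Suc n) \<omega> t) \<longlonglongrightarrow> 0"
    proof (rule Lim_null_comparison[OF _ z0], rule always_eventually, rule allI)
      fix n show "norm (picardX M \<zeta> W X k \<omega> t - Xs (Suc n) \<omega> t) \<le> 4 * c * exp (lam * t) / 16 * (1 / 16) ^ n"
        using le[of n] norm_ge_zero[of "picardK M \<zeta> W X k \<omega> t - ks (Suc n) \<omega> t"] by linarith
    qed
    moreover have "(\<lambda>n. picardX M \<zeta> W X k \<omega> t - Xs (Suc n) \<omega> t) \<longlonglongrightarrow> picardX M \<zeta> W X k \<omega> t - X \<omega> t"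
      by (intro tendsto_diff tendsto_const LIMSEQ_Suc[OF tendsto_eval_bcontfun[OF lX(1)[OF \<omega>]]])
    ultimately have "picardX M \<zeta> W X k \<omega> t - X \<omega> t = 0" by (rule LIMSEQ_unique[THEN sym])
    then show "picardX M \<zeta> W X k \<omega> t = X \<omega> t" by simp
    have "(\<lambda>n. picardK M \<zeta> W X k \<omega> t - ks (Suc n) \<omega> t) \<longlonglongrightarrow> 0"
    proof (rule Lim_null_comparison[OF _ z0], rule always_eventually, rule allI)
      fix n show "norm (picardK M \<zeta> W X k \<omega> t - ks (Suc n) \<omega> t) \<le> 4 * c * exp (lam * t) / 16 * (1 / 16) ^ n"
        using le[of n] norm_ge_zero[of "picardX M \<zeta> W X k \<omega> t - Xs (Suc n) \<omega> t"] by linarith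
    qed
    moreover have "(\<lambda>n. picardK M \<zeta> W X k \<omega> t - ks (Suc n) \<omega> t) \<longlonglongrightarrow> picardK M \<zeta> W X k \<omega> t - k \<omega> t"
      by (intro tendsto_diff tendsto_const LIMSEQ_Suc[OF tendsto_eval_bcontfun[OF lk(1)[OF \<omega>]]])
    ultimately have "picardK M \<zeta> W X k \<omega> t - k \<omega> t = 0" by (rule LIMSEQ_unique[THEN sym])
    then show "picardK M \<zeta> W X k \<omega> t = k \<omega> t" by simp
  qed
  note pa = admissibleD(3,4)[OF picard_admissible[OF inp admL]]
  have "mv_solution p T D b M \<zeta> W X k"
  proof (rule solution_of_fixed_point[OF inp admL])
    fix \<omega> assume \<omega>: "\<omega> \<in> space M"
    show "X \<omega> = picardX M \<zeta> W X k \<omega>"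
      by (rule cpaths_eqI[OF memX[OF \<omega>] pa(1)[OF \<omega>] T0]) (simp add: fix_eq[OF \<omega>])
    show "k \<omega> = picardK M \<zeta> W X k \<omega>"
      by (rule cpaths_eqI[OF memk[OF \<omega>] pa(2)[OF \<omega>] T0]) (simp add: fix_eq[OF \<omega>])
  qed
  then show ?thesis by blast
qed

end

section \<open>Transfer between probability spaces\<close>

lemma input_pullback:
  assumes Z: "Z \<in> M \<rightarrow>\<^sub>M N" "distr M N Z = N" and inp: "mv_input p T D N \<zeta> W"
  shows "mv_input p T D M (\<lambda>\<omega>. \<zeta> (Z \<omega>)) (\<lambda>\<omega>. W (Z \<omega>))"
proof -
  have "prob_space (distr M N Z)" using mv_inputD(1)[OF inp] Z(2) by simp
  then have M: "prob_space M" by (rule prob_space_distrD[OF Z(1)])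
  have "law M (D \<times> cpaths T UNIV) (\<lambda>\<omega>. (\<zeta> (Z \<omega>), W (Z \<omega>))) = law N (D \<times> cpaths T UNIV) (\<lambda>\<omega>. (\<zeta> \<omega>, W \<omega>))"
    using law_distr[OF Z(1) mv_inputD(6)[OF inp]] Z(2) by simp
  then show ?thesis
    using inp M measurable_compose[OF Z(1) mv_inputD(6)[OF inp]] unfolding mv_input_def by simp
qed

context mv_problem
begin

text \<open>Composition with a measure-preserving map leaves all one-time laws unchanged, so the
  drift is the same function of time and position; pathwise properties are inherited almost
  surely.\<close>

lemma solution_pullback:
  assumes Z: "Z \<in> M \<rightarrow>\<^sub>M N" "distr M N Z = N" and sol: "mv_solution p T D b N \<zeta> W X k"
  shows "mv_solution p T D b M (\<lambda>\<omega>. \<zeta> (Z \<omega>)) (\<lambda>\<omega>. W (Z \<omega>)) (\<lambda>\<omega>. X (Z \<omega>)) (\<lambda>\<omega>. k (Z \<omega>))"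
proof -
  note X = solution_measurable[OF sol]
  have l: "law M (D \<times> UNIV) (\<lambda>\<omega>. (X (Z \<omega>) t, k (Z \<omega>) t)) = law N (D \<times> UNIV) (\<lambda>\<omega>. (X \<omega> t, k \<omega> t))" for t
    using law_distr[OF Z(1) measurable_state[OF less_imp_le[OF T] X(1,2), of t]] Z(2) by simp
  \<comment> \<open>Only this direction is used; it transports null sets and does not ask whether
    the pathwise property defines a measurable set.\<close>
  have ae: "AE \<omega> in M. P (Z \<omega>)" if "AE \<omega> in N. P \<omega>" for P
    by (rule AE_distrD[OF Z(1)]) (simp only: Z(2) that)
  show ?thesis
    unfolding mv_solution_def l
  proof (intro conjI)
    show "(\<lambda>\<omega>. X (Z \<omega>)) \<in> M \<rightarrow>\<^sub>M restrict_space borel (cpaths T D)" "(\<lambda>\<omega>. k (Z \<omega>)) \<in> M \<rightarrow>\<^sub>M restrict_space borel (cpaths T UNIV)"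
      using measurable_compose[OF Z(1)] X(1,2) by auto
  next
    show "AE t in lebesgue. t \<in> {0..T} \<longrightarrow> law N (D \<times> UNIV) (\<lambda>\<omega>. (X \<omega> t, k \<omega> t)) \<in> prob_moment p (D \<times> UNIV)"
      using sol unfolding mv_solution_def by blast
  next
    show "AE \<omega> in M. bounded_variation_on (k (Z \<omega>)) 0 T \<and> k (Z \<omega>) 0 = 0 \<and>
        set_integrable lebesgue {0..T} (\<lambda>s. b s (X (Z \<omega>) s) (law N (D \<times> UNIV) (\<lambda>\<omega>. (X \<omega> s, k \<omega> s)))) \<and>
        (\<forall>t\<in>{0..T}. X (Z \<omega>) t = \<zeta> (Z \<omega>)
           + (LINT s:{0..t}|lebesgue. b s (X (Z \<omega>) s) (law N (D \<times> UNIV) (\<lambda>\<omega>. (X \<omega> s, k \<omega> s))))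
           + W (Z \<omega>) t - W (Z \<omega>) 0 - k (Z \<omega>) t) \<and>
        variation_measure T (k (Z \<omega>)) =
          density (variation_measure T (k (Z \<omega>))) (\<lambda>t. indicator (frontier D) (X (Z \<omega>) t)) \<and>
        reflects_along_normals T D (X (Z \<omega>)) (k (Z \<omega>))"
      by (rule ae) (use sol in \<open>unfold mv_solution_def, blast\<close>)
  qed
qed

section \<open>Input laws as canonical probability spaces\<close>

definition canonical :: "'w measure \<Rightarrow> ('w \<Rightarrow> 'a) \<Rightarrow> ('w \<Rightarrow> 'a cpath) \<Rightarrow> ('a \<times> 'a cpath) measure" where
  "canonical M \<zeta> W = law M (D \<times> cpaths T UNIV) (\<lambda>\<omega>. (\<zeta> \<omega>, W \<omega>))"

lemma canonical_input:
  assumes inp: "mv_input p T D M \<zeta> W"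
  shows "mv_input p T D (canonical M \<zeta> W) fst snd"
    "law (canonical M \<zeta> W) (D \<times> cpaths T UNIV) (\<lambda>z. (fst z, snd z)) = canonical M \<zeta> W"
    "(\<lambda>\<omega>. (\<zeta> \<omega>, W \<omega>)) \<in> M \<rightarrow>\<^sub>M canonical M \<zeta> W"
    "distr M (canonical M \<zeta> W) (\<lambda>\<omega>. (\<zeta> \<omega>, W \<omega>)) = canonical M \<zeta> W"
proof -
  let ?E = "D \<times> cpaths T UNIV" and ?N = "canonical M \<zeta> W"
  note m = mv_inputD(6)[OF inp]
  have s: "sets ?N = sets (restrict_space borel ?E)" by (simp add: canonical_def)
  show law: "law ?N ?E (\<lambda>z. (fst z, snd z)) = ?N"
    unfolding law_def using s by (simp add: distr_id2)
  show "(\<lambda>\<omega>. (\<zeta> \<omega>, W \<omega>)) \<in> M \<rightarrow>\<^sub>M ?N" using m by (simp add: canonical_def law_def)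
  show "distr M ?N (\<lambda>\<omega>. (\<zeta> \<omega>, W \<omega>)) = ?N"
    unfolding canonical_def law_def by (rule distr_cong) simp_all
  show "mv_input p T D ?N fst snd"
    unfolding mv_input_def law
  proof (intro conjI)
    show "?N \<in> prob_moment p ?E" using inp by (simp add: mv_input_def canonical_def)
    then show "prob_space ?N" by (simp add: prob_moment_def)
    show "(\<lambda>z. (fst z, snd z)) \<in> ?N \<rightarrow>\<^sub>M restrict_space borel ?E" using measurable_ident_sets[OF s] by simp
  qed
qed

text \<open>The canonical solution, composed with the input, solves the problem on \<open>M\<close>
  for the same input and so agrees almost surely with the given solution by pathwise
  uniqueness.\<close>

lemma solution_law_canonical:
  assumes inp: "mv_input p T D M \<zeta> W" and sol: "mv_solution p T D b M \<zeta> W X k"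
    and sol': "mv_solution p T D b (canonical M \<zeta> W) fst snd X' k'"
  shows "law M (cpaths T D \<times> cpaths T UNIV) (\<lambda>\<omega>. (X \<omega>, k \<omega>)) =
    law (canonical M \<zeta> W) (cpaths T D \<times> cpaths T UNIV) (\<lambda>\<omega>. (X' \<omega>, k' \<omega>))"
proof -
  let ?Z = "\<lambda>\<omega>. (\<zeta> \<omega>, W \<omega>)" and ?S = "cpaths T D \<times> cpaths T UNIV" and ?N = "canonical M \<zeta> W"
  note Z = canonical_input(3,4)[OF inp]
  have pb: "mv_solution p T D b M \<zeta> W (\<lambda>\<omega>. X' (?Z \<omega>)) (\<lambda>\<omega>. k' (?Z \<omega>))"
    using solution_pullback[OF Z sol'] by simp
  have "AE \<omega> in M. (X \<omega>, k \<omega>) = (X' (?Z \<omega>), k' (?Z \<omega>))"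
    using solution_unique[OF inp pb sol] by simp
  then have "law M ?S (\<lambda>\<omega>. (X \<omega>, k \<omega>)) = law M ?S (\<lambda>\<omega>. (X' (?Z \<omega>), k' (?Z \<omega>)))"
    by (rule law_cong_AE) (intro measurable_paths[OF T] solution_measurable[OF sol] solution_measurable[OF pb])+
  also have "\<dots> = law (distr M ?N ?Z) ?S (\<lambda>\<omega>. (X' \<omega>, k' \<omega>))"
    by (rule law_distr[OF Z(1) measurable_paths[OF T solution_measurable(1,2)[OF sol']], symmetric])
  finally show ?thesis by (simp only: Z(2))
qed

text \<open>
  An arbitrary coupling of the two input laws is itself a probability space, on which the two
  canonical solutions are driven by coupled inputs.
\<close>

lemma canonical_stability:
  fixes \<mu> \<nu> :: "('a \<times> 'a cpath) measure"
  assumes inp: "mv_input p T D \<mu> fst snd" "mv_input p T D \<nu> fst snd"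
    and mom: "\<mu> \<in> prob_moment p (D \<times> cpaths T UNIV)" "\<nu> \<in> prob_moment p (D \<times> cpaths T UNIV)"
    and sol: "mv_solution p T D b \<mu> fst snd X k" "mv_solution p T D b \<nu> fst snd X' k'"
  shows "wasserstein p (law \<mu> (cpaths T D \<times> cpaths T UNIV) (\<lambda>\<omega>. (X \<omega>, k \<omega>)))
      (law \<nu> (cpaths T D \<times> cpaths T UNIV) (\<lambda>\<omega>. (X' \<omega>, k' \<omega>))) \<le> 72 * C1 * exp (lam * T) * wasserstein p \<mu> \<nu>"
proof (rule wasserstein_le_of_transfer[OF _ mom p])
  let ?S = "cpaths T D \<times> cpaths T (UNIV :: 'a set)"
  show "0 < 72 * C1 * exp (lam * T)" using C1_pos by simp
  fix \<pi> assume \<pi>: "\<pi> \<in> couplings \<mu> \<nu>"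
  note m = measurable_couplings[OF \<pi>]
  have d: "distr \<pi> \<mu> fst = \<mu>" "distr \<pi> \<nu> snd = \<nu>" using \<pi> by (auto simp: couplings_def)
  note inp1 = input_pullback[OF m(1) d(1) inp(1)] and inp2 = input_pullback[OF m(2) d(2) inp(2)]
    and sol1 = solution_pullback[OF m(1) d(1) sol(1)] and sol2 = solution_pullback[OF m(2) d(2) sol(2)]
  note ms = measurable_paths[OF T solution_measurable(1,2)[OF sol(1)]] measurable_paths[OF T solution_measurable(1,2)[OF sol(2)]]
  note ms' = measurable_compose[OF m(1) ms(1)] measurable_compose[OF m(2) ms(2)]
  let ?Y1 = "\<lambda>z. (X (fst z), k (fst z))" and ?Y2 = "\<lambda>z. (X' (snd z), k' (snd z))"
  let ?N = "law \<mu> ?S (\<lambda>\<omega>. (X \<omega>, k \<omega>)) \<Otimes>\<^sub>M law \<nu> ?S (\<lambda>\<omega>. (X' \<omega>, k' \<omega>))"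
  have l: "law \<pi> ?S ?Y1 = law \<mu> ?S (\<lambda>\<omega>. (X \<omega>, k \<omega>))" "law \<pi> ?S ?Y2 = law \<nu> ?S (\<lambda>\<omega>. (X' \<omega>, k' \<omega>))"
    using law_distr[OF m(1) ms(1)] law_distr[OF m(2) ms(2)] d by simp_all
  have "(\<lambda>z. (?Y1 z, ?Y2 z)) \<in> \<pi> \<rightarrow>\<^sub>M ?N"
    using ms' by (intro measurable_Pair) (simp_all add: law_def)
  \<comment> \<open>An inequality is enough, and it holds although the distance need not be
    measurable on the product of the two path laws.\<close>
  from nn_integral_distr_le[OF this, of "\<lambda>(x, y). ennreal (dist x y powr p)"]
  have "(\<integral>\<^sup>+ (x, y). ennreal (dist x y powr p) \<partial>distr \<pi> ?N (\<lambda>z. (?Y1 z, ?Y2 z)))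
    \<le> (\<integral>\<^sup>+ z. ennreal (dist (?Y1 z) (?Y2 z) powr p) \<partial>\<pi>)" by simp
  also have "\<dots> \<le> ennreal ((72 * C1 * exp (lam * T)) powr p) *
      (\<integral>\<^sup>+ z. ennreal (dist (fst (fst z), snd (fst z)) (fst (snd z), snd (snd z)) powr p) \<partial>\<pi>)"
    by (rule same_space_cost[OF inp1 inp2 sol1 sol2])
  also have "(\<integral>\<^sup>+ z. ennreal (dist (fst (fst z), snd (fst z)) (fst (snd z), snd (snd z)) powr p) \<partial>\<pi>) =
      (\<integral>\<^sup>+ (x, y). ennreal (dist x y powr p) \<partial>\<pi>)" by (simp only: case_prod_unfold prod.collapse)
  finally show "\<exists>\<pi>'\<in>couplings (law \<mu> ?S (\<lambda>\<omega>. (X \<omega>, k \<omega>))) (law \<nu> ?S (\<lambda>\<omega>. (X' \<omega>, k' \<omega>))).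
      (\<integral>\<^sup>+ (x, y). ennreal (dist x y powr p) \<partial>\<pi>') \<le>
      ennreal ((72 * C1 * exp (lam * T)) powr p) * (\<integral>\<^sup>+ (x, y). ennreal (dist x y powr p) \<partial>\<pi>)"
    using law_pair_coupling[OF ms', of \<mu> "\<lambda>\<omega>. (X \<omega>, k \<omega>)" \<nu> "\<lambda>\<omega>. (X' \<omega>, k' \<omega>)"] l by (intro bexI) auto
qed

text \<open>Laws of inputs and solutions do not change when passing to the canonical spaces, whose
  sample type is the same whatever \<open>'v\<close> and \<open>'w\<close> are. A constant for the
  canonical type thus serves all types.\<close>

lemma stability_of_canonical:
  assumes C: "0 < C" and st: "\<And>\<mu> \<nu> X k X' k'. \<lbrakk>mv_input p T D \<mu> fst snd; mv_input p T D \<nu> fst snd;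
      law \<mu> (D \<times> cpaths T UNIV) (\<lambda>z. (fst z, snd z)) = \<mu>; law \<nu> (D \<times> cpaths T UNIV) (\<lambda>z. (fst z, snd z)) = \<nu>;
      mv_solution p T D b \<mu> fst snd X k; mv_solution p T D b \<nu> fst snd X' k'\<rbrakk> \<Longrightarrow>
      wasserstein p (law \<mu> (cpaths T D \<times> cpaths T UNIV) (\<lambda>\<omega>. (X \<omega>, k \<omega>)))
        (law \<nu> (cpaths T D \<times> cpaths T UNIV) (\<lambda>\<omega>. (X' \<omega>, k' \<omega>))) \<le> C * wasserstein p \<mu> \<nu>"
  shows "stability_constant TYPE('v) TYPE('w) p T D b C"
  unfolding stability_constant_def
proof (intro conjI allI impI)
  fix M1 :: "'v measure" and \<zeta>1 W1 X1 k1 and M2 :: "'w measure" and \<zeta>2 W2 X2 k2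
  assume H: "mv_input p T D M1 \<zeta>1 W1 \<and> mv_solution p T D b M1 \<zeta>1 W1 X1 k1 \<and>
    mv_input p T D M2 \<zeta>2 W2 \<and> mv_solution p T D b M2 \<zeta>2 W2 X2 k2"
  then have inp: "mv_input p T D M1 \<zeta>1 W1" "mv_input p T D M2 \<zeta>2 W2"
    and sol: "mv_solution p T D b M1 \<zeta>1 W1 X1 k1" "mv_solution p T D b M2 \<zeta>2 W2 X2 k2" by auto
  note can = canonical_input(1,2)[OF inp(1)] canonical_input(1,2)[OF inp(2)]
  obtain X k where s1: "mv_solution p T D b (canonical M1 \<zeta>1 W1) fst snd X k" using solution_exists[OF can(1)] by blast
  obtain X' k' where s2: "mv_solution p T D b (canonical M2 \<zeta>2 W2) fst snd X' k'" using solution_exists[OF can(3)] by blast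
  show "wasserstein p (law M1 (cpaths T D \<times> cpaths T UNIV) (\<lambda>\<omega>. (X1 \<omega>, k1 \<omega>)))
      (law M2 (cpaths T D \<times> cpaths T UNIV) (\<lambda>\<omega>. (X2 \<omega>, k2 \<omega>)))
    \<le> C * wasserstein p (law M1 (D \<times> cpaths T UNIV) (\<lambda>\<omega>. (\<zeta>1 \<omega>, W1 \<omega>))) (law M2 (D \<times> cpaths T UNIV) (\<lambda>\<omega>. (\<zeta>2 \<omega>, W2 \<omega>)))"
    unfolding solution_law_canonical[OF inp(1) sol(1) s1] solution_law_canonical[OF inp(2) sol(2) s2] canonical_def[symmetric]
    by (rule st[OF can(1) can(3) can(2) can(4) s1 s2])
qed (rule C)

lemma stability: "stability_constant TYPE('v) TYPE('w) p T D b (72 * C1 * exp (lam * T))"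
proof (rule stability_of_canonical)
  show "0 < 72 * C1 * exp (lam * T)" using C1_pos by simp
qed (rule canonical_stability; simp add: mv_input_def)

lemma stability_transfer:
  assumes "stability_constant TYPE('a \<times> 'a cpath) TYPE('a \<times> 'a cpath) p T D b C"
  shows "stability_constant TYPE('v) TYPE('w) p T D b C"
proof (rule stability_of_canonical)
  show "0 < C" using assms by (simp add: stability_constant_def)
  fix \<mu> \<nu> :: "('a \<times> 'a cpath) measure" and X k X' k'
  assume H: "mv_input p T D \<mu> fst snd" "mv_input p T D \<nu> fst snd"
    "law \<mu> (D \<times> cpaths T UNIV) (\<lambda>z. (fst z, snd z)) = \<mu>" "law \<nu> (D \<times> cpaths T UNIV) (\<lambda>z. (fst z, snd z)) = \<nu>"
    "mv_solution p T D b \<mu> fst snd X k" "mv_solution p T D b \<nu> fst snd X' k'"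
  have "wasserstein p (law \<mu> (cpaths T D \<times> cpaths T UNIV) (\<lambda>\<omega>. (X \<omega>, k \<omega>)))
        (law \<nu> (cpaths T D \<times> cpaths T UNIV) (\<lambda>\<omega>. (X' \<omega>, k' \<omega>))) \<le>
    C * wasserstein p (law \<mu> (D \<times> cpaths T UNIV) (\<lambda>z. (fst z, snd z))) (law \<nu> (D \<times> cpaths T UNIV) (\<lambda>z. (fst z, snd z)))"
    using assms H(1,2,5,6) unfolding stability_constant_def by blast
  then show "wasserstein p (law \<mu> (cpaths T D \<times> cpaths T UNIV) (\<lambda>\<omega>. (X \<omega>, k \<omega>)))
        (law \<nu> (cpaths T D \<times> cpaths T UNIV) (\<lambda>\<omega>. (X' \<omega>, k' \<omega>))) \<le> C * wasserstein p \<mu> \<nu>"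
    by (simp only: H(3,4))
qed

text \<open>Both laws equal that of one canonical solution. Setting the stability bound to zero
  would require that the Wasserstein distance separates laws on path space, which is established
  only over second countable types.\<close>

lemma solution_law_eq:
  assumes inp: "mv_input p T D M1 \<zeta>1 W1" "mv_input p T D M2 \<zeta>2 W2"
    and sol: "mv_solution p T D b M1 \<zeta>1 W1 X1 k1" "mv_solution p T D b M2 \<zeta>2 W2 X2 k2"
    and eq: "law M1 (D \<times> cpaths T UNIV) (\<lambda>\<omega>. (\<zeta>1 \<omega>, W1 \<omega>)) = law M2 (D \<times> cpaths T UNIV) (\<lambda>\<omega>. (\<zeta>2 \<omega>, W2 \<omega>))"
  shows "law M1 (cpaths T D \<times> cpaths T UNIV) (\<lambda>\<omega>. (X1 \<omega>, k1 \<omega>)) = law M2 (cpaths T D \<times> cpaths T UNIV) (\<lambda>\<omega>. (X2 \<omega>, k2 \<omega>))"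
proof -
  have c: "canonical M1 \<zeta>1 W1 = canonical M2 \<zeta>2 W2" using eq by (simp add: canonical_def)
  obtain X k where s: "mv_solution p T D b (canonical M1 \<zeta>1 W1) fst snd X k"
    using solution_exists[OF canonical_input(1)[OF inp(1)]] by blast
  show ?thesis
    using solution_law_canonical[OF inp(1) sol(1) s] solution_law_canonical[OF inp(2) sol(2) s[unfolded c]] by (simp add: c)
qed

end

text \<open>The finite moments of solution laws are part of the conclusion because the Wasserstein
  distance in the stability estimate is meaningful only for such laws; with infinite cost
  \<open>enn2real\<close> would make it 0.\<close>

theorem theorem47:
  fixes T p K :: real
    and D :: "'a::euclidean_space set"
    and b :: "real \<Rightarrow> 'a \<Rightarrow> ('a \<times> 'a) measure \<Rightarrow> 'a"
  assumes T: "T > 0" and p: "p \<ge> 1"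
    and D: "polyhedron D" "bounded D" "interior D \<noteq> {}"
    and b_measurable: "(\<lambda>(t, x, \<mu>). b t x \<mu>) \<in>
      restrict_space borel {0..T} \<Otimes>\<^sub>M (restrict_space borel D \<Otimes>\<^sub>M wasserstein_borel p (D \<times> UNIV))
      \<rightarrow>\<^sub>M borel"
    and b_lipschitz: "\<And>t x x' \<mu> \<mu>'. \<lbrakk>t \<in> {0..T}; x \<in> D; x' \<in> D;
        \<mu> \<in> prob_moment p (D \<times> UNIV); \<mu>' \<in> prob_moment p (D \<times> UNIV)\<rbrakk> \<Longrightarrow>
      norm (b t x \<mu> - b t x' \<mu>') powr p \<le> K * (norm (x - x') powr p + wasserstein p \<mu> \<mu>' powr p)"
    and b_integrable: "\<exists>x\<in>D. \<exists>\<mu>\<in>prob_moment p (D \<times> UNIV). set_integrable lebesgue {0..T} (\<lambda>t. b t x \<mu>)"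
  shows
    "(\<forall>(M :: 'u measure) \<zeta> W. mv_input p T D M \<zeta> W \<longrightarrow>
        (\<exists>X k. mv_solution p T D b M \<zeta> W X k \<and>
           (\<forall>X' k'. mv_solution p T D b M \<zeta> W X' k' \<longrightarrow>
              (AE \<omega> in M. X' \<omega> = X \<omega> \<and> k' \<omega> = k \<omega>)))) \<and>
     (\<forall>(M :: 'u measure) \<zeta> W X k. mv_input p T D M \<zeta> W \<and> mv_solution p T D b M \<zeta> W X k \<longrightarrow>
        law M (cpaths T D \<times> cpaths T UNIV) (\<lambda>\<omega>. (X \<omega>, k \<omega>))
          \<in> prob_moment p (cpaths T D \<times> cpaths T UNIV)) \<and>
     ((\<exists>C. stability_constant TYPE('a \<times> 'a cpath) TYPE('a \<times> 'a cpath) p T D b C) \<and>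
      (\<forall>C. stability_constant TYPE('a \<times> 'a cpath) TYPE('a \<times> 'a cpath) p T D b C \<longrightarrow>
           stability_constant TYPE('v) TYPE('w) p T D b C)) \<and>
     (\<forall>(M1 :: 'v measure) \<zeta>1 W1 X1 k1 (M2 :: 'w measure) \<zeta>2 W2 X2 k2.
        mv_input p T D M1 \<zeta>1 W1 \<and> mv_solution p T D b M1 \<zeta>1 W1 X1 k1 \<and>
        mv_input p T D M2 \<zeta>2 W2 \<and> mv_solution p T D b M2 \<zeta>2 W2 X2 k2 \<and>
        law M1 (D \<times> cpaths T UNIV) (\<lambda>\<omega>. (\<zeta>1 \<omega>, W1 \<omega>)) = law M2 (D \<times> cpaths T UNIV) (\<lambda>\<omega>. (\<zeta>2 \<omega>, W2 \<omega>)) \<longrightarrow>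
        law M1 (cpaths T D \<times> cpaths T UNIV) (\<lambda>\<omega>. (X1 \<omega>, k1 \<omega>)) =
        law M2 (cpaths T D \<times> cpaths T UNIV) (\<lambda>\<omega>. (X2 \<omega>, k2 \<omega>)))"
proof -
  interpret mv_problem D T p K b
    by unfold_locales (use assms in auto)
  show ?thesis
  proof (intro conjI allI impI)
    fix M :: "'u measure" and \<zeta> W
    assume inp: "mv_input p T D M \<zeta> W"
    obtain X k where sol: "mv_solution p T D b M \<zeta> W X k" using solution_exists[OF inp] by blast
    then show "\<exists>X k. mv_solution p T D b M \<zeta> W X k \<and>
        (\<forall>X' k'. mv_solution p T D b M \<zeta> W X' k' \<longrightarrow> (AE \<omega> in M. X' \<omega> = X \<omega> \<and> k' \<omega> = k \<omega>))"
      using solution_unique[OF inp sol] by blast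
  next
    fix M :: "'u measure" and \<zeta> W X k
    assume "mv_input p T D M \<zeta> W \<and> mv_solution p T D b M \<zeta> W X k"
    then show "law M (cpaths T D \<times> cpaths T UNIV) (\<lambda>\<omega>. (X \<omega>, k \<omega>)) \<in> prob_moment p (cpaths T D \<times> cpaths T UNIV)"
      using solution_law_prob_moment by blast
  next
    show "\<exists>C. stability_constant TYPE('a \<times> 'a cpath) TYPE('a \<times> 'a cpath) p T D b C"
      using stability by blast
  next
    fix C assume "stability_constant TYPE('a \<times> 'a cpath) TYPE('a \<times> 'a cpath) p T D b C"
    then show "stability_constant TYPE('v) TYPE('w) p T D b C" by (rule stability_transfer)
  next
    fix M1 :: "'v measure" and \<zeta>1 W1 X1 k1 and M2 :: "'w measure" and \<zeta>2 W2 X2 k2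
    assume H: "mv_input p T D M1 \<zeta>1 W1 \<and> mv_solution p T D b M1 \<zeta>1 W1 X1 k1 \<and>
        mv_input p T D M2 \<zeta>2 W2 \<and> mv_solution p T D b M2 \<zeta>2 W2 X2 k2 \<and>
        law M1 (D \<times> cpaths T UNIV) (\<lambda>\<omega>. (\<zeta>1 \<omega>, W1 \<omega>)) = law M2 (D \<times> cpaths T UNIV) (\<lambda>\<omega>. (\<zeta>2 \<omega>, W2 \<omega>))"
    show "law M1 (cpaths T D \<times> cpaths T UNIV) (\<lambda>\<omega>. (X1 \<omega>, k1 \<omega>)) =
        law M2 (cpaths T D \<times> cpaths T UNIV) (\<lambda>\<omega>. (X2 \<omega>, k2 \<omega>))"
      by (rule solution_law_eq[of M1 \<zeta>1 W1 M2 \<zeta>2 W2]) (use H in blast)+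
  qed
qed

end
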